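(* For $n_1=1$ there are exactly four congruence classes of exceptional radial eigencubics of types $(1,3\ell+2)$, $\ell\in\{1,2,4,8\}$, one for each $\ell$. Any exceptional radial eigencubic of type $(1,3\ell+2)$ is congruent to $[g_\ell]_{\mathbb{C}}$, where $$g_\ell(t)=t_{3\ell+3}^3-\tfrac32\,t_{3\ell+3}(t_1^2+\dots+t_{3\ell+2}^2)+\tfrac{1}{\sqrt2}\,\theta_\ell(t_1,\dots,t_{3\ell+2}),\qquad t\in\mathbb{R}^{3\ell+3},$$ and $$[g]_{\mathbb{C}}(x,y):=\tfrac12\big(g(x+\mathrm{i}y)+g(x-\mathrm{i}y)\big),\qquad x,y\in\mathbb{R}^{3\ell+3},$$ is the complex doubling of a polynomial $g$ (a polynomial on $\mathbb{R}^{6\ell+6}$).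
   Context: For a polynomial $f$ on $\mathbb{R}^n$ put $L(f)=|\nabla f|^2\Delta f-\sum_{i,j=1}^n f_{x_i}f_{x_j}f_{x_ix_j}$. A radial eigencubic in $\mathbb{R}^n$ is a homogeneous polynomial $f\not\equiv 0$ of degree 3 such that $L(f)=\lambda |x|^2 f$ for some constant $\lambda\in\mathbb{R}$, where it is assumed that $\lambda\neq 0$. Two cubic forms $f_1,f_2$ on $\mathbb{R}^n$ are congruent if $f_1(x)=cf_2(Ux)$ for some $U\in O(n)$ and some real $c\ne0$. Every radial eigencubic admits a normal form: an orthogonal decomposition $\mathbb{R}^n=\mathrm{span}(e_n)\oplus V_1\oplus V_2\oplus V_3$ ($e_n$ a unit vector, the $V_i$ possibly zero) such that, writing $x=x_ne_n+\xi+\eta+\zeta$ with $\xi\in V_1,\eta\in V_2,\zeta\in V_3$, after multiplication of $f$ by a nonzero constant, $$f=x_n^3-\tfrac32x_n(2|\xi|^2+|\eta|^2-|\zeta|^2)+\psi_{111}+\psi_{102}+\psi_{012}+\psi_{030},$$ where $\psi_{ijk}$ is homogeneous of degree $i$ in $\xi$, $j$ in $\eta$ and $k$ in $\zeta$. The type of $f$ is the pair $(n_1,n_2)=(\dim V_1,\dim V_2)$, which is independent of the normal form; one has $n=3n_1+2n_2-1$. For $m\ge1$, $q\ge0$, a symmetric Clifford system $\mathcal{A}=\{A_0,\dots,A_q\}\in\mathrm{Cliff}(\mathbb{R}^{2m},q)$ is a system of symmetric endomorphisms of $\mathbb{R}^{2m}$ with $A_iA_j+A_jA_i=2\delta_{ij}\mathbf{1}$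 (and, when $q=0$, $\operatorname{tr}A_0=0$). To it one associates the radial eigencubic $C_{\mathcal A}(z,y)=\sum_{i=0}^q\langle y,A_iy\rangle z_{i+1}$ on $\mathbb{R}^{q+1}\times\mathbb{R}^{2m}$. A radial eigencubic is exceptional if it is not congruent to any $C_{\mathcal A}$. For $\ell\in\{1,2,4,8\}$ let $\mathbb{F}_\ell$ be $\mathbb{R},\mathbb{C},\mathbb{H},\mathbb{O}$ respectively. The Cartan polynomial $\theta_\ell$ is the cubic form on $\mathbb{R}^{3\ell+2}=\mathbb{R}^2\oplus\mathbb{F}_\ell^3\ni(x_1,x_2,z_1,z_2,z_3)$ given by $$\theta_\ell=x_1^3+\tfrac{3x_1}{2}\big(|z_1|^2+|z_2|^2-2|z_3|^2-2x_2^2\big)+\tfrac{3\sqrt3}{2}x_2\big(|z_1|^2-|z_2|^2\big)+3\sqrt3\,\mathrm{Re}(z_1z_2z_3),$$ where $\mathrm{Re}\,z=\frac12(z+\bar z)$ (the real part of a triple product is independent of bracketing). *)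

theory Defs
  imports Complex_Main "HOL-Library.Poly_Mapping" "Jordan_Normal_Form.VS_Connect"
begin

section \<open>Polynomials in the variables 0, 1, 2, ...\<close>

text \<open>A monomial is its finitely supported exponent vector; the polynomial ring is the
  convolution ring on finitely supported families of coefficients. Indices start at 0, so the
  coordinate called \<open>t\<^sub>i\<close> in the mathematical text is \<open>Var (i - 1)\<close>. The ambient
  dimension is not part of a polynomial and is always given separately.\<close>

type_synonym 'a mpoly = "(nat \<Rightarrow>\<^sub>0 nat) \<Rightarrow>\<^sub>0 'a"

definition Cst :: "'a::zero \<Rightarrow> 'a mpoly" where
  "Cst c = Poly_Mapping.single 0 c"

definition Var :: "nat \<Rightarrow> 'a::zero_neq_one mpoly" where
  "Var i = Poly_Mapping.single (Poly_Mapping.single i 1) 1"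

text \<open>Substitution of \<open>\<alpha> i\<close> for variable \<open>i\<close>, the coefficients being mapped by \<open>h\<close>.\<close>

definition subst_poly :: "('a::zero \<Rightarrow> 'b::comm_semiring_1) \<Rightarrow> (nat \<Rightarrow> 'b) \<Rightarrow> 'a mpoly \<Rightarrow> 'b" where
  "subst_poly h \<alpha> p =
     (\<Sum>m\<in>Poly_Mapping.keys p. h (Poly_Mapping.lookup p m) *
        (\<Prod>i\<in>Poly_Mapping.keys m. \<alpha> i ^ Poly_Mapping.lookup m i))"

definition poly_val :: "real mpoly \<Rightarrow> real vec \<Rightarrow> real" where
  "poly_val p x = subst_poly (\<lambda>c. c) (vec_index x) p"

definition in_vars :: "nat \<Rightarrow> 'a::zero mpoly \<Rightarrow> bool" where
  "in_vars n p \<longleftrightarrow> (\<forall>m\<in>Poly_Mapping.keys p. Poly_Mapping.keys m \<subseteq> {..<n})"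

definition homogeneous_poly :: "nat \<Rightarrow> 'a::zero mpoly \<Rightarrow> bool" where
  "homogeneous_poly d p \<longleftrightarrow>
     (\<forall>m\<in>Poly_Mapping.keys p. (\<Sum>i\<in>Poly_Mapping.keys m. Poly_Mapping.lookup m i) = d)"

definition pd :: "nat \<Rightarrow> real mpoly \<Rightarrow> real mpoly" where
  "pd i p = (\<Sum>m\<in>Poly_Mapping.keys p.
     Poly_Mapping.single (m - Poly_Mapping.single i 1)
       (real (Poly_Mapping.lookup m i) * Poly_Mapping.lookup p m))"

section \<open>Radial eigencubics and congruence\<close>

definition cubic_form :: "nat \<Rightarrow> real mpoly \<Rightarrow> bool" where
  "cubic_form n f \<longleftrightarrow> in_vars n f \<and> homogeneous_poly 3 f"

definition L_op :: "nat \<Rightarrow> real mpoly \<Rightarrow> real mpoly" where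
  "L_op n f = (\<Sum>i<n. (pd i f)^2) * (\<Sum>i<n. pd i (pd i f))
     - (\<Sum>i<n. \<Sum>j<n. pd i f * pd j f * pd j (pd i f))"

definition radial_eigencubic :: "nat \<Rightarrow> real mpoly \<Rightarrow> bool" where
  "radial_eigencubic n f \<longleftrightarrow> cubic_form n f \<and> f \<noteq> 0 \<and>
     (\<exists>c. c \<noteq> 0 \<and> L_op n f = Cst c * (\<Sum>i<n. (Var i)^2) * f)"

definition congruent_cubics :: "nat \<Rightarrow> real mpoly \<Rightarrow> real mpoly \<Rightarrow> bool" where
  "congruent_cubics n f1 f2 \<longleftrightarrow> cubic_form n f1 \<and> cubic_form n f2 \<and>
     (\<exists>U\<in>carrier_mat n n. transpose_mat U * U = 1\<^sub>m n \<and>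
       (\<exists>c. c \<noteq> 0 \<and> (\<forall>x\<in>carrier_vec n. poly_val f1 x = c * poly_val f2 (U *\<^sub>v x))))"

text \<open>Congruence as a relation on cubic forms of all dimensions; the pair \<open>(n, f)\<close> is the
  form \<open>f\<close> on n-space.\<close>

definition congruence :: "((nat \<times> real mpoly) \<times> (nat \<times> real mpoly)) set" where
  "congruence = {((n1, f1), (n2, f2)). n1 = n2 \<and> congruent_cubics n1 f1 f2}"

section \<open>Normal form and type\<close>

definition vdim :: "nat \<Rightarrow> real vec set \<Rightarrow> nat" where
  "vdim n V = vectorspace.dim class_ring ((module_vec TYPE(real) n)\<lparr>carrier := V\<rparr>)"

definition orthogonal_decomposition ::
  "nat \<Rightarrow> real vec \<Rightarrow> real vec set \<Rightarrow> real vec set \<Rightarrow> real vec set \<Rightarrow> bool" where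
  "orthogonal_decomposition n e V1 V2 V3 \<longleftrightarrow>
     e \<in> carrier_vec n \<and> e \<bullet> e = 1 \<and>
     (\<forall>V\<in>{V1, V2, V3}. VectorSpace.subspace class_ring V (module_vec TYPE(real) n)) \<and>
     (\<forall>v\<in>V1 \<union> V2 \<union> V3. e \<bullet> v = 0) \<and>
     (\<forall>v\<in>V1. \<forall>w\<in>V2. v \<bullet> w = 0) \<and>
     (\<forall>v\<in>V1. \<forall>w\<in>V3. v \<bullet> w = 0) \<and>
     (\<forall>v\<in>V2. \<forall>w\<in>V3. v \<bullet> w = 0) \<and>
     (\<forall>x\<in>carrier_vec n. \<exists>t. \<exists>\<xi>\<in>V1. \<exists>\<eta>\<in>V2. \<exists>\<zeta>\<in>V3. x = t \<cdot>\<^sub>v e + \<xi> + \<eta> + \<zeta>)"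

text \<open>\<open>p\<close> is homogeneous of degrees \<open>i\<close>, \<open>j\<close>, \<open>k\<close> in the components \<open>\<xi>\<close>, \<open>\<eta>\<close>, \<open>\<zeta>\<close>. Only the
  restriction of \<open>p\<close> to the sum of the three subspaces matters.\<close>

definition trihomogeneous ::
  "nat \<Rightarrow> real vec set \<Rightarrow> real vec set \<Rightarrow> real vec set \<Rightarrow> nat \<Rightarrow> nat \<Rightarrow> nat \<Rightarrow> real mpoly \<Rightarrow> bool" where
  "trihomogeneous n V1 V2 V3 i j k p \<longleftrightarrow> in_vars n p \<and>
     (\<forall>\<xi>\<in>V1. \<forall>\<eta>\<in>V2. \<forall>\<zeta>\<in>V3. \<forall>a b c.
        poly_val p (a \<cdot>\<^sub>v \<xi> + b \<cdot>\<^sub>v \<eta> + c \<cdot>\<^sub>v \<zeta>) = a^i * b^j * c^k * poly_val p (\<xi> + \<eta> + \<zeta>))"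

definition has_type :: "nat \<Rightarrow> real mpoly \<Rightarrow> nat \<Rightarrow> nat \<Rightarrow> bool" where
  "has_type n f n1 n2 \<longleftrightarrow>
     (\<exists>e V1 V2 V3 \<psi>111 \<psi>102 \<psi>012 \<psi>030 c.
        orthogonal_decomposition n e V1 V2 V3 \<and> vdim n V1 = n1 \<and> vdim n V2 = n2 \<and>
        trihomogeneous n V1 V2 V3 1 1 1 \<psi>111 \<and> trihomogeneous n V1 V2 V3 1 0 2 \<psi>102 \<and>
        trihomogeneous n V1 V2 V3 0 1 2 \<psi>012 \<and> trihomogeneous n V1 V2 V3 0 3 0 \<psi>030 \<and>
        c \<noteq> 0 \<and>
        (\<forall>t. \<forall>\<xi>\<in>V1. \<forall>\<eta>\<in>V2. \<forall>\<zeta>\<in>V3.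
           c * poly_val f (t \<cdot>\<^sub>v e + \<xi> + \<eta> + \<zeta>) =
             t^3 - 3/2 * t * (2 * (\<xi> \<bullet> \<xi>) + \<eta> \<bullet> \<eta> - \<zeta> \<bullet> \<zeta>)
             + poly_val \<psi>111 (\<xi> + \<eta> + \<zeta>) + poly_val \<psi>102 (\<xi> + \<eta> + \<zeta>)
             + poly_val \<psi>012 (\<xi> + \<eta> + \<zeta>) + poly_val \<psi>030 (\<xi> + \<eta> + \<zeta>)))"

section \<open>Clifford systems and exceptional eigencubics\<close>

definition symmetric_clifford_system :: "nat \<Rightarrow> nat \<Rightarrow> (nat \<Rightarrow> real mat) \<Rightarrow> bool" where
  "symmetric_clifford_system m q A \<longleftrightarrow> m \<ge> 1 \<and>
     (\<forall>i\<le>q. A i \<in> carrier_mat (2*m) (2*m) \<and> transpose_mat (A i) = A i) \<and>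
     (\<forall>i\<le>q. \<forall>j\<le>q. A i * A j + A j * A i = (if i = j then 2 else 0) \<cdot>\<^sub>m 1\<^sub>m (2*m)) \<and>
     (q = 0 \<longrightarrow> (\<Sum>j<2*m. A 0 $$ (j, j)) = 0)"

text \<open>Variables \<open>0, ..., q\<close> are the coordinates of \<open>z\<close>, the following \<open>2 m\<close> ones those of \<open>y\<close>.\<close>

definition clifford_cubic :: "nat \<Rightarrow> nat \<Rightarrow> (nat \<Rightarrow> real mat) \<Rightarrow> real mpoly" where
  "clifford_cubic m q A = (\<Sum>i\<le>q. (\<Sum>j<2*m. \<Sum>k<2*m.
     Cst (A i $$ (j, k)) * Var (q + 1 + j) * Var (q + 1 + k)) * Var i)"

definition exceptional :: "nat \<Rightarrow> real mpoly \<Rightarrow> bool" where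
  "exceptional n f \<longleftrightarrow> radial_eigencubic n f \<and>
     \<not> (\<exists>m q A. symmetric_clifford_system m q A \<and>
          ((n, f), (q + 1 + 2*m, clifford_cubic m q A)) \<in> congruence)"

definition exceptional_of_type :: "nat \<Rightarrow> nat \<Rightarrow> (nat \<times> real mpoly) set" where
  "exceptional_of_type n1 n2 = {(n, f). exceptional n f \<and> has_type n f n1 n2}"

section \<open>Cartan polynomials\<close>

text \<open>The algebras of dimension 1, 2, 4, 8 by Cayley--Dickson doubling,
  \<open>(a, b)(c, d) = (a c - d* b, d a + b c*)\<close>. An element is the family of its coordinates
  with index below the dimension \<open>l\<close> (values at larger indices are ignored); coordinate 0 is the
  real part. The coordinates lie in a commutative ring so that they may be polynomial variables.\<close>

definition cd_conj :: "(nat \<Rightarrow> 'a::comm_ring_1) \<Rightarrow> nat \<Rightarrow> 'a" where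
  "cd_conj x = (\<lambda>i. if i = 0 then x 0 else - x i)"

fun cd_mult :: "nat \<Rightarrow> (nat \<Rightarrow> 'a::comm_ring_1) \<Rightarrow> (nat \<Rightarrow> 'a) \<Rightarrow> nat \<Rightarrow> 'a" where
  "cd_mult l x y i =
     (if l \<le> 1 then x 0 * y 0
      else let h = l div 2;
               a = x; b = (\<lambda>j. x (h + j));
               c = y; d = (\<lambda>j. y (h + j))
           in if i < h then cd_mult h a c i - cd_mult h (cd_conj d) b i
              else cd_mult h d a (i - h) + cd_mult h b (cd_conj c) (i - h))"

declare cd_mult.simps [simp del]

definition theta :: "nat \<Rightarrow> real mpoly" where
  "theta l =
    (let x1 = Var 0; x2 = Var 1;
         z1 = (\<lambda>i. Var (2 + i)); z2 = (\<lambda>i. Var (2 + l + i)); z3 = (\<lambda>i. Var (2 + 2*l + i));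
         nsq = (\<lambda>z. \<Sum>i<l. (z i)^2)
     in x1^3 + Cst (3/2) * x1 * (nsq z1 + nsq z2 - Cst 2 * nsq z3 - Cst 2 * x2^2)
        + Cst (3 * sqrt 3 / 2) * x2 * (nsq z1 - nsq z2)
        + Cst (3 * sqrt 3) * cd_mult l (cd_mult l z1 z2) z3 0)"

definition g_cubic :: "nat \<Rightarrow> real mpoly" where
  "g_cubic l = (Var (3*l + 2))^3
     - Cst (3/2) * Var (3*l + 2) * (\<Sum>i<3*l + 2. (Var i)^2)
     + Cst (1 / sqrt 2) * theta l"

text \<open>Complex doubling of a polynomial in \<open>N\<close> variables: variables \<open>0, ..., N - 1\<close> of the result are
  \<open>x\<close> and variables \<open>N, ..., 2 N - 1\<close> are \<open>y\<close>. The complex polynomial below has real coefficients;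
  \<open>Re\<close> only changes the coefficient type.\<close>

definition complex_doubling :: "nat \<Rightarrow> real mpoly \<Rightarrow> real mpoly" where
  "complex_doubling N g = Poly_Mapping.map Re
     (Cst (1/2) *
       (subst_poly (\<lambda>c. Cst (complex_of_real c)) (\<lambda>i. Var i + Cst \<i> * Var (N + i)) g
      + subst_poly (\<lambda>c. Cst (complex_of_real c)) (\<lambda>i. Var i - Cst \<i> * Var (N + i)) g))"

end

theory Submission
  imports Defs "HOL-Analysis.Inner_Product"
begin

text \<open>A cubic form is \<open>S x x x\<close> for a symmetric trilinear form \<open>S\<close>. With the commutative product defined by
  \<open>(x \<star> y) \<bullet> z = S x y z\<close> the equation \<open>L f = \<lambda> |x|\<^sup>2 f\<close> becomes an algebraic identity for \<open>\<star>\<close>.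
  In a normal form of type \<open>(1, n2)\<close> this identity makes multiplication by the unit vector of \<open>V1\<close>, suitably
  scaled, an isometry of \<open>V2\<close> onto \<open>V3\<close>, and determines \<open>f\<close> by its restriction to \<open>V2\<close>.
  Up to the factor \<open>sqrt 2\<close> that restriction is a solution \<open>h\<close> of the eiconal equation
  \<open>|\<nabla>h|\<^sup>2 = 9 |x|\<^sup>4\<close>. Splitting along an idempotent and Hurwitz's theorem leave, besides the Cartan polynomials,
  only the reducible solutions, for which \<open>f\<close> is a Clifford cubic with \<open>q = 1\<close>.

  Conversely, the product of \<open>g = g_cubic l\<close> satisfies \<open>(x \<star> x) \<star> (x \<star> x) = g(x) x\<close>. Over the complex numbers
  this is the radial eigencubic equation of the doubled form. If the latter were congruent to a Clifford
  cubic, the Clifford relations would force the Cartan polynomial to vanish on a hyperplane.\<close>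

text \<open>The obstacle in the forward direction is the Laplacian, that is, the trace of
  multiplication, about which the normal form says nothing. Testing the equation at
  \<open>t e + y\<close> with \<open>y\<close> orthogonal to \<open>e\<close> removes it: the
  coefficient of \<open>t^4\<close> makes the trace vanish, and the coefficient of \<open>t\<close>
  is a quartic condition on \<open>y\<close> alone. All relations between \<open>V2\<close> and
  \<open>V3\<close> come from this condition by inserting a multiple of \<open>xi\<close> and
  comparing powers of that multiple. They give a square of length \<open>|y|^2 / sqrt 2\<close> in
  \<open>V2\<close>, whence the factor \<open>sqrt 2\<close>. The resulting expression for
  \<open>f\<close> is the real part of a cubic on complexified vectors, with \<open>e\<close>,
  \<open>V2\<close> as real and \<open>xi\<close>, \<open>V3\<close> as imaginary directions; this
  is why the doubling appears.

  The identity for \<open>g\<close> is the adjoint identity \<open>x## = N(x) x\<close> of the cubic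
  Jordan algebra of Hermitian 3 by 3 matrices over the algebra of dimension \<open>l\<close>, split
  into the line of the unit element and the trace zero part, on which the norm is a Cartan
  polynomial. The reducible solutions belong to norms that split off a linear factor.\<close>

no_notation scalar_prod (infix "\<bullet>" 70)
unbundle inner_syntax

section \<open>Finitely supported sequences\<close>

text \<open>The dimension of the ambient space is a term of the statement, not a type. All the spaces
  involved embed into this single inner product space.\<close>

typedef fsvec = "{f :: nat \<Rightarrow> real. finite {i. f i \<noteq> 0}}"
  morphisms crd Abs_fsvec
  by (rule exI[of _ "\<lambda>_. 0"]) simp

setup_lifting type_definition_fsvec

lemma finite_crd [simp]: "finite {i. crd x i \<noteq> 0}"
  using crd[of x] by simp

lemma fsvec_eqI: "(\<And>i. crd x i = crd y i) \<Longrightarrow> x = y"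
  by (metis crd_inject ext)

instantiation fsvec :: real_vector
begin

lift_definition zero_fsvec :: fsvec is "\<lambda>_. 0" by simp

lift_definition plus_fsvec :: "fsvec \<Rightarrow> fsvec \<Rightarrow> fsvec" is "\<lambda>f g i. f i + g i"
proof -
  fix f g :: "nat \<Rightarrow> real"
  assume "finite {i. f i \<noteq> 0}" "finite {i. g i \<noteq> 0}"
  then show "finite {i. f i + g i \<noteq> 0}"
    by (rule_tac finite_subset[of _ "{i. f i \<noteq> 0} \<union> {i. g i \<noteq> 0}"]) auto
qed

lift_definition uminus_fsvec :: "fsvec \<Rightarrow> fsvec" is "\<lambda>f i. - f i" by simp

lift_definition minus_fsvec :: "fsvec \<Rightarrow> fsvec \<Rightarrow> fsvec" is "\<lambda>f g i. f i - g i"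
proof -
  fix f g :: "nat \<Rightarrow> real"
  assume "finite {i. f i \<noteq> 0}" "finite {i. g i \<noteq> 0}"
  then show "finite {i. f i - g i \<noteq> 0}"
    by (rule_tac finite_subset[of _ "{i. f i \<noteq> 0} \<union> {i. g i \<noteq> 0}"]) auto
qed

lift_definition scaleR_fsvec :: "real \<Rightarrow> fsvec \<Rightarrow> fsvec" is "\<lambda>c f i. c * f i"
proof -
  fix c and f :: "nat \<Rightarrow> real"
  assume "finite {i. f i \<noteq> 0}"
  then show "finite {i. c * f i \<noteq> 0}"
    by (rule_tac finite_subset[of _ "{i. f i \<noteq> 0}"]) auto
qed

instance
  by standard (transfer, simp add: algebra_simps fun_eq_iff)+

end

lemma crd_simps [simp]:
  "crd 0 i = 0" "crd (x + y) i = crd x i + crd y i" "crd (- x) i = - crd x i"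
  "crd (x - y) i = crd x i - crd y i" "crd (c *\<^sub>R x) i = c * crd x i"
  by (transfer, simp)+

lemma crd_sum [simp]: "crd (sum f A) i = (\<Sum>a\<in>A. crd (f a) i)"
  by (induction A rule: infinite_finite_induct) auto

instantiation fsvec :: real_inner
begin

definition inner_fsvec :: "fsvec \<Rightarrow> fsvec \<Rightarrow> real" where
  "inner_fsvec x y = (\<Sum>i | crd x i \<noteq> 0. crd x i * crd y i)"

definition norm_fsvec :: "fsvec \<Rightarrow> real" where
  "norm_fsvec x = sqrt (inner x x)"

definition sgn_fsvec :: "fsvec \<Rightarrow> fsvec" where
  "sgn_fsvec x = x /\<^sub>R norm x"

definition dist_fsvec :: "fsvec \<Rightarrow> fsvec \<Rightarrow> real" where
  "dist_fsvec x y = norm (x - y)"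

definition uniformity_fsvec :: "(fsvec \<times> fsvec) filter" where
  "uniformity_fsvec = (INF e\<in>{0<..}. principal {(x, y). dist x y < e})"

definition open_fsvec :: "fsvec set \<Rightarrow> bool" where
  "open_fsvec U \<longleftrightarrow> (\<forall>x\<in>U. eventually (\<lambda>(x', y). x' = x \<longrightarrow> y \<in> U) uniformity)"

lemma inner_fsvec_superset:
  "finite A \<Longrightarrow> {i. crd x i \<noteq> 0} \<subseteq> A \<Longrightarrow> inner x y = (\<Sum>i\<in>A. crd x i * crd y i)"
  unfolding inner_fsvec_def by (rule sum.mono_neutral_left) auto

instance
proof
  fix x y z :: fsvec and r :: real
  let ?A = "{i. crd x i \<noteq> 0} \<union> {i. crd y i \<noteq> 0} \<union> {i. crd z i \<noteq> 0}"
  have sup: "inner v w = (\<Sum>i\<in>?A. crd v i * crd w i)"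
    if "{i. crd v i \<noteq> 0} \<subseteq> ?A" for v w
    by (rule inner_fsvec_superset) (use that in auto)
  show "inner x y = inner y x"
    by (subst (1 2) sup) (auto simp: mult.commute)
  show "inner (x + y) z = inner x z + inner y z"
    by (subst (1 2 3) sup) (auto simp: algebra_simps sum.distrib)
  show "inner (r *\<^sub>R x) y = r * inner x y"
    by (subst (1 2) sup) (auto simp: algebra_simps sum_distrib_left)
  show "0 \<le> inner x x"
    unfolding inner_fsvec_def by (intro sum_nonneg) auto
  show "(inner x x = 0) = (x = 0)"
    unfolding inner_fsvec_def
    by (subst sum_nonneg_eq_0_iff) (auto intro: fsvec_eqI)
qed (fact norm_fsvec_def sgn_fsvec_def dist_fsvec_def uniformity_fsvec_def open_fsvec_def)+

end

lift_definition unitv :: "nat \<Rightarrow> fsvec" is "\<lambda>k i. if i = k then 1 else 0"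
  by simp

lift_definition trunc :: "nat \<Rightarrow> (nat \<Rightarrow> real) \<Rightarrow> fsvec" is "\<lambda>n f i. if i < n then f i else 0"
  by (rule finite_subset[of _ "{..<n}" for n]) auto

lemma crd_unitv: "crd (unitv k) i = (if i = k then 1 else 0)"
  by transfer simp

lemma crd_trunc: "crd (trunc n f) i = (if i < n then f i else 0)"
  by transfer simp

definition euclid :: "nat \<Rightarrow> fsvec set" where
  "euclid n = {x. \<forall>i\<ge>n. crd x i = 0}"

lemma inner_euclid: "x \<in> euclid n \<Longrightarrow> inner x y = (\<Sum>i<n. crd x i * crd y i)"
  by (rule inner_fsvec_superset) (auto simp: euclid_def not_le[symmetric])

lemma inner_unitv_left [simp]: "inner (unitv i) x = crd x i"
  unfolding inner_fsvec_def by (simp add: crd_unitv)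

lemma inner_unitv_right [simp]: "inner x (unitv i) = crd x i"
  by (subst inner_commute) simp

section \<open>Orthonormal frames\<close>

definition orthonormal :: "nat \<Rightarrow> (nat \<Rightarrow> 'a::real_inner) \<Rightarrow> bool" where
  "orthonormal d u \<longleftrightarrow> (\<forall>i<d. \<forall>j<d. u i \<bullet> u j = (if i = j then 1 else 0))"

text \<open>Finite dimension of a subspace is always expressed by such a frame, so that dimension,
  trace and orthogonal expansion are plain finite sums in any inner product type. That
  \<open>d\<close> depends only on \<open>V\<close> is \<open>onframe_dim_unique\<close>.\<close>

definition onframe :: "'a::real_inner set \<Rightarrow> nat \<Rightarrow> (nat \<Rightarrow> 'a) \<Rightarrow> bool" where
  "onframe V d u \<longleftrightarrow> subspace V \<and> (\<forall>i<d. u i \<in> V) \<and> orthonormal d u \<and>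
     (\<forall>x\<in>V. x = (\<Sum>i<d. (x \<bullet> u i) *\<^sub>R u i))"

lemma onframe_subspace: "onframe V d u \<Longrightarrow> subspace V"
  and onframe_in: "onframe V d u \<Longrightarrow> i < d \<Longrightarrow> u i \<in> V"
  and onframe_orthonormal: "onframe V d u \<Longrightarrow> orthonormal d u"
  and onframe_expand: "onframe V d u \<Longrightarrow> x \<in> V \<Longrightarrow> x = (\<Sum>i<d. (x \<bullet> u i) *\<^sub>R u i)"
  by (auto simp: onframe_def)

lemma orthonormalD: "orthonormal d u \<Longrightarrow> i < d \<Longrightarrow> j < d \<Longrightarrow> u i \<bullet> u j = (if i = j then 1 else 0)"
  by (auto simp: orthonormal_def)

lemma orthonormal_coeff:
  assumes "orthonormal d u" "j < d"
  shows "(\<Sum>i<d. x i *\<^sub>R u i) \<bullet> u j = x j"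
proof -
  have "(\<Sum>i<d. x i *\<^sub>R u i) \<bullet> u j = (\<Sum>i<d. if i = j then x i else 0)"
    unfolding inner_sum_left by (rule sum.cong) (use assms in \<open>auto simp: orthonormal_def\<close>)
  then show ?thesis using assms by simp
qed

lemma orthonormal_inner:
  assumes "orthonormal d u"
  shows "(\<Sum>i<d. x i *\<^sub>R u i) \<bullet> (\<Sum>i<d. y i *\<^sub>R u i) = (\<Sum>i<d. x i * y i)"
  unfolding inner_sum_right[of _ _ "{..<d}"] using assms
  by (intro sum.cong) (auto simp: orthonormal_coeff)

lemma bessel_identity:
  assumes "orthonormal d u"
  defines "r \<equiv> \<lambda>x. x - (\<Sum>i<d. (x \<bullet> u i) *\<^sub>R u i)"
  shows "r x \<bullet> r x = x \<bullet> x - (\<Sum>i<d. (x \<bullet> u i)^2)"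
proof -
  have "x \<bullet> (\<Sum>i<d. (x \<bullet> u i) *\<^sub>R u i) = (\<Sum>i<d. (x \<bullet> u i)^2)"
    by (simp add: inner_sum_right power2_eq_square)
  then show ?thesis
    using orthonormal_inner[OF assms(1), of "\<lambda>i. x \<bullet> u i" "\<lambda>i. x \<bullet> u i"]
    by (simp add: r_def inner_diff_left inner_diff_right inner_commute power2_eq_square)
qed

lemma bessel: "orthonormal d u \<Longrightarrow> (\<Sum>i<d. (x \<bullet> u i)^2) \<le> x \<bullet> x"
  using bessel_identity[of d u x] inner_ge_zero[of "x - (\<Sum>i<d. (x \<bullet> u i) *\<^sub>R u i)"] by linarith

lemma onframe_inner:
  assumes "onframe V d u" "x \<in> V"
  shows "x \<bullet> y = (\<Sum>i<d. (x \<bullet> u i) * (y \<bullet> u i))"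
proof -
  have "x \<bullet> y = (\<Sum>i<d. (x \<bullet> u i) *\<^sub>R u i) \<bullet> y"
    using onframe_expand[OF assms] by simp
  also have "\<dots> = (\<Sum>i<d. (x \<bullet> u i) * (y \<bullet> u i))"
    unfolding inner_sum_left inner_scaleR_left
    by (intro sum.cong refl arg_cong2[of _ _ _ _ "(*)"]) (rule inner_commute)
  finally show ?thesis .
qed

lemma onframe_eqI:
  assumes "onframe V d u" "x \<in> V" "y \<in> V" "\<And>z. z \<in> V \<Longrightarrow> x \<bullet> z = y \<bullet> z"
  shows "x = y"
proof -
  have "(\<Sum>i<d. (x \<bullet> u i) *\<^sub>R u i) = (\<Sum>i<d. (y \<bullet> u i) *\<^sub>R u i)"
    using assms(4) onframe_in[OF assms(1)] by (intro sum.cong) auto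
  then show ?thesis using onframe_expand[OF assms(1)] assms(2,3) by metis
qed

lemma onframe_lin: "onframe V d u \<Longrightarrow> (\<Sum>i<d. x i *\<^sub>R u i) \<in> V"
  by (intro subspace_sum subspace_scale) (auto simp: onframe_def)

text \<open>Expand each \<open>u i\<close> along \<open>v\<close>, exchange the sums, and recollect
  \<open>v j\<close> from its expansion along \<open>u\<close>. With the inner product as
  \<open>B\<close> this compares dimensions; with \<open>S e\<close> as \<open>B\<close> it turns a
  vanishing trace into an equality of dimensions (\<open>k_eq_N\<close>).\<close>

lemma onframe_trace:
  assumes u: "onframe V d u" and v: "onframe V d' v"
    and B: "\<And>x y z. B (x + y) z = B x z + B y z" "\<And>c x z. B (c *\<^sub>R x) z = c * B x z"
      "\<And>x y z. B z (x + y) = B z x + B z y" "\<And>c x z. B z (c *\<^sub>R x) = c * B z x"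
  shows "(\<Sum>i<d. B (u i) (u i)) = (\<Sum>j<d'. B (v j) (v j) :: real)"
proof -
  have B0: "B 0 z = 0" "B z 0 = 0" for z
    using B(2)[of 0 0 z] B(4)[of z 0 0] by auto
  have sl: "B (sum f A) z = (\<Sum>a\<in>A. B (f a) z)" and sr: "B z (sum f A) = (\<Sum>a\<in>A. B z (f a))"
    for f :: "nat \<Rightarrow> _" and A z
    by (induction A rule: infinite_finite_induct) (auto simp: B B0)
  have "(\<Sum>i<d. B (u i) (u i)) = (\<Sum>i<d. \<Sum>j<d'. (u i \<bullet> v j) * B (v j) (u i))"
  proof (intro sum.cong refl)
    fix i assume "i \<in> {..<d}"
    then have "u i \<in> V" using u by (auto simp: onframe_in)
    from onframe_expand[OF v this] have "B (u i) (u i) = B (\<Sum>j<d'. (u i \<bullet> v j) *\<^sub>R v j) (u i)"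
      by simp
    then show "B (u i) (u i) = (\<Sum>j<d'. (u i \<bullet> v j) * B (v j) (u i))" by (simp add: sl B)
  qed
  also have "\<dots> = (\<Sum>j<d'. \<Sum>i<d. (v j \<bullet> u i) * B (v j) (u i))"
    by (subst sum.swap) (simp add: inner_commute)
  also have "\<dots> = (\<Sum>j<d'. B (v j) (v j))"
  proof (intro sum.cong refl)
    fix j assume "j \<in> {..<d'}"
    then have "v j \<in> V" using v by (auto simp: onframe_in)
    from onframe_expand[OF u this] have "B (v j) (v j) = B (v j) (\<Sum>i<d. (v j \<bullet> u i) *\<^sub>R u i)"
      by simp
    then show "(\<Sum>i<d. (v j \<bullet> u i) * B (v j) (u i)) = B (v j) (v j)" by (simp add: sr B)
  qed
  finally show ?thesis .
qed

lemma onframe_dim_unique: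
  assumes "onframe V d u" "onframe V d' v" shows "d = d'"
proof -
  have "(\<Sum>i<d. u i \<bullet> u i) = (\<Sum>j<d'. v j \<bullet> v j)"
    by (rule onframe_trace[OF assms, of "\<lambda>x y. x \<bullet> y"]) (simp_all add: inner_add_left inner_add_right)
  then have "real d = real d'"
    using assms by (simp add: onframe_def orthonormal_def)
  then show ?thesis by simp
qed

text \<open>The sum of all \<open>(w j \<bullet> u i)^2\<close> is counted twice: summed over
  \<open>j\<close> first it is \<open>k\<close>, summed over \<open>i\<close> first it is at most
  \<open>n\<close> by Bessel. The defects \<open>g j\<close> add up to \<open>n - k\<close>; if they
  all vanish, every \<open>w j\<close>, hence every vector of \<open>W\<close>, equals its expansion
  along \<open>u\<close>.\<close>

lemma orthonormal_in_onframe: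
  assumes w: "onframe W n w" and u: "orthonormal k u" "\<And>i. i < k \<Longrightarrow> u i \<in> W"
  shows orthonormal_le: "k \<le> n"
    and orthonormal_onframe: "k = n \<Longrightarrow> onframe W n u"
proof -
  define g where "g j = w j \<bullet> w j - (\<Sum>i<k. (w j \<bullet> u i)^2)" for j
  have g: "0 \<le> g j" for j using bessel[OF u(1)] by (simp add: g_def)
  have "real k = (\<Sum>i<k. u i \<bullet> u i)" using u by (simp add: orthonormal_def)
  also have "\<dots> = (\<Sum>i<k. \<Sum>j<n. (w j \<bullet> u i)^2)"
    by (intro sum.cong refl, subst onframe_inner[OF w])
      (auto simp: u power2_eq_square inner_commute)
  also have "\<dots> = (\<Sum>j<n. \<Sum>i<k. (w j \<bullet> u i)^2)" by (rule sum.swap)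
  also have "\<dots> = (\<Sum>j<n. w j \<bullet> w j - g j)" by (simp add: g_def)
  also have "\<dots> = real n - (\<Sum>j<n. g j)"
    using w by (simp add: sum_subtractf onframe_def orthonormal_def)
  finally have k: "real k = real n - (\<Sum>j<n. g j)" .
  moreover have "0 \<le> (\<Sum>j<n. g j)" by (intro sum_nonneg g)
  ultimately show "k \<le> n" by linarith
  assume "k = n"
  then have "(\<Sum>j<n. g j) = 0" using k by simp
  then have g0: "g j = 0" if "j < n" for j
    using that g by (subst (asm) sum_nonneg_eq_0_iff) auto
  have wj: "w j = (\<Sum>i<k. (w j \<bullet> u i) *\<^sub>R u i)" if "j < n" for j
    using g0[OF that] bessel_identity[OF u(1), of "w j"] by (simp add: g_def)
  have "x = (\<Sum>i<k. (x \<bullet> u i) *\<^sub>R u i)" if "x \<in> W" for x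
  proof -
    have "x = (\<Sum>j<n. (x \<bullet> w j) *\<^sub>R w j)" by (rule onframe_expand[OF w that])
    also have "\<dots> = (\<Sum>j<n. \<Sum>i<k. ((x \<bullet> w j) * (w j \<bullet> u i)) *\<^sub>R u i)"
      by (intro sum.cong refl, subst (2) wj) (auto simp: scaleR_sum_right)
    also have "\<dots> = (\<Sum>i<k. (\<Sum>j<n. (x \<bullet> w j) * (w j \<bullet> u i)) *\<^sub>R u i)"
      by (subst sum.swap) (simp add: scaleR_sum_left)
    also have "\<dots> = (\<Sum>i<k. (x \<bullet> u i) *\<^sub>R u i)"
      by (subst (2) onframe_inner[OF w that]) (simp add: inner_commute)
    finally show ?thesis .
  qed
  then show "onframe W n u"
    using u w \<open>k = n\<close> by (auto simp: onframe_def)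
qed

lemma orthonormal_Suc:
  assumes u: "orthonormal k u" and r: "r \<bullet> r = 1" "\<And>i. i < k \<Longrightarrow> r \<bullet> u i = 0"
  shows "orthonormal (Suc k) (u(k := r))"
proof -
  have "u i \<bullet> r = 0" if "i < k" for i using r(2)[OF that] by (metis inner_commute)
  then show ?thesis using u r by (auto simp: orthonormal_def less_Suc_eq)
qed

lemma unit_vector:
  fixes r :: "'a::real_inner"
  assumes "r \<noteq> 0" shows "(r /\<^sub>R sqrt (r \<bullet> r)) \<bullet> (r /\<^sub>R sqrt (r \<bullet> r)) = 1"
proof -
  have "0 < r \<bullet> r" using assms by simp
  then show ?thesis by (simp add: field_simps flip: power2_eq_square)
qed

lemma residual_orthogonal:
  assumes "orthonormal k u" "i < k"
  shows "(x - (\<Sum>i<k. (x \<bullet> u i) *\<^sub>R u i)) \<bullet> u i = 0"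
  using orthonormal_coeff[OF assms, of "\<lambda>i. x \<bullet> u i"] by (simp add: inner_diff_left)

text \<open>A longest orthonormal family in \<open>V\<close> is a frame, lengths being bounded by
  \<open>n\<close>: a vector different from its expansion would leave a residual that, normalized,
  lengthens the family.\<close>

lemma onframe_exists:
  assumes V: "subspace V" "V \<subseteq> W" and w: "onframe W n w"
  obtains d u where "onframe V d u"
proof -
  define P where "P k \<longleftrightarrow> (\<exists>u. orthonormal k u \<and> (\<forall>i<k. u i \<in> V))" for k
  have "P 0" by (simp add: P_def orthonormal_def)
  moreover have bound: "\<forall>k. P k \<longrightarrow> k \<le> n"
    using orthonormal_le[OF w] V by (auto simp: P_def)
  ultimately obtain k where k: "P k" "\<not> P (Suc k)"
    by (metis GreatestI_nat Greatest_le_nat not_less_eq_eq order_refl)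
  then obtain u where u: "orthonormal k u" "\<And>i. i < k \<Longrightarrow> u i \<in> V" by (auto simp: P_def)
  have "x = (\<Sum>i<k. (x \<bullet> u i) *\<^sub>R u i)" if x: "x \<in> V" for x
  proof (rule ccontr)
    assume ne: "x \<noteq> (\<Sum>i<k. (x \<bullet> u i) *\<^sub>R u i)"
    define r where "r = x - (\<Sum>i<k. (x \<bullet> u i) *\<^sub>R u i)"
    define r' where "r' = r /\<^sub>R sqrt (r \<bullet> r)"
    have "r \<in> V" unfolding r_def
      by (intro subspace_diff[OF V(1)] x subspace_sum[OF V(1)] subspace_scale[OF V(1)] u) auto
    then have "r' \<in> V" unfolding r'_def by (rule subspace_scale[OF V(1)])
    moreover have "r' \<bullet> r' = 1" unfolding r'_def using ne by (intro unit_vector) (simp add: r_def)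
    moreover have "r' \<bullet> u i = 0" if "i < k" for i
      using residual_orthogonal[OF u(1) that] by (simp add: r'_def r_def)
    ultimately have "P (Suc k)"
      unfolding P_def using u
      by (intro exI[of _ "u(k := r')"] conjI orthonormal_Suc) auto
    with k show False by simp
  qed
  with u V have "onframe V k u" by (auto simp: onframe_def)
  then show ?thesis by (rule that)
qed

lemma onframe_exists_head:
  assumes V: "subspace V" "V \<subseteq> W" and w: "onframe W n w" and e: "e \<in> V" "e \<bullet> e = 1"
  obtains d u where "onframe V (Suc d) u" "u 0 = e"
    "onframe {x\<in>V. x \<bullet> e = 0} d (\<lambda>i. u (Suc i))"
proof -
  let ?V = "{x\<in>V. x \<bullet> e = 0}"
  have "subspace ?V"
    using V by (auto simp: subspace_def inner_add_left)
  moreover have "?V \<subseteq> W" using V by auto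
  ultimately obtain d v where v: "onframe ?V d v" using w by (rule onframe_exists)
  define u where "u i = (case i of 0 \<Rightarrow> e | Suc j \<Rightarrow> v j)" for i
  have vV: "v i \<in> V" "v i \<bullet> e = 0" if "i < d" for i using onframe_in[OF v that] by auto
  have ev: "e \<bullet> v i = 0" if "i < d" for i using vV(2)[OF that] by (metis inner_commute)
  have "orthonormal (Suc d) u"
    using onframe_orthonormal[OF v] e vV ev
    by (auto simp: orthonormal_def u_def split: nat.splits)
  moreover have "x = (\<Sum>i<Suc d. (x \<bullet> u i) *\<^sub>R u i)" if "x \<in> V" for x
  proof -
    have "x - (x \<bullet> e) *\<^sub>R e \<in> ?V"
      using that e V by (auto simp: inner_diff_left subspace_diff subspace_scale)
    from onframe_expand[OF v this]
    have "x = (x \<bullet> e) *\<^sub>R e + (\<Sum>i<d. ((x - (x \<bullet> e) *\<^sub>R e) \<bullet> v i) *\<^sub>R v i)"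
      by (simp add: algebra_simps)
    also have "\<dots> = (x \<bullet> e) *\<^sub>R e + (\<Sum>i<d. (x \<bullet> v i) *\<^sub>R v i)"
      by (intro arg_cong2[of _ _ _ _ "(+)"] sum.cong refl)
        (use ev in \<open>auto simp: inner_diff_left\<close>)
    finally show ?thesis
      unfolding sum.lessThan_Suc_shift u_def by simp
  qed
  moreover have "u i \<in> V" if "i < Suc d" for i
    using that vV e by (auto simp: u_def split: nat.splits)
  ultimately have "onframe V (Suc d) u" using V by (auto simp: onframe_def)
  moreover have "onframe ?V d (\<lambda>i. u (Suc i))" using v by (simp add: u_def)
  ultimately show ?thesis using that[of d u] by (simp add: u_def)
qed

definition append_frame :: "nat \<Rightarrow> (nat \<Rightarrow> 'a) \<Rightarrow> (nat \<Rightarrow> 'a) \<Rightarrow> nat \<Rightarrow> 'a" where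
  "append_frame d u v i = (if i < d then u i else v (i - d))"

text \<open>The summand sees both the index and the vector, so that with dummy frames the lemma also
  splits a plain sum over an index range.\<close>

lemma sum_append_frame:
  fixes g :: "nat \<Rightarrow> 'a \<Rightarrow> 'b::comm_monoid_add"
  shows "(\<Sum>i<d + d'. g i (append_frame d u v i)) = (\<Sum>i<d. g i (u i)) + (\<Sum>i<d'. g (d + i) (v i))"
proof -
  have "(\<Sum>i<d + d'. g i (append_frame d u v i))
      = (\<Sum>i<d. g i (append_frame d u v i)) + (\<Sum>i<d'. g (d + i) (append_frame d u v (d + i)))"
    by (induction d') (auto simp: algebra_simps)
  then show ?thesis by (simp add: append_frame_def)
qed

lemma orthonormal_append:
  assumes "orthonormal d u" "orthonormal d' v" and uv: "\<And>i j. i < d \<Longrightarrow> j < d' \<Longrightarrow> u i \<bullet> v j = 0"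
  shows "orthonormal (d + d') (append_frame d u v)"
  unfolding orthonormal_def
proof (intro allI impI)
  fix i j assume ij: "i < d + d'" "j < d + d'"
  show "append_frame d u v i \<bullet> append_frame d u v j = (if i = j then 1 else 0)"
    using ij uv[of i "j - d"] uv[of j "i - d"] inner_commute[of "v (i - d)" "u j"]
      orthonormalD[OF assms(1), of i j] orthonormalD[OF assms(2), of "i - d" "j - d"]
    by (cases "i < d"; cases "j < d") (simp_all add: append_frame_def, arith?)
qed

lemma onframe_append:
  assumes u: "onframe A d u" and v: "onframe B d' v"
    and AB: "\<And>x y. x \<in> A \<Longrightarrow> y \<in> B \<Longrightarrow> x \<bullet> y = 0"
  shows "onframe {x + y | x y. x \<in> A \<and> y \<in> B} (d + d') (append_frame d u v)"
proof -
  let ?w = "append_frame d u v"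
  have sub: "subspace {x + y | x y. x \<in> A \<and> y \<in> B}"
    by (intro subspace_sums onframe_subspace[OF u] onframe_subspace[OF v])
  have zero: "0 \<in> A" "0 \<in> B"
    using onframe_subspace[OF u] onframe_subspace[OF v] by (auto intro: subspace_0)
  have "?w i \<in> {x + y | x y. x \<in> A \<and> y \<in> B}" if "i < d + d'" for i
  proof (cases "i < d")
    case True
    then show ?thesis using onframe_in[OF u] zero
      by (intro CollectI exI[of _ "u i"] exI[of _ 0]) (simp add: append_frame_def)
  next
    case False
    then show ?thesis using onframe_in[OF v, of "i - d"] zero that
      by (intro CollectI exI[of _ 0] exI[of _ "v (i - d)"]) (simp add: append_frame_def)
  qed
  moreover have "orthonormal (d + d') ?w"
    using AB onframe_in[OF u] onframe_in[OF v]
    by (intro orthonormal_append onframe_orthonormal[OF u] onframe_orthonormal[OF v]) auto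
  moreover have "z = (\<Sum>i<d + d'. (z \<bullet> ?w i) *\<^sub>R ?w i)"
    if "z \<in> {x + y | x y. x \<in> A \<and> y \<in> B}" for z
  proof -
    from that obtain x y where z: "z = x + y" "x \<in> A" "y \<in> B" by auto
    have "(\<Sum>i<d + d'. (z \<bullet> ?w i) *\<^sub>R ?w i)
        = (\<Sum>i<d. (z \<bullet> u i) *\<^sub>R u i) + (\<Sum>i<d'. (z \<bullet> v i) *\<^sub>R v i)"
      by (rule sum_append_frame)
    also have "(\<Sum>i<d. (z \<bullet> u i) *\<^sub>R u i) = (\<Sum>i<d. (x \<bullet> u i) *\<^sub>R u i)"
      by (intro sum.cong refl) (use z AB[OF onframe_in[OF u]] in \<open>auto simp: inner_add_left inner_commute[of y "u _"]\<close>)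
    also have "\<dots> = x" using onframe_expand[OF u z(2)] by simp
    also have "(\<Sum>i<d'. (z \<bullet> v i) *\<^sub>R v i) = (\<Sum>i<d'. (y \<bullet> v i) *\<^sub>R v i)"
      by (intro sum.cong refl) (use z AB onframe_in[OF v] in \<open>auto simp: inner_add_left\<close>)
    also have "\<dots> = y" using onframe_expand[OF v z(3)] by simp
    finally show ?thesis using z by simp
  qed
  ultimately show ?thesis using sub unfolding onframe_def by blast
qed

lemma subspace_euclid: "subspace (euclid n)"
  by (auto simp: subspace_def euclid_def)

lemma unitv_euclid: "i < n \<Longrightarrow> unitv i \<in> euclid n"
  by (auto simp: euclid_def crd_unitv)

lemma trunc_euclid: "trunc n f \<in> euclid n"
  by (auto simp: euclid_def crd_trunc)

lemma onframe_euclid: "onframe (euclid n) n unitv"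
proof -
  have "x = (\<Sum>i<n. (x \<bullet> unitv i) *\<^sub>R unitv i)" if "x \<in> euclid n" for x
  proof (rule fsvec_eqI)
    fix i
    have "crd (\<Sum>i<n. (x \<bullet> unitv i) *\<^sub>R unitv i) i = (\<Sum>j<n. if i = j then crd x j else 0)"
      by (simp add: crd_unitv if_distrib cong: if_cong)
    also have "\<dots> = crd x i" using that by (auto simp: euclid_def)
    finally show "crd x i = crd (\<Sum>i<n. (x \<bullet> unitv i) *\<^sub>R unitv i) i" ..
  qed
  then show ?thesis
    by (auto simp: onframe_def subspace_euclid unitv_euclid orthonormal_def crd_unitv)
qed

section \<open>Symmetric trilinear forms and their commutative algebras\<close>

text \<open>Interpolation at 0, 1, -1, 2, -2. This is the means of polarization below: an identity
  is written at \<open>x + s z\<close> and its coefficients in \<open>s\<close> are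
  compared.\<close>

lemma quartic_coeffs:
  fixes a0 :: real
  assumes "\<And>s. a0 + a1 * s + a2 * s^2 + a3 * s^3 + a4 * s^4 = b0 + b1 * s + b2 * s^2 + b3 * s^3 + b4 * s^4"
  shows "a0 = b0" "a1 = b1" "a2 = b2" "a3 = b3" "a4 = b4"
  using assms[of 0] assms[of 1] assms[of "-1"] assms[of 2] assms[of "-2"] by auto

lemma inner_eqI: "(\<And>z. x \<bullet> z = y \<bullet> z) \<Longrightarrow> x = (y :: 'a::real_inner)"
  by (metis eq_iff_diff_eq_0 inner_diff_left inner_eq_zero_iff)

lemma scaleR_3: "3 *\<^sub>R x = x + x + (x :: 'a::real_vector)"
proof -
  have "(1 + 1 + 1) *\<^sub>R x = x + x + x" unfolding scaleR_left_distrib by simp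
  then show ?thesis by simp
qed

locale trilinear_form =
  fixes S :: "'a::real_vector \<Rightarrow> 'a \<Rightarrow> 'a \<Rightarrow> real"
  assumes S_add [simp]: "S (x + y) z w = S x z w + S y z w"
    and S_scale [simp]: "S (c *\<^sub>R x) z w = c * S x z w"
    and S_swap12: "S x y z = S y x z"
    and S_swap23: "S x y z = S x z y"
begin

lemma S_swap13: "S x y z = S z y x"
  by (metis S_swap12 S_swap23)

lemmas S_ac = S_swap12 S_swap23 S_swap13

lemma S_add2 [simp]: "S z (x + y) w = S z x w + S z y w"
  by (simp add: S_swap12[of z])

lemma S_add3 [simp]: "S z w (x + y) = S z w x + S z w y"
  by (simp add: S_swap13[of z])

lemma S_scale2 [simp]: "S z (c *\<^sub>R x) w = c * S z x w"
  by (simp add: S_swap12[of z])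

lemma S_scale3 [simp]: "S z w (c *\<^sub>R x) = c * S z w x"
  by (simp add: S_swap13[of z])

lemma S_zero [simp]: "S 0 x y = 0" "S x 0 y = 0" "S x y 0 = 0"
  using S_scale[of 0 0 x y] S_scale2[of x 0 0 y] S_scale3[of x y 0 0] by auto

lemma S_minus [simp]: "S (- x) y z = - S x y z" "S y (- x) z = - S y x z" "S y z (- x) = - S y z x"
  using S_scale[of "-1" x y z] S_scale2[of y "-1" x z] S_scale3[of y z "-1" x] by auto

lemma S_diff [simp]:
  "S (x - w) y z = S x y z - S w y z" "S y (x - w) z = S y x z - S y w z"
  "S y z (x - w) = S y z x - S y z w"
  using S_add[of x "- w"] S_add2[of y x "- w"] S_add3[of y z x "- w"] by auto

lemma S_sum:
  "S (sum f A) y z = (\<Sum>a\<in>A. S (f a) y z)" "S y (sum f A) z = (\<Sum>a\<in>A. S y (f a) z)"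
  "S y z (sum f A) = (\<Sum>a\<in>A. S y z (f a))"
  by (induction A rule: infinite_finite_induct) auto

lemma S_cube_add:
  "S (x + y) (x + y) (x + y) = S x x x + 3 * S x x y + 3 * S x y y + S y y y"
  using S_swap23[of x y x] S_swap12[of y x x] S_swap12[of y x y] S_swap13[of y y x] by simp

end

text \<open>Polarization: the cubes at \<open>x + y\<close> and \<open>x - y\<close> determine
  \<open>S x x y\<close>, and \<open>S (x + y) (x + y) z\<close> then determines
  \<open>S x y z\<close>.\<close>

lemma trilinear_form_eqI:
  assumes "trilinear_form S" "trilinear_form S'" "subspace V"
    and eq: "\<And>x. x \<in> V \<Longrightarrow> S x x x = S' x x x"
    and V: "x \<in> V" "y \<in> V" "z \<in> V"
  shows "S x y z = S' x y z"
proof -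
  interpret S: trilinear_form S by fact
  interpret S': trilinear_form S' by fact
  have *: "S x x y = S' x x y" if "x \<in> V" "y \<in> V" for x y
  proof -
    have "x + y \<in> V" "x - y \<in> V" using that assms(3) by (auto intro: subspace_add subspace_diff)
    from this[THEN eq] that[THEN eq]
    show ?thesis
      using S.S_cube_add[of x y] S.S_cube_add[of x "- y"] S'.S_cube_add[of x y] S'.S_cube_add[of x "- y"]
      by simp
  qed
  have "S (x + y) (x + y) z = S x x z + 2 * S x y z + S y y z"
    using S.S_swap12[of y x z] by simp
  moreover have "S' (x + y) (x + y) z = S' x x z + 2 * S' x y z + S' y y z"
    using S'.S_swap12[of y x z] by simp
  ultimately show ?thesis
    using *[of x z] *[of y z] *[of "x + y" z] V assms(3) by (simp add: subspace_add)
qed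

locale cubic_space = trilinear_form S
  for S :: "'a::real_inner \<Rightarrow> 'a \<Rightarrow> 'a \<Rightarrow> real" +
  fixes V :: "'a set" and d :: nat and u :: "nat \<Rightarrow> 'a"
  assumes frame: "onframe V d u"
begin

text \<open>The vector of \<open>V\<close> representing the functional \<open>S x y\<close>. Being
  defined through the frame it is bilinear on the whole type, while the duality
  \<open>inner_mul\<close> holds for test vectors in \<open>V\<close>.\<close>

definition mul :: "'a \<Rightarrow> 'a \<Rightarrow> 'a" (infixl "\<star>" 71) where
  "x \<star> y = (\<Sum>i<d. S x y (u i) *\<^sub>R u i)"

lemmas V_subspace = onframe_subspace[OF frame]

lemma V_closed [simp, intro]:
  "0 \<in> V" "x \<in> V \<Longrightarrow> y \<in> V \<Longrightarrow> x + y \<in> V" "x \<in> V \<Longrightarrow> y \<in> V \<Longrightarrow> x - y \<in> V"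
  "x \<in> V \<Longrightarrow> c *\<^sub>R x \<in> V" "x \<in> V \<Longrightarrow> - x \<in> V"
  using V_subspace by (auto intro: subspace_0 subspace_add subspace_diff subspace_scale subspace_neg)

lemma mul_in [simp, intro]: "x \<star> y \<in> V"
  unfolding mul_def by (rule onframe_lin[OF frame])

lemma inner_mul: "(x \<star> y) \<bullet> z = S x y z" if "z \<in> V"
proof -
  have "S x y z = S x y (\<Sum>i<d. (z \<bullet> u i) *\<^sub>R u i)"
    using onframe_expand[OF frame that] by simp
  also have "\<dots> = (\<Sum>i<d. S x y (u i) * (u i \<bullet> z))"
    unfolding S_sum S_scale3 by (intro sum.cong refl) (simp add: inner_commute)
  finally show ?thesis by (simp add: mul_def inner_sum_left)
qed

lemma inner_mul': "z \<in> V \<Longrightarrow> z \<bullet> (x \<star> y) = S x y z"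
  using inner_mul[of z x y] by (simp add: inner_commute)

lemma eq_inI: "x \<in> V \<Longrightarrow> y \<in> V \<Longrightarrow> (\<And>z. z \<in> V \<Longrightarrow> x \<bullet> z = y \<bullet> z) \<Longrightarrow> x = y"
  by (rule onframe_eqI[OF frame])

lemma mul_eqI: "w \<in> V \<Longrightarrow> (\<And>z. z \<in> V \<Longrightarrow> S x y z = w \<bullet> z) \<Longrightarrow> x \<star> y = w"
  by (rule eq_inI) (auto simp: inner_mul)

lemma mul_commute: "x \<star> y = y \<star> x"
  by (simp add: mul_def S_swap12[of x y])

lemma mul_linear [simp]:
  "(x + y) \<star> z = x \<star> z + y \<star> z" "z \<star> (x + y) = z \<star> x + z \<star> y"
  "(c *\<^sub>R x) \<star> z = c *\<^sub>R (x \<star> z)" "z \<star> (c *\<^sub>R x) = c *\<^sub>R (z \<star> x)"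
  "(x - y) \<star> z = x \<star> z - y \<star> z" "z \<star> (x - y) = z \<star> x - z \<star> y"
  "(- x) \<star> z = - (x \<star> z)" "z \<star> (- x) = - (z \<star> x)" "0 \<star> z = 0" "z \<star> 0 = 0"
  by (simp_all add: mul_def scaleR_add_left sum.distrib scaleR_sum_right scaleR_diff_left
      sum_subtractf sum_negf)

lemma inner_mul_shift: "x \<in> V \<Longrightarrow> z \<in> V \<Longrightarrow> (x \<star> y) \<bullet> z = x \<bullet> (y \<star> z)"
  by (simp add: inner_mul inner_mul' S_ac)

end

section \<open>Cubic solutions of the eiconal equation\<close>

text \<open>For \<open>h x = S x x x\<close> the gradient is \<open>3 (x \<star> x)\<close>, so this is the equation
  \<open>|\<nabla>h|\<^sup>2 = 9 |x|\<^sup>4\<close>.\<close>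

locale eiconal = cubic_space +
  assumes norm_sq: "x \<in> V \<Longrightarrow> (x \<star> x) \<bullet> (x \<star> x) = (x \<bullet> x)^2"
begin

lemma norm_sq_polar1:
  assumes [simp]: "x \<in> V" "z \<in> V"
  shows "(x \<star> x) \<bullet> (x \<star> z) = (x \<bullet> x) * (x \<bullet> z)"
proof -
  have "(x \<star> x) \<bullet> (x \<star> x) + (4 * ((x \<star> x) \<bullet> (x \<star> z))) * s
      + (2 * ((x \<star> x) \<bullet> (z \<star> z)) + 4 * ((x \<star> z) \<bullet> (x \<star> z))) * s^2
      + (4 * ((x \<star> z) \<bullet> (z \<star> z))) * s^3 + ((z \<star> z) \<bullet> (z \<star> z)) * s^4
    = (x \<bullet> x)^2 + (4 * (x \<bullet> x) * (x \<bullet> z)) * s + (2 * (x \<bullet> x) * (z \<bullet> z) + 4 * (x \<bullet> z)^2) * s^2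
      + (4 * (x \<bullet> z) * (z \<bullet> z)) * s^3 + (z \<bullet> z)^2 * s^4" for s
    using norm_sq[of "x + s *\<^sub>R z"]
    by (simp add: inner_add_left inner_add_right mul_commute[of z x] inner_commute[of z x]
        inner_commute[of "z \<star> z" "x \<star> x"] inner_commute[of "z \<star> z" "x \<star> z"]
        inner_commute[of "x \<star> z" "x \<star> x"] algebra_simps power2_eq_square power3_eq_cube power4_eq_xxxx)
  from quartic_coeffs(2)[OF this] show ?thesis by simp
qed

lemma norm_sq_polar2:
  assumes [simp]: "x \<in> V" "z \<in> V" "w \<in> V"
  shows "2 * ((x \<star> w) \<bullet> (x \<star> z)) + (x \<star> x) \<bullet> (w \<star> z) = 2 * (x \<bullet> w) * (x \<bullet> z) + (x \<bullet> x) * (w \<bullet> z)"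
proof -
  have "(x \<star> x) \<bullet> (x \<star> z) + (2 * ((x \<star> w) \<bullet> (x \<star> z)) + (x \<star> x) \<bullet> (w \<star> z)) * s
     + (2 * ((x \<star> w) \<bullet> (w \<star> z)) + (w \<star> w) \<bullet> (x \<star> z)) * s^2 + ((w \<star> w) \<bullet> (w \<star> z)) * s^3 + 0 * s^4
   = (x \<bullet> x) * (x \<bullet> z) + (2 * (x \<bullet> w) * (x \<bullet> z) + (x \<bullet> x) * (w \<bullet> z)) * s
     + (2 * (x \<bullet> w) * (w \<bullet> z) + (w \<bullet> w) * (x \<bullet> z)) * s^2 + ((w \<bullet> w) * (w \<bullet> z)) * s^3 + 0 * s^4" for s
    using norm_sq_polar1[of "x + s *\<^sub>R w" z]
    by (simp add: inner_add_left inner_add_right mul_commute[of w x] inner_commute[of w x]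
        algebra_simps power2_eq_square power3_eq_cube power4_eq_xxxx)
  from quartic_coeffs(2)[OF this] show ?thesis by simp
qed

text \<open>The eiconal equation is quartic. In its full polarization the fourth vector
  \<open>w\<close> sits in one factor of each inner product, and symmetry of \<open>S\<close> moves
  it out, leaving an identity between vectors. On the diagonal it reads
  \<open>x \<star> (x \<star> x) = (x \<bullet> x) x\<close>; the product rules of the next sections
  are instances of it.\<close>

lemma jordan_linearized:
  assumes [simp]: "x \<in> V" "y \<in> V" "z \<in> V"
  shows "x \<star> (y \<star> z) + y \<star> (x \<star> z) + z \<star> (x \<star> y)
    = (x \<bullet> y) *\<^sub>R z + (x \<bullet> z) *\<^sub>R y + (y \<bullet> z) *\<^sub>R x"
proof (rule eq_inI)
  fix w assume [simp]: "w \<in> V"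
  have shift: "(a \<star> b) \<bullet> w = b \<bullet> (a \<star> w)" if "a \<in> V" "b \<in> V" for a b
    using that by (simp add: inner_mul inner_mul' S_ac)
  have "2 * ((x \<star> w) \<bullet> (y \<star> z)) + 2 * ((y \<star> w) \<bullet> (x \<star> z)) + 2 * ((x \<star> y) \<bullet> (w \<star> z))
      = 2 * (x \<bullet> w) * (y \<bullet> z) + 2 * (y \<bullet> w) * (x \<bullet> z) + 2 * (x \<bullet> y) * (w \<bullet> z)"
    using norm_sq_polar2[of "x + y" z w] norm_sq_polar2[of x z w] norm_sq_polar2[of y z w]
    by (simp add: inner_add_left inner_add_right mul_commute[of y x] inner_commute[of y x] algebra_simps)
  then show "(x \<star> (y \<star> z) + y \<star> (x \<star> z) + z \<star> (x \<star> y)) \<bullet> w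
      = ((x \<bullet> y) *\<^sub>R z + (x \<bullet> z) *\<^sub>R y + (y \<bullet> z) *\<^sub>R x) \<bullet> w"
    by (simp add: inner_add_left shift mul_commute[of z w] inner_commute[of z w] inner_commute[of "_ \<star> w"]
       inner_commute[of "w \<star> _"] algebra_simps)
qed auto

lemma jordan_cube: "x \<in> V \<Longrightarrow> x \<star> (x \<star> x) = (x \<bullet> x) *\<^sub>R x"
proof -
  assume [simp]: "x \<in> V"
  have "3 *\<^sub>R (x \<star> (x \<star> x)) = 3 *\<^sub>R ((x \<bullet> x) *\<^sub>R x)"
    using jordan_linearized[of x x x] unfolding scaleR_3 by simp
  then show ?thesis by (simp del: scaleR_scaleR)
qed

lemma jordan_square:
  assumes [simp]: "x \<in> V"
  shows "(x \<star> x) \<star> (x \<star> x) = (2 * (x \<bullet> (x \<star> x))) *\<^sub>R x - (x \<bullet> x) *\<^sub>R (x \<star> x)"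
proof -
  have "(x \<star> x) \<star> (x \<star> x) + 2 *\<^sub>R ((x \<bullet> x) *\<^sub>R (x \<star> x))
      = 2 *\<^sub>R ((x \<bullet> (x \<star> x)) *\<^sub>R x) + (x \<bullet> x) *\<^sub>R (x \<star> x)"
    using jordan_linearized[of x x "x \<star> x"]
    unfolding jordan_cube[OF assms] scaleR_2 mul_linear by (simp add: add_ac)
  then have "(x \<star> x) \<star> (x \<star> x)
      = 2 *\<^sub>R ((x \<bullet> (x \<star> x)) *\<^sub>R x) + (x \<bullet> x) *\<^sub>R (x \<star> x) - 2 *\<^sub>R ((x \<bullet> x) *\<^sub>R (x \<star> x))"
    by (simp only: eq_diff_eq)
  then show ?thesis unfolding scaleR_scaleR[symmetric] scaleR_2 by simp
qed

text \<open>A unit vector \<open>x1\<close> and its square \<open>y\<close> span a subspace closed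
  under the product. If it is a plane, take \<open>x1\<close> as 1 and \<open>n\<close> as the
  imaginary unit, so that \<open>y = exp(i t)\<close>; the product becomes
  \<open>exp(i t) conj(z) conj(w)\<close>. A unit vector of angle \<open>s\<close> is then
  idempotent if \<open>s = t - 2 s\<close>, so \<open>s = t / 3\<close> works. This avoids
  maximizing the cubic on the sphere.\<close>

lemma exists_idempotent:
  assumes x: "x \<in> V" "x \<noteq> 0"
  obtains e where "e \<in> V" "e \<bullet> e = 1" "e \<star> e = e"
proof -
  define x1 where "x1 = x /\<^sub>R sqrt (x \<bullet> x)"
  have x1 [simp]: "x1 \<in> V" "x1 \<bullet> x1 = 1" using x unit_vector[of x] by (auto simp: x1_def)
  define y where "y = x1 \<star> x1"
  define c where "c = x1 \<bullet> y"
  define r where "r = y - c *\<^sub>R x1"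
  define s where "s = sqrt (r \<bullet> r)"
  have [simp]: "y \<in> V" "r \<in> V" by (auto simp: y_def r_def)
  have yy: "y \<bullet> y = 1" using norm_sq[of x1] by (simp add: y_def)
  have xr: "x1 \<bullet> r = 0" by (simp add: r_def inner_diff_right c_def)
  have ss: "s^2 = r \<bullet> r" by (simp add: s_def)
  have cs: "c^2 + s^2 = 1"
    unfolding ss using yy by (simp add: r_def inner_diff_left inner_diff_right c_def inner_commute[of y x1] power2_eq_square)
  have c2: "1 - c^2 = s^2" using cs by simp
  have xy: "x1 \<star> y = x1" using jordan_cube[of x1] by (simp add: y_def)
  have yy2: "y \<star> y = c *\<^sub>R x1 + c *\<^sub>R x1 - y"
    unfolding y_def c_def using jordan_square[of x1]
    by (simp only: mult_2 scaleR_left_distrib x1 scaleR_one)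
  show ?thesis
  proof (cases "s = 0")
    case True
    then have "y = c *\<^sub>R x1" using ss by (simp add: r_def)
    moreover have "c * c = 1" using cs True by (simp add: power2_eq_square)
    ultimately show ?thesis
      using that[of "c *\<^sub>R x1"] by (simp add: y_def[symmetric])
  next
    case False
    define n where "n = r /\<^sub>R s"
    have [simp]: "n \<in> V" by (simp add: n_def)
    have n: "n \<bullet> n = 1" "x1 \<bullet> n = 0" "n \<bullet> x1 = 0"
      using False xr ss by (auto simp: n_def inner_commute[of r x1] power2_eq_square field_simps)
    have y: "y = c *\<^sub>R x1 + s *\<^sub>R n" using False by (simp add: n_def r_def)
    have "s *\<^sub>R (x1 \<star> n) = x1 \<star> y - c *\<^sub>R (x1 \<star> x1)" by (simp add: y)
    also have "\<dots> = x1 - c *\<^sub>R y" by (simp only: xy y_def[symmetric])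
    also have "\<dots> = (1 - c^2) *\<^sub>R x1 - (c * s) *\<^sub>R n" by (simp add: y algebra_simps power2_eq_square)
    also have "\<dots> = s *\<^sub>R (s *\<^sub>R x1 - c *\<^sub>R n)"
      unfolding c2 by (simp add: algebra_simps power2_eq_square)
    finally have xn: "x1 \<star> n = s *\<^sub>R x1 - c *\<^sub>R n" using False by simp
    have "s^2 *\<^sub>R (n \<star> n) = (y - c *\<^sub>R x1) \<star> (y - c *\<^sub>R x1)"
      by (simp add: y power2_eq_square)
    also have "\<dots> = y \<star> y - c *\<^sub>R (x1 \<star> y) - c *\<^sub>R (x1 \<star> y) + c^2 *\<^sub>R (x1 \<star> x1)"
      by (simp add: mul_commute[of y x1] algebra_simps power2_eq_square)
    also have "\<dots> = (c^2 - 1) *\<^sub>R y"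
      unfolding xy yy2 y_def[symmetric] by (simp add: algebra_simps)
    also have "\<dots> = s^2 *\<^sub>R (- y)" using cs by (simp add: algebra_simps flip: scaleR_add_left)
    finally have nn: "n \<star> n = - y" using False by (simp del: scaleR_minus_right)
    obtain t where t: "c = cos t" "s = sin t" using sincos_total_2pi[of c s] cs by metis
    define a where "a = cos (t / 3)"
    define b where "b = sin (t / 3)"
    define q where "q = 2 * a * b"
    have third: "t - 2 * (t / 3) = t / 3" by simp
    have ab: "a^2 + b^2 = 1" by (simp add: a_def b_def)
    have 1: "(a^2 - b^2) * c + q * s = a"
      using arg_cong[OF third, of cos] unfolding cos_diff cos_double sin_double
      by (simp add: t a_def b_def q_def algebra_simps)
    have 2: "(a^2 - b^2) * s - q * c = b"
      using arg_cong[OF third, of sin] unfolding sin_diff cos_double sin_double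
      by (simp add: t a_def b_def q_def algebra_simps)
    define X where "X = s *\<^sub>R x1 - c *\<^sub>R n"
    have qX: "q *\<^sub>R X = (a * b) *\<^sub>R X + (a * b) *\<^sub>R X"
      by (simp only: q_def mult_2 distrib_right scaleR_left_distrib)
    define e where "e = a *\<^sub>R x1 + b *\<^sub>R n"
    have "e \<star> e = (a^2 - b^2) *\<^sub>R y + q *\<^sub>R X"
      unfolding qX e_def mul_linear mul_commute[of n x1] xn X_def[symmetric] nn y_def[symmetric]
      by (simp add: algebra_simps power2_eq_square)
    also have "\<dots> = ((a^2 - b^2) * c + q * s) *\<^sub>R x1 + ((a^2 - b^2) * s - q * c) *\<^sub>R n"
      by (simp add: y X_def algebra_simps)
    also have "\<dots> = e" by (simp only: 1 2 e_def)
    finally have "e \<star> e = e" .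
    moreover have "e \<bullet> e = 1"
      using ab by (simp add: e_def inner_add_left inner_add_right n power2_eq_square)
    moreover have "e \<in> V" by (simp add: e_def)
    ultimately show ?thesis using that by blast
  qed
qed

end

section \<open>Euclidean composition algebras\<close>

text \<open>A unital product on \<open>W\<close> with multiplicative norm; the product is bilinear on the whole type
  so that no closure conditions are needed for bilinearity.\<close>

locale composition_algebra =
  fixes W :: "'a::real_inner set" and p :: "'a \<Rightarrow> 'a \<Rightarrow> 'a" (infixl "\<bowtie>" 71) and one :: 'a
  assumes W: "subspace W"
    and p_in [simp]: "x \<in> W \<Longrightarrow> y \<in> W \<Longrightarrow> x \<bowtie> y \<in> W"
    and p_bilinear [simp]: "(x + y) \<bowtie> z = x \<bowtie> z + y \<bowtie> z" "z \<bowtie> (x + y) = z \<bowtie> x + z \<bowtie> y"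
      "(c *\<^sub>R x) \<bowtie> z = c *\<^sub>R (x \<bowtie> z)" "z \<bowtie> (c *\<^sub>R x) = c *\<^sub>R (z \<bowtie> x)"
    and one_in [simp]: "one \<in> W" and one_norm [simp]: "one \<bullet> one = 1"
    and one_left [simp]: "x \<in> W \<Longrightarrow> one \<bowtie> x = x"
    and one_right [simp]: "x \<in> W \<Longrightarrow> x \<bowtie> one = x"
    and norm_mult: "x \<in> W \<Longrightarrow> y \<in> W \<Longrightarrow> (x \<bowtie> y) \<bullet> (x \<bowtie> y) = (x \<bullet> x) * (y \<bullet> y)"
begin

lemma W_closed [simp, intro]:
  "0 \<in> W" "x \<in> W \<Longrightarrow> y \<in> W \<Longrightarrow> x + y \<in> W" "x \<in> W \<Longrightarrow> y \<in> W \<Longrightarrow> x - y \<in> W"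
  "x \<in> W \<Longrightarrow> c *\<^sub>R x \<in> W" "x \<in> W \<Longrightarrow> - x \<in> W"
  using W by (auto intro: subspace_0 subspace_add subspace_diff subspace_scale subspace_neg)

lemma p_minus [simp]: "(- x) \<bowtie> z = - (x \<bowtie> z)" "z \<bowtie> (- x) = - (z \<bowtie> x)"
  "(x - y) \<bowtie> z = x \<bowtie> z - y \<bowtie> z" "z \<bowtie> (x - y) = z \<bowtie> x - z \<bowtie> y"
  "0 \<bowtie> z = 0" "z \<bowtie> 0 = 0"
proof -
  show 1: "(- x) \<bowtie> z = - (x \<bowtie> z)" "z \<bowtie> (- x) = - (z \<bowtie> x)" for x z
    using p_bilinear(3)[of "-1" x z] p_bilinear(4)[of z "-1" x] by auto
  show "(x - y) \<bowtie> z = x \<bowtie> z - y \<bowtie> z" "z \<bowtie> (x - y) = z \<bowtie> x - z \<bowtie> y"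
    using p_bilinear(1)[of x "- y" z] p_bilinear(2)[of z x "- y"] by (auto simp: 1)
  show "0 \<bowtie> z = 0" "z \<bowtie> 0 = 0"
    using p_bilinear(3)[of 0 0 z] p_bilinear(4)[of z 0 0] by auto
qed

lemma p_sum: "sum f A \<bowtie> z = (\<Sum>a\<in>A. f a \<bowtie> z)" "z \<bowtie> sum f A = (\<Sum>a\<in>A. z \<bowtie> f a)"
  by (induction A rule: infinite_finite_induct) auto

lemma W_eqI: "x \<in> W \<Longrightarrow> y \<in> W \<Longrightarrow> (\<And>z. z \<in> W \<Longrightarrow> x \<bullet> z = y \<bullet> z) \<Longrightarrow> x = y"
  by (metis W_closed(3) eq_iff_diff_eq_0 inner_diff_left inner_eq_zero_iff)

lemma norm_mult_polar_right:
  assumes "x \<in> W" "y \<in> W" "z \<in> W"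
  shows "(x \<bowtie> y) \<bullet> (x \<bowtie> z) = (x \<bullet> x) * (y \<bullet> z)"
  using norm_mult[of x "y + z"] norm_mult[of x y] norm_mult[of x z] assms
  by (simp add: inner_add_left inner_add_right inner_commute[of z y]
      inner_commute[of "x \<bowtie> z" "x \<bowtie> y"] algebra_simps)

lemma norm_mult_polar_left:
  assumes "x \<in> W" "y \<in> W" "z \<in> W"
  shows "(y \<bowtie> x) \<bullet> (z \<bowtie> x) = (y \<bullet> z) * (x \<bullet> x)"
  using norm_mult[of "y + z" x] norm_mult[of y x] norm_mult[of z x] assms
  by (simp add: inner_add_left inner_add_right inner_commute[of z y]
      inner_commute[of "z \<bowtie> x" "y \<bowtie> x"] algebra_simps)

lemma norm_mult_polar:
  assumes "x \<in> W" "y \<in> W" "z \<in> W" "w \<in> W"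
  shows "(x \<bowtie> y) \<bullet> (z \<bowtie> w) + (x \<bowtie> w) \<bullet> (z \<bowtie> y) = 2 * (x \<bullet> z) * (y \<bullet> w)"
  using norm_mult_polar_right[of "x + z" y w] norm_mult_polar_right[of x y w]
    norm_mult_polar_right[of z y w] assms
  by (simp add: inner_add_left inner_add_right inner_commute[of z x]
      inner_commute[of "z \<bowtie> y" "x \<bowtie> w"] algebra_simps)

definition cj :: "'a \<Rightarrow> 'a" where
  "cj x = (2 * (x \<bullet> one)) *\<^sub>R one - x"

lemma cj_in [simp]: "x \<in> W \<Longrightarrow> cj x \<in> W"
  by (simp add: cj_def)

lemma cj_cj [simp]: "cj (cj x) = x"
  by (simp add: cj_def inner_diff_left)

lemma cj_add [simp]: "cj (x + y) = cj x + cj y"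
  by (simp add: cj_def inner_add_left algebra_simps)

lemma cj_orth: "x \<bullet> one = 0 \<Longrightarrow> cj x = - x"
  by (simp add: cj_def)

text \<open>The polarized norm law with \<open>one\<close> as one of the factors: the adjoint of
  left multiplication by \<open>x\<close> is left multiplication by \<open>cj x\<close>.\<close>

lemma inner_mult_cj_left:
  assumes "x \<in> W" "y \<in> W" "z \<in> W"
  shows "(x \<bowtie> y) \<bullet> z = y \<bullet> (cj x \<bowtie> z)"
  using norm_mult_polar[of x y one z] assms
  by (simp add: cj_def inner_diff_right inner_commute[of "x \<bowtie> z"])

lemma inner_mult_cj_right:
  assumes "x \<in> W" "y \<in> W" "z \<in> W"
  shows "(x \<bowtie> y) \<bullet> z = x \<bullet> (z \<bowtie> cj y)"
  using norm_mult_polar[of x y z one] assms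
  by (simp add: cj_def inner_diff_right algebra_simps)

lemma cj_mult:
  assumes [simp]: "x \<in> W" "y \<in> W"
  shows "cj (x \<bowtie> y) = cj y \<bowtie> cj x"
proof (rule W_eqI)
  fix z assume [simp]: "z \<in> W"
  have "cj (x \<bowtie> y) \<bullet> z = (cj (x \<bowtie> y) \<bowtie> one) \<bullet> z" by simp
  also have "\<dots> = one \<bullet> ((x \<bowtie> y) \<bowtie> z)" using inner_mult_cj_left[of "cj (x \<bowtie> y)" one z] by simp
  also have "\<dots> = (x \<bowtie> y) \<bullet> cj z" using inner_mult_cj_right[of "x \<bowtie> y" z one] by (simp add: inner_commute)
  also have "\<dots> = y \<bullet> (cj x \<bowtie> cj z)" by (simp add: inner_mult_cj_left)
  also have "\<dots> = (y \<bowtie> z) \<bullet> cj x" using inner_mult_cj_right[of "cj x" "cj z" y] by (simp add: inner_commute)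
  also have "\<dots> = (cj y \<bowtie> cj x) \<bullet> z" using inner_mult_cj_left[of y z "cj x"] by (simp add: inner_commute)
  finally show "cj (x \<bowtie> y) \<bullet> z = (cj y \<bowtie> cj x) \<bullet> z" .
qed auto

text \<open>The polarized norm law with the outer factors moved across by adjoints. For
  \<open>x = y\<close> it is \<open>cj x \<bowtie> (x \<bowtie> z) = (x \<bullet> x) z\<close>, the
  weak form of associativity that is available in a composition algebra.\<close>

lemma exchange_left:
  assumes [simp]: "x \<in> W" "y \<in> W" "z \<in> W"
  shows "cj x \<bowtie> (y \<bowtie> z) + cj y \<bowtie> (x \<bowtie> z) = (2 * (x \<bullet> y)) *\<^sub>R z"
proof (rule W_eqI)
  fix w assume [simp]: "w \<in> W"
  have "(cj x \<bowtie> (y \<bowtie> z)) \<bullet> w = (y \<bowtie> z) \<bullet> (x \<bowtie> w)" "(cj y \<bowtie> (x \<bowtie> z)) \<bullet> w = (x \<bowtie> z) \<bullet> (y \<bowtie> w)"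
    by (simp_all add: inner_mult_cj_left[of "cj _"])
  then show "(cj x \<bowtie> (y \<bowtie> z) + cj y \<bowtie> (x \<bowtie> z)) \<bullet> w = ((2 * (x \<bullet> y)) *\<^sub>R z) \<bullet> w"
    using norm_mult_polar[of x z y w]
    by (simp add: inner_add_left inner_commute[of "y \<bowtie> z" "x \<bowtie> w"])
qed auto

lemma exchange_right:
  assumes [simp]: "x \<in> W" "y \<in> W" "z \<in> W"
  shows "(x \<bowtie> y) \<bowtie> cj z + (x \<bowtie> z) \<bowtie> cj y = (2 * (y \<bullet> z)) *\<^sub>R x"
proof (rule W_eqI)
  fix w assume [simp]: "w \<in> W"
  have "((x \<bowtie> y) \<bowtie> cj z) \<bullet> w = (x \<bowtie> y) \<bullet> (w \<bowtie> z)" "((x \<bowtie> z) \<bowtie> cj y) \<bullet> w = (x \<bowtie> z) \<bullet> (w \<bowtie> y)"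
    by (simp_all add: inner_mult_cj_right[of _ "cj _"])
  then show "((x \<bowtie> y) \<bowtie> cj z + (x \<bowtie> z) \<bowtie> cj y) \<bullet> w = ((2 * (y \<bullet> z)) *\<^sub>R x) \<bullet> w"
    using norm_mult_polar[of x y w z] by (simp add: inner_add_left)
qed auto

end

text \<open>One step of the Cayley--Dickson construction inside a composition algebra.\<close>

locale doubling_step = composition_algebra +
  fixes B :: "'a set" and l :: 'a
  assumes B: "B \<subseteq> W" "\<And>x. x \<in> B \<Longrightarrow> cj x \<in> B" "\<And>x y. x \<in> B \<Longrightarrow> y \<in> B \<Longrightarrow> x \<bowtie> y \<in> B" "one \<in> B"
    and l: "l \<in> W" "l \<bullet> l = 1" "\<And>x. x \<in> B \<Longrightarrow> x \<bullet> l = 0"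
begin

lemma BW [simp]: "x \<in> B \<Longrightarrow> x \<in> W" using B by auto
lemmas [simp] = B(2,3,4) l(1,2,3)

lemma l_orth [simp]: "x \<in> B \<Longrightarrow> l \<bullet> x = 0"
  using l(3)[of x] by (simp add: inner_commute)

lemma cj_l [simp]: "cj l = - l"
  by (rule cj_orth) simp

lemma bl_orth: "b \<in> B \<Longrightarrow> c \<in> B \<Longrightarrow> c \<bullet> (b \<bowtie> l) = 0"
  using inner_mult_cj_left[of b l c] by (simp add: inner_commute)

lemma bl_inner: "b \<in> B \<Longrightarrow> d \<in> B \<Longrightarrow> (b \<bowtie> l) \<bullet> (d \<bowtie> l) = b \<bullet> d"
  by (simp add: norm_mult_polar_left)

lemma l_commute: "a \<in> B \<Longrightarrow> l \<bowtie> cj a = a \<bowtie> l"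
  using exchange_right[of one a l] by (simp add: eq_neg_iff_add_eq_0)

lemma mult_a_dl: "a \<in> B \<Longrightarrow> d \<in> B \<Longrightarrow> a \<bowtie> (d \<bowtie> l) = (d \<bowtie> a) \<bowtie> l"
proof -
  assume [simp]: "a \<in> B" "d \<in> B"
  have "a \<bowtie> (l \<bowtie> cj d) - l \<bowtie> (cj a \<bowtie> cj d) = 0"
    using exchange_left[of "cj a" l "cj d"] by simp
  moreover have "l \<bowtie> (cj a \<bowtie> cj d) = (d \<bowtie> a) \<bowtie> l"
    using l_commute[of "d \<bowtie> a"] by (simp add: cj_mult)
  ultimately show ?thesis by (simp add: l_commute)
qed

lemma mult_bl_c: "b \<in> B \<Longrightarrow> c \<in> B \<Longrightarrow> (b \<bowtie> l) \<bowtie> c = (b \<bowtie> cj c) \<bowtie> l"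
  using exchange_right[of b l "cj c"] by simp

lemma mult_bl_dl: "b \<in> B \<Longrightarrow> d \<in> B \<Longrightarrow> (b \<bowtie> l) \<bowtie> (d \<bowtie> l) = - (cj d \<bowtie> b)"
proof -
  assume [simp]: "b \<in> B" "d \<in> B"
  have orth: "(d \<bowtie> l) \<bullet> one = 0" using bl_orth[of d one] by (simp add: inner_commute)
  have ll: "(x \<bowtie> l) \<bowtie> l = - x" if "x \<in> B" for x
  proof -
    have "2 *\<^sub>R ((x \<bowtie> l) \<bowtie> l) = 2 *\<^sub>R (- x)"
      using exchange_right[of x l l] that by (simp add: minus_equation_iff flip: scaleR_2)
    then show ?thesis by (simp del: scaleR_minus_right)
  qed
  have ld: "l \<bullet> (d \<bowtie> l) = d \<bullet> one" using bl_inner[of one d] by (simp add: inner_commute)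
  have "- ((b \<bowtie> l) \<bowtie> (d \<bowtie> l)) - (b \<bowtie> (d \<bowtie> l)) \<bowtie> l = (2 * (d \<bullet> one)) *\<^sub>R b"
    using exchange_right[of b l "d \<bowtie> l"] by (simp add: cj_orth[OF orth] ld)
  moreover have "(b \<bowtie> (d \<bowtie> l)) \<bowtie> l = - (d \<bowtie> b)"
    by (simp add: mult_a_dl ll)
  ultimately have "- ((b \<bowtie> l) \<bowtie> (d \<bowtie> l)) = (2 * (d \<bullet> one)) *\<^sub>R b - d \<bowtie> b"
    by (simp add: eq_diff_eq)
  from arg_cong[OF this, of uminus] show ?thesis by (simp add: cj_def)
qed

text \<open>The right-hand side is the recursion defining \<open>cd_mult\<close>, including the
  order of the factors. Hence a frame obtained by doubling multiplies by that table.\<close>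

lemma doubled_mult:
  assumes "a \<in> B" "b \<in> B" "c \<in> B" "d \<in> B"
  shows "(a + b \<bowtie> l) \<bowtie> (c + d \<bowtie> l) = (a \<bowtie> c - cj d \<bowtie> b) + (d \<bowtie> a + b \<bowtie> cj c) \<bowtie> l"
  using assms by (simp add: mult_a_dl mult_bl_c mult_bl_dl)

end

context composition_algebra
begin

definition cd_frame :: "nat \<Rightarrow> (nat \<Rightarrow> 'a) \<Rightarrow> bool" where
  "cd_frame h \<phi> \<longleftrightarrow> 1 \<le> h \<and> (\<forall>i<h. \<phi> i \<in> W) \<and> orthonormal h \<phi> \<and> \<phi> 0 = one \<and>
     (\<forall>x y. (\<Sum>i<h. x i *\<^sub>R \<phi> i) \<bowtie> (\<Sum>i<h. y i *\<^sub>R \<phi> i) = (\<Sum>i<h. cd_mult h x y i *\<^sub>R \<phi> i))"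

lemma cd_frame_1: "cd_frame 1 (\<lambda>_. one)"
  by (simp add: cd_frame_def orthonormal_def cd_mult.simps)

lemma cd_frame_cj:
  assumes "cd_frame h \<phi>"
  shows "cj (\<Sum>i<h. x i *\<^sub>R \<phi> i) = (\<Sum>i<h. cd_conj x i *\<^sub>R \<phi> i)"
proof -
  obtain k where h: "h = Suc k" using assms by (cases h) (auto simp: cd_frame_def)
  have \<phi>: "\<phi> 0 = one" "orthonormal h \<phi>" using assms by (auto simp: cd_frame_def)
  have "(\<Sum>i<h. x i *\<^sub>R \<phi> i) \<bullet> one = x 0"
    using orthonormal_coeff[OF \<phi>(2), of 0 x] \<phi>(1) h by simp
  then have "cj (\<Sum>i<h. x i *\<^sub>R \<phi> i) = (2 * x 0) *\<^sub>R one - (\<Sum>i<h. x i *\<^sub>R \<phi> i)"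
    by (simp add: cj_def)
  also have "\<dots> = x 0 *\<^sub>R one - (\<Sum>i<k. x (Suc i) *\<^sub>R \<phi> (Suc i))"
    unfolding h sum.lessThan_Suc_shift mult_2 scaleR_left_distrib by (simp add: \<phi>)
  also have "\<dots> = (\<Sum>i<h. cd_conj x i *\<^sub>R \<phi> i)"
    unfolding h sum.lessThan_Suc_shift by (simp add: \<phi> cd_conj_def sum_negf)
  finally show ?thesis .
qed

lemma cd_frame_double:
  assumes \<phi>: "cd_frame h \<phi>" and l: "l \<in> W" "l \<bullet> l = 1" "\<And>i. i < h \<Longrightarrow> \<phi> i \<bullet> l = 0"
  shows "cd_frame (2 * h) (append_frame h \<phi> (\<lambda>i. \<phi> i \<bowtie> l))"
proof -
  let ?L = "\<lambda>x. \<Sum>i<h. x i *\<^sub>R \<phi> i"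
  let ?\<psi> = "append_frame h \<phi> (\<lambda>i. \<phi> i \<bowtie> l)"
  have h: "1 \<le> h" and in_W: "\<And>i. i < h \<Longrightarrow> \<phi> i \<in> W" and on: "orthonormal h \<phi>" and zero: "\<phi> 0 = one"
    and mult: "\<And>x y. ?L x \<bowtie> ?L y = ?L (cd_mult h x y)"
    using \<phi> by (auto simp: cd_frame_def)
  have LW: "?L x \<in> W" for x using in_W by (intro subspace_sum[OF W] subspace_scale[OF W]) auto
  interpret doubling_step W p one "range ?L" l
  proof
    show "range ?L \<subseteq> W" using LW by auto
    show "cj x \<in> range ?L" if "x \<in> range ?L" for x using that cd_frame_cj[OF \<phi>] by auto
    show "x \<bowtie> y \<in> range ?L" if "x \<in> range ?L" "y \<in> range ?L" for x y using that mult by auto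
    have "one = ?L (\<lambda>i. if i = 0 then 1 else 0)"
      using h by (simp add: if_distrib[of "\<lambda>c. c *\<^sub>R _"] zero cong: if_cong)
    then show "one \<in> range ?L" by auto
    show "x \<bullet> l = 0" if "x \<in> range ?L" for x using that l(3) by (auto simp: inner_sum_left)
  qed (use l in auto)
  have \<phi>B: "\<phi> i \<in> range ?L" if "i < h" for i
  proof
    show "\<phi> i = ?L (\<lambda>j. if j = i then 1 else 0)"
      using that by (simp add: if_distrib[of "\<lambda>c. c *\<^sub>R _"] cong: if_cong)
  qed simp
  have double: "(\<Sum>i<2 * h. x i *\<^sub>R ?\<psi> i) = ?L x + ?L (\<lambda>i. x (h + i)) \<bowtie> l" for x
    using sum_append_frame[of "\<lambda>i v. x i *\<^sub>R v" h \<phi> "\<lambda>i. \<phi> i \<bowtie> l" h] by (simp add: mult_2 p_sum)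
  have "(\<Sum>i<2 * h. x i *\<^sub>R ?\<psi> i) \<bowtie> (\<Sum>i<2 * h. y i *\<^sub>R ?\<psi> i) = (\<Sum>i<2 * h. cd_mult (2 * h) x y i *\<^sub>R ?\<psi> i)"
    for x y
  proof -
    let ?b = "\<lambda>i. x (h + i)" and ?d = "\<lambda>i. y (h + i)"
    have "(\<Sum>i<2 * h. x i *\<^sub>R ?\<psi> i) \<bowtie> (\<Sum>i<2 * h. y i *\<^sub>R ?\<psi> i)
        = (?L (cd_mult h x y) - ?L (cd_mult h (cd_conj ?d) ?b))
          + (?L (cd_mult h ?d x) + ?L (cd_mult h ?b (cd_conj y))) \<bowtie> l"
      unfolding double by (subst doubled_mult) (auto simp: mult cd_frame_cj[OF \<phi>])
    also have "\<dots> = ?L (\<lambda>i. cd_mult h x y i - cd_mult h (cd_conj ?d) ?b i)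
          + ?L (\<lambda>i. cd_mult h ?d x i + cd_mult h ?b (cd_conj y) i) \<bowtie> l"
      by (simp add: scaleR_left_diff_distrib scaleR_left_distrib sum.distrib sum_subtractf)
    also have "\<dots> = (\<Sum>i<2 * h. cd_mult (2 * h) x y i *\<^sub>R ?\<psi> i)"
      unfolding double using h
      by (intro arg_cong2[of _ _ _ _ "(+)"] arg_cong[of _ _ "\<lambda>v. v \<bowtie> l"] sum.cong refl)
        (auto simp: cd_mult.simps[of "2 * h"] Let_def)
    finally show ?thesis .
  qed
  moreover have "orthonormal (2 * h) ?\<psi>"
    unfolding orthonormal_def
  proof (intro allI impI)
    fix i j assume ij: "i < 2 * h" "j < 2 * h"
    have 1: "\<phi> i \<bullet> (\<phi> j \<bowtie> l) = 0" "(\<phi> j \<bowtie> l) \<bullet> \<phi> i = 0" if "i < h" "j < h" for i j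
      using bl_orth[OF \<phi>B[OF that(2)] \<phi>B[OF that(1)]] by (auto simp: inner_commute)
    have 2: "(\<phi> i \<bowtie> l) \<bullet> (\<phi> j \<bowtie> l) = (if i = j then 1 else 0)" if "i < h" "j < h" for i j
      using bl_inner[OF \<phi>B[OF that(1)] \<phi>B[OF that(2)]] orthonormalD[OF on that] by simp
    show "?\<psi> i \<bullet> ?\<psi> j = (if i = j then 1 else 0)"
      using ij orthonormalD[OF on, of i j] 2[of "i - h" "j - h"] 1[of i "j - h"] 1[of j "i - h"]
      by (cases "i < h"; cases "j < h") (simp_all add: append_frame_def, arith?)
  qed
  moreover have "?\<psi> i \<in> W" if "i < 2 * h" for i
    using that in_W l by (simp add: append_frame_def)
  ultimately show ?thesis
    unfolding cd_frame_def using h zero by (simp add: append_frame_def)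
qed

text \<open>As long as the subalgebra obtained by doubling does not fill \<open>W\<close>, there is
  a unit vector orthogonal to it, and the doubling continues. The dimensions run through the powers
  of two, so the dimension \<open>2 ^ k\<close> of \<open>W\<close> is met exactly.\<close>

theorem hurwitz:
  assumes w: "onframe W d w" and d: "d = 2 ^ k"
  obtains \<phi> where "cd_frame d \<phi>" "onframe W d \<phi>"
proof -
  have "\<exists>\<phi>. cd_frame (2 ^ m) \<phi>" if "m \<le> k" for m
    using that
  proof (induction m)
    case 0
    then show ?case using cd_frame_1 by auto
  next
    case (Suc m)
    then obtain \<phi> where \<phi>: "cd_frame (2 ^ m) \<phi>" by auto
    let ?h = "2 ^ m :: nat"
    have on: "orthonormal ?h \<phi>" and in_W: "\<And>i. i < ?h \<Longrightarrow> \<phi> i \<in> W" using \<phi> by (auto simp: cd_frame_def)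
    have "?h < d" using Suc.prems by (simp add: d)
    obtain x where x: "x \<in> W" "x \<noteq> (\<Sum>i<?h. (x \<bullet> \<phi> i) *\<^sub>R \<phi> i)"
    proof (rule ccontr)
      assume "\<not> thesis"
      then have "onframe W ?h \<phi>" using that on in_W W by (auto simp: onframe_def)
      from onframe_dim_unique[OF this w] \<open>?h < d\<close> show False by simp
    qed
    define r where "r = x - (\<Sum>i<?h. (x \<bullet> \<phi> i) *\<^sub>R \<phi> i)"
    define l where "l = r /\<^sub>R sqrt (r \<bullet> r)"
    have "r \<in> W" unfolding r_def
      by (intro W_closed x subspace_sum[OF W] in_W) auto
    then have "l \<in> W" by (simp add: l_def)
    moreover have "l \<bullet> l = 1" unfolding l_def using x by (intro unit_vector) (simp add: r_def)
    moreover have "\<phi> i \<bullet> l = 0" if "i < ?h" for i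
      using residual_orthogonal[OF on that, of x]
      by (simp add: l_def r_def inner_commute)
    ultimately have "cd_frame (2 * ?h) (append_frame ?h \<phi> (\<lambda>i. \<phi> i \<bowtie> l))"
      by (rule cd_frame_double[OF \<phi>])
    then show ?case by auto
  qed
  then obtain \<phi> where \<phi>: "cd_frame d \<phi>" using d by auto
  then have "onframe W d \<phi>"
    by (intro orthonormal_onframe[OF w]) (auto simp: cd_frame_def)
  with \<phi> that show ?thesis by blast
qed

end

section \<open>Peirce decomposition of an eiconal algebra\<close>

lemma onframe_single: "e \<bullet> e = 1 \<Longrightarrow> onframe (range (\<lambda>r. r *\<^sub>R e)) 1 (\<lambda>_. e)"
  by (auto simp: onframe_def orthonormal_def subspace_def scaleR_left_distrib[symmetric]
      intro: range_eqI[of _ _ 0] range_eqI[of _ _ 1])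

lemma inner_eqD: "x = y \<Longrightarrow> x \<bullet> z = y \<bullet> z"
  by simp

lemmas inner_expand = inner_add_left inner_diff_left inner_minus_left

lemma onframe_isometry:
  assumes w: "onframe W d w" and E: "subspace E" "\<And>x. x \<in> W \<Longrightarrow> T x \<in> E"
    and T: "\<And>x y. T (x + y) = T x + T y" "\<And>c x. T (c *\<^sub>R x) = c *\<^sub>R T x"
    and iso: "\<And>x y. x \<in> W \<Longrightarrow> y \<in> W \<Longrightarrow> T x \<bullet> T y = x \<bullet> y"
    and onto: "\<And>y. y \<in> E \<Longrightarrow> \<exists>x\<in>W. y = T x"
  shows "onframe E d (\<lambda>i. T (w i))"
proof -
  have T_sum: "T (sum f A) = (\<Sum>a\<in>A. T (f a))" for f :: "nat \<Rightarrow> _" and A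
    using T(2)[of 0] by (induction A rule: infinite_finite_induct) (auto simp: T)
  have "y = (\<Sum>i<d. (y \<bullet> T (w i)) *\<^sub>R T (w i))" if "y \<in> E" for y
  proof -
    from onto[OF that] obtain x where x: "x \<in> W" "y = T x" by auto
    have "y = T (\<Sum>i<d. (x \<bullet> w i) *\<^sub>R w i)" using onframe_expand[OF w x(1)] x by simp
    also have "\<dots> = (\<Sum>i<d. (y \<bullet> T (w i)) *\<^sub>R T (w i))"
      unfolding T_sum T by (intro sum.cong refl) (simp add: x iso onframe_in[OF w])
    finally show ?thesis .
  qed
  then show ?thesis
    using E onframe_in[OF w] onframe_orthonormal[OF w] iso
    by (auto simp: onframe_def orthonormal_def)
qed

context eiconal
begin

text \<open>The idempotent \<open>e\<close> splits its orthogonal complement into the eigenspaces \<open>U e\<close> and \<open>N e\<close> of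
  multiplication by \<open>e\<close>, for the eigenvalues 1/2 and -1.\<close>

definition idem :: "'a \<Rightarrow> bool" where
  "idem e \<longleftrightarrow> e \<in> V \<and> e \<bullet> e = 1 \<and> e \<star> e = e"

definition U :: "'a \<Rightarrow> 'a set" where
  "U e = {y\<in>V. e \<star> y = (1/2) *\<^sub>R y}"

definition N :: "'a \<Rightarrow> 'a set" where
  "N e = {y\<in>V. e \<star> y = - y}"

text \<open>This is the case of trivial \<open>U e\<close>. The cubic is then
  \<open>x0^3 - 3 x0 |x'|^2\<close>, with the linear factor \<open>x0\<close>.\<close>

definition reducible_at :: "'a \<Rightarrow> bool" where
  "reducible_at e \<longleftrightarrow> idem e \<and> (\<forall>y\<in>V. y \<bullet> e = 0 \<longrightarrow> e \<star> y = - y)"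

lemma subspace_U: "subspace (U e)"
  by (auto simp: subspace_def U_def algebra_simps)

lemma subspace_N: "subspace (N e)"
  by (auto simp: subspace_def N_def)

lemma inner_eigen:
  assumes "x \<in> V" "y \<in> V" "e \<in> V" "e \<star> x = a *\<^sub>R x" "e \<star> y = b *\<^sub>R y" "a \<noteq> b"
  shows "x \<bullet> y = 0"
proof -
  have "a * (x \<bullet> y) = (e \<star> x) \<bullet> y" using assms by simp
  also have "\<dots> = x \<bullet> (e \<star> y)" using assms(1-3) by (simp add: inner_mul inner_mul' S_ac)
  also have "\<dots> = b * (x \<bullet> y)" using assms by simp
  finally show ?thesis using assms(6) by simp
qed

end

locale eiconal_idem = eiconal +
  fixes e
  assumes idem: "idem e"
begin

lemma e [simp]: "e \<in> V" "e \<bullet> e = 1" "e \<star> e = e"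
  using idem by (auto simp: idem_def)

lemma UN_V: "x \<in> U e \<Longrightarrow> x \<in> V" "x \<in> N e \<Longrightarrow> x \<in> V"
  by (auto simp: U_def N_def)

lemma e_U: "x \<in> U e \<Longrightarrow> e \<star> x = (1/2) *\<^sub>R x" "x \<in> U e \<Longrightarrow> x \<star> e = (1/2) *\<^sub>R x"
  by (auto simp: U_def mul_commute[of x])

lemma e_N: "x \<in> N e \<Longrightarrow> e \<star> x = - x" "x \<in> N e \<Longrightarrow> x \<star> e = - x"
  by (auto simp: N_def mul_commute[of x])

lemma U_orth_e: "x \<in> U e \<Longrightarrow> x \<bullet> e = 0" "x \<in> U e \<Longrightarrow> e \<bullet> x = 0"
  using inner_eigen[of x e e "1/2" 1] by (auto simp: U_def inner_commute)

lemma N_orth_e: "x \<in> N e \<Longrightarrow> x \<bullet> e = 0" "x \<in> N e \<Longrightarrow> e \<bullet> x = 0"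
  using inner_eigen[of x e e "-1" 1] by (auto simp: N_def inner_commute)

lemma U_orth_N: "x \<in> U e \<Longrightarrow> y \<in> N e \<Longrightarrow> x \<bullet> y = 0" "x \<in> U e \<Longrightarrow> y \<in> N e \<Longrightarrow> y \<bullet> x = 0"
  using inner_eigen[of x y e "1/2" "-1"] by (auto simp: U_def N_def inner_commute)

text \<open>Multiplication \<open>L\<close> by \<open>e\<close> satisfies
  \<open>2 L^2 + L - 1 = (2 L - 1) (L + 1) = 0\<close> on the complement of \<open>e\<close>, whence
  the eigenvalues 1/2 and -1. The vectors \<open>?a\<close> and \<open>?b\<close> in
  \<open>split_UN\<close> are the two eigenprojections \<open>(2/3) (L + 1) y\<close> and
  \<open>(1/3) (1 - 2 L) y\<close>.\<close>

lemma quad_e: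
  assumes [simp]: "y \<in> V" and "y \<bullet> e = 0"
  shows "2 *\<^sub>R (e \<star> (e \<star> y)) = y - e \<star> y"
proof -
  have ey: "e \<bullet> y = 0" using assms(2) by (simp add: inner_commute)
  have "e \<star> (e \<star> y) + e \<star> (e \<star> y) + e \<star> y = y"
    using jordan_linearized[of e e y] by (simp add: mul_commute[of y e] ey)
  then show ?thesis unfolding scaleR_2 by (simp only: eq_diff_eq)
qed

lemma split_UN:
  assumes [simp]: "y \<in> V" and "y \<bullet> e = 0"
  obtains a b where "a \<in> U e" "b \<in> N e" "y = a + b"
proof -
  note q = quad_e[OF assms]
  let ?a = "(2/3) *\<^sub>R (e \<star> y + y)" and ?b = "(1/3) *\<^sub>R (y - 2 *\<^sub>R (e \<star> y))"
  have e2: "e \<star> (e \<star> y) = (1/2) *\<^sub>R (y - e \<star> y)" using q[THEN arg_cong, of "\<lambda>v. (1/2) *\<^sub>R v"] by simp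
  have "e \<star> ?a = (1/2) *\<^sub>R ?a" "e \<star> ?b = - ?b"
    by (rule inner_eqI, simp add: e2 inner_add_left inner_diff_left inner_minus_left field_simps)+
  then have "?a \<in> U e" "?b \<in> N e" by (simp_all add: U_def N_def del: mul_linear)
  moreover have "y = ?a + ?b"
    by (rule inner_eqI) (simp add: inner_add_left inner_diff_left algebra_simps)
  ultimately show ?thesis by (rule that)
qed

lemma e_mul_sq: "y \<in> V \<Longrightarrow> y \<bullet> e = 0 \<Longrightarrow> e \<star> (y \<star> y) + 2 *\<^sub>R (y \<star> (e \<star> y)) = (y \<bullet> y) *\<^sub>R e"
  using jordan_linearized[of e y y] by (simp add: mul_commute[of y e] inner_commute[of e y] scaleR_2 add.assoc)

text \<open>The difference \<open>r\<close> of the two sides satisfies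
  \<open>e \<star> r = 2 r\<close>. It is orthogonal to \<open>e\<close>, where 2 is not an
  eigenvalue, so it vanishes.\<close>

lemma N_sq:
  assumes v: "v \<in> N e"
  shows "v \<star> v = - (v \<bullet> v) *\<^sub>R e"
proof -
  have [simp]: "v \<in> V" using v by (rule UN_V)
  define r where "r = v \<star> v + (v \<bullet> v) *\<^sub>R e"
  have [simp]: "r \<in> V" by (simp add: r_def)
  have "e \<star> (v \<star> v) = (v \<bullet> v) *\<^sub>R e + 2 *\<^sub>R (v \<star> v)"
    using e_mul_sq[of v] v by (simp add: N_orth_e e_N diff_eq_eq)
  then have er: "e \<star> r = 2 *\<^sub>R r" by (simp add: r_def scaleR_2)
  then have "r \<bullet> e = 0" using inner_eigen[of r e e 2 1] by simp
  with er have "2 *\<^sub>R (2 *\<^sub>R (2 *\<^sub>R r)) = r - 2 *\<^sub>R r"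
    using quad_e[of r] by (simp del: scaleR_scaleR)
  from arg_cong[OF this, of "\<lambda>v. v \<bullet> r"] have "r = 0" by (simp add: inner_diff_left)
  then show ?thesis by (simp add: r_def eq_neg_iff_add_eq_0)
qed

lemma N_mul:
  assumes "v \<in> N e" "w \<in> N e"
  shows "v \<star> w = - (v \<bullet> w) *\<^sub>R e"
proof -
  have "v + w \<in> N e" using assms subspace_N by (auto intro: subspace_add)
  note sq = N_sq[OF this] N_sq[OF assms(1)] N_sq[OF assms(2)]
  show ?thesis
  proof (rule inner_eqI)
    fix z
    show "(v \<star> w) \<bullet> z = (- (v \<bullet> w) *\<^sub>R e) \<bullet> z"
      using sq[THEN inner_eqD, of z]
      by (simp add: inner_expand inner_add_right mul_commute[of w v] inner_commute[of w v] algebra_simps)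
  qed
qed

lemma U_sq_minus:
  assumes g: "g \<in> U e"
  shows "g \<star> g - ((g \<bullet> g) / 2) *\<^sub>R e \<in> N e"
proof -
  have [simp]: "g \<in> V" using g by (rule UN_V)
  have "e \<star> (g \<star> g) + g \<star> g = (g \<bullet> g) *\<^sub>R e"
    using e_mul_sq[of g] g by (simp add: U_orth_e e_U)
  then have *: "e \<star> (g \<star> g) = (g \<bullet> g) *\<^sub>R e - g \<star> g" by (simp only: eq_diff_eq)
  have "e \<star> (g \<star> g - ((g \<bullet> g) / 2) *\<^sub>R e) = - (g \<star> g - ((g \<bullet> g) / 2) *\<^sub>R e)"
    by (rule inner_eqI) (simp add: * inner_expand field_simps)
  then show ?thesis by (simp add: N_def del: mul_linear)
qed

text \<open>In the linearized identity for \<open>v\<close>, \<open>w\<close>, \<open>g\<close> the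
  term \<open>g \<star> (v \<star> w)\<close> is known from \<open>N_mul\<close>. Up to the scaling
  \<open>2 / sqrt 3\<close> these are Clifford relations, so \<open>U e\<close> is a Clifford module
  over \<open>N e\<close>. Multiplication by a unit vector squares to 3/4, which is the origin of
  the eigenvalues \<open>sqrt 3 / 2\<close> and \<open>- sqrt 3 / 2\<close>.\<close>

lemma N_N_U:
  assumes g: "g \<in> U e" and v: "v \<in> N e" and w: "w \<in> N e"
  shows "v \<star> (w \<star> g) + w \<star> (v \<star> g) = (3/2 * (v \<bullet> w)) *\<^sub>R g"
proof -
  have [simp]: "g \<in> V" "v \<in> V" "w \<in> V" using g v w UN_V by auto
  have *: "v \<star> (w \<star> g) + w \<star> (v \<star> g) + - ((v \<bullet> w) / 2) *\<^sub>R g = (v \<bullet> w) *\<^sub>R g"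
    using jordan_linearized[of v w g] g v w by (simp add: U_orth_N N_mul[OF v w] e_U)
  have "v \<star> (w \<star> g) + w \<star> (v \<star> g) = (v \<bullet> w) *\<^sub>R g - (- ((v \<bullet> w) / 2) *\<^sub>R g)"
    using * by (simp only: eq_diff_eq)
  also have "\<dots> = (3/2 * (v \<bullet> w)) *\<^sub>R g" by (rule inner_eqI) (simp add: inner_diff_left inner_add_left)
  finally show ?thesis .
qed

lemma N_U:
  assumes g: "g \<in> U e" and v: "v \<in> N e"
  shows "v \<star> g \<in> U e"
proof -
  have [simp]: "g \<in> V" "v \<in> V" using g v UN_V by auto
  have *: "e \<star> (g \<star> v) - g \<star> v + (1/2) *\<^sub>R (g \<star> v) = 0"
    using jordan_linearized[of g e v] g v
    by (simp add: U_orth_N U_orth_e N_orth_e e_U e_N mul_commute[of v g])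
  have "e \<star> (v \<star> g) = (1/2) *\<^sub>R (v \<star> g)"
    by (rule inner_eqI) (use *[THEN inner_eqD] in \<open>simp add: inner_expand mul_commute[of v g] field_simps\<close>)
  then show ?thesis by (simp add: U_def)
qed

lemma N_U_norm:
  assumes g: "g \<in> U e" "g' \<in> U e" and v: "v \<in> N e"
  shows "(v \<star> g) \<bullet> (v \<star> g') = 3/4 * (v \<bullet> v) * (g \<bullet> g')"
proof -
  have [simp]: "g \<in> V" "g' \<in> V" "v \<in> V" using g v UN_V by auto
  have "(v \<star> g) \<bullet> (v \<star> g') = (v \<star> (v \<star> g)) \<bullet> g'" by (simp add: inner_mul inner_mul' S_ac)
  moreover have "2 * ((v \<star> (v \<star> g)) \<bullet> g') = (v \<star> (v \<star> g) + v \<star> (v \<star> g)) \<bullet> g'"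
    by (simp add: inner_add_left)
  ultimately show ?thesis unfolding N_N_U[OF g(1) v v] by simp
qed

text \<open>The eigenspace of multiplication by the unit vector \<open>v \<in> N e\<close> on \<open>U e\<close> for the eigenvalue
  \<open>sqrt 3 / 2\<close>; the one for \<open>- sqrt 3 / 2\<close> is \<open>E (- v)\<close>.\<close>

definition E :: "'a \<Rightarrow> 'a set" where
  "E v = {x\<in>U e. v \<star> x = (sqrt 3 / 2) *\<^sub>R x}"

lemma subspace_E: "subspace (E v)"
  using subspace_U[of e] by (auto simp: subspace_def E_def algebra_simps)

lemma E_U: "x \<in> E v \<Longrightarrow> x \<in> U e"
  by (simp add: E_def)

lemma E_V: "x \<in> E v \<Longrightarrow> x \<in> V"
  by (auto simp: E_def UN_V)

lemma E_mul: "x \<in> E v \<Longrightarrow> v \<star> x = (sqrt 3 / 2) *\<^sub>R x" "x \<in> E v \<Longrightarrow> x \<star> v = (sqrt 3 / 2) *\<^sub>R x"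
  by (simp_all add: E_def mul_commute[of x])

lemma E_mul_neg: "x \<in> E (- v) \<Longrightarrow> v \<star> x = - (sqrt 3 / 2) *\<^sub>R x" "x \<in> E (- v) \<Longrightarrow> x \<star> v = - (sqrt 3 / 2) *\<^sub>R x"
  using E_mul[of x "- v", THEN arg_cong, of uminus] by simp_all

lemma split_E:
  assumes v: "v \<in> N e" "v \<bullet> v = 1" and x: "x \<in> U e"
  obtains a b where "a \<in> E v" "b \<in> E (- v)" "x = a + b"
proof -
  have [simp]: "x \<in> V" "v \<in> V" using x v UN_V by auto
  let ?k = "sqrt 3 / 2"
  let ?y = "(2 / sqrt 3) *\<^sub>R (v \<star> x)"
  let ?a = "(1/2) *\<^sub>R (x + ?y)" and ?b = "(1/2) *\<^sub>R (x - ?y)"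
  have s3: "sqrt 3 * (sqrt 3 * t) = 3 * t" for t by (simp add: mult.assoc[symmetric])
  have "2 *\<^sub>R (v \<star> (v \<star> x)) = 2 *\<^sub>R ((3/4) *\<^sub>R x)"
    using N_N_U[OF x v(1) v(1)] v by (simp add: scaleR_2)
  then have vv: "v \<star> (v \<star> x) = (3/4) *\<^sub>R x" by (simp del: scaleR_scaleR)
  have U: "?a \<in> U e" "?b \<in> U e"
    using x N_U[OF x v(1)] subspace_U[of e] by (auto intro!: subspace_scale subspace_add subspace_diff)
  have "v \<star> ?a = ?k *\<^sub>R ?a" "(- v) \<star> ?b = ?k *\<^sub>R ?b"
    by (rule inner_eqI, simp add: vv inner_diff_left inner_add_left field_simps s3)+
  with U have "?a \<in> E v" "?b \<in> E (- v)" by (simp_all add: E_def del: mul_linear)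
  moreover have "x = ?a + ?b"
    by (rule inner_eqI) (simp add: inner_add_left inner_diff_left algebra_simps)
  ultimately show ?thesis by (rule that)
qed

lemma E_orth:
  assumes "v \<in> V" "a \<in> E v" "b \<in> E (- v)"
  shows "a \<bullet> b = 0"
  using inner_eigen[of a b v "sqrt 3 / 2" "- (sqrt 3 / 2)"] assms by (simp add: E_V E_mul E_mul_neg)

text \<open>Equality in the Cauchy-Schwarz inequality: the part \<open>r\<close> of
  \<open>a \<star> a\<close> in \<open>N e\<close> has length
  \<open>sqrt 3 / 2 * (a \<bullet> a)\<close> by the eiconal equation, and its component along the
  unit vector \<open>v\<close> has the same size because \<open>a\<close> is an eigenvector of
  \<open>v\<close>. Hence \<open>r\<close> is a multiple of \<open>v\<close>.\<close>

lemma E_sq: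
  assumes v: "v \<in> N e" "v \<bullet> v = 1" and a: "a \<in> E v"
  shows "a \<star> a = ((a \<bullet> a) / 2) *\<^sub>R e + (sqrt 3 / 2 * (a \<bullet> a)) *\<^sub>R v"
proof -
  have [simp]: "a \<in> V" "v \<in> V" using a v UN_V E_V by auto
  define r where "r = a \<star> a - ((a \<bullet> a) / 2) *\<^sub>R e"
  have rN: "r \<in> N e" unfolding r_def by (rule U_sq_minus[OF E_U[OF a]])
  have aa: "a \<star> a = r + ((a \<bullet> a) / 2) *\<^sub>R e" by (simp add: r_def)
  have rr: "r \<bullet> r = 3/4 * (a \<bullet> a)^2"
    using norm_sq[of a] rN unfolding aa
    by (simp add: inner_add_left inner_add_right N_orth_e power2_eq_square)
  have rv: "r \<bullet> v = sqrt 3 / 2 * (a \<bullet> a)"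
  proof -
    have "r \<bullet> v = (a \<star> a) \<bullet> v" using v by (simp add: aa inner_add_left N_orth_e)
    also have "\<dots> = (v \<star> a) \<bullet> a" by (simp add: inner_mul S_ac)
    finally show ?thesis using a by (simp add: E_mul)
  qed
  define t where "t = r - (sqrt 3 / 2 * (a \<bullet> a)) *\<^sub>R v"
  have "t \<bullet> t = r \<bullet> r - 2 * (sqrt 3 / 2 * (a \<bullet> a)) * (r \<bullet> v) + (sqrt 3 / 2 * (a \<bullet> a))^2"
    by (simp add: t_def inner_diff_left inner_diff_right v inner_commute[of v r] power2_eq_square algebra_simps)
  also have "\<dots> = 0" by (simp add: rr rv power2_eq_square algebra_simps)
  finally have "t = 0" by simp
  then show ?thesis by (simp add: aa t_def algebra_simps)
qed

definition W :: "'a \<Rightarrow> 'a set" where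
  "W v = {w\<in>N e. w \<bullet> v = 0}"

lemma W_N: "w \<in> W v \<Longrightarrow> w \<in> N e" and W_orth: "w \<in> W v \<Longrightarrow> w \<bullet> v = 0" "w \<in> W v \<Longrightarrow> v \<bullet> w = 0"
  by (auto simp: W_def inner_commute)

lemma W_V: "w \<in> W v \<Longrightarrow> w \<in> V"
  by (auto simp: W_def UN_V)

lemma subspace_W: "subspace (W v)"
  using subspace_N[of e] by (auto simp: subspace_def W_def inner_add_left)

lemma W_neg: "W (- v) = W v"
  by (auto simp: W_def)

lemma N_neg: "v \<in> N e \<Longrightarrow> - v \<in> N e"
  using subspace_N by (rule subspace_neg)

text \<open>Multiplications by orthogonal elements of \<open>N e\<close> anticommute on
  \<open>U e\<close>, so \<open>w\<close> exchanges the two eigenspaces of \<open>v\<close>.\<close>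

lemma W_mul_E:
  assumes v: "v \<in> N e" and w: "w \<in> W v" and a: "a \<in> E v"
  shows "w \<star> a \<in> E (- v)"
proof -
  have [simp]: "a \<in> V" "v \<in> V" "w \<in> V" using a v UN_V E_V w W_V by auto
  have "v \<star> (w \<star> a) + w \<star> (v \<star> a) = 0"
    using N_N_U[OF E_U[OF a] v W_N[OF w]] w by (simp add: W_orth)
  then have "v \<star> (w \<star> a) = - (w \<star> (v \<star> a))" by (simp add: eq_neg_iff_add_eq_0)
  then have "(- v) \<star> (w \<star> a) = (sqrt 3 / 2) *\<^sub>R (w \<star> a)" using a by (simp add: E_mul)
  then show ?thesis using N_U[OF E_U[OF a] W_N[OF w]] by (simp add: E_def del: mul_linear)
qed

lemma E_mul_E:
  assumes v: "v \<in> N e" "v \<bullet> v = 1" and a: "a \<in> E v" and b: "b \<in> E (- v)"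
  shows "a \<star> b \<in> W v"
proof -
  have [simp]: "a \<in> V" "v \<in> V" "b \<in> V" using a v UN_V E_V b by auto
  note ab = E_orth[OF _ a b, simplified]
  have "e \<star> (a \<star> b) + a \<star> b = 0"
  proof -
    have "e \<star> (a \<star> b) + (1/2) *\<^sub>R (a \<star> b) + (1/2) *\<^sub>R (a \<star> b) = 0"
      using jordan_linearized[of e a b] a b
      by (simp add: U_orth_e E_U e_U ab mul_commute[of b a])
    then show ?thesis by (simp add: add.assoc flip: scaleR_add_left)
  qed
  then have "a \<star> b \<in> N e" by (simp add: N_def eq_neg_iff_add_eq_0)
  moreover have "(a \<star> b) \<bullet> v = 0"
  proof -
    have "(a \<star> b) \<bullet> v = a \<bullet> (v \<star> b)" by (simp add: inner_mul inner_mul' S_ac)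
    then show ?thesis using b by (simp add: E_mul_neg ab)
  qed
  ultimately show ?thesis by (simp add: W_def)
qed

text \<open>The linearized identity for \<open>a\<close>, \<open>a\<close>, \<open>b\<close>, where
  \<open>b \<star> (a \<star> a)\<close> is known from \<open>E_sq\<close>. With
  \<open>E_E_W\<close> it says that, after scaling by \<open>2 / sqrt 3\<close>, multiplication by a
  unit vector of \<open>E v\<close> exchanges \<open>E (- v)\<close> and \<open>W v\<close>
  isometrically and is its own inverse. This triality is the source of the composition
  algebra.\<close>

lemma E_E_E:
  assumes v: "v \<in> N e" "v \<bullet> v = 1" and a: "a \<in> E v" and b: "b \<in> E (- v)"
  shows "a \<star> (a \<star> b) = (3/4 * (a \<bullet> a)) *\<^sub>R b"
proof -
  have [simp]: "a \<in> V" "v \<in> V" "b \<in> V" using a v UN_V E_V b by auto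
  have s3: "sqrt 3 * (sqrt 3 * t) = 3 * t" for t by (simp add: mult.assoc[symmetric])
  have b_aa: "b \<star> (a \<star> a) = - ((a \<bullet> a) / 2) *\<^sub>R b"
    unfolding E_sq[OF v a]
    by (rule inner_eqI) (use b in \<open>simp add: e_U E_U E_mul_neg inner_add_left inner_diff_left s3 field_simps\<close>)
  have "2 *\<^sub>R (a \<star> (a \<star> b)) - ((a \<bullet> a) / 2) *\<^sub>R b = (a \<bullet> a) *\<^sub>R b"
    using jordan_linearized[of a a b] E_orth[OF _ a b] by (simp add: b_aa scaleR_2)
  then have "2 *\<^sub>R (a \<star> (a \<star> b)) = (a \<bullet> a) *\<^sub>R b + ((a \<bullet> a) / 2) *\<^sub>R b"
    by (simp only: diff_eq_eq)
  then have "2 *\<^sub>R (a \<star> (a \<star> b)) = 2 *\<^sub>R ((3/4 * (a \<bullet> a)) *\<^sub>R b)"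
    by (simp flip: scaleR_add_left)
  then show ?thesis by (simp del: scaleR_scaleR)
qed

lemma E_E_W:
  assumes v: "v \<in> N e" "v \<bullet> v = 1" and a: "a \<in> E v" and w: "w \<in> W v"
  shows "a \<star> (a \<star> w) = (3/4 * (a \<bullet> a)) *\<^sub>R w"
proof -
  have [simp]: "a \<in> V" "v \<in> V" "w \<in> V" using a v UN_V E_V w W_V by auto
  have aw: "a \<bullet> w = 0" using U_orth_N[OF E_U[OF a] W_N[OF w]] by simp
  have "w \<star> v = 0" using N_mul[OF W_N[OF w] v(1)] w by (simp add: W_orth)
  then have w_aa: "w \<star> (a \<star> a) = - ((a \<bullet> a) / 2) *\<^sub>R w"
    unfolding E_sq[OF v a] using w by (simp add: e_N W_N)
  have "2 *\<^sub>R (a \<star> (a \<star> w)) - ((a \<bullet> a) / 2) *\<^sub>R w = (a \<bullet> a) *\<^sub>R w"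
    using jordan_linearized[of a a w] aw by (simp add: w_aa scaleR_2)
  then have "2 *\<^sub>R (a \<star> (a \<star> w)) = (a \<bullet> a) *\<^sub>R w + ((a \<bullet> a) / 2) *\<^sub>R w"
    by (simp only: diff_eq_eq)
  then have "2 *\<^sub>R (a \<star> (a \<star> w)) = 2 *\<^sub>R ((3/4 * (a \<bullet> a)) *\<^sub>R w)"
    by (simp flip: scaleR_add_left)
  then show ?thesis by (simp del: scaleR_scaleR)
qed

text \<open>If one of the two eigenspaces vanishes, the idempotent opposite to it in the plane of
  \<open>e\<close> and \<open>v\<close> has trivial space \<open>U\<close>.\<close>

lemma reducible_if_E_trivial:
  assumes v: "v \<in> N e" "v \<bullet> v = 1" and triv: "E (- v) \<subseteq> {0}" and g: "g \<in> U e" "g \<noteq> 0"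
  shows "reducible_at (- (1/2) *\<^sub>R e - (sqrt 3 / 2) *\<^sub>R v)"
proof -
  have [simp]: "g \<in> V" "v \<in> V" using g v UN_V by auto
  have s3: "sqrt 3 * (sqrt 3 * t) = 3 * t" for t by (simp add: mult.assoc[symmetric])
  have UE: "U e \<subseteq> E v"
  proof
    fix x assume "x \<in> U e"
    then obtain a b where "a \<in> E v" "b \<in> E (- v)" "x = a + b" using split_E[OF v] by metis
    then show "x \<in> E v" using triv by auto
  qed
  \<comment> \<open>\<open>w \<star> g\<close> lies in the trivial space \<open>E (- v)\<close>, but
    its squared length is \<open>3/4 * (w \<bullet> w) * (g \<bullet> g)\<close> with
    \<open>g\<close> nonzero.\<close>
  have W0: "w = 0" if w: "w \<in> W v" for w
  proof -
    have "w \<star> g = 0" using W_mul_E[OF v(1) w, of g] UE g triv by auto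
    then have "(w \<bullet> w) * (g \<bullet> g) = 0" using N_U_norm[OF g(1) g(1) W_N[OF w]] by simp
    then show ?thesis using g by simp
  qed
  \<comment> \<open>On the plane of \<open>e\<close> and \<open>v\<close>, with \<open>e\<close> as
    1 and \<open>v\<close> as the imaginary unit, the product is \<open>conj(z) conj(w)\<close>. Its
    idempotents are the three cube roots of unity, and \<open>?f\<close> is one of the two nonreal
    ones.\<close>
  let ?f = "- (1/2) *\<^sub>R e - (sqrt 3 / 2) *\<^sub>R v"
  have ev: "e \<bullet> v = 0" "v \<bullet> e = 0" using v by (auto simp: N_orth_e)
  have prods: "e \<star> v = - v" "v \<star> e = - v" "v \<star> v = - e"
    using v by (simp_all add: e_N N_sq)
  have "idem ?f"
    unfolding idem_def
  proof (intro conjI)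
    show "?f \<bullet> ?f = 1" by (simp add: inner_diff_left inner_diff_right ev v)
    show "?f \<star> ?f = ?f"
      by (rule inner_eqI) (simp add: prods inner_diff_left inner_add_left field_simps s3)
  qed auto
  moreover have "?f \<star> y = - y" if y: "y \<in> V" "y \<bullet> ?f = 0" for y
  proof -
    define z where "z = y - (y \<bullet> e) *\<^sub>R e"
    have z: "z \<in> V" "z \<bullet> e = 0" using y by (auto simp: z_def inner_diff_left)
    then obtain a n where an: "a \<in> U e" "n \<in> N e" "z = a + n" by (rule split_UN)
    have "n - (n \<bullet> v) *\<^sub>R v \<in> W v"
      using an v subspace_N[of e] by (auto simp: W_def inner_diff_left intro: subspace_diff subspace_scale)
    from W0[OF this] have n: "n = (n \<bullet> v) *\<^sub>R v" by simp
    define p where "p = y \<bullet> e"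
    define q where "q = n \<bullet> v"
    have y_eq: "y = p *\<^sub>R e + q *\<^sub>R v + a" using an(3) n[symmetric] by (simp add: z_def p_def q_def algebra_simps)
    have "p / 2 + sqrt 3 / 2 * q = 0"
      using y(2) an(1) v unfolding y_eq
      by (simp add: inner_add_left inner_diff_right ev U_orth_e U_orth_N)
    then have p: "p = - sqrt 3 * q" by simp
    have a: "e \<star> a = (1/2) *\<^sub>R a" "v \<star> a = (sqrt 3 / 2) *\<^sub>R a" using an UE by (auto simp: e_U E_mul)
    show ?thesis
      unfolding y_eq p
      by (rule inner_eqI) (simp add: prods a inner_diff_left inner_add_left field_simps s3)
  qed
  ultimately show ?thesis by (simp add: reducible_at_def)
qed

end

section \<open>Coordinate expressions of the reducible and the Cartan solutions\<close>

definition theta_val :: "nat \<Rightarrow> (nat \<Rightarrow> real) \<Rightarrow> real" where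
  "theta_val l x =
    (let z1 = (\<lambda>i. x (2 + i)); z2 = (\<lambda>i. x (2 + l + i)); z3 = (\<lambda>i. x (2 + 2*l + i));
         nsq = (\<lambda>z. \<Sum>i<l. (z i)^2)
     in x 0^3 + 3/2 * x 0 * (nsq z1 + nsq z2 - 2 * nsq z3 - 2 * (x 1)^2)
        + 3 * sqrt 3 / 2 * x 1 * (nsq z1 - nsq z2)
        + 3 * sqrt 3 * cd_mult l (cd_mult l z1 z2) z3 0)"

text \<open>By induction on the doublings, the real part of a product pairs one factor with the
  conjugate of the other. Thus \<open>Re (z1 z2 z3)\<close> is the inner product of
  \<open>z1 z2\<close> with the conjugate of \<open>z3\<close>, which is why
  \<open>theta_form\<close> needs a conjugated frame for its third block.\<close>

lemma cd_mult_0: "cd_mult (2 ^ k) x y 0 = (\<Sum>i<2 ^ k. x i * cd_conj y i)"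
proof (induction k arbitrary: x y)
  case 0
  then show ?case by (simp add: cd_mult.simps cd_conj_def)
next
  case (Suc k)
  let ?h = "2 ^ k :: nat"
  obtain j where j: "?h = Suc j" by (metis Suc_pred' zero_less_power zero_less_numeral)
  have "cd_mult (2 ^ Suc k) x y 0 = cd_mult ?h x y 0 - cd_mult ?h (cd_conj (\<lambda>i. y (?h + i))) (\<lambda>i. x (?h + i)) 0"
    using j by (subst cd_mult.simps) (auto simp: Let_def)
  also have "\<dots> = (\<Sum>i<?h. x i * cd_conj y i) - (\<Sum>i<?h. cd_conj (\<lambda>i. y (?h + i)) i * cd_conj (\<lambda>i. x (?h + i)) i)"
    by (simp only: Suc.IH)
  also have "(\<Sum>i<?h. cd_conj (\<lambda>i. y (?h + i)) i * cd_conj (\<lambda>i. x (?h + i)) i) = (\<Sum>i<?h. - (x (?h + i) * cd_conj y (?h + i)))"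
    by (intro sum.cong refl) (auto simp: cd_conj_def)
  also have "(\<Sum>i<?h. x i * cd_conj y i) - \<dots> = (\<Sum>i<?h + ?h. x i * cd_conj y i)"
    using sum_append_frame[of "\<lambda>i _. x i * cd_conj y i" ?h "\<lambda>_. ()" "\<lambda>_. ()" ?h] by (simp add: sum_negf)
  finally show ?case by (simp add: mult_2)
qed

context eiconal_idem
begin

lemma reducible_form:
  assumes "reducible_at e"
  obtains b where "onframe V d b"
    "\<And>x. S (\<Sum>i<d. x i *\<^sub>R b i) (\<Sum>i<d. x i *\<^sub>R b i) (\<Sum>i<d. x i *\<^sub>R b i)
       = x 0^3 - 3 * x 0 * (\<Sum>i<d - 1. (x (Suc i))^2)"
proof -
  obtain d' b where b: "onframe V (Suc d') b" "b 0 = e"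
    and b': "onframe {x\<in>V. x \<bullet> e = 0} d' (\<lambda>i. b (Suc i))"
    by (rule onframe_exists_head[OF V_subspace order_refl frame e(1,2)])
  have d: "d = Suc d'" by (rule onframe_dim_unique[OF frame b(1)])
  have "S (\<Sum>i<d. x i *\<^sub>R b i) (\<Sum>i<d. x i *\<^sub>R b i) (\<Sum>i<d. x i *\<^sub>R b i)
       = x 0^3 - 3 * x 0 * (\<Sum>i<d - 1. (x (Suc i))^2)" for x
  proof -
    define y where "y = (\<Sum>i<d'. x (Suc i) *\<^sub>R b (Suc i))"
    have X: "(\<Sum>i<d. x i *\<^sub>R b i) = x 0 *\<^sub>R e + y"
      unfolding d sum.lessThan_Suc_shift y_def by (simp add: b)
    have "y \<in> {x\<in>V. x \<bullet> e = 0}" unfolding y_def by (rule onframe_lin[OF b'])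
    then have y: "y \<in> V" "y \<bullet> e = 0" "e \<bullet> y = 0" by (auto simp: inner_commute)
    then have yN: "y \<in> N e" using assms by (simp add: reducible_at_def N_def)
    have yy: "y \<bullet> y = (\<Sum>i<d'. (x (Suc i))^2)"
      unfolding y_def
      using orthonormal_inner[OF onframe_orthonormal[OF b'], of "\<lambda>i. x (Suc i)" "\<lambda>i. x (Suc i)"]
      by (simp add: power2_eq_square)
    have "S e e e = 1" using inner_mul[of e e e] by simp
    moreover have "S e e y = 0" using inner_mul[of y e e] y by simp
    moreover have "S e y y = - (y \<bullet> y)" using inner_mul[of y e y] y e_N[OF yN] by simp
    moreover have "S y y y = 0" using inner_mul[of y y y] y N_sq[OF yN] by simp
    ultimately have "S (x 0 *\<^sub>R e + y) (x 0 *\<^sub>R e + y) (x 0 *\<^sub>R e + y) = x 0 ^ 3 - 3 * x 0 * (y \<bullet> y)"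
      unfolding S_cube_add S_scale S_scale2 S_scale3 by (simp add: power3_eq_cube)
    then show ?thesis unfolding X yy by (simp add: d)
  qed
  with b d that show ?thesis by blast
qed

text \<open>Split \<open>X\<close> into \<open>P\<close> in the plane of \<open>e\<close>,
  \<open>v\<close> and \<open>Y = A + B + C\<close>. Multiplication by \<open>P\<close> acts on
  \<open>A\<close>, \<open>B\<close>, \<open>C\<close> by scalars, and each of the three has its
  square in the plane, so the only term of degree three in \<open>Y\<close> is the mixed
  one.\<close>

lemma cube_form:
  fixes t s :: real
  assumes v: "v \<in> N e" "v \<bullet> v = 1" and A: "A \<in> E v" and B: "B \<in> E (- v)" and C: "C \<in> W v"
    and X: "X = t *\<^sub>R e + (s *\<^sub>R v + (A + (B + C)))"
  shows "S X X X = t^3 + 3/2 * t * (A \<bullet> A + B \<bullet> B - 2 * (C \<bullet> C) - 2 * s^2)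
    + 3 * sqrt 3 / 2 * s * (A \<bullet> A - B \<bullet> B) + 6 * S A B C"
proof -
  have V: "v \<in> V" "A \<in> V" "B \<in> V" "C \<in> V" using v A B C UN_V E_V W_V by auto
  have v': "- v \<in> N e" "(- v) \<bullet> (- v) = 1" using v by (auto intro: N_neg)
  define P where "P = t *\<^sub>R e + s *\<^sub>R v"
  define Y where "Y = A + (B + C)"
  have orth1: "A \<bullet> B = 0" "A \<bullet> C = 0" "B \<bullet> C = 0" "A \<bullet> e = 0" "B \<bullet> e = 0" "C \<bullet> e = 0"
    "A \<bullet> v = 0" "B \<bullet> v = 0" "C \<bullet> v = 0" "v \<bullet> e = 0"
    using E_orth[OF V(1) A B] U_orth_N[OF E_U[OF A] W_N[OF C]] U_orth_N[OF E_U[OF B] W_N[OF C]]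
      U_orth_e[OF E_U[OF A]] U_orth_e[OF E_U[OF B]] N_orth_e[OF W_N[OF C]] N_orth_e[OF v(1)]
      U_orth_N[OF E_U[OF A] v(1)] U_orth_N[OF E_U[OF B] v(1)] W_orth[OF C]
    by simp_all
  note orth = orth1 orth1[THEN trans[OF inner_commute]]
  have prods: "e \<star> v = - v" "v \<star> e = - v" "v \<star> v = - e"
    using v by (simp_all add: e_N N_sq)
  have PP: "P \<star> P = (t^2 - s^2) *\<^sub>R e - (t * s + t * s) *\<^sub>R v"
    by (rule inner_eqI) (simp add: P_def prods inner_expand power2_eq_square algebra_simps)
  have PV: "P \<in> V" and YV: "Y \<in> V" using V by (auto simp: P_def Y_def)
  have 1: "S P P P = t^3 - 3 * t * s^2"
    using inner_mul[OF PV, of P P] unfolding PP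
    by (simp add: P_def inner_expand inner_add_right orth v power2_eq_square power3_eq_cube algebra_simps)
  have 2: "S P P Y = 0"
    using inner_mul[OF YV, of P P] unfolding PP
    by (simp add: Y_def inner_expand inner_add_right orth)
  have vC: "v \<star> C = 0" using N_mul[OF v(1) W_N[OF C]] W_orth[OF C] by simp
  have "P \<star> Y = (t / 2 + sqrt 3 / 2 * s) *\<^sub>R A + (t / 2 - sqrt 3 / 2 * s) *\<^sub>R B - t *\<^sub>R C"
    unfolding P_def Y_def
    by (rule inner_eqI) (simp add: vC e_U(1)[OF E_U[OF A]] e_U(1)[OF E_U[OF B]] e_N(1)[OF W_N[OF C]]
      E_mul(1)[OF A] E_mul_neg(1)[OF B] inner_expand algebra_simps)
  then have 3: "S P Y Y = (t / 2 + sqrt 3 / 2 * s) * (A \<bullet> A) + (t / 2 - sqrt 3 / 2 * s) * (B \<bullet> B) - t * (C \<bullet> C)"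
    using inner_mul[OF YV, of P Y] by (simp add: Y_def inner_expand inner_add_right orth)
  have zero: "S A A A = 0" "S A A B = 0" "S A A C = 0" "S B B B = 0" "S B B A = 0" "S B B C = 0"
    "S C C C = 0" "S C C A = 0" "S C C B = 0"
    using V by (simp_all add: inner_mul[symmetric] E_sq[OF v A] E_sq[OF v' B] N_sq[OF W_N[OF C]]
        inner_expand orth)
  have 4: "S Y Y Y = 6 * S A B C"
    unfolding Y_def S_cube_add[of A] S_cube_add[of B C] using zero
    by (simp add: S_swap13[of A B B] S_swap13[of A C C] S_swap13[of B C C] S_swap23[of A C B])
  have "X = P + Y" by (simp add: X P_def Y_def)
  then have "S X X X = S P P P + 3 * S P P Y + 3 * S P Y Y + S Y Y Y" by (simp only: S_cube_add)
  then show ?thesis unfolding 1 2 3 4 by (simp add: field_simps)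
qed

text \<open>Unit vectors \<open>a0\<close> and \<open>b0\<close> identify the three spaces: the
  rescaled product \<open>m\<close> makes \<open>m b0\<close> an isometry of \<open>W v\<close> onto
  \<open>E v\<close> and \<open>m a0\<close> one onto \<open>E (- v)\<close>. Transporting the
  product of \<open>E v\<close> and \<open>E (- v)\<close> back to \<open>W v\<close> gives a
  composition algebra with unit \<open>m a0 b0\<close>, and Hurwitz's theorem supplies a frame
  multiplying by the table \<open>cd_mult\<close>.\<close>

lemma theta_form:
  assumes v: "v \<in> N e" "v \<bullet> v = 1" and a0: "a0 \<in> E v" "a0 \<bullet> a0 = 1" and b0: "b0 \<in> E (- v)" "b0 \<bullet> b0 = 1"
    and d: "d = 3 * l + 2" and l: "l = 2 ^ k"
  obtains b where "onframe V d b"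
    "\<And>x. S (\<Sum>i<d. x i *\<^sub>R b i) (\<Sum>i<d. x i *\<^sub>R b i) (\<Sum>i<d. x i *\<^sub>R b i) = theta_val l x"
proof -
  have v': "- v \<in> N e" "(- v) \<bullet> (- v) = 1" using v by (auto intro: N_neg)
  have V [simp]: "v \<in> V" "a0 \<in> V" "b0 \<in> V" using v a0 b0 UN_V E_V by auto
  define m where "m x y = (2 / sqrt 3) *\<^sub>R (x \<star> y)" for x y
  have m_linear: "m (x + y) z = m x z + m y z" "m z (x + y) = m z x + m z y"
    "m (c *\<^sub>R x) z = c *\<^sub>R m x z" "m z (c *\<^sub>R x) = c *\<^sub>R m z x" for x y z c
    by (simp_all add: m_def algebra_simps)
  have m_V: "m x y \<in> V" for x y by (simp add: m_def)
  have s3: "sqrt 3 * (sqrt 3 * t) = 3 * t" for t by (simp add: mult.assoc[symmetric])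
  have m_comm: "m x y = m y x" for x y by (simp add: m_def mul_commute[of x])
  have mb: "m b0 x \<in> E v" if "x \<in> W v" for x
    using W_mul_E[OF v'(1), of x b0] that b0 subspace_E[of v]
    by (auto simp: W_neg m_def mul_commute[of b0] intro: subspace_scale)
  have ma: "m a0 x \<in> E (- v)" if "x \<in> W v" for x
    using W_mul_E[OF v(1), of x a0] that a0 subspace_E[of "- v"]
    by (auto simp: m_def mul_commute[of a0] intro: subspace_scale)
  have mab: "m a b \<in> W v" if "a \<in> E v" "b \<in> E (- v)" for a b
    using E_mul_E[OF v that] subspace_W[of v] by (auto simp: m_def intro: subspace_scale)
  have mba: "m b a \<in> W v" if "a \<in> E v" "b \<in> E (- v)" for a b
    using mab[OF that] by (simp add: m_comm)
  have aaE: "m a (m a b) = (a \<bullet> a) *\<^sub>R b" if "a \<in> E v" "b \<in> E (- v)" for a b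
    using E_E_E[OF v that] by (simp add: m_def s3 field_simps)
  have aaW: "m a0 (m a0 w) = w" if "w \<in> W v" for w
    using E_E_W[OF v a0(1) that] a0 by (simp add: m_def s3 field_simps)
  have bbE: "m b0 (m b0 a) = a" if "a \<in> E v" for a
    using E_E_E[OF v' b0(1)] that b0 by (simp add: m_def s3 field_simps)
  have bbW: "m b0 (m b0 w) = w" if "w \<in> W v" for w
    using E_E_W[OF v' b0(1)] that b0 by (simp add: m_def s3 field_simps W_neg)
  have adj: "m x y \<bullet> z = y \<bullet> m x z" if "y \<in> V" "z \<in> V" for x y z
    using that by (simp add: m_def inner_mul inner_mul' S_ac)
  have iso_a: "m a0 x \<bullet> m a0 y = x \<bullet> y" if "x \<in> W v" "y \<in> W v" for x y
    using that by (simp add: adj m_V W_V aaW)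
  have iso_b: "m b0 x \<bullet> m b0 y = x \<bullet> y" if "x \<in> W v" "y \<in> W v" for x y
    using that by (simp add: adj m_V W_V bbW)
  have norm_ab: "m a b \<bullet> m a b = (a \<bullet> a) * (b \<bullet> b)" if "a \<in> E v" "b \<in> E (- v)" for a b
    using that by (simp add: adj[of _ _ a] m_V E_V aaE)
  define p where "p x y = m (m b0 x) (m a0 y)" for x y
  define one where "one = m a0 b0"
  interpret C: composition_algebra "W v" p one
  proof
    show "subspace (W v)" by (rule subspace_W)
    show "p x y \<in> W v" if "x \<in> W v" "y \<in> W v" for x y using that by (simp add: p_def mab ma mb)
    show "one \<in> W v" using a0 b0 by (simp add: one_def mab)
    show "one \<bullet> one = 1" using norm_ab[OF a0(1) b0(1)] a0 b0 by (simp add: one_def)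
    show "p one x = x" if "x \<in> W v" for x
      using that a0(1) by (simp add: p_def one_def m_comm[of a0 b0] bbE aaW)
    show "p x one = x" if "x \<in> W v" for x
      using that aaE[OF a0(1) b0(1)] a0(2) by (simp add: p_def one_def m_comm[of _ b0] bbW)
    show "p x y \<bullet> p x y = (x \<bullet> x) * (y \<bullet> y)" if "x \<in> W v" "y \<in> W v" for x y
      using that by (simp add: p_def norm_ab ma mb iso_a iso_b)
  qed (simp_all add: p_def m_linear)
  have frame_b: "onframe (E v) n (\<lambda>i. m b0 (w i))" if "onframe (W v) n w" for n w
  proof (rule onframe_isometry[OF that subspace_E])
    show "\<exists>x\<in>W v. y = m b0 x" if "y \<in> E v" for y
      using bbE[OF that] mba[OF that b0(1)] by (intro bexI[of _ "m b0 y"]) auto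
  qed (simp_all add: mb m_linear iso_b)
  have frame_a: "onframe (E (- v)) n (\<lambda>i. m a0 (w i))" if "onframe (W v) n w" for n w
  proof (rule onframe_isometry[OF that subspace_E])
    show "\<exists>x\<in>W v. y = m a0 x" if "y \<in> E (- v)" for y
      using aaE[OF a0(1) that] a0 mab[OF a0(1) that] by (intro bexI[of _ "m a0 y"]) auto
  qed (simp_all add: ma m_linear iso_a)
  have orth: "x \<in> E (- v) \<Longrightarrow> w \<in> W v \<Longrightarrow> x \<bullet> w = 0" "y \<in> E v \<Longrightarrow> w \<in> W v \<Longrightarrow> y \<bullet> w = 0"
    "y \<in> E v \<Longrightarrow> x \<in> E (- v) \<Longrightarrow> y \<bullet> x = 0"
    "x \<in> E (- v) \<Longrightarrow> v \<bullet> x = 0" "y \<in> E v \<Longrightarrow> v \<bullet> y = 0" "w \<in> W v \<Longrightarrow> v \<bullet> w = 0"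
    "x \<in> E (- v) \<Longrightarrow> e \<bullet> x = 0" "y \<in> E v \<Longrightarrow> e \<bullet> y = 0" "w \<in> W v \<Longrightarrow> e \<bullet> w = 0" for x y w
    using U_orth_N(1)[OF E_U W_N] E_orth[OF V(1)] U_orth_N(2)[OF E_U v(1)] W_orth(2) U_orth_e(2)[OF E_U]
      N_orth_e(2)[OF W_N] by blast+
  \<comment> \<open>\<open>w\<close> provides the frames of \<open>E v\<close> and
    \<open>E (- v)\<close>, and \<open>w'\<close> that of \<open>W v\<close> itself; they are kept
    apart because the last one will be the conjugate of the other.\<close>
  define F where "F n w w' = append_frame 1 (\<lambda>_. e) (append_frame 1 (\<lambda>_. v)
      (append_frame n (\<lambda>i. m b0 (w i)) (append_frame n (\<lambda>i. m a0 (w i)) w')))" for n w and w' :: "nat \<Rightarrow> 'a"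
  have frame_V: "onframe V (1 + (1 + (n + (n + n)))) (F n w w')"
    if w: "onframe (W v) n w" and w': "onframe (W v) n w'" for n w w'
  proof -
    let ?X1 = "{x + y | x y. x \<in> E (- v) \<and> y \<in> W v}"
    let ?X2 = "{x + y | x y. x \<in> E v \<and> y \<in> ?X1}"
    let ?X3 = "{x + y | x y. x \<in> range (\<lambda>r. r *\<^sub>R v) \<and> y \<in> ?X2}"
    let ?X4 = "{x + y | x y. x \<in> range (\<lambda>r. r *\<^sub>R e) \<and> y \<in> ?X3}"
    have "onframe ?X1 (n + n) (append_frame n (\<lambda>i. m a0 (w i)) w')"
      by (rule onframe_append[OF frame_a[OF w] w']) (rule orth)
    then have "onframe ?X2 (n + (n + n)) (append_frame n (\<lambda>i. m b0 (w i)) (append_frame n (\<lambda>i. m a0 (w i)) w'))"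
      by (rule onframe_append[OF frame_b[OF w]])
        (auto simp: inner_add_right orth)
    then have "onframe ?X3 (1 + (n + (n + n))) (append_frame 1 (\<lambda>_. v) (append_frame n (\<lambda>i. m b0 (w i)) (append_frame n (\<lambda>i. m a0 (w i)) w')))"
      by (rule onframe_append[OF onframe_single[OF v(2)]])
        (auto simp: inner_add_right orth)
    then have X4: "onframe ?X4 (1 + (1 + (n + (n + n)))) (F n w w')"
      unfolding F_def
      by (rule onframe_append[OF onframe_single[OF e(2)]])
        (auto simp: inner_add_right orth N_orth_e[OF v(1)])
    have "?X4 = V"
    proof (intro subset_antisym subsetI)
      fix z assume "z \<in> ?X4"
      then show "z \<in> V" by (auto intro!: V_closed dest: E_V W_V)
    next
      fix z assume z: "z \<in> V"
      have "z - (z \<bullet> e) *\<^sub>R e \<in> V" "(z - (z \<bullet> e) *\<^sub>R e) \<bullet> e = 0"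
        using z by (auto simp: inner_diff_left)
      then obtain g y where gy: "g \<in> U e" "y \<in> N e" "z - (z \<bullet> e) *\<^sub>R e = g + y" by (rule split_UN)
      obtain a b where ab: "a \<in> E v" "b \<in> E (- v)" "g = a + b" using split_E[OF v gy(1)] by metis
      have "y - (y \<bullet> v) *\<^sub>R v \<in> W v"
        using gy v subspace_N[of e] by (auto simp: W_def inner_diff_left intro: subspace_diff subspace_scale)
      moreover have "z = (z \<bullet> e) *\<^sub>R e + ((y \<bullet> v) *\<^sub>R v + (a + (b + (y - (y \<bullet> v) *\<^sub>R v))))"
        using gy(3) ab(3) by (simp add: algebra_simps)
      ultimately show "z \<in> ?X4" using ab by blast
    qed
    with X4 show ?thesis by simp
  qed
  have "W v \<subseteq> V" using W_V by auto
  then obtain n w where w: "onframe (W v) n w" by (rule onframe_exists[OF subspace_W _ frame])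
  \<comment> \<open>The three isometric blocks together with \<open>e\<close> and \<open>v\<close>
    have dimension \<open>2 + 3 n\<close>, so the dimension of the composition algebra is
    \<open>l\<close>.\<close>
  have "d = 1 + (1 + (n + (n + n)))" by (rule onframe_dim_unique[OF frame frame_V[OF w w]])
  then have n: "n = l" using d by simp
  obtain \<phi> where \<phi>: "C.cd_frame l \<phi>" "onframe (W v) l \<phi>" using C.hurwitz[OF w] l n by metis
  \<comment> \<open>Signs of the conjugation: 1 at index 0 and -1 elsewhere.\<close>
  define \<phi>' where "\<phi>' = cd_conj (\<lambda>_. 1 :: real)"
  define w' where "w' i = \<phi>' i *\<^sub>R \<phi> i" for i
  have sq1: "\<phi>' i * \<phi>' i = 1" "\<phi>' i * (\<phi>' i * t) = t" for i t by (auto simp: \<phi>'_def cd_conj_def)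
  have w': "onframe (W v) l w'"
    by (rule orthonormal_onframe[OF \<phi>(2)])
      (use \<phi>(2) sq1 in \<open>auto simp: onframe_def orthonormal_def w'_def subspace_scale\<close>)
  define b where "b = F l \<phi> w'"
  have d': "d = 1 + (1 + (l + (l + l)))" using d by simp
  have b: "onframe V d b" unfolding b_def d' by (rule frame_V[OF \<phi>(2) w'])
  have "S (\<Sum>i<d. x i *\<^sub>R b i) (\<Sum>i<d. x i *\<^sub>R b i) (\<Sum>i<d. x i *\<^sub>R b i) = theta_val l x" for x
  proof -
    define z1 where "z1 = (\<lambda>i. x (2 + i))"
    define z2 where "z2 = (\<lambda>i. x (2 + l + i))"
    define z3 where "z3 = (\<lambda>i. x (2 + 2*l + i))"
    let ?L = "\<lambda>z. \<Sum>i<l. z i *\<^sub>R \<phi> i"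
    let ?A = "m b0 (?L z1)" and ?B = "m a0 (?L z2)" and ?C = "\<Sum>i<l. z3 i *\<^sub>R w' i"
    have L: "?L z \<in> W v" for z by (rule onframe_lin[OF \<phi>(2)])
    have m_sum: "m y (sum f A) = (\<Sum>a\<in>A. m y (f a))" for y f and A :: "nat set"
      using m_linear(4)[of y 0 0] by (induction A rule: infinite_finite_induct) (auto simp: m_linear)
    have X: "(\<Sum>i<d. x i *\<^sub>R b i) = x 0 *\<^sub>R e + (x 1 *\<^sub>R v + (?A + (?B + ?C)))"
      unfolding b_def F_def d' z1_def z2_def z3_def
      by (subst sum_append_frame, subst sum_append_frame, subst sum_append_frame, subst sum_append_frame)
        (simp add: m_sum m_linear mult_2 add.assoc)
    have nsq: "?L z \<bullet> ?L z = (\<Sum>i<l. (z i)^2)" for z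
      using orthonormal_inner[OF onframe_orthonormal[OF \<phi>(2)], of z z] by (simp add: power2_eq_square)
    have C: "?C = ?L (cd_conj z3)" "?C \<bullet> ?C = (\<Sum>i<l. (z3 i)^2)" "?C \<in> W v"
    proof -
      show 1: "?C = ?L (cd_conj z3)"
        by (intro sum.cong refl) (auto simp: w'_def \<phi>'_def cd_conj_def)
      show "?C \<bullet> ?C = (\<Sum>i<l. (z3 i)^2)"
        unfolding 1 nsq by (intro sum.cong refl) (auto simp: cd_conj_def)
      show "?C \<in> W v" unfolding 1 by (rule L)
    qed
    have AB: "x \<star> y = (sqrt 3 / 2) *\<^sub>R m x y" for x y by (simp add: m_def)
    have "S ?A ?B ?C = (?A \<star> ?B) \<bullet> ?C"
      by (rule inner_mul[OF W_V[OF C(3)], symmetric])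
    also have "\<dots> = (sqrt 3 / 2) * (m ?A ?B \<bullet> ?C)" unfolding AB by (rule inner_scaleR_left)
    also have "m ?A ?B = p (?L z1) (?L z2)" by (simp add: p_def)
    also have "\<dots> = ?L (cd_mult l z1 z2)" using \<phi>(1) by (simp add: C.cd_frame_def)
    also have "\<dots> \<bullet> ?C = (\<Sum>i<l. cd_mult l z1 z2 i * cd_conj z3 i)"
      unfolding C(1) by (rule orthonormal_inner[OF onframe_orthonormal[OF \<phi>(2)]])
    also have "\<dots> = cd_mult l (cd_mult l z1 z2) z3 0" unfolding l cd_mult_0 ..
    finally have SABC: "S ?A ?B ?C = sqrt 3 / 2 * cd_mult l (cd_mult l z1 z2) z3 0" .
    show ?thesis
      unfolding cube_form[OF v mb[OF L] ma[OF L] C(3) X] SABC iso_a[OF L L] iso_b[OF L L] nsq C(2)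
      by (simp add: theta_val_def Let_def z1_def z2_def z3_def)
  qed
  with b that show ?thesis by blast
qed

end

context eiconal
begin

text \<open>Everything depends on whether one of \<open>U e\<close>, \<open>E v\<close>,
  \<open>E (- v)\<close> is trivial. If so, some idempotent is of the reducible kind; otherwise the
  two eigenspaces of \<open>v\<close> contain the base points \<open>a0\<close>, \<open>b0\<close>
  of \<open>theta_form\<close>.\<close>

theorem eiconal_classification:
  assumes d: "d = 3 * l + 2" and l: "l = 2 ^ k"
  obtains
    (reducible) b where "onframe V d b"
      "\<And>x. S (\<Sum>i<d. x i *\<^sub>R b i) (\<Sum>i<d. x i *\<^sub>R b i) (\<Sum>i<d. x i *\<^sub>R b i)
         = x 0^3 - 3 * x 0 * (\<Sum>i<d - 1. (x (Suc i))^2)"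
  | (cartan) b where "onframe V d b"
      "\<And>x. S (\<Sum>i<d. x i *\<^sub>R b i) (\<Sum>i<d. x i *\<^sub>R b i) (\<Sum>i<d. x i *\<^sub>R b i) = theta_val l x"
proof -
  have u0: "u 0 \<in> V" "u 0 \<noteq> 0"
    using onframe_in[OF frame, of 0] orthonormalD[OF onframe_orthonormal[OF frame], of 0 0] d by auto
  then obtain e where "e \<in> V" "e \<bullet> e = 1" "e \<star> e = e" by (rule exists_idempotent)
  then have e: "idem e" by (simp add: idem_def)
  interpret eiconal_idem S V d u e by unfold_locales (rule e)
  have red: thesis if "reducible_at f" for f
  proof -
    interpret f: eiconal_idem S V d u f using that by unfold_locales (simp add: reducible_at_def)
    show thesis by (rule f.reducible_form[OF that]) (rule reducible)
  qed
  show thesis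
  proof (cases "U e \<subseteq> {0}")
    case True
    have "e \<star> y = - y" if y: "y \<in> V" "y \<bullet> e = 0" for y
    proof -
      obtain g n where "g \<in> U e" "n \<in> N e" "y = g + n" using y by (rule split_UN)
      then show ?thesis using True by (auto simp: e_N)
    qed
    then have "reducible_at e" using idem by (simp add: reducible_at_def)
    then show ?thesis by (rule red)
  next
    case False
    then obtain g where g: "g \<in> U e" "g \<noteq> 0" by auto
    \<comment> \<open>The part of \<open>g \<star> g\<close> in \<open>N e\<close> provides the
      vector \<open>v\<close>. It is nonzero, since the part along \<open>e\<close> has squared
      length only a quarter of the required \<open>(g \<bullet> g)^2\<close>.\<close>
    define r where "r = g \<star> g - ((g \<bullet> g) / 2) *\<^sub>R e"
    have rN: "r \<in> N e" unfolding r_def by (rule U_sq_minus[OF g(1)])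
    have "r \<noteq> 0"
    proof
      assume "r = 0"
      then have "g \<star> g = ((g \<bullet> g) / 2) *\<^sub>R e" by (simp add: r_def)
      then have "(g \<bullet> g)^2 = (g \<bullet> g)^2 / 4"
        using norm_sq[of g] UN_V(1)[OF g(1)] by (simp add: power2_eq_square)
      then show False using g by simp
    qed
    define v where "v = r /\<^sub>R sqrt (r \<bullet> r)"
    have v: "v \<in> N e" "v \<bullet> v = 1"
      using rN subspace_N unit_vector[OF \<open>r \<noteq> 0\<close>] by (auto simp: v_def intro: subspace_scale)
    have v': "- v \<in> N e" "(- v) \<bullet> (- v) = 1" using v by (auto intro: N_neg)
    have unit: "\<exists>a\<in>E x. a \<bullet> a = 1" if "\<not> E x \<subseteq> {0}" for x
    proof -
      from that obtain y where "y \<in> E x" "y \<noteq> 0" by auto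
      then show ?thesis using unit_vector[of y] subspace_E[of x] by (meson subspace_scale)
    qed
    show ?thesis
    proof (cases "E v \<subseteq> {0} \<or> E (- v) \<subseteq> {0}")
      case True
      then show ?thesis
        using red[OF reducible_if_E_trivial[OF v _ g]] red[OF reducible_if_E_trivial[OF v' _ g]] by auto
    next
      case False
      then obtain a0 b0 where "a0 \<in> E v" "a0 \<bullet> a0 = 1" "b0 \<in> E (- v)" "b0 \<bullet> b0 = 1"
        using unit[of v] unit[of "- v"] by blast
      then show ?thesis by (rule theta_form[OF v _ _ _ _ d l]) (rule cartan)
    qed
  qed
qed

end

section \<open>Normal forms with one-dimensional first component\<close>

lemma quintic_coeffs:
  fixes a0 :: real
  assumes "\<And>s. a0 + a1 * s + a2 * s^2 + a3 * s^3 + a4 * s^4 + a5 * s^5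
    = b0 + b1 * s + b2 * s^2 + b3 * s^3 + b4 * s^4 + b5 * s^5"
  shows "a0 = b0" "a1 = b1" "a2 = b2" "a3 = b3" "a4 = b4" "a5 = b5"
  using assms[of 0] assms[of 1] assms[of "-1"] assms[of 2] assms[of "-2"] assms[of 3] by auto

lemmas power_expand = power2_eq_square power3_eq_cube power4_eq_xxxx

context cubic_space
begin

text \<open>One sixth of the Laplacian of the cubic at \<open>x\<close>.\<close>

definition tr :: "'a \<Rightarrow> real" where
  "tr x = (\<Sum>i<d. S x (u i) (u i))"

lemma tr_linear [simp]: "tr (x + y) = tr x + tr y" "tr (c *\<^sub>R x) = c * tr x"
  by (simp_all add: tr_def sum.distrib sum_distrib_left)

end

text \<open>For the cubic form \<open>S x x x\<close> the value of \<open>L\<close> is 54 times the left-hand side of the equation below.\<close>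

locale eigencubic = cubic_space +
  fixes lam :: real
  assumes eig: "x \<in> V \<Longrightarrow> ((x \<star> x) \<bullet> (x \<star> x)) * tr x - (x \<star> x) \<bullet> (x \<star> (x \<star> x))
    = lam * (x \<bullet> x) * (x \<bullet> (x \<star> x))"

text \<open>The polarized normal form as a multiplication table. The values left free are those on
  \<open>xi\<close>, \<open>V2\<close>, \<open>V3\<close>, on \<open>xi\<close>, \<open>V3\<close>,
  \<open>V3\<close>, on \<open>V2\<close>, \<open>V3\<close>, \<open>V3\<close> and on
  \<open>V2\<close>, \<open>V2\<close>, \<open>V2\<close>; they carry \<psi>111, \<psi>102,
  \<psi>012 and \<psi>030.\<close>

locale normal_form = eigencubic +
  fixes e xi :: 'a and V2 V3 :: "'a set" and N k :: nat and eta zeta :: "nat \<Rightarrow> 'a"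
  assumes e_V: "e \<in> V" and xi_V: "xi \<in> V" and V2_V: "V2 \<subseteq> V" and V3_V: "V3 \<subseteq> V"
    and frame2: "onframe V2 N eta" and frame3: "onframe V3 k zeta"
    and e_e: "e \<bullet> e = 1" and xi_xi: "xi \<bullet> xi = 1" and e_xi: "e \<bullet> xi = 0"
    and e_2: "y \<in> V2 \<Longrightarrow> e \<bullet> y = 0" and e_3: "z \<in> V3 \<Longrightarrow> e \<bullet> z = 0"
    and xi_2: "y \<in> V2 \<Longrightarrow> xi \<bullet> y = 0" and xi_3: "z \<in> V3 \<Longrightarrow> xi \<bullet> z = 0"
    and orth23: "y \<in> V2 \<Longrightarrow> z \<in> V3 \<Longrightarrow> y \<bullet> z = 0"
    and decomp: "x \<in> V \<Longrightarrow> \<exists>t s. \<exists>y\<in>V2. \<exists>z\<in>V3. x = t *\<^sub>R e + s *\<^sub>R xi + y + z"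
    and S_eee: "S e e e = 1" and S_eexi: "S e e xi = 0"
    and S_ee2: "y \<in> V2 \<Longrightarrow> S e e y = 0" and S_ee3: "z \<in> V3 \<Longrightarrow> S e e z = 0"
    and S_exixi: "S e xi xi = -1" and S_exi2: "y \<in> V2 \<Longrightarrow> S e xi y = 0" and S_exi3: "z \<in> V3 \<Longrightarrow> S e xi z = 0"
    and S_e22: "y \<in> V2 \<Longrightarrow> y' \<in> V2 \<Longrightarrow> S e y y' = - (y \<bullet> y') / 2"
    and S_e33: "z \<in> V3 \<Longrightarrow> z' \<in> V3 \<Longrightarrow> S e z z' = (z \<bullet> z') / 2"
    and S_e23: "y \<in> V2 \<Longrightarrow> z \<in> V3 \<Longrightarrow> S e y z = 0"
    and S_xixixi: "S xi xi xi = 0" and S_xixi2: "y \<in> V2 \<Longrightarrow> S xi xi y = 0"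
    and S_xixi3: "z \<in> V3 \<Longrightarrow> S xi xi z = 0"
    and S_xi22: "y \<in> V2 \<Longrightarrow> y' \<in> V2 \<Longrightarrow> S xi y y' = 0"
    and S_223: "y \<in> V2 \<Longrightarrow> y' \<in> V2 \<Longrightarrow> z \<in> V3 \<Longrightarrow> S y y' z = 0"
    and S_333: "z \<in> V3 \<Longrightarrow> z' \<in> V3 \<Longrightarrow> z'' \<in> V3 \<Longrightarrow> S z z' z'' = 0"
begin

lemma in_V [simp]: "e \<in> V" "xi \<in> V" "y \<in> V2 \<Longrightarrow> y \<in> V" "z \<in> V3 \<Longrightarrow> z \<in> V"
  using e_V xi_V V2_V V3_V by auto

lemmas orth = e_e xi_xi e_xi e_xi[THEN trans[OF inner_commute]] e_2 e_2[THEN trans[OF inner_commute]]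
  e_3 e_3[THEN trans[OF inner_commute]] xi_2 xi_2[THEN trans[OF inner_commute]]
  xi_3 xi_3[THEN trans[OF inner_commute]] orth23 orth23[THEN trans[OF inner_commute]]

lemma comp_eqI:
  assumes [simp]: "v \<in> V" "w \<in> V" and "v \<bullet> e = w \<bullet> e" "v \<bullet> xi = w \<bullet> xi"
    and "\<And>y. y \<in> V2 \<Longrightarrow> v \<bullet> y = w \<bullet> y" "\<And>z. z \<in> V3 \<Longrightarrow> v \<bullet> z = w \<bullet> z"
  shows "v = w"
proof (rule eq_inI)
  fix x assume "x \<in> V"
  then obtain t s y z where "y \<in> V2" "z \<in> V3" "x = t *\<^sub>R e + s *\<^sub>R xi + y + z" using decomp by metis
  then show "v \<bullet> x = w \<bullet> x" using assms by (simp add: inner_add_right)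
qed auto

lemma e_mul [simp]:
  "e \<star> e = e" "e \<star> xi = - xi" "xi \<star> e = - xi" "xi \<star> xi = - e"
  "y \<in> V2 \<Longrightarrow> e \<star> y = - (1/2) *\<^sub>R y" "y \<in> V2 \<Longrightarrow> y \<star> e = - (1/2) *\<^sub>R y"
  "z \<in> V3 \<Longrightarrow> e \<star> z = (1/2) *\<^sub>R z" "z \<in> V3 \<Longrightarrow> z \<star> e = (1/2) *\<^sub>R z"
proof -
  show "e \<star> e = e"
    by (rule comp_eqI) (simp_all add: inner_mul orth S_eee S_eexi S_ee2 S_ee3)
  show "xi \<star> xi = - e"
    by (rule comp_eqI) (simp_all add: inner_mul orth S_exixi S_xixixi S_xixi2 S_xixi3 S_swap13[of xi xi e])
  show "e \<star> xi = - xi"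
    by (rule comp_eqI) (simp_all add: inner_mul orth S_eexi S_exixi S_exi2 S_exi3 S_swap23[of e xi e])
  then show "xi \<star> e = - xi" by (simp add: mul_commute[of xi])
  show 2: "e \<star> y = - (1/2) *\<^sub>R y" if "y \<in> V2" for y
    using that by (intro comp_eqI) (simp_all add: inner_mul orth S_ee2 S_exi2 S_e22 S_e23
        S_swap23[of e y e] S_swap23[of e y xi])
  show "y \<star> e = - (1/2) *\<^sub>R y" if "y \<in> V2" using 2[OF that] by (simp add: mul_commute[of y])
  show 3: "e \<star> z = (1/2) *\<^sub>R z" if "z \<in> V3" for z
    using that by (intro comp_eqI) (simp_all add: inner_mul orth S_ee3 S_exi3 S_e33 S_e23
        S_swap23[of e z e] S_swap23[of e z xi] S_e23[THEN trans[OF S_swap23]])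
  show "z \<star> e = (1/2) *\<^sub>R z" if "z \<in> V3" using 3[OF that] by (simp add: mul_commute[of z])
qed

text \<open>The span of \<open>e\<close> and \<open>xi\<close> is a subalgebra. On it the equation already determines the eigenvalue
  and the trace of multiplication by \<open>e\<close>.\<close>

lemma tr_e: "tr e = 0" and lam: "lam = -1"
proof -
  have *: "tr xi + (tr e + 3 + 3 * lam) * t + (2 * tr xi) * t^2
     + (2 * tr e + 2 + 2 * lam) * t^3 + tr xi * t^4 + (tr e - 1 - lam) * t^5
    = 0 + 0 * t + 0 * t^2 + 0 * t^3 + 0 * t^4 + 0 * t^5" for t :: real
    using eig[of "t *\<^sub>R e + xi"]
    by (simp add: inner_add_left inner_add_right inner_diff_left inner_diff_right orth algebra_simps
        eval_nat_numeral)
  show "tr e = 0" "lam = -1"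
    using quintic_coeffs(2)[OF *] quintic_coeffs(6)[OF *] by auto
qed

lemma onframe_V: "onframe V (1 + (1 + (N + k))) (append_frame 1 (\<lambda>_. e) (append_frame 1 (\<lambda>_. xi) (append_frame N eta zeta)))"
proof -
  let ?X1 = "{x + y | x y. x \<in> V2 \<and> y \<in> V3}"
  let ?X2 = "{x + y | x y. x \<in> range (\<lambda>r. r *\<^sub>R xi) \<and> y \<in> ?X1}"
  let ?X3 = "{x + y | x y. x \<in> range (\<lambda>r. r *\<^sub>R e) \<and> y \<in> ?X2}"
  have "onframe ?X1 (N + k) (append_frame N eta zeta)"
    by (rule onframe_append[OF frame2 frame3 orth23])
  then have "onframe ?X2 (1 + (N + k)) (append_frame 1 (\<lambda>_. xi) (append_frame N eta zeta))"
    by (rule onframe_append[OF onframe_single[OF xi_xi]]) (auto simp: inner_add_right orth)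
  then have X3: "onframe ?X3 (1 + (1 + (N + k))) (append_frame 1 (\<lambda>_. e) (append_frame 1 (\<lambda>_. xi) (append_frame N eta zeta)))"
    by (rule onframe_append[OF onframe_single[OF e_e]]) (auto simp: inner_add_right orth)
  have "?X3 = V"
  proof (intro subset_antisym subsetI)
    fix x assume "x \<in> ?X3"
    then show "x \<in> V" by (auto intro!: V_closed)
  next
    fix x assume "x \<in> V"
    then obtain t s y z where "y \<in> V2" "z \<in> V3" "x = t *\<^sub>R e + (s *\<^sub>R xi + (y + z))"
      using decomp by (metis add.assoc)
    then show "x \<in> ?X3" by blast
  qed
  with X3 show ?thesis by simp
qed

text \<open>In the adapted frame \<open>tr e = 0\<close> reads
  \<open>1 - 1 - N/2 + k/2 = 0\<close>.\<close>

lemma k_eq_N: "k = N"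
proof -
  have "tr e = (\<Sum>i<1 + (1 + (N + k)). (\<lambda>v. S e v v) (append_frame 1 (\<lambda>_. e) (append_frame 1 (\<lambda>_. xi) (append_frame N eta zeta)) i))"
    unfolding tr_def by (rule onframe_trace[OF frame onframe_V, of "\<lambda>x y. S e x y"]) simp_all
  also have "\<dots> = S e e e + (S e xi xi + ((\<Sum>i<N. S e (eta i) (eta i)) + (\<Sum>i<k. S e (zeta i) (zeta i))))"
    by (subst sum_append_frame, subst sum_append_frame, subst sum_append_frame) simp
  also have "(\<Sum>i<N. S e (eta i) (eta i)) = (\<Sum>i<N. - (1/2))"
    by (intro sum.cong refl) (use onframe_in[OF frame2] orthonormalD[OF onframe_orthonormal[OF frame2]] in \<open>simp add: S_e22\<close>)
  also have "(\<Sum>i<k. S e (zeta i) (zeta i)) = (\<Sum>i<k. 1/2)"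
    by (intro sum.cong refl) (use onframe_in[OF frame3] orthonormalD[OF onframe_orthonormal[OF frame3]] in \<open>simp add: S_e33\<close>)
  finally show ?thesis using tr_e by (simp add: S_eee S_exixi)
qed

text \<open>The coefficient of \<open>t\<close> in the equation at \<open>t e + y\<close>.\<close>

lemma eig_t1:
  assumes y [simp]: "y \<in> V" and ye: "e \<bullet> y = 0"
  shows "(y \<star> y) \<bullet> (e \<star> (y \<star> y)) + 4 * ((y \<star> y) \<bullet> (y \<star> (e \<star> y))) = 3 * (y \<bullet> y) * ((e \<star> y) \<bullet> y)"
proof -
  define p where "p = e \<star> y"
  define q where "q = y \<star> y"
  define r where "r = tr y"
  have [simp]: "p \<in> V" "q \<in> V" by (simp_all add: p_def q_def)
  have prods: "e \<star> y = p" "y \<star> e = p" "y \<star> y = q" by (simp_all add: p_def q_def mul_commute[of y e])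
  have eep: "e \<bullet> (e \<star> x) = e \<bullet> x" if "x \<in> V" for x
    using inner_mul_shift[of e x e] that by simp
  have ep: "e \<bullet> p = 0" unfolding p_def using eep[OF y] ye by simp
  have comm: "y \<bullet> e = 0" "p \<bullet> e = 0" using ye ep by (simp_all add: inner_commute)
  have *: "((q \<bullet> q) * r - q \<bullet> (y \<star> q))
     + (4 * (p \<bullet> q) * r - (q \<bullet> (e \<star> q) + 2 * (q \<bullet> (y \<star> p)) + 2 * (p \<bullet> (y \<star> q)))) * t
     + ((4 * (p \<bullet> p) + 2 * (e \<bullet> q)) * r - (e \<bullet> (y \<star> q) + 2 * (p \<bullet> (e \<star> q)) + 4 * (p \<bullet> (y \<star> p)) + 2 * (q \<bullet> (e \<star> p)) + p \<bullet> q)) * t^2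
     + (- (2 * (e \<bullet> q) + 2 * (e \<bullet> (y \<star> p)) + 4 * (p \<bullet> (e \<star> p)) + 2 * (p \<bullet> p))) * t^3
     + r * t^4 + (- 1) * t^5
   = (- (y \<bullet> y) * (y \<bullet> q)) + (- (y \<bullet> y) * (2 * (p \<bullet> y) + e \<bullet> q)) * t + (- (y \<bullet> q)) * t^2
     + (- (2 * (p \<bullet> y) + e \<bullet> q) - (y \<bullet> y)) * t^3 + 0 * t^4 + (- 1) * t^5" for t :: real
    using eig[of "t *\<^sub>R e + y"]
    by (simp add: inner_add_left inner_add_right orth lam tr_e prods comm ye ep eep r_def[symmetric]
        inner_commute[of q e] inner_commute[of q p] inner_commute[of y p] algebra_simps eval_nat_numeral)
  \<comment> \<open>The coefficient of \<open>t^4\<close> is the trace of \<open>y\<close>; its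
    vanishing clears the trace from the coefficient of \<open>t\<close>.\<close>
  have r0: "r = 0" by (rule quintic_coeffs(5)[OF *])
  have "e \<bullet> q = p \<bullet> y" unfolding p_def q_def by (simp add: inner_mul inner_mul' S_ac)
  moreover have "p \<bullet> (y \<star> q) = q \<bullet> (y \<star> p)" by (simp add: inner_mul' S_ac)
  ultimately show ?thesis using quintic_coeffs(2)[OF *] r0
    by (simp add: prods)
qed

end

context normal_form
begin

lemma V2_memI:
  assumes "x \<in> V" "x \<bullet> e = 0" "x \<bullet> xi = 0" "\<And>z. z \<in> V3 \<Longrightarrow> x \<bullet> z = 0"
  shows "x \<in> V2"
proof -
  obtain t s y z where x: "y \<in> V2" "z \<in> V3" "x = t *\<^sub>R e + s *\<^sub>R xi + y + z" using decomp assms(1) by metis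
  have "t = 0" "s = 0" "z = 0"
    using assms(2,3) assms(4)[OF x(2)] x(1,2) by (simp_all add: x(3) inner_add_left orth)
  with x show ?thesis by simp
qed

lemma V3_memI:
  assumes "x \<in> V" "x \<bullet> e = 0" "x \<bullet> xi = 0" "\<And>y. y \<in> V2 \<Longrightarrow> x \<bullet> y = 0"
  shows "x \<in> V3"
proof -
  obtain t s y z where x: "y \<in> V2" "z \<in> V3" "x = t *\<^sub>R e + s *\<^sub>R xi + y + z" using decomp assms(1) by metis
  have "t = 0" "s = 0" "y = 0"
    using assms(2,3) assms(4)[OF x(1)] x(1,2) by (simp_all add: x(3) inner_add_left orth)
  with x show ?thesis by simp
qed

definition J :: "'a \<Rightarrow> 'a" where
  "J x = 2 *\<^sub>R (xi \<star> x)"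

lemma J_linear [simp]: "J (x + y) = J x + J y" "J (c *\<^sub>R x) = c *\<^sub>R J x"
  by (simp_all add: J_def algebra_simps)

lemma S_xi_e: "S xi x e = - (x \<bullet> xi)" if "x \<in> V"
  using inner_mul'[OF that, of xi e] by (simp add: S_swap23[of xi x e])

lemma J_V3:
  assumes "y \<in> V2" shows "J y \<in> V3"
  using assms
  by (intro V3_memI) (simp_all add: J_def inner_mul orth S_xi_e S_xi22 S_swap23[of xi y xi] S_xixi2)

lemma xi_mul_2: "y \<in> V2 \<Longrightarrow> xi \<star> y = (1/2) *\<^sub>R J y" "y \<in> V2 \<Longrightarrow> y \<star> xi = (1/2) *\<^sub>R J y"
  by (simp_all add: J_def mul_commute[of y])

text \<open>The component of \<open>y \<star> y\<close> in \<open>V2\<close>, the rest being a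
  multiple of \<open>e\<close>. Up to \<open>sqrt 2\<close> it is the square of \<open>y\<close> in
  the algebra of the restriction to \<open>V2\<close>.\<close>

definition K :: "'a \<Rightarrow> 'a" where
  "K y = y \<star> y + ((y \<bullet> y) / 2) *\<^sub>R e"

lemma K_V2:
  assumes "y \<in> V2" shows "K y \<in> V2"
  using assms
  by (intro V2_memI)
    (simp_all add: K_def inner_mul orth inner_add_left S_223 S_e22 S_swap13[of y y e] S_swap13[of y y xi] S_xi22)

lemma e_K: "y \<in> V2 \<Longrightarrow> e \<star> K y = - (1/2) *\<^sub>R K y"
  and e_J: "y \<in> V2 \<Longrightarrow> e \<star> J y = (1/2) *\<^sub>R J y"
  using K_V2 J_V3 by auto

text \<open>Both follow from \<open>eig_t1\<close> at \<open>a xi + y\<close>: the coefficient of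
  \<open>a^2\<close> gives the length of \<open>J y\<close>, the constant term that of
  \<open>K y\<close>. The factor 1/2 in the latter is absorbed by \<open>sqrt 2\<close> in
  \<open>eiconal_V2\<close>.\<close>

lemma JJ_KK:
  assumes y: "y \<in> V2"
  shows J_norm: "J y \<bullet> J y = y \<bullet> y" and K_norm: "K y \<bullet> K y = (y \<bullet> y)^2 / 2"
proof -
  note [simp] = e_K[OF y] e_J[OF y]
  define h where "h = y \<bullet> y"
  have yy: "y \<star> y = - (h / 2) *\<^sub>R e + K y" by (simp add: K_def h_def)
  have o: "K y \<bullet> J y = 0" "J y \<bullet> K y = 0" "e \<bullet> J y = 0" "J y \<bullet> e = 0" "e \<bullet> K y = 0" "K y \<bullet> e = 0"
    using K_V2[OF y] J_V3[OF y] by (simp_all add: orth)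
  have *: "(h * h / 4 - (K y \<bullet> K y) / 2 - h * h / 2 - 2 * (K y \<bullet> K y)) + 0 * a
      + (- 2 * h - 5/2 * (J y \<bullet> J y)) * a^2 + 0 * a^3 + (- 3) * a^4
    = (- 3/2 * h * h) + 0 * a + (- 9/2 * h) * a^2 + 0 * a^3 + (- 3) * a^4" for a :: real
  proof -
    let ?y = "a *\<^sub>R xi + y"
    have q: "?y \<star> ?y = - (a^2 + h / 2) *\<^sub>R e + a *\<^sub>R J y + K y"
      by (rule inner_eqI) (simp add: yy xi_mul_2 y inner_add_left inner_diff_left power2_eq_square algebra_simps)
    have p: "e \<star> ?y = - a *\<^sub>R xi - (1/2) *\<^sub>R y" using y by simp
    have yp: "?y \<star> (e \<star> ?y) = (a^2 + h / 4) *\<^sub>R e - (3/4 * a) *\<^sub>R J y - (1/2) *\<^sub>R K y"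
      unfolding p by (rule inner_eqI) (simp add: yy xi_mul_2 y inner_add_left inner_diff_left power2_eq_square algebra_simps)
    have n: "?y \<bullet> ?y = a^2 + h" "(e \<star> ?y) \<bullet> ?y = - (a^2) - h / 2"
      unfolding p using y by (simp_all add: inner_add_left inner_add_right inner_diff_left orth h_def power2_eq_square)
    have "(- (a^2 + h / 2) *\<^sub>R e + a *\<^sub>R J y + K y) \<bullet> (e \<star> (- (a^2 + h / 2) *\<^sub>R e + a *\<^sub>R J y + K y))
       = (a^2 + h/2)^2 + a^2 / 2 * (J y \<bullet> J y) - (K y \<bullet> K y) / 2"
      by (simp add: inner_add_left inner_add_right inner_diff_left inner_diff_right o e_e power2_eq_square algebra_simps)
    moreover have "(- (a^2 + h / 2) *\<^sub>R e + a *\<^sub>R J y + K y) \<bullet> ((a^2 + h / 4) *\<^sub>R e - (3/4 * a) *\<^sub>R J y - (1/2) *\<^sub>R K y)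
       = - (a^2 + h / 2) * (a^2 + h / 4) - 3/4 * a^2 * (J y \<bullet> J y) - (K y \<bullet> K y) / 2"
      by (simp add: inner_add_left inner_add_right inner_diff_left inner_diff_right o e_e power2_eq_square algebra_simps)
    ultimately have "(a^2 + h/2)^2 + a^2 / 2 * (J y \<bullet> J y) - (K y \<bullet> K y) / 2
        + 4 * (- (a^2 + h / 2) * (a^2 + h / 4) - 3/4 * a^2 * (J y \<bullet> J y) - (K y \<bullet> K y) / 2)
      = 3 * (a^2 + h) * (- (a^2) - h / 2)"
      using eig_t1[of ?y] y unfolding q yp n by (simp add: orth inner_add_right)
    then show ?thesis by (simp add: field_simps power_expand)
  qed
  show "J y \<bullet> J y = y \<bullet> y" "K y \<bullet> K y = (y \<bullet> y)^2 / 2"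
    using quartic_coeffs(1)[OF *] quartic_coeffs(3)[OF *] by (simp_all add: h_def power2_eq_square)
qed

lemma J_inner:
  assumes "x \<in> V2" "y \<in> V2" shows "J x \<bullet> J y = x \<bullet> y"
proof -
  have "x + y \<in> V2" using assms onframe_subspace[OF frame2] by (simp add: subspace_add)
  from J_norm[OF this] J_norm[OF assms(1)] J_norm[OF assms(2)] show ?thesis
    by (simp add: inner_add_left inner_add_right inner_commute[of y x] inner_commute[of "J y" "J x"])
qed

text \<open>Now \<open>eig_t1\<close> at \<open>a xi + J y\<close>. The component of
  \<open>xi \<star> J y\<close> in \<open>V2\<close> is \<open>y / 2\<close> since \<open>J\<close>
  is isometric; \<open>M\<close> is the component in \<open>V3\<close>, which carries \<psi>102, and
  comparing coefficients of \<open>a^2\<close> gives \<open>M \<bullet> M = 0\<close>. The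
  components of \<open>J y \<star> J y\<close> along \<open>xi\<close> and in \<open>V2\<close> are
  called \<open>r\<close> and \<open>g\<close>.\<close>

lemma xi_J:
  assumes y: "y \<in> V2" shows "xi \<star> J y = (1/2) *\<^sub>R y"
proof -
  define z where "z = J y"
  define h where "h = y \<bullet> y"
  define m where "m = xi \<star> z"
  define M where "M = m - (1/2) *\<^sub>R y"
  define g where "g = z \<star> z - (h / 2) *\<^sub>R e - (m \<bullet> z) *\<^sub>R xi"
  have z: "z \<in> V3" using J_V3[OF y] by (simp add: z_def)
  have zz: "z \<bullet> z = h" using J_norm[OF y] by (simp add: z_def h_def)
  have M: "M \<in> V3"
  proof (rule V3_memI)
    show "M \<in> V" using y by (simp add: M_def m_def)
    show "M \<bullet> e = 0" "M \<bullet> xi = 0"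
      using y z by (simp_all add: M_def m_def inner_diff_left orth inner_mul S_xi_e S_swap23[of xi z xi] S_xixi3)
    show "M \<bullet> x = 0" if x: "x \<in> V2" for x
    proof -
      have "m \<bullet> x = (xi \<star> x) \<bullet> z" unfolding m_def using x z by (simp add: inner_mul S_swap23[of xi z x])
      also have "\<dots> = (x \<bullet> y) / 2" using x y by (simp add: xi_mul_2 z_def J_inner)
      finally show ?thesis by (simp add: M_def inner_diff_left inner_commute[of y x])
    qed
  qed
  have g: "g \<in> V2"
  proof (rule V2_memI)
    show "g \<in> V" using z by (simp add: g_def)
    show "g \<bullet> e = 0" using z zz
      by (simp add: g_def inner_diff_left orth inner_mul S_swap13[of z z e] S_e33)
    show "g \<bullet> xi = 0" using z
      by (simp add: g_def inner_diff_left orth m_def inner_mul S_swap13[of z z xi])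
    show "g \<bullet> x = 0" if "x \<in> V3" for x
      using z that by (simp add: g_def inner_diff_left orth inner_mul S_333)
  qed
  have m: "m = (1/2) *\<^sub>R y + M" by (simp add: M_def)
  define r where "r = m \<bullet> z"
  have z2: "z \<star> z = (h / 2) *\<^sub>R e + r *\<^sub>R xi + g" by (simp add: g_def r_def)
  have zxi: "xi \<star> z = m" "z \<star> xi = m" by (simp_all add: m_def mul_commute[of z])
  note o = orth(1-4) orth(5,6)[OF g] orth(5,6)[OF y] orth(7,8)[OF M] orth(7,8)[OF z] orth(9,10)[OF g] orth(9,10)[OF y]
    orth(11,12)[OF M] orth(11,12)[OF z] orth(13,14)[OF y M] orth(13,14)[OF g M]
  define yg where "yg = y \<bullet> g"
  have yg: "y \<bullet> g = yg" "g \<bullet> y = yg" by (simp_all add: yg_def inner_commute)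
  have *: "(h * h / 4 - r * r - (g \<bullet> g) / 2 + 4 * (h * h / 8 + r * r / 2 + (g \<bullet> g) / 2)) + 0 * a
      + (- h + 4 * (- h / 8 + (M \<bullet> M) / 2) + h - 4 * (h / 4 + M \<bullet> M)) * a^2 + 0 * a^3 + (- 3) * a^4
    = (3/2 * h * h) + 0 * a + (- 3/2 * h) * a^2 + 0 * a^3 + (- 3) * a^4" for a :: real
  proof -
    let ?y = "a *\<^sub>R xi + z"
    have q: "?y \<star> ?y = (h / 2 - (a^2)) *\<^sub>R e + a *\<^sub>R y + (2 * a) *\<^sub>R M + r *\<^sub>R xi + g"
      by (rule inner_eqI) (simp add: z2 zxi m inner_add_left inner_diff_left power2_eq_square algebra_simps)
    have p: "e \<star> ?y = - a *\<^sub>R xi + (1/2) *\<^sub>R z" using z by simp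
    have yp: "?y \<star> (e \<star> ?y) = (a^2 + h / 4) *\<^sub>R e - (a / 4) *\<^sub>R y - (a / 2) *\<^sub>R M + (r / 2) *\<^sub>R xi + (1/2) *\<^sub>R g"
      unfolding p by (rule inner_eqI) (simp add: z2 zxi m inner_add_left inner_diff_left power2_eq_square algebra_simps)
    have n: "?y \<bullet> ?y = a^2 + h" "(e \<star> ?y) \<bullet> ?y = - (a^2) + h / 2"
      unfolding p using z by (simp_all add: inner_add_left inner_add_right inner_diff_left orth zz power2_eq_square)
    let ?q = "(h / 2 - (a^2)) *\<^sub>R e + a *\<^sub>R y + (2 * a) *\<^sub>R M + r *\<^sub>R xi + g"
    have eq: "e \<star> ?q = (h / 2 - (a^2)) *\<^sub>R e - (a / 2) *\<^sub>R y + a *\<^sub>R M - r *\<^sub>R xi - (1/2) *\<^sub>R g"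
      using y M g by simp
    have "?q \<bullet> (e \<star> ?q) = (h / 2 - (a^2))^2 - (a^2) / 2 * h - a * yg + 2 * a^2 * (M \<bullet> M) - r * r - (g \<bullet> g) / 2"
      unfolding eq
      by (simp add: inner_add_left inner_add_right inner_diff_left inner_diff_right o yg h_def[symmetric] field_simps power2_eq_square)
    moreover have "?q \<bullet> ((a^2 + h / 4) *\<^sub>R e - (a / 4) *\<^sub>R y - (a / 2) *\<^sub>R M + (r / 2) *\<^sub>R xi + (1/2) *\<^sub>R g)
       = (h / 2 - (a^2)) * (a^2 + h / 4) - (a^2) / 4 * h + a / 4 * yg - (a^2) * (M \<bullet> M) + r * r / 2 + (g \<bullet> g) / 2"
      by (simp add: inner_add_left inner_add_right inner_diff_left inner_diff_right o yg h_def[symmetric] field_simps power2_eq_square)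
    ultimately have "(h / 2 - (a^2))^2 - (a^2) / 2 * h - a * yg + 2 * a^2 * (M \<bullet> M) - r * r - (g \<bullet> g) / 2
        + 4 * ((h / 2 - (a^2)) * (a^2 + h / 4) - (a^2) / 4 * h + a / 4 * yg - (a^2) * (M \<bullet> M) + r * r / 2 + (g \<bullet> g) / 2)
      = 3 * (a^2 + h) * (- (a^2) + h / 2)"
      using eig_t1[of ?y] z unfolding q yp n by (simp add: orth inner_add_right)
    then show ?thesis by (simp add: field_simps power_expand)
  qed
  have "M \<bullet> M = 0" using quartic_coeffs(3)[OF *] by simp
  then show ?thesis using m by (simp add: m_def z_def)
qed

text \<open>The coefficient of \<open>a\<close> in \<open>eig_t1\<close> at \<open>a xi + w\<close>
  with \<open>w = x + J y\<close>. Writing \<open>m = xi \<star> w\<close>,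
  \<open>Q = w \<star> w\<close> and \<open>D = w \<star> (e \<star> w)\<close>, the terms with
  \<open>em = e \<star> m\<close> cancel and \<open>2 (m \<bullet> D) = Q \<bullet> m\<close>
  remains; expanded in \<open>x\<close> and \<open>J y\<close> this is the claim.\<close>

lemma S_2JJ_aux:
  assumes x: "x \<in> V2" and y: "y \<in> V2"
  shows "S x (J x) (J y) = - S x x y"
proof -
  define z where "z = J y"
  have z: "z \<in> V3" using J_V3[OF y] by (simp add: z_def)
  define w where "w = x + z"
  define P where "P = - (1/2) *\<^sub>R x + (1/2) *\<^sub>R z"
  define m where "m = (1/2) *\<^sub>R J x + (1/2) *\<^sub>R y"
  define Q where "Q = w \<star> w"
  define D where "D = w \<star> P"
  define em where "em = (1/4) *\<^sub>R J x - (1/4) *\<^sub>R y"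
  have [simp]: "w \<in> V" "P \<in> V" "m \<in> V" "Q \<in> V" "D \<in> V" "em \<in> V"
    using x y z J_V3[OF x] by (simp_all add: w_def P_def m_def Q_def D_def em_def)
  have e_m: "e \<star> m = em" using x y J_V3[OF x] by (simp add: m_def em_def)
  have xi_w: "xi \<star> w = m" "w \<star> xi = m"
    using x y by (simp_all add: w_def m_def z_def xi_mul_2 xi_J mul_commute[of _ xi])
  have xi_P: "xi \<star> P = - em"
    using x y by (simp add: P_def em_def z_def xi_mul_2 xi_J)
  have e_w: "e \<star> w = P" using x z by (simp add: w_def P_def)
  have ew: "e \<bullet> w = 0" "xi \<bullet> w = 0" "w \<bullet> xi = 0" "P \<bullet> xi = 0" using x z by (simp_all add: w_def P_def inner_add_right inner_add_left inner_diff_left orth)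
  have em': "e \<bullet> m = 0" "m \<bullet> e = 0" "e \<bullet> em = 0" "em \<bullet> e = 0"
    using x y J_V3[OF x] by (simp_all add: m_def em_def inner_add_right inner_add_left inner_diff_left inner_diff_right orth)
  have eQ: "e \<bullet> (e \<star> Q) = e \<bullet> Q" using inner_mul_shift[of e Q e] by simp
  have mQ: "m \<bullet> (e \<star> Q) = em \<bullet> Q" using e_m by (simp add: inner_mul inner_mul' S_ac flip: e_m)
  have *: "(Q \<bullet> (e \<star> Q) + 4 * (Q \<bullet> D)) + (4 * (em \<bullet> Q) + 8 * (m \<bullet> D) - 4 * (Q \<bullet> em) - 4 * (Q \<bullet> m)) * a
      + (2 * (m \<bullet> em) * 2 - 2 * (e \<bullet> Q) + 4 * (Q \<bullet> e) - 4 * (e \<bullet> D) - 8 * (m \<bullet> em) - 8 * (m \<bullet> m)) * a^2 + 0 * a^3 + (- 3) * a^4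
    = (3 * (w \<bullet> w) * (P \<bullet> w)) + 0 * a + (3 * (P \<bullet> w) - 3 * (w \<bullet> w)) * a^2 + 0 * a^3 + (- 3) * a^4" for a :: real
  proof -
    let ?y = "a *\<^sub>R xi + w"
    have q: "?y \<star> ?y = - (a^2) *\<^sub>R e + (2 * a) *\<^sub>R m + Q"
      by (rule inner_eqI) (simp add: xi_w Q_def inner_add_left inner_diff_left power2_eq_square algebra_simps)
    have p: "e \<star> ?y = - a *\<^sub>R xi + P" using e_w by simp
    have yp: "?y \<star> (e \<star> ?y) = a^2 *\<^sub>R e - a *\<^sub>R em - a *\<^sub>R m + D"
      unfolding p by (rule inner_eqI) (simp add: xi_w xi_P D_def inner_add_left inner_diff_left power2_eq_square algebra_simps)
    have n: "?y \<bullet> ?y = a^2 + w \<bullet> w" "(e \<star> ?y) \<bullet> ?y = - (a^2) + P \<bullet> w"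
      unfolding p by (simp_all add: inner_add_left inner_add_right inner_diff_left ew orth power2_eq_square)
    have eq: "e \<star> (- (a^2) *\<^sub>R e + (2 * a) *\<^sub>R m + Q) = - (a^2) *\<^sub>R e + (2 * a) *\<^sub>R em + e \<star> Q"
      using e_m by simp
    have "e \<bullet> ?y = 0" by (simp add: inner_add_right ew orth)
    then have "(- (a^2) *\<^sub>R e + (2 * a) *\<^sub>R m + Q) \<bullet> (- (a^2) *\<^sub>R e + (2 * a) *\<^sub>R em + e \<star> Q)
      + 4 * ((- (a^2) *\<^sub>R e + (2 * a) *\<^sub>R m + Q) \<bullet> (a^2 *\<^sub>R e - a *\<^sub>R em - a *\<^sub>R m + D))
      = 3 * (a^2 + w \<bullet> w) * (- (a^2) + P \<bullet> w)"
      using eig_t1[of ?y] unfolding q yp n eq by simp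
    then show ?thesis
      by (simp add: inner_add_left inner_add_right inner_diff_left inner_diff_right em' eQ mQ e_e
          inner_commute[of Q e] inner_commute[of Q em] field_simps power_expand)
  qed
  have key: "2 * (m \<bullet> D) = Q \<bullet> m" using quartic_coeffs(2)[OF *] by (simp add: inner_commute[of Q em])
  have Jx: "J x \<in> V3" using J_V3[OF x] .
  have "D = - (1/2) *\<^sub>R (x \<star> x) + (1/2) *\<^sub>R (z \<star> z)"
    by (rule inner_eqI) (simp add: D_def w_def P_def mul_commute[of z x] inner_add_left algebra_simps)
  then have mD: "2 * (m \<bullet> D) = - (m \<bullet> (x \<star> x)) + m \<bullet> (z \<star> z)" by (simp add: inner_add_right inner_diff_right)
  have Qm: "Q \<bullet> m = m \<bullet> (x \<star> x) + 2 * (m \<bullet> (x \<star> z)) + m \<bullet> (z \<star> z)"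
    by (simp add: Q_def w_def mul_commute[of z x] inner_add_left inner_add_right inner_commute[of _ m] algebra_simps)
  have "m \<bullet> (x \<star> x) + m \<bullet> (x \<star> z) = 0" using key unfolding mD Qm by simp
  moreover have "m \<bullet> (x \<star> x) = (1/2) * S x x y" "m \<bullet> (x \<star> z) = (1/2) * S x (J x) z"
    using x y z Jx unfolding m_def
    by (simp_all add: inner_add_left inner_mul' S_223 S_swap23[of x z "J x"] S_swap23[of x z y])
  ultimately show ?thesis by (simp add: z_def)
qed

text \<open>The defect \<open>D\<close> is symmetric in its last two arguments and, by polarizing
  \<open>S_2JJ_aux\<close>, antisymmetric in its first two. A trilinear form with both properties
  vanishes.\<close>

lemma S_2JJ:
  assumes x: "x \<in> V2" and y: "y \<in> V2" and z: "z \<in> V2"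
  shows "S x (J y) (J z) = - S x y z"
proof -
  define D where "D a b c = S a (J b) (J c) + S a b c" for a b c
  have sym: "D a b c = D a c b" for a b c
    by (simp add: D_def S_swap23[of a "J b"] S_swap23[of a b])
  have zero: "D a a b = 0" if "a \<in> V2" "b \<in> V2" for a b
    using S_2JJ_aux[OF that] by (simp add: D_def)
  have anti: "D a b c = - D b a c" if "a \<in> V2" "b \<in> V2" "c \<in> V2" for a b c
  proof -
    have "a + b \<in> V2" using that onframe_subspace[OF frame2] by (simp add: subspace_add)
    from zero[OF this that(3)] zero[OF that(1,3)] zero[OF that(2,3)] show ?thesis by (simp add: D_def)
  qed
  have "D x y z = 0"
    using anti[OF x y z] anti[OF y z x] anti[OF z x y] sym[of x y z] sym[of y z x] sym[of z x y]
      sym[of y x z] sym[of z y x] sym[of x z y] by linarith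
  then show ?thesis by (simp add: D_def)
qed

text \<open>The right-hand side is the real part of \<open>T^3 - 3/2 T |Y|^2 + S Y Y Y\<close>,
  extended complex multilinearly, at \<open>T = t + i s\<close> and \<open>Y = y + i y'\<close>. The
  doubling can be read off from it, and only the restriction of \<open>S\<close> to
  \<open>V2\<close> enters.\<close>

lemma normal_cube:
  assumes y: "y \<in> V2" "y' \<in> V2" and X: "X = t *\<^sub>R e + s *\<^sub>R xi + y + J y'"
  shows "S X X X = t^3 - 3/2 * t * (2 * s^2 + y \<bullet> y - y' \<bullet> y') + 3 * s * (y \<bullet> y') + S y y y - 3 * S y y' y'"
proof -
  define z where "z = J y'"
  have z: "z \<in> V3" "z \<bullet> z = y' \<bullet> y'" using J_V3[OF y(2)] J_norm[OF y(2)] by (simp_all add: z_def)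
  define A where "A = t *\<^sub>R e + s *\<^sub>R xi"
  define B where "B = y + z"
  have 1: "S A A A = t^3 - 3 * t * s^2"
    unfolding A_def S_cube_add by (simp add: S_eee S_eexi S_exixi S_xixixi power_expand)
  have 2: "S A A B = 0"
    using y z by (simp add: A_def B_def S_ee2 S_ee3 S_exi2 S_exi3 S_xixi2 S_xixi3 S_swap12[of xi e])
  have xi_yz: "S xi y z = (y \<bullet> y') / 2"
    using inner_mul[of z xi y] y z by (simp add: xi_mul_2 z_def J_inner)
  have xi_zz: "S xi z z = 0"
    using inner_mul[of z xi z] y z xi_J[OF y(2)] by (simp add: z_def orth)
  have 3: "S A B B = t * (- (y \<bullet> y) / 2 + (y' \<bullet> y') / 2) + s * (y \<bullet> y')"
    using y z by (simp add: A_def B_def S_e22 S_e33 S_e23 S_xi22 xi_yz xi_zz S_swap23[of _ z y] algebra_simps)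
  have 4: "S B B B = S y y y - 3 * S y y' y'"
    unfolding B_def S_cube_add using y z S_2JJ[OF y(1) y(2) y(2)] by (simp add: S_223 S_333 z_def)
  have "X = A + B" by (simp add: X A_def B_def z_def)
  then show ?thesis unfolding \<open>X = A + B\<close> S_cube_add 1 2 3 4 by (simp add: field_simps power_expand)
qed

lemma eiconal_V2: "eiconal (\<lambda>x y z. sqrt 2 * S x y z) V2 N eta"
proof -
  interpret T: trilinear_form "\<lambda>x y z. sqrt 2 * S x y z"
    by unfold_locales (simp_all add: algebra_simps S_ac)
  interpret T: cubic_space "\<lambda>x y z. sqrt 2 * S x y z" V2 N eta
    by unfold_locales (rule frame2)
  show ?thesis
  proof unfold_locales
    fix x assume x: "x \<in> V2"
    have "T.mul x x = sqrt 2 *\<^sub>R K x"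
      using x K_V2[OF x] onframe_subspace[OF frame2]
      by (intro T.mul_eqI) (auto simp: K_def inner_add_left inner_mul orth subspace_scale)
    then show "T.mul x x \<bullet> T.mul x x = (x \<bullet> x)^2"
      using K_norm[OF x] by (simp flip: mult.assoc)
  qed
qed

end

section \<open>Evaluation of polynomials\<close>

definition mono_val :: "(nat \<Rightarrow> 'b::comm_semiring_1) \<Rightarrow> (nat \<Rightarrow>\<^sub>0 nat) \<Rightarrow> 'b" where
  "mono_val \<alpha> m = (\<Prod>i\<in>Poly_Mapping.keys m. \<alpha> i ^ Poly_Mapping.lookup m i)"

lemma mono_val_superset:
  "finite A \<Longrightarrow> Poly_Mapping.keys m \<subseteq> A \<Longrightarrow> mono_val \<alpha> m = (\<Prod>i\<in>A. \<alpha> i ^ Poly_Mapping.lookup m i)"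
  unfolding mono_val_def by (rule prod.mono_neutral_left) (auto simp: in_keys_iff)

lemma mono_val_add: "mono_val \<alpha> (m + m') = mono_val \<alpha> m * mono_val \<alpha> m'"
proof -
  let ?A = "Poly_Mapping.keys m \<union> Poly_Mapping.keys m'"
  have "Poly_Mapping.keys (m + m') \<subseteq> ?A" by (rule Poly_Mapping.keys_add)
  then show ?thesis
    by (simp add: mono_val_superset[of ?A] lookup_add power_add prod.distrib)
qed

lemma mono_val_single: "mono_val \<alpha> (Poly_Mapping.single i 1) = \<alpha> i"
  by (simp add: mono_val_def)

lemma mono_val_0 [simp]: "mono_val \<alpha> 0 = 1"
  by (simp add: mono_val_def)

lemma poly_mapping_sum_singles:
  "p = (\<Sum>m\<in>Poly_Mapping.keys p. Poly_Mapping.single m (Poly_Mapping.lookup p m))"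
  by (rule poly_mapping_eqI)
    (auto simp: lookup_sum lookup_single when_def in_keys_iff)

text \<open>A ring homomorphism on the coefficients covers the three substitutions in use: real
  evaluation, evaluation of a real polynomial at complex points, and complex evaluation.\<close>

locale coeff_hom =
  fixes h :: "'a::comm_ring_1 \<Rightarrow> 'b::comm_ring_1"
  assumes h_one: "h 1 = 1" and h_add: "h (x + y) = h x + h y"
    and h_mult: "h (x * y) = h x * h y"
begin

lemma h_zero: "h 0 = 0"
  using h_add[of 0 0] by simp

lemma subst_superset:
  "finite A \<Longrightarrow> Poly_Mapping.keys p \<subseteq> A \<Longrightarrow>
    subst_poly h \<alpha> p = (\<Sum>m\<in>A. h (Poly_Mapping.lookup p m) * mono_val \<alpha> m)"
  unfolding subst_poly_def mono_val_def[symmetric]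
  by (rule sum.mono_neutral_left) (auto simp: in_keys_iff h_zero)

lemma subst_single [simp]: "subst_poly h \<alpha> (Poly_Mapping.single m c) = h c * mono_val \<alpha> m"
  by (subst subst_superset[of "{m}"]) auto

lemma subst_add [simp]: "subst_poly h \<alpha> (p + q) = subst_poly h \<alpha> p + subst_poly h \<alpha> q"
proof -
  let ?A = "Poly_Mapping.keys p \<union> Poly_Mapping.keys q"
  have "Poly_Mapping.keys (p + q) \<subseteq> ?A" by (rule Poly_Mapping.keys_add)
  then show ?thesis
    by (simp add: subst_superset[of ?A] lookup_add h_add algebra_simps sum.distrib)
qed

lemma subst_0 [simp]: "subst_poly h \<alpha> 0 = 0"
  by (simp add: subst_poly_def)

lemma subst_sum [simp]: "subst_poly h \<alpha> (sum f A) = (\<Sum>a\<in>A. subst_poly h \<alpha> (f a))"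
  by (induction A rule: infinite_finite_induct) auto

lemma subst_uminus [simp]: "subst_poly h \<alpha> (- p) = - subst_poly h \<alpha> p"
  using subst_add[of \<alpha> p "- p"] by (simp add: eq_neg_iff_add_eq_0 add.commute)

lemma subst_diff [simp]: "subst_poly h \<alpha> (p - q) = subst_poly h \<alpha> p - subst_poly h \<alpha> q"
  using subst_add[of \<alpha> p "- q"] by simp

lemma subst_mult [simp]: "subst_poly h \<alpha> (p * q) = subst_poly h \<alpha> p * subst_poly h \<alpha> q"
proof -
  have "p * q = (\<Sum>m\<in>Poly_Mapping.keys p. \<Sum>m'\<in>Poly_Mapping.keys q.
      Poly_Mapping.single (m + m') (Poly_Mapping.lookup p m * Poly_Mapping.lookup q m'))"
    by (subst (1) poly_mapping_sum_singles[of p], subst (1) poly_mapping_sum_singles[of q])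
      (simp add: sum_product mult_single)
  then have "subst_poly h \<alpha> (p * q) = (\<Sum>m\<in>Poly_Mapping.keys p. \<Sum>m'\<in>Poly_Mapping.keys q.
      (h (Poly_Mapping.lookup p m) * mono_val \<alpha> m) * (h (Poly_Mapping.lookup q m') * mono_val \<alpha> m'))"
    by (simp add: mono_val_add h_mult algebra_simps)
  then show ?thesis
    by (simp add: sum_product[symmetric] subst_superset[of "Poly_Mapping.keys p" p]
        subst_superset[of "Poly_Mapping.keys q" q])
qed

lemma subst_Cst [simp]: "subst_poly h \<alpha> (Cst c) = h c"
  by (simp add: Cst_def)

lemma subst_Var [simp]: "subst_poly h \<alpha> (Var i) = \<alpha> i"
  using mono_val_single[of \<alpha> i] by (simp add: Var_def h_one)

lemma subst_1 [simp]: "subst_poly h \<alpha> 1 = 1"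
  using subst_single[of \<alpha> 0 1] by (simp add: h_one)

lemma subst_power [simp]: "subst_poly h \<alpha> (p ^ k) = subst_poly h \<alpha> p ^ k"
  by (induction k) auto

lemma subst_cd_conj: "(\<lambda>i. subst_poly h \<alpha> (cd_conj x i)) = cd_conj (\<lambda>i. subst_poly h \<alpha> (x i))"
  by (auto simp: cd_conj_def fun_eq_iff)

lemma subst_cd_mult:
  "subst_poly h \<alpha> (cd_mult l x y i) = cd_mult l (\<lambda>i. subst_poly h \<alpha> (x i)) (\<lambda>i. subst_poly h \<alpha> (y i)) i"
proof (induction l x y i rule: cd_mult.induct)
  case (1 l x y i)
  show ?case
  proof (cases "l \<le> 1")
    case True
    then show ?thesis by (simp add: cd_mult.simps)
  next
    case False
    then show ?thesis
      using 1 by (subst (1 2) cd_mult.simps) (simp add: Let_def subst_cd_conj)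
  qed
qed

lemma subst_in_vars_cong:
  assumes "in_vars n p" "\<And>i. i < n \<Longrightarrow> \<alpha> i = \<beta> i"
  shows "subst_poly h \<alpha> p = subst_poly h \<beta> p"
proof -
  have "\<alpha> j = \<beta> j" if "m \<in> Poly_Mapping.keys p" "j \<in> Poly_Mapping.keys m" for m j
    using assms that by (auto simp: in_vars_def)
  then show ?thesis
    unfolding subst_poly_def by (intro sum.cong refl arg_cong2[of _ _ _ _ "(*)"] prod.cong) auto
qed

end

interpretation real_id: coeff_hom "\<lambda>c :: real. c"
  by unfold_locales auto

interpretation of_real_hom: coeff_hom "complex_of_real"
  by unfold_locales auto

interpretation complex_id: coeff_hom "\<lambda>c :: complex. c"
  by unfold_locales auto

abbreviation pval :: "(nat \<Rightarrow> real) \<Rightarrow> real mpoly \<Rightarrow> real" where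
  "pval \<equiv> subst_poly (\<lambda>c. c)"

lemma pval_sum_monomials:
  "pval \<alpha> p = (\<Sum>m\<in>Poly_Mapping.keys p. Poly_Mapping.lookup p m * mono_val \<alpha> m)"
  by (rule real_id.subst_superset) auto

text \<open>Ties the formal derivative to the analytic one, so that gradient and Hessian of a cubic
  can be read off from its trilinear form by uniqueness of derivatives. When \<open>i\<close> does
  not occur in a monomial, the truncated subtraction in \<open>pd\<close> leaves the monomial
  unchanged, but its factor is 0.\<close>

lemma pval_pd:
  "((\<lambda>t. pval (\<alpha>(i := t)) p) has_real_derivative pval \<alpha> (pd i p)) (at (\<alpha> i))"
proof -
  let ?l = Poly_Mapping.lookup and ?k = Poly_Mapping.keys
  have "((\<lambda>t. mono_val (\<alpha>(i := t)) m) has_real_derivative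
      real (?l m i) * mono_val \<alpha> (m - Poly_Mapping.single i 1)) (at (\<alpha> i))" for m
  proof -
    let ?A = "insert i (?k m)" and ?B = "?k m - {i}"
    let ?R = "\<Prod>j\<in>?B. \<alpha> j ^ ?l m j"
    have A: "?A = insert i ?B" by auto
    have prod_A: "(\<Prod>j\<in>?A. f j) = f i * (\<Prod>j\<in>?B. f j)" for f :: "nat \<Rightarrow> real"
      unfolding A by (rule prod.insert) auto
    have 1: "mono_val (\<alpha>(i := t)) m = t ^ ?l m i * ?R" for t
      by (subst mono_val_superset[of ?A]) (auto simp: prod_A intro!: arg_cong2[of _ _ _ _ "(*)"] prod.cong)
    have "?k (m - Poly_Mapping.single i 1) \<subseteq> ?A"
      by (auto simp: in_keys_iff lookup_minus)
    then have 2: "mono_val \<alpha> (m - Poly_Mapping.single i 1) = \<alpha> i ^ (?l m i - 1) * ?R"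
      by (subst mono_val_superset[of ?A])
        (auto simp: prod_A lookup_minus lookup_single intro!: arg_cong2[of _ _ _ _ "(*)"] prod.cong)
    show ?thesis unfolding 1 2 by (auto intro!: derivative_eq_intros)
  qed
  then have "((\<lambda>t. pval (\<alpha>(i := t)) p) has_real_derivative
      (\<Sum>m\<in>?k p. ?l p m * (real (?l m i) * mono_val \<alpha> (m - Poly_Mapping.single i 1)))) (at (\<alpha> i))"
    unfolding pval_sum_monomials by (intro DERIV_sum DERIV_cmult) auto
  moreover have "(\<Sum>m\<in>?k p. ?l p m * (real (?l m i) * mono_val \<alpha> (m - Poly_Mapping.single i 1)))
      = pval \<alpha> (pd i p)"
    unfolding pd_def by (simp add: mult_ac)
  ultimately show ?thesis by simp
qed

text \<open>Reduction modulo \<open>D\<close> gives the lowest digit, division the rest. It makes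
  the exponents of the Kronecker substitution distinct.\<close>

lemma base_digits_unique:
  fixes f g :: "nat \<Rightarrow> nat"
  assumes "\<And>i. i < K \<Longrightarrow> f i < D" "\<And>i. i < K \<Longrightarrow> g i < D"
    and "(\<Sum>i<K. f i * D ^ i) = (\<Sum>i<K. g i * D ^ i)" and "i < K"
  shows "f i = g i"
  using assms
proof (induction K arbitrary: f g i)
  case (Suc K)
  have split: "(\<Sum>i<Suc K. f i * D ^ i) = f 0 + D * (\<Sum>i<K. f (Suc i) * D ^ i)" for f :: "nat \<Rightarrow> nat"
    unfolding sum.lessThan_Suc_shift sum_distrib_left by (simp add: mult_ac)
  have D: "f 0 < D" "g 0 < D" using Suc.prems by auto
  note eq = Suc.prems(3)[unfolded split]
  have "f 0 = g 0"
    using arg_cong[OF eq, of "\<lambda>x. x mod D"] D by simp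
  moreover have "(\<Sum>i<K. f (Suc i) * D ^ i) = (\<Sum>i<K. g (Suc i) * D ^ i)"
    using eq D \<open>f 0 = g 0\<close> by simp
  then have "f (Suc j) = g (Suc j)" if "j < K" for j
    using Suc.IH[of "\<lambda>i. f (Suc i)" "\<lambda>i. g (Suc i)" j] Suc.prems(1,2) that by auto
  ultimately show ?case using Suc.prems(4) by (cases i) auto
qed simp

text \<open>Kronecker substitution: the variables are replaced by sufficiently sparse powers of a single
  one, which keeps distinct monomials distinct.\<close>

lemma pval_zero_imp_zero:
  assumes "\<And>x. pval (crd x) p = 0"
  shows "p = 0"
proof (rule ccontr)
  let ?l = Poly_Mapping.lookup and ?k = Poly_Mapping.keys
  assume "p \<noteq> 0"
  then obtain m0 where m0: "m0 \<in> ?k p"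
    using poly_mapping_eqI[of p 0] by (auto simp: in_keys_iff)
  define M where "M = \<Union> (?k ` ?k p)"
  have "finite M" by (simp add: M_def)
  then obtain K where K: "M \<subseteq> {..<K}" using finite_nat_iff_bounded by blast
  have "finite (\<Union>m\<in>?k p. ?l m ` {..<K})" by simp
  then obtain D where D: "(\<Union>m\<in>?k p. ?l m ` {..<K}) \<subseteq> {..<D}" using finite_nat_iff_bounded by blast
  define \<phi> where "\<phi> m = (\<Sum>i<K. ?l m i * D ^ i)" for m
  have keys_K: "?k m \<subseteq> {..<K}" if "m \<in> ?k p" for m using K that by (auto simp: M_def)
  have inj: "m = m'" if "m \<in> ?k p" "m' \<in> ?k p" "\<phi> m = \<phi> m'" for m m'
  proof (rule poly_mapping_eqI)
    fix i
    show "?l m i = ?l m' i"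
    proof (cases "i < K")
      case True
      then show ?thesis using base_digits_unique[of K "?l m" D "?l m'" i] D that by (auto simp: \<phi>_def)
    next
      case False
      then have "i \<notin> ?k m" "i \<notin> ?k m'" using keys_K that by auto
      then show ?thesis by (simp add: in_keys_iff)
    qed
  qed
  define P where "P = (\<Sum>m\<in>?k p. monom (?l p m) (\<phi> m))"
  have "poly P t = 0" for t
  proof -
    let ?\<alpha> = "crd (trunc K (\<lambda>i. t ^ (D ^ i)))"
    have "mono_val ?\<alpha> m = t ^ \<phi> m" if "m \<in> ?k p" for m
      using keys_K[OF that]
      by (subst mono_val_superset[of "{..<K}"])
        (auto simp: crd_trunc \<phi>_def power_sum power_mult[symmetric] mult.commute intro!: prod.cong)
    then have "pval ?\<alpha> p = poly P t"
      unfolding pval_sum_monomials P_def by (simp add: poly_sum poly_monom)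
    then show ?thesis using assms by simp
  qed
  then have "P = 0" using poly_all_0_iff_0 by blast
  then have "0 = coeff P (\<phi> m0)" by simp
  also have "\<dots> = (\<Sum>m\<in>?k p. if m = m0 then ?l p m else 0)"
    unfolding P_def coeff_sum using inj[OF _ m0] by (intro sum.cong) auto
  also have "\<dots> = ?l p m0" using m0 by simp
  finally show False using m0 by (simp add: in_keys_iff)
qed

section \<open>The symmetric trilinear form of a cubic polynomial\<close>

definition mdeg :: "(nat \<Rightarrow>\<^sub>0 nat) \<Rightarrow> nat" where
  "mdeg m = (\<Sum>i\<in>Poly_Mapping.keys m. Poly_Mapping.lookup m i)"

lemma mdeg_superset:
  "finite A \<Longrightarrow> Poly_Mapping.keys m \<subseteq> A \<Longrightarrow> mdeg m = (\<Sum>i\<in>A. Poly_Mapping.lookup m i)"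
  unfolding mdeg_def by (rule sum.mono_neutral_left) (auto simp: in_keys_iff)

lemma mdeg_add: "mdeg (m + m') = mdeg m + mdeg m'"
proof -
  let ?A = "Poly_Mapping.keys m \<union> Poly_Mapping.keys m'"
  have "Poly_Mapping.keys (m + m') \<subseteq> ?A" by (rule Poly_Mapping.keys_add)
  then show ?thesis by (simp add: mdeg_superset[of ?A] lookup_add sum.distrib)
qed

lemma mdeg_0 [simp]: "mdeg 0 = 0" and mdeg_single [simp]: "mdeg (Poly_Mapping.single i k) = k"
  by (auto simp: mdeg_def)

lemma mdeg_eq_0: "mdeg m = 0 \<Longrightarrow> m = 0"
  by (rule poly_mapping_eqI) (auto simp: mdeg_def in_keys_iff)

lemma mdeg_Suc:
  assumes "mdeg m = Suc d"
  obtains a m' where "m = Poly_Mapping.single a 1 + m'" "mdeg m' = d"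
proof -
  have "Poly_Mapping.keys m \<noteq> {}" using assms by (auto simp: mdeg_def)
  then obtain a where a: "a \<in> Poly_Mapping.keys m" by blast
  define m' where "m' = m - Poly_Mapping.single a 1"
  have "m = Poly_Mapping.single a 1 + m'"
    using a by (intro poly_mapping_eqI) (auto simp: m'_def lookup_add lookup_minus lookup_single when_def in_keys_iff)
  moreover from this assms have "mdeg m' = d" by (metis mdeg_add mdeg_single Suc_inject plus_1_eq_Suc)
  ultimately show ?thesis by (rule that)
qed

text \<open>The same three indices serve for real and complex arguments, so that the form built from
  real values also computes complex ones.\<close>

lemma mono_val_mdeg_3:
  assumes "mdeg m = 3"
  obtains a b c where "\<And>\<alpha> :: nat \<Rightarrow> real. mono_val \<alpha> m = \<alpha> a * \<alpha> b * \<alpha> c"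
    "\<And>\<alpha> :: nat \<Rightarrow> complex. mono_val \<alpha> m = \<alpha> a * \<alpha> b * \<alpha> c"
proof -
  obtain a m1 where 1: "m = Poly_Mapping.single a 1 + m1" "mdeg m1 = 2"
    using mdeg_Suc[of m 2] assms by (auto simp: numeral_3_eq_3)
  obtain b m2 where 2: "m1 = Poly_Mapping.single b 1 + m2" "mdeg m2 = 1"
    using mdeg_Suc[of m1 1] 1 by (auto simp: numeral_2_eq_2)
  obtain c m3 where 3: "m2 = Poly_Mapping.single c 1 + m3" "mdeg m3 = 0"
    using mdeg_Suc[of m2 0] 2 by auto
  show ?thesis
    by (rule that[of a b c]; simp only: 1(1) 2(1) 3(1) mdeg_eq_0[OF 3(2)] mono_val_add mono_val_single mono_val_0)
      simp_all
qed

definition vplus_i :: "fsvec \<Rightarrow> fsvec \<Rightarrow> nat \<Rightarrow> complex" where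
  "vplus_i x y i = Complex (crd x i) (crd y i)"

text \<open>Each monomial is a product of three variables and is symmetrized over its six orderings.
  The last property is the real part of the binomial expansion of \<open>f\<close> at
  \<open>x + i y\<close>.\<close>

lemma cubic_trilinear:
  assumes "homogeneous_poly 3 f"
  obtains S where "trilinear_form S" "\<And>x. S x x x = pval (crd x) f"
    "\<And>x y. Re (subst_poly complex_of_real (vplus_i x y) f) = S x x x - 3 * S x y y"
proof -
  let ?l = Poly_Mapping.lookup and ?k = Poly_Mapping.keys
  have "\<exists>a b c. (\<forall>\<alpha> :: nat \<Rightarrow> real. mono_val \<alpha> m = \<alpha> a * \<alpha> b * \<alpha> c) \<and>
      (\<forall>\<alpha> :: nat \<Rightarrow> complex. mono_val \<alpha> m = \<alpha> a * \<alpha> b * \<alpha> c)" if "m \<in> ?k f" for m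
  proof -
    have "mdeg m = 3" using that assms by (auto simp: homogeneous_poly_def mdeg_def)
    then show ?thesis by (rule mono_val_mdeg_3) blast
  qed
  then obtain a b c where abc: "\<And>m (\<alpha> :: nat \<Rightarrow> real). m \<in> ?k f \<Longrightarrow> mono_val \<alpha> m = \<alpha> (a m) * \<alpha> (b m) * \<alpha> (c m)"
    "\<And>m (\<alpha> :: nat \<Rightarrow> complex). m \<in> ?k f \<Longrightarrow> mono_val \<alpha> m = \<alpha> (a m) * \<alpha> (b m) * \<alpha> (c m)"
    by metis
  define T where "T m x y z =
      crd x (a m) * crd y (b m) * crd z (c m) + crd x (a m) * crd z (b m) * crd y (c m)
    + crd y (a m) * crd x (b m) * crd z (c m) + crd y (a m) * crd z (b m) * crd x (c m)
    + crd z (a m) * crd x (b m) * crd y (c m) + crd z (a m) * crd y (b m) * crd x (c m)" for m x y z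
  define S where "S x y z = (\<Sum>m\<in>?k f. ?l f m / 6 * T m x y z)" for x y z
  have "trilinear_form S"
  proof
    show "S (x + y) z w = S x z w + S y z w" for x y z w
      unfolding S_def sum.distrib[symmetric] by (intro sum.cong refl) (simp add: T_def field_simps)
    show "S (r *\<^sub>R x) z w = r * S x z w" for r x z w
      unfolding S_def sum_distrib_left by (intro sum.cong refl) (simp add: T_def algebra_simps)
    show "S x y z = S y x z" "S x y z = S x z y" for x y z
      unfolding S_def by (intro sum.cong refl; simp add: T_def)+
  qed
  moreover have "S x x x = pval (crd x) f" for x
    unfolding S_def pval_sum_monomials
    by (intro sum.cong refl) (simp add: T_def abc)
  moreover have "Re (subst_poly complex_of_real (vplus_i x y) f) = S x x x - 3 * S x y y" for x y
  proof -
    have "subst_poly complex_of_real (vplus_i x y) f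
        = (\<Sum>m\<in>?k f. complex_of_real (?l f m) * mono_val (vplus_i x y) m)"
      by (rule of_real_hom.subst_superset) auto
    also have "Re \<dots> = (\<Sum>m\<in>?k f. ?l f m / 6 * T m x x x - 3 * (?l f m / 6 * T m x y y))"
      unfolding Re_sum by (intro sum.cong refl) (simp add: abc T_def vplus_i_def field_simps)
    finally show ?thesis unfolding S_def by (simp add: sum_subtractf sum_distrib_left)
  qed
  ultimately show ?thesis by (rule that)
qed

lemma pd_trilinear:
  assumes S: "trilinear_form S" and f: "\<And>x. S x x x = pval (crd x) f"
  shows pd1_trilinear: "pval (crd x) (pd i f) = 3 * S (unitv i) x x"
    and pd2_trilinear: "pval (crd x) (pd j (pd i f)) = 6 * S (unitv i) (unitv j) x"
proof -
  interpret trilinear_form S by fact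
  have upd: "(crd x)(i := t) = crd (x + (t - crd x i) *\<^sub>R unitv i)" for x i t
    by (auto simp: fun_eq_iff crd_unitv)
  show 1: "pval (crd x) (pd i f) = 3 * S (unitv i) x x" for x i
  proof (rule DERIV_unique[OF pval_pd])
    have "((\<lambda>t. S x x x + 3 * (S x x (unitv i) * (t - crd x i)) + 3 * (S x (unitv i) (unitv i) * (t - crd x i)^2)
      + S (unitv i) (unitv i) (unitv i) * (t - crd x i)^3) has_real_derivative 3 * S (unitv i) x x) (at (crd x i))"
      by (auto intro!: derivative_eq_intros simp: S_swap13[of x x "unitv i"])
    moreover have "pval ((crd x)(i := t)) f = S x x x + 3 * (S x x (unitv i) * (t - crd x i))
      + 3 * (S x (unitv i) (unitv i) * (t - crd x i)^2) + S (unitv i) (unitv i) (unitv i) * (t - crd x i)^3" for t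
      unfolding upd f[symmetric] S_cube_add by (simp add: power_expand algebra_simps)
    ultimately show "((\<lambda>t. pval ((crd x)(i := t)) f) has_real_derivative 3 * S (unitv i) x x) (at (crd x i))"
      by simp
  qed
  show "pval (crd x) (pd j (pd i f)) = 6 * S (unitv i) (unitv j) x"
  proof (rule DERIV_unique[OF pval_pd])
    have "((\<lambda>t. 3 * (S (unitv i) x x + 2 * (S (unitv i) (unitv j) x * (t - crd x j))
      + S (unitv i) (unitv j) (unitv j) * (t - crd x j)^2)) has_real_derivative 6 * S (unitv i) (unitv j) x) (at (crd x j))"
      by (auto intro!: derivative_eq_intros)
    moreover have "pval ((crd x)(j := t)) (pd i f) = 3 * (S (unitv i) x x + 2 * (S (unitv i) (unitv j) x * (t - crd x j))
      + S (unitv i) (unitv j) (unitv j) * (t - crd x j)^2)" for t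
      unfolding upd 1 by (simp add: S_swap23[of "unitv i" x "unitv j"] power_expand algebra_simps)
    ultimately show "((\<lambda>t. pval ((crd x)(j := t)) (pd i f)) has_real_derivative 6 * S (unitv i) (unitv j) x) (at (crd x j))"
      by simp
  qed
qed

text \<open>Each term has two first derivatives, contributing 3 each, and one second derivative
  contributing 6; hence 54.\<close>

lemma L_op_trilinear:
  fixes n :: nat
  assumes S: "trilinear_form S" and f: "\<And>x. S x x x = pval (crd x) f"
  defines "Q \<equiv> cubic_space.mul S n unitv"
  shows "pval (crd x) (L_op n f) = 54 * ((Q x x \<bullet> Q x x) * cubic_space.tr S n unitv x - Q x x \<bullet> Q x (Q x x))"
proof -
  interpret cubic_space S "euclid n" n unitv
    using S by (simp add: cubic_space_def cubic_space_axioms_def onframe_euclid)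
  note [simp] = pd_trilinear[OF S f]
  have Q: "Q = mul" by (simp add: Q_def)
  let ?u = unitv
  have sw1: "S x x (?u i) = S (?u i) x x" for i by (rule S_swap13)
  have sw2: "S x (?u i) (?u j) = S (?u i) (?u j) x" for i j by (simp add: S_swap12[of x] S_swap23[of "?u i" x])
  have Qx: "mul x x = (\<Sum>i<n. S (?u i) x x *\<^sub>R ?u i)" by (simp add: mul_def sw1)
  have 1: "mul x x \<bullet> mul x x = (\<Sum>i<n. S (?u i) x x * S (?u i) x x)"
    unfolding Qx by (rule orthonormal_inner[OF onframe_orthonormal[OF frame]])
  have 2: "mul x x \<bullet> mul x (mul x x) = (\<Sum>i<n. \<Sum>j<n. S (?u i) x x * (S (?u j) x x * S (?u i) (?u j) x))"
  proof -
    have "mul x x \<bullet> mul x (mul x x) = S x (mul x x) (mul x x)" by (simp add: inner_mul')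
    also have "\<dots> = (\<Sum>i<n. \<Sum>j<n. S (?u i) x x * (S (?u j) x x * S (?u i) (?u j) x))"
      unfolding Qx S_sum S_scale2 S_scale3 sw2 sum_distrib_left
      by (intro sum.cong refl arg_cong2[of _ _ _ _ "(*)"]) (rule S_swap12)
    finally show ?thesis .
  qed
  have 3: "tr x = (\<Sum>i<n. S (?u i) (?u i) x)"
    unfolding tr_def sw2 ..
  have "pval (crd x) (L_op n f) = (\<Sum>i<n. (3 * S (?u i) x x)^2) * (\<Sum>i<n. 6 * S (?u i) (?u i) x)
      - (\<Sum>i<n. \<Sum>j<n. 3 * S (?u i) x x * (3 * S (?u j) x x) * (6 * S (?u i) (?u j) x))"
    unfolding L_op_def by simp
  also have "\<dots> = 54 * ((\<Sum>i<n. S (?u i) x x * S (?u i) x x) * (\<Sum>i<n. S (?u i) (?u i) x))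
      - 54 * (\<Sum>i<n. \<Sum>j<n. S (?u i) x x * (S (?u j) x x * S (?u i) (?u j) x))"
    by (simp add: power2_eq_square sum_distrib_left mult_ac)
  finally show ?thesis unfolding Q 1 2 3 by (simp add: right_diff_distrib)
qed

section \<open>Column vectors as finitely supported sequences\<close>

definition of_vec :: "real vec \<Rightarrow> fsvec" where
  "of_vec x = trunc (dim_vec x) (vec_index x)"

definition to_vec :: "nat \<Rightarrow> fsvec \<Rightarrow> real vec" where
  "to_vec n x = vec n (crd x)"

lemma crd_of_vec: "x \<in> carrier_vec n \<Longrightarrow> crd (of_vec x) i = (if i < n then x $ i else 0)"
  by (auto simp: of_vec_def crd_trunc)

lemma of_vec_euclid: "x \<in> carrier_vec n \<Longrightarrow> of_vec x \<in> euclid n"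
  by (auto simp: of_vec_def trunc_euclid)

lemma to_vec_carrier [simp]: "to_vec n x \<in> carrier_vec n"
  by (simp add: to_vec_def)

lemma to_vec_index [simp]: "i < n \<Longrightarrow> to_vec n x $ i = crd x i"
  by (simp add: to_vec_def)

lemma to_vec_of_vec [simp]: "x \<in> carrier_vec n \<Longrightarrow> to_vec n (of_vec x) = x"
  by (rule eq_vecI) (auto simp: crd_of_vec to_vec_def)

lemma of_vec_to_vec [simp]: "y \<in> euclid n \<Longrightarrow> of_vec (to_vec n y) = y"
  by (rule fsvec_eqI) (auto simp: crd_of_vec[of _ n] euclid_def)

lemma of_vec_add: "x \<in> carrier_vec n \<Longrightarrow> y \<in> carrier_vec n \<Longrightarrow> of_vec (x + y) = of_vec x + of_vec y"
  by (rule fsvec_eqI) (auto simp: crd_of_vec[of _ n])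

lemma of_vec_smult: "x \<in> carrier_vec n \<Longrightarrow> of_vec (c \<cdot>\<^sub>v x) = c *\<^sub>R of_vec x"
  by (rule fsvec_eqI) (auto simp: crd_of_vec[of _ n])

lemma of_vec_zero: "of_vec (0\<^sub>v n) = 0"
  by (rule fsvec_eqI) (auto simp: crd_of_vec[of _ n])

lemma scalar_prod_of_vec: "x \<in> carrier_vec n \<Longrightarrow> y \<in> carrier_vec n \<Longrightarrow> scalar_prod x y = of_vec x \<bullet> of_vec y"
  by (subst inner_euclid[OF of_vec_euclid]) (auto simp: crd_of_vec[of _ n] scalar_prod_def lessThan_atLeast0)

lemma poly_val_of_vec:
  assumes "in_vars n p" "x \<in> carrier_vec n"
  shows "poly_val p x = pval (crd (of_vec x)) p"
  unfolding poly_val_def using assms(2) by (intro real_id.subst_in_vars_cong[OF assms(1)]) (simp add: crd_of_vec)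

lemma jnf_subspace:
  assumes "VectorSpace.subspace class_ring V (module_vec TYPE(real) n)"
  shows "V \<subseteq> carrier_vec n" "subspace (of_vec ` V)"
proof -
  interpret vec_space "TYPE(real)" n .
  have sub: "submodule class_ring V (module_vec TYPE(real) n)" using assms by (simp add: VectorSpace.subspace_def)
  show V: "V \<subseteq> carrier_vec n" using submodule.subset[OF sub] by simp
  have "0\<^sub>v n \<in> V" using submodule.zero_closed[OF sub] by (simp add: module_vec_simps)
  moreover have "v + w \<in> V" if "v \<in> V" "w \<in> V" for v w
    using submodule.m_closed[OF sub that] by (simp add: module_vec_simps)
  moreover have "c \<cdot>\<^sub>v v \<in> V" if "v \<in> V" for c v
    using submodule.smult_closed[OF sub, of c v] that by (simp add: module_vec_simps class_ring_simps)
  ultimately show "subspace (of_vec ` V)"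
    using V image_eqI[of 0 of_vec "0\<^sub>v n" V] unfolding subspace_def
    by (auto simp: of_vec_zero of_vec_add[symmetric, of _ n] of_vec_smult[symmetric, of _ n] subset_iff)
qed

lemma jnf_subspaceI:
  assumes "subspace W" "W \<subseteq> euclid n"
  shows "VectorSpace.subspace class_ring (to_vec n ` W) (module_vec TYPE(real) n)"
proof -
  interpret vec_space "TYPE(real)" n .
  have "submodule class_ring (to_vec n ` W) (module_vec TYPE(real) n)"
  proof
    show "to_vec n ` W \<subseteq> carrier (module_vec TYPE(real) n)" by (auto simp: module_vec_simps)
    have zero: "to_vec n 0 = 0\<^sub>v n" by (rule eq_vecI) (auto simp: to_vec_def)
    show "\<zero>\<^bsub>module_vec TYPE(real) n\<^esub> \<in> to_vec n ` W"
      using subspace_0[OF assms(1)] by (auto simp: module_vec_simps zero[symmetric])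
    have add: "to_vec n x + to_vec n y = to_vec n (x + y)" for x y by (rule eq_vecI) (auto simp: to_vec_def)
    show "v \<oplus>\<^bsub>module_vec TYPE(real) n\<^esub> w \<in> to_vec n ` W" if "v \<in> to_vec n ` W" "w \<in> to_vec n ` W" for v w
      using that subspace_add[OF assms(1)] by (auto simp: module_vec_simps add)
    have scale: "c \<cdot>\<^sub>v to_vec n x = to_vec n (c *\<^sub>R x)" for c x by (rule eq_vecI) (auto simp: to_vec_def)
    show "c \<odot>\<^bsub>module_vec TYPE(real) n\<^esub> v \<in> to_vec n ` W" if "v \<in> to_vec n ` W" for c v
      using that subspace_scale[OF assms(1)] by (auto simp: module_vec_simps scale)
  qed
  then show ?thesis by (simp add: VectorSpace.subspace_def vec_vs)
qed

text \<open>Read as column vectors, the frame is a basis; this connects the dimension used in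
  \<open>has_type\<close> with frames.\<close>

lemma vdim_eq:
  assumes V: "VectorSpace.subspace class_ring V (module_vec TYPE(real) n)" and u: "onframe (of_vec ` V) d u"
  shows "vdim n V = d"
proof -
  interpret vec_space "TYPE(real)" n .
  have VC: "V \<subseteq> carrier_vec n" by (rule jnf_subspace[OF V])
  have sub: "submodule class_ring V (module_vec TYPE(real) n)" using V by (simp add: VectorSpace.subspace_def)
  let ?M = "module_vec TYPE(real) n"
  define v where "v i = to_vec n (u i)" for i
  define A where "A = v ` {..<d}"
  have vV: "v i \<in> V" "of_vec (v i) = u i" if "i < d" for i
    using onframe_in[OF u that] VC by (auto simp: v_def)
  have inj: "inj_on v {..<d}"
  proof (rule inj_onI)
    fix i j assume ij: "i \<in> {..<d}" "j \<in> {..<d}" "v i = v j"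
    then have "u i = u j" using vV(2)[of i] vV(2)[of j] by auto
    then have "u i \<bullet> u j = 1" using orthonormalD[OF onframe_orthonormal[OF u], of i i] ij by simp
    then show "i = j" using orthonormalD[OF onframe_orthonormal[OF u], of i j] ij by (auto split: if_splits)
  qed
  have A: "finite A" "A \<subseteq> V" "A \<subseteq> carrier_vec n" "card A = d"
    using vV VC by (auto simp: A_def card_image[OF inj])
  have lc: "of_vec (lincomb a A) = (\<Sum>i<d. a (v i) *\<^sub>R u i)" for a
  proof (rule fsvec_eqI)
    fix j
    have *: "lincomb a A \<in> carrier_vec n" using A by (intro lincomb_closed) auto
    have u0: "crd (u i) j = 0" if "\<not> j < n" "i < d" for i
      using that vV(2)[OF that(2)] vV(1)[OF that(2)] VC crd_of_vec[of "v i" n j] by auto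
    show "crd (of_vec (lincomb a A)) j = crd (\<Sum>i<d. a (v i) *\<^sub>R u i) j"
    proof (cases "j < n")
      case True
      have "crd (of_vec (lincomb a A)) j = (\<Sum>x\<in>A. a x * x $ j)"
        using True by (simp add: crd_of_vec[OF *] lincomb_index[OF _ A(3)])
      also have "\<dots> = (\<Sum>i<d. a (v i) * v i $ j)" unfolding A_def by (simp add: sum.reindex[OF inj])
      finally show ?thesis using True by (simp add: v_def)
    next
      case False
      then show ?thesis by (simp add: crd_of_vec[OF *] u0)
    qed
  qed
  have "lin_indpt A"
  proof (rule finite_lin_indpt2[OF A(1)])
    show "A \<subseteq> carrier_vec n" by (rule A(3))
    fix a assume "lincomb a A = 0\<^sub>v n"
    then have "(\<Sum>i<d. a (v i) *\<^sub>R u i) = 0" unfolding lc[symmetric] by (simp add: of_vec_zero)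
    then have "a (v i) = 0" if "i < d" for i
      using orthonormal_coeff[OF onframe_orthonormal[OF u] that, of "\<lambda>i. a (v i)"] by simp
    then show "\<forall>x\<in>A. a x = 0" by (auto simp: A_def)
  qed
  moreover have "span A = V"
  proof (intro subset_antisym subsetI)
    fix x assume "x \<in> span A"
    then show "x \<in> V" using span_is_subset[OF A(2) sub] by auto
  next
    fix x assume x: "x \<in> V"
    have "of_vec x = of_vec (lincomb (\<lambda>y. of_vec x \<bullet> of_vec y) A)"
      unfolding lc using onframe_expand[OF u, of "of_vec x"] x vV(2) by simp
    then have "x = lincomb (\<lambda>y. of_vec x \<bullet> of_vec y) A"
      using x VC A by (metis lincomb_closed lincomb_dim subset_iff to_vec_of_vec carrier_vec_dim_vec)
    then show "x \<in> span A" unfolding span_def using A by (auto simp: class_ring_simps intro!: exI[of _ A])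
  qed
  ultimately have "vectorspace.basis class_ring (vs V) A"
    using vectorspace.basis_def[OF subspace_is_vs[OF V]] span_li_not_depend[OF A(2) sub] A(2) by simp
  then show ?thesis
    unfolding vdim_def using vectorspace.dim_basis[OF subspace_is_vs[OF V] A(1)] A(4) by simp
qed

section \<open>Congruence\<close>

lemma congruent_cubicsI:
  assumes f: "cubic_form n f" and g: "cubic_form n g" and b: "onframe (euclid n) n b" and c: "c \<noteq> 0"
    and eq: "\<And>x. pval (crd (\<Sum>i<n. x i *\<^sub>R b i)) f = c * pval x g"
  shows "congruent_cubics n f g"
proof -
  \<comment> \<open>Row \<open>i\<close> is \<open>b i\<close>, so \<open>U\<close> sends a vector
    to its coordinates in the frame; its columns are orthonormal by the Parseval identity.\<close>
  define U where "U = mat n n (\<lambda>(i, j). crd (b i) j)"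
  have U: "U \<in> carrier_mat n n" by (simp add: U_def)
  have "transpose_mat U * U = 1\<^sub>m n"
  proof (rule eq_matI)
    fix j k assume jk: "j < dim_row (1\<^sub>m n)" "k < dim_col (1\<^sub>m n)"
    have "(transpose_mat U * U) $$ (j, k) = (\<Sum>i<n. crd (b i) j * crd (b i) k)"
      using jk by (simp add: U_def scalar_prod_def lessThan_atLeast0)
    also have "\<dots> = unitv j \<bullet> unitv k"
      using jk by (subst onframe_inner[OF b]) (auto simp: unitv_euclid inner_commute[of "unitv _"])
    finally show "(transpose_mat U * U) $$ (j, k) = 1\<^sub>m n $$ (j, k)" using jk by (simp add: crd_unitv)
  qed (simp_all add: U_def)
  moreover have "poly_val f x = c * poly_val g (U *\<^sub>v x)" if x: "x \<in> carrier_vec n" for x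
  proof -
    have Ux: "U *\<^sub>v x \<in> carrier_vec n" using U x by simp
    have coords: "(U *\<^sub>v x) $ i = of_vec x \<bullet> b i" if "i < n" for i
      using that x by (subst inner_euclid[OF of_vec_euclid[OF x]])
        (simp add: U_def scalar_prod_def lessThan_atLeast0 crd_of_vec[OF x] mult.commute)
    have "poly_val f x = pval (crd (\<Sum>i<n. (of_vec x \<bullet> b i) *\<^sub>R b i)) f"
      using f poly_val_of_vec[OF _ x, of f] onframe_expand[OF b of_vec_euclid[OF x]]
      by (simp add: cubic_form_def)
    also have "\<dots> = c * pval (\<lambda>i. of_vec x \<bullet> b i) g" by (rule eq)
    also have "pval (\<lambda>i. of_vec x \<bullet> b i) g = poly_val g (U *\<^sub>v x)"
      unfolding poly_val_def using g
      by (intro real_id.subst_in_vars_cong[of n]) (auto simp: cubic_form_def coords)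
    finally show ?thesis .
  qed
  ultimately show ?thesis unfolding congruent_cubics_def using f g U c by blast
qed

lemma congruent_cubics_sym:
  assumes "congruent_cubics n f g" shows "congruent_cubics n g f"
proof -
  from assms obtain U c where U: "U \<in> carrier_mat n n" "transpose_mat U * U = 1\<^sub>m n" and c: "c \<noteq> 0"
    and eq: "\<And>x. x \<in> carrier_vec n \<Longrightarrow> poly_val f x = c * poly_val g (U *\<^sub>v x)"
    and fg: "cubic_form n f" "cubic_form n g"
    by (auto simp: congruent_cubics_def)
  have UT: "transpose_mat U \<in> carrier_mat n n" using U by simp
  have inv: "U * transpose_mat U = 1\<^sub>m n" by (rule mat_mult_left_right_inverse[OF UT U(1) U(2)])
  have "poly_val g x = inverse c * poly_val f (transpose_mat U *\<^sub>v x)" if x: "x \<in> carrier_vec n" for x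
  proof -
    have "U *\<^sub>v (transpose_mat U *\<^sub>v x) = x"
      using U x by (simp add: assoc_mult_mat_vec[OF U(1) UT x, symmetric] inv)
    then show ?thesis using eq[of "transpose_mat U *\<^sub>v x"] UT x c by simp
  qed
  moreover have "transpose_mat (transpose_mat U) * transpose_mat U = 1\<^sub>m n" using inv by simp
  ultimately show ?thesis
    unfolding congruent_cubics_def using fg UT c by (metis nonzero_imp_inverse_nonzero)
qed

lemma congruent_cubics_trans:
  assumes "congruent_cubics n f g" "congruent_cubics n g h" shows "congruent_cubics n f h"
proof -
  from assms(1) obtain U c where U: "U \<in> carrier_mat n n" "transpose_mat U * U = 1\<^sub>m n" and c: "c \<noteq> 0"
    and eq: "\<And>x. x \<in> carrier_vec n \<Longrightarrow> poly_val f x = c * poly_val g (U *\<^sub>v x)"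
    and f: "cubic_form n f"
    by (auto simp: congruent_cubics_def)
  from assms(2) obtain U' c' where U': "U' \<in> carrier_mat n n" "transpose_mat U' * U' = 1\<^sub>m n" and c': "c' \<noteq> 0"
    and eq': "\<And>x. x \<in> carrier_vec n \<Longrightarrow> poly_val g x = c' * poly_val h (U' *\<^sub>v x)"
    and h: "cubic_form n h"
    by (auto simp: congruent_cubics_def)
  let ?W = "U' * U"
  have W: "?W \<in> carrier_mat n n" using U U' by simp
  have TU: "transpose_mat U \<in> carrier_mat n n" "transpose_mat U' \<in> carrier_mat n n" using U U' by auto
  have "transpose_mat ?W * ?W = transpose_mat U * (transpose_mat U' * (U' * U))"
    using U U' TU by (simp add: transpose_mult[OF U'(1) U(1)] assoc_mult_mat[OF TU W])
  also have "transpose_mat U' * (U' * U) = U"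
    using U U' TU by (simp add: assoc_mult_mat[OF TU(2) U'(1) U(1), symmetric])
  finally have "transpose_mat ?W * ?W = 1\<^sub>m n" using U by simp
  moreover have "poly_val f x = (c * c') * poly_val h (?W *\<^sub>v x)" if "x \<in> carrier_vec n" for x
    using that U U' by (simp add: eq eq' assoc_mult_mat_vec[OF U'(1) U(1)])
  ultimately show ?thesis unfolding congruent_cubics_def using f h W c c' by (metis mult_eq_0_iff)
qed

section \<open>Forms and their values\<close>

text \<open>Variable range and degree in one predicate, for any coefficient type and degree: the
  factors of a cubic are not cubic, and the doubling passes through complex coefficients.\<close>

definition form :: "nat \<Rightarrow> nat \<Rightarrow> 'a::zero mpoly \<Rightarrow> bool" where
  "form n d p \<longleftrightarrow> (\<forall>m\<in>Poly_Mapping.keys p. Poly_Mapping.keys m \<subseteq> {..<n} \<and> mdeg m = d)"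

lemma cubic_form_iff: "cubic_form n p \<longleftrightarrow> form n 3 p"
  by (auto simp: cubic_form_def form_def in_vars_def homogeneous_poly_def mdeg_def)

lemma form_in_vars: "form n d p \<Longrightarrow> in_vars n p"
  by (auto simp: form_def in_vars_def)

lemma form_keys_subset: "form n d p \<Longrightarrow> Poly_Mapping.keys q \<subseteq> Poly_Mapping.keys p \<Longrightarrow> form n d q"
  by (auto simp: form_def)

lemma form_0 [simp]: "form n d 0"
  by (simp add: form_def)

lemma form_add: "form n d p \<Longrightarrow> form n d q \<Longrightarrow> form n d (p + q)"
  using Poly_Mapping.keys_add[of p q] by (auto simp: form_def)

lemma form_uminus: "form n d p \<Longrightarrow> form n d (- p :: 'a::ab_group_add mpoly)"
  by (erule form_keys_subset) (auto simp: in_keys_iff)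

lemma form_diff: "form n d p \<Longrightarrow> form n d q \<Longrightarrow> form n d (p - q :: 'a::ab_group_add mpoly)"
  using form_add[of n d p "- q"] form_uminus[of n d q] by simp

lemma form_sum: "(\<And>a. a \<in> A \<Longrightarrow> form n d (f a)) \<Longrightarrow> form n d (sum f A)"
  by (induction A rule: infinite_finite_induct) (auto intro: form_add)

lemma form_mult:
  assumes "form n d p" "form n d' q" shows "form n (d + d') (p * q :: 'a::semiring_0 mpoly)"
  unfolding form_def
proof
  fix m assume "m \<in> Poly_Mapping.keys (p * q)"
  then obtain a b where ab: "a \<in> Poly_Mapping.keys p" "b \<in> Poly_Mapping.keys q" "m = a + b"
    using keys_mult[of p q] by auto
  have "Poly_Mapping.keys m \<subseteq> Poly_Mapping.keys a \<union> Poly_Mapping.keys b"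
    unfolding ab(3) by (rule Poly_Mapping.keys_add)
  then show "Poly_Mapping.keys m \<subseteq> {..<n} \<and> mdeg m = d + d'"
    using assms ab by (auto simp: form_def mdeg_add)
qed

lemma form_Cst: "form n 0 (Cst c)"
  by (simp add: form_def Cst_def)

lemma form_Cst_mult: "form n d p \<Longrightarrow> form n d (Cst c * p :: 'a::semiring_0 mpoly)"
  using form_mult[OF form_Cst, of n d p c] by simp

lemma form_Var: "i < n \<Longrightarrow> form n 1 (Var i :: 'a::zero_neq_one mpoly)"
  by (auto simp: form_def Var_def)

lemma form_1: "form n 0 (1 :: 'a::comm_ring_1 mpoly)"
  by (simp add: form_def)

lemma form_power: "form n d p \<Longrightarrow> form n (k * d) (p ^ k :: 'a::comm_ring_1 mpoly)"
  by (induction k) (auto intro: form_mult form_1)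

lemma form_prod:
  "(\<And>a. a \<in> A \<Longrightarrow> form n (d a) (f a)) \<Longrightarrow> form n (\<Sum>a\<in>A. d a) (\<Prod>a\<in>A. f a :: 'a::comm_ring_1 mpoly)"
  by (induction A rule: infinite_finite_induct) (auto intro: form_mult form_1)

lemma form_mult_eq: "form n d p \<Longrightarrow> form n d' q \<Longrightarrow> k = d + d' \<Longrightarrow> form n k (p * q :: 'a::semiring_0 mpoly)"
  using form_mult by blast

lemma form_power_eq: "form n d p \<Longrightarrow> e = k * d \<Longrightarrow> form n e (p ^ k :: 'a::comm_ring_1 mpoly)"
  using form_power by blast

lemma form_cd_mult:
  assumes "\<And>j. j < 2 ^ k \<Longrightarrow> form n d (x j)" "\<And>j. j < 2 ^ k \<Longrightarrow> form n d' (y j)" "i < 2 ^ k"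
  shows "form n (d + d') (cd_mult (2 ^ k) x y i :: 'a::comm_ring_1 mpoly)"
  using assms
proof (induction k arbitrary: d d' x y i)
  case 0
  then show ?case by (simp add: cd_mult.simps form_mult)
next
  case (Suc k)
  let ?h = "2 ^ k :: nat"
  obtain j where j: "?h = Suc j" by (metis Suc_pred' zero_less_power zero_less_numeral)
  have conj: "form n r (cd_conj z i)" if "\<And>i. i < ?h \<Longrightarrow> form n r (z i)" "i < ?h" for r i and z :: "nat \<Rightarrow> 'a mpoly"
    using that by (auto simp: cd_conj_def intro: form_uminus)
  have x: "form n d (x i)" "form n d (x (?h + i))" and y: "form n d' (y i)" "form n d' (y (?h + i))" if "i < ?h" for i
    using that Suc.prems by auto
  have c: "form n (d + d') (cd_mult ?h x y i)" "form n (d + d') (cd_mult ?h (cd_conj (\<lambda>j. y (?h + j))) (\<lambda>j. x (?h + j)) i)"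
    "form n (d + d') (cd_mult ?h (\<lambda>j. y (?h + j)) x i)" "form n (d + d') (cd_mult ?h (\<lambda>j. x (?h + j)) (cd_conj y) i)"
    if "i < ?h" for i
    using Suc.IH[of d x d' y i] Suc.IH[of d' "cd_conj (\<lambda>j. y (?h + j))" d "\<lambda>j. x (?h + j)" i]
      Suc.IH[of d' "\<lambda>j. y (?h + j)" d x i] Suc.IH[of d "\<lambda>j. x (?h + j)" d' "cd_conj y" i] x y conj that
    by (simp_all add: add.commute)
  have "\<not> 2 ^ Suc k \<le> (1 :: nat)" using j by simp
  moreover have "i - ?h < ?h" if "\<not> i < ?h" using that Suc.prems(3) by simp
  ultimately show ?case
    using c by (subst cd_mult.simps) (auto simp: Let_def intro: form_diff form_add)
qed

lemma form_cd_mult_eq: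
  assumes "l = 2 ^ k" "\<And>j. j < l \<Longrightarrow> form n d (x j)" "\<And>j. j < l \<Longrightarrow> form n d' (y j)" "i < l" "e = d + d'"
  shows "form n e (cd_mult l x y i :: 'a::comm_ring_1 mpoly)"
  unfolding assms(1,5) by (rule form_cd_mult) (use assms in auto)

lemma form_theta:
  assumes "l = 2 ^ k" shows "form (3 * l + 2) 3 (theta l)"
proof -
  have V: "form (3 * l + 2) 1 (Var i :: real mpoly)" if "i < 3 * l + 2" for i using that by (rule form_Var)
  have sq: "form (3 * l + 2) 2 (\<Sum>i<l. (Var (a + i))^2 :: real mpoly)" if "a + l \<le> 3 * l + 2" for a
    using that by (intro form_sum form_power_eq[OF V]) auto
  have c: "form (3 * l + 2) 3 (cd_mult l (cd_mult l (\<lambda>i. Var (2 + i)) (\<lambda>i. Var (2 + l + i))) (\<lambda>i. Var (2 + 2*l + i)) 0 :: real mpoly)"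
    by (intro form_cd_mult_eq[OF assms, of _ 2 _ 1] form_cd_mult_eq[OF assms, of _ 1 _ 1] V) (auto simp: assms)
  show ?thesis
    unfolding theta_def Let_def
    by (intro form_add form_diff form_Cst_mult c form_mult_eq[of _ 1 _ 2] form_mult_eq[of _ 1 "Cst _ * Var _" 2] sq V
        form_power_eq[OF V]) auto
qed

lemma form_g_cubic:
  assumes "l = 2 ^ k" shows "form (3 * l + 3) 3 (g_cubic l)"
proof -
  have V: "form (3 * l + 3) 1 (Var i :: real mpoly)" if "i < 3 * l + 3" for i using that by (rule form_Var)
  have th: "form (3 * l + 3) 3 (theta l)" using form_theta[OF assms] by (force simp: form_def)
  have s: "form (3 * l + 3) 2 (\<Sum>i<3*l + 2. (Var i)^2 :: real mpoly)"
    by (intro form_sum form_power_eq[OF V]) auto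
  have c: "form (3 * l + 3) 1 (Cst (3/2) * Var (3*l + 2) :: real mpoly)" by (intro form_Cst_mult V) simp
  show ?thesis
    unfolding g_cubic_def
    by (intro form_add form_diff form_Cst_mult th form_mult_eq[OF c s] form_power_eq[OF V]) auto
qed

lemma form_subst_poly:
  assumes g: "form M d g" and \<gamma>: "\<And>i. i < M \<Longrightarrow> form n 1 (\<gamma> i)"
  shows "form n d (subst_poly (\<lambda>c. Cst (h c)) \<gamma> g :: 'a::comm_ring_1 mpoly)"
  unfolding subst_poly_def
proof (rule form_sum)
  fix m assume m: "m \<in> Poly_Mapping.keys g"
  have "form n (\<Sum>i\<in>Poly_Mapping.keys m. Poly_Mapping.lookup m i * 1) (\<Prod>i\<in>Poly_Mapping.keys m. \<gamma> i ^ Poly_Mapping.lookup m i)"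
    using g m by (intro form_prod form_power \<gamma>) (auto simp: form_def)
  moreover have "(\<Sum>i\<in>Poly_Mapping.keys m. Poly_Mapping.lookup m i * 1) = d"
    using g m by (auto simp: form_def mdeg_def)
  ultimately show "form n d (Cst (h (Poly_Mapping.lookup g m)) * (\<Prod>i\<in>Poly_Mapping.keys m. \<gamma> i ^ Poly_Mapping.lookup m i))"
    by (auto intro: form_Cst_mult)
qed

lemma keys_map_Re: "Poly_Mapping.keys (Poly_Mapping.map Re p) \<subseteq> Poly_Mapping.keys p"
  by (auto simp: in_keys_iff Poly_Mapping.map.rep_eq when_def split: if_splits)

lemma form_complex_doubling:
  assumes "form M d g" shows "form (2 * M) d (complex_doubling M g)"
proof -
  have V: "form (2 * M) 1 (Var i :: complex mpoly)" if "i < 2 * M" for i using that by (rule form_Var)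
  have "form (2 * M) d (Cst (1/2) *
       (subst_poly (\<lambda>c. Cst (complex_of_real c)) (\<lambda>i. Var i + Cst \<i> * Var (M + i)) g
      + subst_poly (\<lambda>c. Cst (complex_of_real c)) (\<lambda>i. Var i - Cst \<i> * Var (M + i)) g))"
    by (intro form_Cst_mult form_add form_subst_poly[OF assms] form_diff V) auto
  then show ?thesis unfolding complex_doubling_def by (rule form_keys_subset) (rule keys_map_Re)
qed

lemma form_clifford_cubic: "form (q + 1 + 2 * m) 3 (clifford_cubic m q A)"
proof -
  have V: "form (q + 1 + 2 * m) 1 (Var i :: real mpoly)" if "i < q + 1 + 2 * m" for i using that by (rule form_Var)
  have C: "form (q + 1 + 2 * m) 1 (Cst c * Var i :: real mpoly)" if "i < q + 1 + 2 * m" for i c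
    using that by (intro form_Cst_mult V)
  show ?thesis
    unfolding clifford_cubic_def
    by (intro form_sum form_mult_eq[of _ 2 _ 1] form_mult_eq[of _ 1 _ 1] C V) auto
qed

lemma pval_theta: "pval \<alpha> (theta l) = theta_val l \<alpha>"
  by (simp add: theta_def theta_val_def Let_def real_id.subst_cd_mult)

lemma pval_g_cubic:
  "pval \<alpha> (g_cubic l) = \<alpha> (3*l + 2)^3 - 3/2 * \<alpha> (3*l + 2) * (\<Sum>i<3*l + 2. (\<alpha> i)^2) + theta_val l \<alpha> / sqrt 2"
  by (simp add: g_cubic_def pval_theta)

lemma pval_clifford_cubic:
  "pval \<alpha> (clifford_cubic m q A)
    = (\<Sum>i\<le>q. (\<Sum>j<2*m. \<Sum>k<2*m. A i $$ (j, k) * \<alpha> (q + 1 + j) * \<alpha> (q + 1 + k)) * \<alpha> i)"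
  by (simp add: clifford_cubic_def)

lemma pval_map_Re: "pval \<alpha> (Poly_Mapping.map Re p) = Re (subst_poly (\<lambda>c. c) (\<lambda>i. complex_of_real (\<alpha> i)) p)"
proof -
  have mono: "mono_val (\<lambda>i. complex_of_real (\<alpha> i)) m = of_real (mono_val \<alpha> m)" for m
    by (simp add: mono_val_def)
  have "pval \<alpha> (Poly_Mapping.map Re p) = (\<Sum>m\<in>Poly_Mapping.keys p. Re (Poly_Mapping.lookup p m) * mono_val \<alpha> m)"
    by (subst real_id.subst_superset[OF _ keys_map_Re])
      (auto simp: Poly_Mapping.map.rep_eq when_def intro!: sum.cong)
  then show ?thesis
    by (subst complex_id.subst_superset[of "Poly_Mapping.keys p"]) (auto simp: mono)
qed

lemma subst_subst_poly:
  "subst_poly (\<lambda>c. c) \<beta> (subst_poly (\<lambda>c. Cst (complex_of_real c)) \<gamma> g)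
    = subst_poly complex_of_real (\<lambda>i. subst_poly (\<lambda>c :: complex. c) \<beta> (\<gamma> i)) g"
proof -
  have prod: "subst_poly (\<lambda>c :: complex. c) \<beta> (prod f A) = (\<Prod>a\<in>A. subst_poly (\<lambda>c. c) \<beta> (f a))" for f :: "nat \<Rightarrow> _" and A
    by (induction A rule: infinite_finite_induct) auto
  show ?thesis by (subst (2 3) subst_poly_def) (simp add: prod)
qed

text \<open>For a cubic, \<open>Re g(x + i y) = S x x x - 3 S x y y\<close>, and
  \<open>g(x + y) + g(x - y) = 2 S x x x + 6 S x y y\<close>. Eliminating the mixed term expresses
  the doubling by real values of \<open>g\<close> alone.\<close>

lemma pval_complex_doubling:
  assumes g: "form M 3 g"
  shows "pval \<alpha> (complex_doubling M g) = 2 * pval \<alpha> g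
    - (pval (\<lambda>i. \<alpha> i + \<alpha> (M + i)) g + pval (\<lambda>i. \<alpha> i - \<alpha> (M + i)) g) / 2"
proof -
  have "homogeneous_poly 3 g" using g by (simp add: cubic_form_iff[symmetric] cubic_form_def)
  then obtain S where S: "trilinear_form S" "\<And>x. S x x x = pval (crd x) g"
    "\<And>x y. Re (subst_poly complex_of_real (vplus_i x y) g) = S x x x - 3 * S x y y"
    by (rule cubic_trilinear) (rule that)
  interpret trilinear_form S by (rule S)
  note cong_r = real_id.subst_in_vars_cong[OF form_in_vars[OF g]]
  note cong_c = of_real_hom.subst_in_vars_cong[OF form_in_vars[OF g]]
  let ?X = "trunc M \<alpha>" and ?Y = "trunc M (\<lambda>i. \<alpha> (M + i))"
  let ?a = "\<lambda>i. complex_of_real (\<alpha> i)"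
  have 1: "subst_poly complex_of_real (\<lambda>i. ?a i + \<i> * ?a (M + i)) g = subst_poly complex_of_real (vplus_i ?X ?Y) g"
    by (rule cong_c) (auto simp: vplus_i_def crd_trunc complex_eq_iff)
  have 2: "subst_poly complex_of_real (\<lambda>i. ?a i - \<i> * ?a (M + i)) g = subst_poly complex_of_real (vplus_i ?X (- ?Y)) g"
    by (rule cong_c) (auto simp: vplus_i_def crd_trunc complex_eq_iff)
  have "pval \<alpha> (complex_doubling M g) = (S ?X ?X ?X - 3 * S ?X ?Y ?Y + (S ?X ?X ?X - 3 * S ?X (- ?Y) (- ?Y))) / 2"
    unfolding complex_doubling_def pval_map_Re by (simp add: subst_subst_poly 1 2 S(3) del: S_minus)
  also have "\<dots> = 2 * S ?X ?X ?X - (S (?X + ?Y) (?X + ?Y) (?X + ?Y) + S (?X + (- ?Y)) (?X + (- ?Y)) (?X + (- ?Y))) / 2"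
    unfolding S_cube_add by (simp add: field_simps)
  also have "S ?X ?X ?X = pval \<alpha> g" unfolding S by (rule cong_r) (simp add: crd_trunc)
  also have "S (?X + ?Y) (?X + ?Y) (?X + ?Y) = pval (\<lambda>i. \<alpha> i + \<alpha> (M + i)) g"
    unfolding S by (rule cong_r) (simp add: crd_trunc)
  also have "S (?X + (- ?Y)) (?X + (- ?Y)) (?X + (- ?Y)) = pval (\<lambda>i. \<alpha> i - \<alpha> (M + i)) g"
    unfolding S by (rule cong_r) (simp add: crd_trunc)
  finally show ?thesis .
qed

section \<open>From the definition of type to the algebraic normal form\<close>

lemma normal_form_products:
  fixes S :: "'a::real_inner \<Rightarrow> 'a \<Rightarrow> 'a \<Rightarrow> real"
  assumes S: "trilinear_form S"
    and P: "\<And>a b c. p111 (a *\<^sub>R x + b *\<^sub>R y + c *\<^sub>R z) = a * b * c * p111 (x + y + z)"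
      "\<And>a b c. p102 (a *\<^sub>R x + b *\<^sub>R y + c *\<^sub>R z) = a * c^2 * p102 (x + y + z)"
      "\<And>a b c. p012 (a *\<^sub>R x + b *\<^sub>R y + c *\<^sub>R z) = b * c^2 * p012 (x + y + z)"
      "\<And>a b c. p030 (a *\<^sub>R x + b *\<^sub>R y + c *\<^sub>R z) = b^3 * p030 (x + y + z)"
    and H: "\<And>t a b c. S (t *\<^sub>R e + a *\<^sub>R x + b *\<^sub>R y + c *\<^sub>R z) (t *\<^sub>R e + a *\<^sub>R x + b *\<^sub>R y + c *\<^sub>R z)
        (t *\<^sub>R e + a *\<^sub>R x + b *\<^sub>R y + c *\<^sub>R z)
      = t^3 - 3/2 * t * (2 * ((a *\<^sub>R x) \<bullet> (a *\<^sub>R x)) + (b *\<^sub>R y) \<bullet> (b *\<^sub>R y) - (c *\<^sub>R z) \<bullet> (c *\<^sub>R z))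
        + p111 (a *\<^sub>R x + b *\<^sub>R y + c *\<^sub>R z) + p102 (a *\<^sub>R x + b *\<^sub>R y + c *\<^sub>R z)
        + p012 (a *\<^sub>R x + b *\<^sub>R y + c *\<^sub>R z) + p030 (a *\<^sub>R x + b *\<^sub>R y + c *\<^sub>R z)"
  shows "S e e e = 1" "S e e x = 0" "S e e y = 0" "S e e z = 0"
    "S e x x = - (x \<bullet> x)" "S e y y = - (y \<bullet> y) / 2" "S e z z = (z \<bullet> z) / 2"
    "S e x y = 0" "S e x z = 0" "S e y z = 0"
    "S x x x = 0" "S x x y = 0" "S x x z = 0" "S x y y = 0" "S y y z = 0" "S z z z = 0"
proof -
  interpret trilinear_form S by fact
  define P111 where "P111 = p111 (x + y + z)"
  define P102 where "P102 = p102 (x + y + z)"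
  define P012 where "P012 = p012 (x + y + z)"
  define P030 where "P030 = p030 (x + y + z)"
  have key: "t^3 * S e e e + a^3 * S x x x + b^3 * S y y y + c^3 * S z z z
     + 3 * t^2 * a * S e e x + 3 * t^2 * b * S e e y + 3 * t^2 * c * S e e z + 3 * t * a^2 * S e x x
     + 3 * a^2 * b * S x x y + 3 * a^2 * c * S x x z + 3 * t * b^2 * S e y y + 3 * a * b^2 * S x y y
     + 3 * b^2 * c * S y y z + 3 * t * c^2 * S e z z + 3 * a * c^2 * S x z z + 3 * b * c^2 * S y z z
     + 6 * t * a * b * S e x y + 6 * t * a * c * S e x z + 6 * t * b * c * S e y z + 6 * a * b * c * S x y z
    = t^3 - 3/2 * t * (2 * a^2 * (x \<bullet> x) + b^2 * (y \<bullet> y) - c^2 * (z \<bullet> z))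
      + a * b * c * P111 + a * c^2 * P102 + b * c^2 * P012 + b^3 * P030" for t a b c
    using H[of t a b c] unfolding P S_cube_add P111_def[symmetric] P102_def[symmetric] P012_def[symmetric] P030_def[symmetric]
    by (simp add: S_swap12[of x e] S_swap12[of y e] S_swap12[of y x] power_expand algebra_simps)
  \<comment> \<open>Coefficients 0, 1, -1 are enough: one nonzero coefficient isolates a cube, a
    sign change separates the two mixed terms of a pair of vectors, and three ones reach the
    products of \<open>e\<close> with two different components.\<close>
  note k = key[of 1 0 0 0] key[of 0 1 0 0] key[of 0 0 1 0] key[of 0 0 0 1] key[of 1 1 0 0] key[of 1 "-1" 0 0]
    key[of 1 0 1 0] key[of 1 0 "-1" 0] key[of 1 0 0 1] key[of 1 0 0 "-1"] key[of 0 1 1 0] key[of 0 1 "-1" 0]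
    key[of 0 1 0 1] key[of 0 "-1" 0 1] key[of 0 0 1 1] key[of 0 0 "-1" 1] key[of 1 1 1 0] key[of 1 1 0 1] key[of 1 0 1 1]
  note k' = k[simplified]
  show 1: "S e e e = 1" "S x x x = 0" "S z z z = 0" using k'(1,2,4) by simp_all
  show 2: "S e e x = 0" "S e x x = - (x \<bullet> x)" using k'(5,6) 1 by simp_all
  show 3: "S e e y = 0" "S e y y = - (y \<bullet> y) / 2" using k'(3,7,8) 1 by (simp_all add: field_simps)
  show 4: "S e e z = 0" "S e z z = (z \<bullet> z) / 2" using k'(9,10) 1 by (simp_all add: field_simps)
  show 5: "S x x y = 0" "S x y y = 0" using k'(3,11,12) 1 by (simp_all add: field_simps)
  show 6: "S x x z = 0" using k'(13,14) 1 by (simp add: field_simps)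
  show 7: "S y y z = 0" using k'(3,15,16) 1 by (simp add: field_simps)
  show "S e x y = 0" using k'(17,3) 1 2 3 5 by (simp add: field_simps)
  show "S e x z = 0" using k'(18,13) 1 2 4 6 by (simp add: field_simps)
  show "S e y z = 0" using k'(19,15,3) 1 3 4 7 by (simp add: field_simps)
qed

lemma trilinear_form_scale:
  assumes "trilinear_form S" shows "trilinear_form (\<lambda>x y z. c * S x y z)"
proof -
  interpret trilinear_form S by fact
  show ?thesis
  proof
    show "c * S x y z = c * S y x z" "c * S x y z = c * S x z y" for x y z
      using S_swap12[of x y z] S_swap23[of x y z] by simp_all
  qed (simp_all add: algebra_simps)
qed

lemma has_type_normal_form:
  assumes rad: "radial_eigencubic n f" and type: "has_type n f 1 N"
  obtains S lam e xi V2 V3 k eta zeta c where "normal_form S (euclid n) n unitv lam e xi V2 V3 N k eta zeta"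
    "c \<noteq> 0" "\<And>x. S x x x = c * pval (crd x) f"
proof -
  from type obtain e' V1' V2' V3' p111 p102 p012 p030 c where
    dec: "orthogonal_decomposition n e' V1' V2' V3'" and dim: "vdim n V1' = 1" "vdim n V2' = N"
    and tri: "trihomogeneous n V1' V2' V3' 1 1 1 p111" "trihomogeneous n V1' V2' V3' 1 0 2 p102"
      "trihomogeneous n V1' V2' V3' 0 1 2 p012" "trihomogeneous n V1' V2' V3' 0 3 0 p030"
    and c: "c \<noteq> 0"
    and f: "\<And>t \<xi> \<eta> \<zeta>. \<xi> \<in> V1' \<Longrightarrow> \<eta> \<in> V2' \<Longrightarrow> \<zeta> \<in> V3' \<Longrightarrow>
           c * poly_val f (t \<cdot>\<^sub>v e' + \<xi> + \<eta> + \<zeta>) =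
             t^3 - 3/2 * t * (2 * (scalar_prod \<xi> \<xi>) + scalar_prod \<eta> \<eta> - scalar_prod \<zeta> \<zeta>)
             + poly_val p111 (\<xi> + \<eta> + \<zeta>) + poly_val p102 (\<xi> + \<eta> + \<zeta>)
             + poly_val p012 (\<xi> + \<eta> + \<zeta>) + poly_val p030 (\<xi> + \<eta> + \<zeta>)"
    unfolding has_type_def by blast
  have e'n: "e' \<in> carrier_vec n" and e'e': "scalar_prod e' e' = 1"
    and sub': "\<And>V. V \<in> {V1', V2', V3'} \<Longrightarrow> VectorSpace.subspace class_ring V (module_vec TYPE(real) n)"
    and orth': "\<And>v. v \<in> V1' \<union> V2' \<union> V3' \<Longrightarrow> scalar_prod e' v = 0"
      "\<And>v w. v \<in> V1' \<Longrightarrow> w \<in> V2' \<Longrightarrow> scalar_prod v w = 0" "\<And>v w. v \<in> V1' \<Longrightarrow> w \<in> V3' \<Longrightarrow> scalar_prod v w = 0"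
      "\<And>v w. v \<in> V2' \<Longrightarrow> w \<in> V3' \<Longrightarrow> scalar_prod v w = 0"
    and decomp': "\<And>x. x \<in> carrier_vec n \<Longrightarrow> \<exists>t. \<exists>\<xi>\<in>V1'. \<exists>\<eta>\<in>V2'. \<exists>\<zeta>\<in>V3'. x = t \<cdot>\<^sub>v e' + \<xi> + \<eta> + \<zeta>"
    using dec unfolding orthogonal_decomposition_def by auto
  have cn: "\<And>v. v \<in> V1' \<Longrightarrow> v \<in> carrier_vec n" "\<And>v. v \<in> V2' \<Longrightarrow> v \<in> carrier_vec n" "\<And>v. v \<in> V3' \<Longrightarrow> v \<in> carrier_vec n"
    using jnf_subspace(1)[OF sub'] by auto
  have cub: "cubic_form n f" using rad by (simp add: radial_eigencubic_def)
  then have fn: "in_vars n f" "homogeneous_poly 3 f" by (auto simp: cubic_form_def)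
  obtain S0 where S0: "trilinear_form S0" "\<And>x. S0 x x x = pval (crd x) f"
    using cubic_trilinear[OF fn(2)] by metis
  define S where "S x y z = c * S0 x y z" for x y z
  have S: "trilinear_form S" unfolding S_def by (rule trilinear_form_scale[OF S0(1)])
  interpret S0: cubic_space S0 "euclid n" n unitv
    using S0(1) by (simp add: cubic_space_def cubic_space_axioms_def onframe_euclid)
  interpret S: cubic_space S "euclid n" n unitv
    using S by (simp add: cubic_space_def cubic_space_axioms_def onframe_euclid)
  have mul: "S.mul x y = c *\<^sub>R S0.mul x y" for x y
    unfolding S.mul_def S0.mul_def by (simp add: S_def scaleR_sum_right)
  have trS: "S.tr x = c * S0.tr x" for x
    unfolding S.tr_def S0.tr_def by (simp add: S_def sum_distrib_left)
  obtain lam where lam: "L_op n f = Cst lam * (\<Sum>i<n. (Var i)^2) * f"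
    using rad by (auto simp: radial_eigencubic_def)
  \<comment> \<open>Passing from \<open>f\<close> to \<open>c f\<close> multiplies the left-hand
    side by \<open>c^3\<close> and the cubic on the right by \<open>c\<close>, and 54 is the factor
    from \<open>L_op_trilinear\<close>.\<close>
  have ext: "eigencubic S (euclid n) n unitv (lam * c^2 / 54)"
  proof unfold_locales
    fix x assume x: "x \<in> euclid n"
    have "54 * ((S0.mul x x \<bullet> S0.mul x x) * S0.tr x - S0.mul x x \<bullet> S0.mul x (S0.mul x x)) = pval (crd x) (L_op n f)"
      by (rule L_op_trilinear[OF S0, symmetric])
    also have "\<dots> = lam * (x \<bullet> x) * (x \<bullet> S0.mul x x)"
      unfolding lam using x by (simp add: inner_euclid power2_eq_square S0(2)[symmetric] S0.inner_mul' flip: inner_euclid)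
    finally have "c^3 * ((S0.mul x x \<bullet> S0.mul x x) * S0.tr x - S0.mul x x \<bullet> S0.mul x (S0.mul x x))
        = c^3 * (lam * (x \<bullet> x) * (x \<bullet> S0.mul x x) / 54)" by simp
    then show "(S.mul x x \<bullet> S.mul x x) * S.tr x - S.mul x x \<bullet> S.mul x (S.mul x x)
      = (lam * c^2 / 54) * (x \<bullet> x) * (x \<bullet> S.mul x x)"
      unfolding mul trS by (simp add: mul power_expand algebra_simps)
  qed
  define e where "e = of_vec e'"
  define W1 where "W1 = of_vec ` V1'"
  define W2 where "W2 = of_vec ` V2'"
  define W3 where "W3 = of_vec ` V3'"
  have W: "subspace W1" "subspace W2" "subspace W3"
    using jnf_subspace(2)[OF sub'] by (auto simp: W1_def W2_def W3_def)
  have WE: "W1 \<subseteq> euclid n" "W2 \<subseteq> euclid n" "W3 \<subseteq> euclid n"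
    using cn of_vec_euclid by (auto simp: W1_def W2_def W3_def)
  obtain d1 xi' where x1: "onframe W1 d1 xi'" by (rule onframe_exists[OF W(1) WE(1) onframe_euclid])
  obtain d2 eta where x2: "onframe W2 d2 eta" by (rule onframe_exists[OF W(2) WE(2) onframe_euclid])
  obtain k zeta where x3: "onframe W3 k zeta" by (rule onframe_exists[OF W(3) WE(3) onframe_euclid])
  have "d1 = 1" "d2 = N"
    using vdim_eq[OF sub', of V1' d1 xi'] vdim_eq[OF sub', of V2' d2 eta] x1 x2 dim by (auto simp: W1_def W2_def)
  note x1 = x1[unfolded \<open>d1 = 1\<close>] and x2 = x2[unfolded \<open>d2 = N\<close>]
  define xi where "xi = xi' 0"
  have xiW: "xi \<in> W1" "xi \<bullet> xi = 1" using onframe_in[OF x1, of 0] orthonormalD[OF onframe_orthonormal[OF x1], of 0 0] by (auto simp: xi_def)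
  have W1_xi: "x = (x \<bullet> xi) *\<^sub>R xi" if "x \<in> W1" for x using onframe_expand[OF x1 that] by (simp add: xi_def)
  have hom: "pval (crd (a *\<^sub>R x + b *\<^sub>R y + r *\<^sub>R z)) p = a^i * b^j * r^l * pval (crd (x + y + z)) p"
    if p: "trihomogeneous n V1' V2' V3' i j l p" and xyz: "x \<in> W1" "y \<in> W2" "z \<in> W3" for p i j l a b r x y z
  proof -
    from xyz obtain x' y' z' where x': "x' \<in> V1'" "x = of_vec x'" "y' \<in> V2'" "y = of_vec y'" "z' \<in> V3'" "z = of_vec z'"
      by (auto simp: W1_def W2_def W3_def)
    have cc: "x' \<in> carrier_vec n" "y' \<in> carrier_vec n" "z' \<in> carrier_vec n" using x' cn by auto
    have p': "in_vars n p" "poly_val p (a \<cdot>\<^sub>v x' + b \<cdot>\<^sub>v y' + r \<cdot>\<^sub>v z') = a^i * b^j * r^l * poly_val p (x' + y' + z')"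
      using p x' unfolding trihomogeneous_def by blast+
    then show ?thesis
      using cc x' by (simp add: poly_val_of_vec[OF p'(1)] of_vec_add[of _ n] of_vec_smult[of _ n] add.assoc)
  qed
  have val: "S (t *\<^sub>R e + x + y + z) (t *\<^sub>R e + x + y + z) (t *\<^sub>R e + x + y + z)
      = t^3 - 3/2 * t * (2 * (x \<bullet> x) + y \<bullet> y - z \<bullet> z) + pval (crd (x + y + z)) p111 + pval (crd (x + y + z)) p102
        + pval (crd (x + y + z)) p012 + pval (crd (x + y + z)) p030"
    if xyz: "x \<in> W1" "y \<in> W2" "z \<in> W3" for t x y z
  proof -
    from xyz obtain x' y' z' where x': "x' \<in> V1'" "x = of_vec x'" "y' \<in> V2'" "y = of_vec y'" "z' \<in> V3'" "z = of_vec z'"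
      by (auto simp: W1_def W2_def W3_def)
    have cc: "x' \<in> carrier_vec n" "y' \<in> carrier_vec n" "z' \<in> carrier_vec n" using x' cn by auto
    have in_p: "in_vars n p111" "in_vars n p102" "in_vars n p012" "in_vars n p030"
      using tri unfolding trihomogeneous_def by blast+
    show ?thesis
      using f[OF x'(1,3,5), of t] cc e'n
      by (simp add: S_def S0(2) e_def x' poly_val_of_vec[OF fn(1)] in_p[THEN poly_val_of_vec] scalar_prod_of_vec[of _ n]
         of_vec_add[of _ n] of_vec_smult[of _ n] add.assoc)
  qed
  have prods: "S e e e = 1" "S e e x = 0" "S e e y = 0" "S e e z = 0"
    "S e x x = - (x \<bullet> x)" "S e y y = - (y \<bullet> y) / 2" "S e z z = (z \<bullet> z) / 2"
    "S e x y = 0" "S e x z = 0" "S e y z = 0"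
    "S x x x = 0" "S x x y = 0" "S x x z = 0" "S x y y = 0" "S y y z = 0" "S z z z = 0"
    if xyz: "x \<in> W1" "y \<in> W2" "z \<in> W3" for x y z
  proof -
    note h = tri[THEN hom, OF xyz, simplified]
    note v = val[OF subspace_scale[OF W(1) xyz(1)] subspace_scale[OF W(2) xyz(2)] subspace_scale[OF W(3) xyz(3)]]
    note np = normal_form_products[OF S, of "\<lambda>v. pval (crd v) p111" x y z "\<lambda>v. pval (crd v) p102" "\<lambda>v. pval (crd v) p012"
        "\<lambda>v. pval (crd v) p030" e, OF h v]
    show "S e e e = 1" "S e e x = 0" "S e e y = 0" "S e e z = 0"
      "S e x x = - (x \<bullet> x)" "S e y y = - (y \<bullet> y) / 2" "S e z z = (z \<bullet> z) / 2"
      "S e x y = 0" "S e x z = 0" "S e y z = 0"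
      "S x x x = 0" "S x x y = 0" "S x x z = 0" "S x y y = 0" "S y y z = 0" "S z z z = 0"
      by (rule np)+
  qed
  have zero: "0 \<in> W1" "0 \<in> W2" "0 \<in> W3" using W by (auto intro: subspace_0)
  have polar: "S w y y' = (S w (y + y') (y + y') - S w y y - S w y' y') / 2" for w y y'
    by (simp add: S.S_swap23[of w y' y])
  have orths: "e \<bullet> e = 1" "\<And>x. x \<in> W1 \<Longrightarrow> e \<bullet> x = 0" "\<And>x. x \<in> W2 \<Longrightarrow> e \<bullet> x = 0" "\<And>x. x \<in> W3 \<Longrightarrow> e \<bullet> x = 0"
    "\<And>x y. x \<in> W1 \<Longrightarrow> y \<in> W2 \<Longrightarrow> x \<bullet> y = 0" "\<And>x y. x \<in> W1 \<Longrightarrow> y \<in> W3 \<Longrightarrow> x \<bullet> y = 0"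
    "\<And>x y. x \<in> W2 \<Longrightarrow> y \<in> W3 \<Longrightarrow> x \<bullet> y = 0"
    using e'e' orth' e'n cn by (auto simp: e_def W1_def W2_def W3_def scalar_prod_of_vec[of _ n, symmetric])
  interpret eigencubic S "euclid n" n unitv "lam * c^2 / 54" by (rule ext)
  have "normal_form S (euclid n) n unitv (lam * c^2 / 54) e xi W2 W3 N k eta zeta"
  proof unfold_locales
    show "e \<in> euclid n" using of_vec_euclid[OF e'n] by (simp add: e_def)
    show "xi \<in> euclid n" using xiW WE by auto
    show "W2 \<subseteq> euclid n" "W3 \<subseteq> euclid n" by (fact WE)+
    show "onframe W2 N eta" "onframe W3 k zeta" by (fact x2 x3)+
    show "e \<bullet> e = 1" "xi \<bullet> xi = 1" "e \<bullet> xi = 0" using orths xiW by auto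
    show "e \<bullet> y = 0" "xi \<bullet> y = 0" if "y \<in> W2" for y using orths xiW that by auto
    show "e \<bullet> y = 0" "xi \<bullet> y = 0" if "y \<in> W3" for y using orths xiW that by auto
    show "y \<bullet> z = 0" if "y \<in> W2" "z \<in> W3" for y z using orths that by auto
    show "\<exists>t s. \<exists>y\<in>W2. \<exists>z\<in>W3. x = t *\<^sub>R e + s *\<^sub>R xi + y + z" if x: "x \<in> euclid n" for x
    proof -
      from decomp'[of "to_vec n x"] obtain t x' y' z' where x': "x' \<in> V1'" "y' \<in> V2'" "z' \<in> V3'"
        and eq: "to_vec n x = t \<cdot>\<^sub>v e' + x' + y' + z'" by auto
      have "x = of_vec (to_vec n x)" using x by simp
      also have "\<dots> = t *\<^sub>R e + of_vec x' + of_vec y' + of_vec z'"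
        unfolding eq e_def using x' cn e'n by (simp add: of_vec_add[of _ n] of_vec_smult[of _ n])
      also have "of_vec x' = (of_vec x' \<bullet> xi) *\<^sub>R xi" using x' by (intro W1_xi) (simp add: W1_def)
      finally show ?thesis using x' by (auto simp: W2_def W3_def)
    qed
    show "S e e e = 1" "S e e xi = 0" "S e xi xi = -1" "S xi xi xi = 0"
      using prods[OF xiW(1) zero(2,3)] xiW(2) by auto
    show "S e e y = 0" "S e xi y = 0" "S xi xi y = 0" if "y \<in> W2" for y
      using prods[OF xiW(1) that zero(3)] by auto
    show "S e e z = 0" "S e xi z = 0" "S xi xi z = 0" if "z \<in> W3" for z
      using prods[OF xiW(1) zero(2) that] by auto
    show "S e y z = 0" if "y \<in> W2" "z \<in> W3" for y z using prods[OF xiW(1) that] by auto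
    show "S e y y' = - (y \<bullet> y') / 2" "S xi y y' = 0" if "y \<in> W2" "y' \<in> W2" for y y'
    proof -
      note p = prods[OF xiW(1) _ zero(3)]
      have "y + y' \<in> W2" using W(2) that by (rule subspace_add)
      then show "S e y y' = - (y \<bullet> y') / 2" "S xi y y' = 0"
        using p(6,14)[OF that(1)] p(6,14)[OF that(2)] p(6,14)[of "y + y'"]
        by (simp_all add: polar[of e y y'] polar[of xi y y'] inner_add_left inner_add_right inner_commute[of y' y] del: S.S_add2 S.S_add3)
    qed
    show "S e z z' = (z \<bullet> z') / 2" if "z \<in> W3" "z' \<in> W3" for z z'
    proof -
      note p = prods[OF xiW(1) zero(2)]
      have "z + z' \<in> W3" using W(3) that by (rule subspace_add)
      then show ?thesis
        using p(7)[OF that(1)] p(7)[OF that(2)] p(7)[of "z + z'"]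
        by (simp add: polar[of e z z'] inner_add_left inner_add_right inner_commute[of z' z] del: S.S_add2 S.S_add3)
    qed
    show "S y y' z = 0" if "y \<in> W2" "y' \<in> W2" "z \<in> W3" for y y' z
    proof -
      have "y + y' \<in> W2" using W(2) that(1,2) by (rule subspace_add)
      note sq = prods(15)[OF xiW(1) _ that(3)]
      from sq[OF \<open>y + y' \<in> W2\<close>] sq[OF that(1)] sq[OF that(2)]
      show ?thesis by (simp add: S.S_swap12[of y' y])
    qed
    show "S z z' z'' = 0" if "z \<in> W3" "z' \<in> W3" "z'' \<in> W3" for z z' z''
    proof -
      have "trilinear_form (\<lambda>x y z. 0 :: real)" by unfold_locales auto
      from trilinear_form_eqI[OF S this W(3) _ that] show ?thesis using prods(16)[OF xiW(1) zero(2)] by auto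
    qed
  qed
  moreover have "S x x x = c * pval (crd x) f" for x by (simp add: S_def S0(2))
  ultimately show ?thesis using c that by blast
qed

lemma orthonormal_1: "e \<bullet> e = 1 \<Longrightarrow> orthonormal 1 (\<lambda>_. e)"
  by (simp add: orthonormal_def)

lemma sum_square_add:
  fixes g h :: "nat \<Rightarrow> real"
  shows "(\<Sum>i<n. (g i + h i)^2) = (\<Sum>i<n. g i * g i) + 2 * (\<Sum>i<n. g i * h i) + (\<Sum>i<n. h i * h i)"
    and sum_square_diff: "(\<Sum>i<n. (g i - h i)^2) = (\<Sum>i<n. g i * g i) - 2 * (\<Sum>i<n. g i * h i) + (\<Sum>i<n. h i * h i)"
  by (induction n) (simp_all add: power2_eq_square algebra_simps)

section \<open>Clifford systems of two reflections\<close>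

text \<open>On pairs \<open>(y1, y2)\<close> of vectors of length \<open>m\<close>: index 0 changes
  the sign of \<open>y2\<close>, index 1 swaps \<open>y1\<close> and \<open>y2\<close>. The Clifford
  cubic is \<open>z1 (|y1|^2 - |y2|^2) + 2 z2 <y1, y2>\<close>.\<close>

definition refl_pair :: "nat \<Rightarrow> nat \<Rightarrow> real mat" where
  "refl_pair m i = mat (2 * m) (2 * m) (\<lambda>(j, k).
     if i = 0 then (if j = k then if j < m then 1 else -1 else 0)
     else (if k = (if j < m then j + m else j - m) then 1 else 0))"

lemma refl_pair_sum:
  assumes "j < 2 * m"
  shows "(\<Sum>k<2 * m. refl_pair m i $$ (j, k) * g k)
    = (if i = 0 then (if j < m then 1 else -1) * g j else g (if j < m then j + m else j - m))"
proof (cases "i = 0")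
  case True
  have "(\<Sum>k<2 * m. refl_pair m i $$ (j, k) * g k) = (\<Sum>k<2 * m. if k = j then (if j < m then 1 else -1) * g j else 0)"
    using assms True by (intro sum.cong) (auto simp: refl_pair_def)
  then show ?thesis using True assms by simp
next
  case False
  let ?s = "if j < m then j + m else j - m"
  have "(\<Sum>k<2 * m. refl_pair m i $$ (j, k) * g k) = (\<Sum>k<2 * m. if k = ?s then g ?s else 0)"
    using assms False by (intro sum.cong) (auto simp: refl_pair_def)
  then show ?thesis using False assms by (auto simp: sum.delta)
qed

lemma refl_pair_index:
  "j < 2 * m \<Longrightarrow> k < 2 * m \<Longrightarrow> refl_pair m i $$ (j, k) =
    (if i = 0 then (if j = k then if j < m then 1 else -1 else 0)
     else (if k = (if j < m then j + m else j - m) then 1 else 0))"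
  by (simp add: refl_pair_def)

lemma refl_pair_clifford:
  assumes "1 \<le> m" shows "symmetric_clifford_system m 1 (refl_pair m)"
  unfolding symmetric_clifford_system_def
proof (intro conjI allI impI)
  fix i j :: nat assume ij: "i \<le> 1" "j \<le> 1"
  have carrier: "refl_pair m i \<in> carrier_mat (2 * m) (2 * m)" for i by (simp add: refl_pair_def)
  have prod: "(refl_pair m i * refl_pair m j) $$ (r, s)
      = (if i = 0 then (if r < m then 1 else -1) * refl_pair m j $$ (r, s)
         else refl_pair m j $$ ((if r < m then r + m else r - m), s))" if "r < 2 * m" "s < 2 * m" for i j r s
    using that carrier[of i] carrier[of j] refl_pair_sum[OF that(1), of i "\<lambda>k. refl_pair m j $$ (k, s)"]
    by (simp add: scalar_prod_def lessThan_atLeast0)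
  show "refl_pair m i * refl_pair m j + refl_pair m j * refl_pair m i = (if i = j then 2 else 0) \<cdot>\<^sub>m 1\<^sub>m (2 * m)"
  proof (rule eq_matI)
    fix r s assume rs: "r < dim_row ((if i = j then 2 else 0) \<cdot>\<^sub>m 1\<^sub>m (2 * m) :: real mat)"
      "s < dim_col ((if i = j then 2 else 0) \<cdot>\<^sub>m 1\<^sub>m (2 * m) :: real mat)"
    then have rs': "r < 2 * m" "s < 2 * m" by auto
    have r': "(if r < m then r + m else r - m) < 2 * m" using rs' by auto
    have dims: "dim_row (refl_pair m i * refl_pair m j) = 2 * m" "dim_col (refl_pair m i * refl_pair m j) = 2 * m" for i j
      using carrier by auto
    have "(refl_pair m i * refl_pair m j + refl_pair m j * refl_pair m i) $$ (r, s)
        = (refl_pair m i * refl_pair m j) $$ (r, s) + (refl_pair m j * refl_pair m i) $$ (r, s)"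
      by (rule index_add_mat) (use rs' dims carrier in auto)
    also have "\<dots> = ((if i = j then 2 else 0) \<cdot>\<^sub>m 1\<^sub>m (2 * m)) $$ (r, s)"
      unfolding prod[OF rs'] refl_pair_index[OF rs'] refl_pair_index[OF r' rs'(2)]
      using ij rs' by auto
    finally show "(refl_pair m i * refl_pair m j + refl_pair m j * refl_pair m i) $$ (r, s)
        = ((if i = j then 2 else 0) \<cdot>\<^sub>m 1\<^sub>m (2 * m)) $$ (r, s)" .
  qed (auto simp: refl_pair_def)
next
  fix i :: nat assume "i \<le> 1"
  show "refl_pair m i \<in> carrier_mat (2 * m) (2 * m)" by (simp add: refl_pair_def)
  show "transpose_mat (refl_pair m i) = refl_pair m i"
    by (rule eq_matI) (auto simp: refl_pair_def)
qed (use assms in auto)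

lemma pval_refl_pair:
  "pval \<alpha> (clifford_cubic m 1 (refl_pair m))
    = \<alpha> 0 * (\<Sum>j<m. (\<alpha> (2 + j))^2 - (\<alpha> (2 + m + j))^2) + \<alpha> 1 * (2 * (\<Sum>j<m. \<alpha> (2 + j) * \<alpha> (2 + m + j)))"
proof -
  have split: "(\<Sum>j<2 * m. g j) = (\<Sum>j<m. g j) + (\<Sum>j<m. g (m + j))" for g :: "nat \<Rightarrow> real"
    using sum_append_frame[of "\<lambda>i _. g i" m "\<lambda>_. ()" "\<lambda>_. ()" m] by (simp add: mult_2)
  have quad: "(\<Sum>j<2 * m. \<Sum>k<2 * m. refl_pair m i $$ (j, k) * \<alpha> (2 + j) * \<alpha> (2 + k))
      = (\<Sum>j<2 * m. \<alpha> (2 + j) * (if i = 0 then (if j < m then 1 else -1) * \<alpha> (2 + j)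
            else \<alpha> (2 + (if j < m then j + m else j - m))))" for i
  proof (rule sum.cong[OF refl])
    fix j assume "j \<in> {..<2 * m}"
    then show "(\<Sum>k<2 * m. refl_pair m i $$ (j, k) * \<alpha> (2 + j) * \<alpha> (2 + k))
      = \<alpha> (2 + j) * (if i = 0 then (if j < m then 1 else -1) * \<alpha> (2 + j) else \<alpha> (2 + (if j < m then j + m else j - m)))"
      using refl_pair_sum[of j m i "\<lambda>k. \<alpha> (2 + j) * \<alpha> (2 + k)"] by (simp add: mult.assoc)
  qed
  have "pval \<alpha> (clifford_cubic m 1 (refl_pair m))
     = (\<Sum>i\<le>1. (\<Sum>j<2 * m. \<Sum>k<2 * m. refl_pair m i $$ (j, k) * \<alpha> (2 + j) * \<alpha> (2 + k)) * \<alpha> i)"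
    unfolding pval_clifford_cubic by (simp add: numeral_2_eq_2)
  also have "\<dots> = \<alpha> 0 * (\<Sum>j<m. (\<alpha> (2 + j))^2 - (\<alpha> (2 + m + j))^2) + \<alpha> 1 * (2 * (\<Sum>j<m. \<alpha> (2 + j) * \<alpha> (2 + m + j)))"
    unfolding quad unfolding split
    by (simp add: sum_subtractf sum_negf power2_eq_square ac_simps distrib_left right_diff_distrib)
  finally show ?thesis .
qed

text \<open>The factorization \<open>t\<^sup>3 - 3/2 t (p\<^sup>2 + P) + (p\<^sup>3 - 3 p P) / sqrt 2 = 3 sqrt 3 / 2 u (v\<^sup>2 - P)\<close> with
  \<open>u = (t + sqrt 2 p) / sqrt 3\<close> and \<open>v = (sqrt 2 t - p) / sqrt 3\<close>, after complexification.\<close>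

lemma reducible_identity:
  fixes r a :: real
  assumes r: "r * r = 2" and a: "a * a = 1/3"
    and defs: "t = a * x0 + r * a * x2" "p0 = r * a * x0 - a * x2" "s = a * x1 - r * a * w" "q0 = r * a * x1 + a * w"
  shows "t^3 - 3/2 * t * (2 * s^2 + (p0^2 + PP) - (q0^2 + QQ)) + 3 * s * (p0 * q0 + PQ) + (r/2) * (p0^3 - 3 * p0 * PP)
    - ((r/2) * (((p0 + q0)^3 - 3 * (p0 + q0) * (PP + 2 * PQ + QQ)) + ((p0 - q0)^3 - 3 * (p0 - q0) * (PP - 2 * PQ + QQ))) / 2
       - (r/2) * (p0^3 - 3 * p0 * PP))
    = 9 * a / 2 * (x0 * (x2^2 + QQ - (w^2 + PP)) + 2 * x1 * (x2 * w + PQ))"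
proof -
  have [simp]: "a * (a * z) = z / 3" "r * (r * z) = 2 * z" for z
    using a r by (simp_all flip: mult.assoc)
  show ?thesis unfolding defs using a r by (simp add: power2_eq_square power3_eq_cube field_simps)
qed

section \<open>Exceptional cubics of type (1, 3 l + 2)\<close>

theorem exceptional_congruent:
  assumes exc: "exceptional n f" and type: "has_type n f 1 (3 * l + 2)" and l: "l = 2 ^ k'"
  shows "n = 6 * l + 6" "congruent_cubics n f (complex_doubling (3 * l + 3) (g_cubic l))"
proof -
  define N where "N = 3 * l + 2"
  have rad: "radial_eigencubic n f" using exc by (simp add: exceptional_def)
  then have cub: "cubic_form n f" by (simp add: radial_eigencubic_def)
  obtain S lam e xi V2 V3 k eta zeta c where nf: "normal_form S (euclid n) n unitv lam e xi V2 V3 N k eta zeta"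
    and c: "c \<noteq> 0" and Sf: "\<And>x. S x x x = c * pval (crd x) f"
    by (rule has_type_normal_form[OF rad type[folded N_def]]) (rule that)
  interpret NF: normal_form S "euclid n" n unitv lam e xi V2 V3 N k eta zeta by (rule nf)
  interpret T: eiconal "\<lambda>x y z. sqrt 2 * S x y z" V2 N eta by (rule NF.eiconal_V2)
  have n: "n = N + (1 + (N + 1))"
    using onframe_dim_unique[OF onframe_euclid NF.onframe_V] NF.k_eq_N by simp
  then show n': "n = 6 * l + 6" by (simp add: N_def)
  define J where "J = NF.J"
  note J_linear = NF.J_linear[folded J_def] and J_V3 = NF.J_V3[folded J_def]
    and J_inner = NF.J_inner[folded J_def] and normal_cube = NF.normal_cube[folded J_def]
  have J_sum: "J (sum g A) = (\<Sum>a\<in>A. J (g a))" for g and A :: "nat set"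
    using J_linear(2)[of 0 0] by (induction A rule: infinite_finite_induct) (auto simp: J_linear)
  have frame: "onframe (euclid n) n B" if "orthonormal n B" "\<And>i. i < n \<Longrightarrow> B i \<in> euclid n" for B
    using orthonormal_onframe[OF onframe_euclid that] by simp
  show "congruent_cubics n f (complex_doubling (3 * l + 3) (g_cubic l))"
  proof (rule T.eiconal_classification[OF N_def l])
    fix b assume b: "onframe V2 N b"
      and S3: "\<And>x. sqrt 2 * S (\<Sum>i<N. x i *\<^sub>R b i) (\<Sum>i<N. x i *\<^sub>R b i) (\<Sum>i<N. x i *\<^sub>R b i) = theta_val l x"
    let ?L = "\<lambda>x. \<Sum>i<N. x i *\<^sub>R b i"
    have bV: "b i \<in> V2" "J (b i) \<in> V3" if "i < N" for i using onframe_in[OF b that] J_V3 by auto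
    note LV = onframe_lin[OF b]
    \<comment> \<open>The order of the variables of the doubling: first the real part,
      \<open>V2\<close> and then \<open>e\<close>, since the distinguished variable of
      \<open>g_cubic\<close> comes last; then the imaginary part, \<open>J\<close> of
      \<open>V2\<close> and then \<open>xi\<close>.\<close>
    define B where "B = append_frame N b (append_frame 1 (\<lambda>_. e) (append_frame N (\<lambda>i. J (b i)) (\<lambda>_. xi)))"
    have oJ: "orthonormal N (\<lambda>i. J (b i))"
      using onframe_orthonormal[OF b] bV by (auto simp: orthonormal_def J_inner)
    have "orthonormal (N + (1 + (N + 1))) B"
      unfolding B_def
      by (intro orthonormal_append orthonormal_1 onframe_orthonormal[OF b] oJ)
        (auto simp: append_frame_def bV NF.orth)
    moreover have "B i \<in> euclid n" if "i < n" for i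
      using that bV(1)[THEN NF.in_V(3)] bV(2)[THEN NF.in_V(4)] NF.e_V NF.xi_V by (auto simp: B_def append_frame_def n)
    ultimately have fB: "onframe (euclid n) n B" by (intro frame) (simp_all only: n)
    have inner_L: "?L x \<bullet> ?L y = (\<Sum>i<N. x i * y i)" for x y by (rule orthonormal_inner[OF onframe_orthonormal[OF b]])
    have val: "pval (crd (\<Sum>i<n. x i *\<^sub>R B i)) f = (1 / c) * pval x (complex_doubling (3 * l + 3) (g_cubic l))" for x
    proof -
      let ?p = "\<lambda>i. x i" and ?q = "\<lambda>i. x (N + 1 + i)"
      have X: "(\<Sum>i<n. x i *\<^sub>R B i) = x N *\<^sub>R e + x (N + 1 + N) *\<^sub>R xi + ?L ?p + J (?L ?q)"
        unfolding n B_def by (subst sum_append_frame, subst sum_append_frame, subst sum_append_frame)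
          (simp add: J_sum J_linear algebra_simps)
      have add: "?L ?p + ?L ?q = ?L (\<lambda>i. x i + x (N + 1 + i))" "?L ?p + (- ?L ?q) = ?L (\<lambda>i. x i - x (N + 1 + i))"
        by (simp_all add: scaleR_left_distrib scaleR_left_diff_distrib sum.distrib sum_subtractf)
      have "S (?L ?p + ?L ?q) (?L ?p + ?L ?q) (?L ?p + ?L ?q) + S (?L ?p + (- ?L ?q)) (?L ?p + (- ?L ?q)) (?L ?p + (- ?L ?q))
          = 2 * S (?L ?p) (?L ?p) (?L ?p) + 6 * S (?L ?p) (?L ?q) (?L ?q)"
        unfolding NF.S_cube_add by simp
      note S4 = this[unfolded add]
      define th where "th y = theta_val l y / sqrt 2" for y
      have S3': "S (?L x) (?L x) (?L x) = th x" for x using S3[of x] by (simp add: th_def field_simps)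
      have S4': "6 * S (?L ?p) (?L ?q) (?L ?q) = th (\<lambda>i. x i + x (N + 1 + i)) + th (\<lambda>i. x i - x (N + 1 + i)) - 2 * th x"
        using S4 unfolding S3' by simp
      have sq: "(\<Sum>i<N. (x i)^2) = (\<Sum>i<N. x i * x i)" by (simp add: power2_eq_square)
      have M: "3 * l + 3 = N + 1" by (simp add: N_def)
      have g: "pval y (g_cubic l) = y N ^ 3 - 3/2 * y N * (\<Sum>i<N. (y i)^2) + th y" for y
        unfolding pval_g_cubic th_def by (simp add: N_def)
      have "pval x (complex_doubling (3 * l + 3) (g_cubic l)) = S (\<Sum>i<n. x i *\<^sub>R B i) (\<Sum>i<n. x i *\<^sub>R B i) (\<Sum>i<n. x i *\<^sub>R B i)"
        unfolding M pval_complex_doubling[OF form_g_cubic[OF l], unfolded M] normal_cube[OF LV LV X] inner_L S3' g sq sum_square_add sum_square_diff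
        using S4' by (simp add: field_simps power2_eq_square power3_eq_cube)
      then show ?thesis using Sf c by simp
    qed
    show ?thesis
      by (rule congruent_cubicsI[OF cub _ fB _ val])
        (use c form_complex_doubling[OF form_g_cubic[OF l]] n' in \<open>auto simp: cubic_form_iff\<close>)
  next
    fix b assume b: "onframe V2 N b"
      and S3: "\<And>x. sqrt 2 * S (\<Sum>i<N. x i *\<^sub>R b i) (\<Sum>i<N. x i *\<^sub>R b i) (\<Sum>i<N. x i *\<^sub>R b i)
         = x 0^3 - 3 * x 0 * (\<Sum>i<N - 1. (x (Suc i))^2)"
    let ?L = "\<lambda>x. \<Sum>i<N. x i *\<^sub>R b i"
    define M where "M = 3 * l + 1"
    have NM: "N = Suc M" by (simp add: N_def M_def)
    have bV: "b i \<in> V2" "J (b i) \<in> V3" if "i < N" for i using onframe_in[OF b that] J_V3 by auto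
    note LV = onframe_lin[OF b]
    define a r where "a = 1 / sqrt 3" and "r = sqrt 2"
    have ar: "a * a = 1/3" "r * r = 2" "a * (a * z) = z / 3" "r * (r * z) = 2 * z" for z
      by (simp_all add: a_def r_def)
    \<comment> \<open>New coordinates adapted to the factorization \<open>u (v^2 - P)\<close>:
      \<open>x 0 + i x 1\<close> is the complexified \<open>u\<close>, and
      \<open>x 2 - i x (2 + N)\<close> is \<open>v\<close>. In the remaining coordinates the
      imaginary parts go to the first block and the real parts to the second, because
      \<open>P\<close> has the sign opposite to \<open>v^2\<close>.\<close>
    define C1 where "C1 i = (if i = 0 then (r * a) *\<^sub>R e - a *\<^sub>R b 0 else J (b i))" for i
    define C2 where "C2 i = (if i = 0 then a *\<^sub>R J (b 0) - (r * a) *\<^sub>R xi else b i)" for i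
    define B0 where "B0 = a *\<^sub>R e + (r * a) *\<^sub>R b 0"
    define B1 where "B1 = a *\<^sub>R xi + (r * a) *\<^sub>R J (b 0)"
    define B where "B = append_frame 1 (\<lambda>_. B0) (append_frame 1 (\<lambda>_. B1) (append_frame N C1 C2))"
    have ob: "b i \<bullet> b j = (if i = j then 1 else 0)" "J (b i) \<bullet> J (b j) = (if i = j then 1 else 0)" if "i < N" "j < N" for i j
      using orthonormalD[OF onframe_orthonormal[OF b] that] bV that by (auto simp: J_inner)
    have N0: "0 < N" by (simp add: NM)
    note inn = inner_add_left inner_add_right inner_diff_left inner_diff_right NF.orth ob bV N0
    have "orthonormal (1 + (1 + (N + N))) B"
      unfolding B_def
    proof (intro orthonormal_append orthonormal_1)
      show "orthonormal N C1" "orthonormal N C2"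
        unfolding orthonormal_def C1_def C2_def by (auto simp: inn ar mult_ac)
      show "B0 \<bullet> B0 = 1" "B1 \<bullet> B1 = 1" by (simp_all add: B0_def B1_def inn ar mult_ac)
      show "C1 i \<bullet> C2 j = 0" if "i < N" "j < N" for i j
        using that by (simp add: C1_def C2_def inn)
      show "B1 \<bullet> append_frame N C1 C2 j = 0" if "j < N + N" for j
        using that by (auto simp: append_frame_def B1_def C1_def C2_def inn mult_ac)
      show "B0 \<bullet> append_frame 1 (\<lambda>_. B1) (append_frame N C1 C2) j = 0" if "j < 1 + (N + N)" for j
        using that by (auto simp: append_frame_def B0_def B1_def C1_def C2_def inn mult_ac)
    qed
    moreover have n2: "n = 1 + (1 + (N + N))" using n by simp
    moreover have C_in: "C1 i \<in> euclid n" "C2 i \<in> euclid n" if "i < N" for i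
      using that bV(1)[THEN NF.in_V(3)] bV(2)[THEN NF.in_V(4)] N0 by (auto simp: C1_def C2_def)
    have "B0 \<in> euclid n" "B1 \<in> euclid n"
      using bV(1)[OF N0, THEN NF.in_V(3)] bV(2)[OF N0, THEN NF.in_V(4)] by (auto simp: B0_def B1_def)
    then have "B i \<in> euclid n" if "i < n" for i
      using that C_in by (auto simp: B_def append_frame_def n2)
    ultimately have fB: "onframe (euclid n) n B" by (intro frame) (simp_all only:)
    have inner_L: "?L x \<bullet> ?L y = x 0 * y 0 + (\<Sum>i<M. x (Suc i) * y (Suc i))" for x y
      unfolding orthonormal_inner[OF onframe_orthonormal[OF b]] unfolding NM sum.lessThan_Suc_shift by simp
    have val: "pval (crd (\<Sum>i<n. x i *\<^sub>R B i)) f = (9 * a / 2 / c) * pval x (clifford_cubic N 1 (refl_pair N))" for x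
    proof -
      define t where "t = a * x 0 + r * a * x 2"
      define p0 where "p0 = r * a * x 0 - a * x 2"
      define s where "s = a * x 1 - r * a * x (2 + N)"
      define q0 where "q0 = r * a * x 1 + a * x (2 + N)"
      define p where "p i = (if i = 0 then p0 else x (2 + N + i))" for i
      define q where "q i = (if i = 0 then q0 else x (2 + i))" for i
      define PP where "PP = (\<Sum>i<M. x (2 + N + Suc i) * x (2 + N + Suc i))"
      define QQ where "QQ = (\<Sum>i<M. x (2 + Suc i) * x (2 + Suc i))"
      define PQ where "PQ = (\<Sum>i<M. x (2 + N + Suc i) * x (2 + Suc i))"
      have X: "(\<Sum>i<n. x i *\<^sub>R B i) = t *\<^sub>R e + s *\<^sub>R xi + ?L p + J (?L q)"
        unfolding n2 B_def
        apply (subst sum_append_frame, subst sum_append_frame, subst sum_append_frame)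
        unfolding NM sum.lessThan_Suc_shift
        by (simp add: J_sum J_linear C1_def C2_def B0_def B1_def p_def q_def t_def s_def p0_def q0_def NM numeral_2_eq_2 algebra_simps)
      have sums: "?L p \<bullet> ?L p = p0^2 + PP" "?L q \<bullet> ?L q = q0^2 + QQ" "?L p \<bullet> ?L q = p0 * q0 + PQ"
        unfolding inner_L by (simp_all add: p_def q_def PP_def QQ_def PQ_def power2_eq_square)
      have add: "?L p + ?L q = ?L (\<lambda>i. p i + q i)" "?L p + (- ?L q) = ?L (\<lambda>i. p i - q i)"
        by (simp_all add: scaleR_left_distrib scaleR_left_diff_distrib sum.distrib sum_subtractf)
      have S3': "S (?L y) (?L y) (?L y) = (r / 2) * (y 0^3 - 3 * y 0 * (\<Sum>i<M. (y (Suc i))^2))" for y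
      proof -
        have "2 * S (?L y) (?L y) (?L y) = r * (sqrt 2 * S (?L y) (?L y) (?L y))" by (simp add: r_def)
        then show ?thesis unfolding S3 by (simp add: NM)
      qed
      have sq: "(\<Sum>i<M. (p (Suc i) + q (Suc i))^2) = PP + 2 * PQ + QQ" "(\<Sum>i<M. (p (Suc i) - q (Suc i))^2) = PP - 2 * PQ + QQ"
        "(\<Sum>i<M. (p (Suc i))^2) = PP"
        unfolding sum_square_add sum_square_diff by (simp_all add: PP_def QQ_def PQ_def p_def q_def power2_eq_square)
      have "S (?L p + ?L q) (?L p + ?L q) (?L p + ?L q) + S (?L p + (- ?L q)) (?L p + (- ?L q)) (?L p + (- ?L q))
          = 2 * S (?L p) (?L p) (?L p) + 6 * S (?L p) (?L q) (?L q)"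
        unfolding NF.S_cube_add by simp
      note S4' = this[unfolded add S3' sq]
      have S4: "3 * S (?L p) (?L q) (?L q) = (r/2) * (((p0 + q0)^3 - 3 * (p0 + q0) * (PP + 2 * PQ + QQ)) + ((p0 - q0)^3 - 3 * (p0 - q0) * (PP - 2 * PQ + QQ))) / 2
       - (r/2) * (p0^3 - 3 * p0 * PP)"
        using S4' by (simp add: p_def q_def field_simps)
      have Spp: "S (?L p) (?L p) (?L p) = (r/2) * (p0^3 - 3 * p0 * PP)" unfolding S3' sq by (simp add: p_def)
      have "S (\<Sum>i<n. x i *\<^sub>R B i) (\<Sum>i<n. x i *\<^sub>R B i) (\<Sum>i<n. x i *\<^sub>R B i)
        = 9 * a / 2 * (x 0 * ((x 2)^2 + QQ - ((x (2 + N))^2 + PP)) + 2 * x 1 * (x 2 * x (2 + N) + PQ))"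
        unfolding normal_cube[OF LV LV X] sums S4 Spp
        by (rule reducible_identity[OF ar(2) ar(1) t_def p0_def s_def q0_def])
      also have "x 0 * ((x 2)^2 + QQ - ((x (2 + N))^2 + PP)) + 2 * x 1 * (x 2 * x (2 + N) + PQ)
          = pval x (clifford_cubic N 1 (refl_pair N))"
        unfolding pval_refl_pair PP_def QQ_def PQ_def NM sum.lessThan_Suc_shift
        by (simp add: sum_subtractf power2_eq_square numeral_2_eq_2 algebra_simps)
      finally show ?thesis using Sf c by (simp add: field_simps)
    qed
    have "congruent_cubics n f (clifford_cubic N 1 (refl_pair N))"
    proof (rule congruent_cubicsI[OF cub _ fB _ val])
      show "cubic_form n (clifford_cubic N 1 (refl_pair N))"
        using form_clifford_cubic[of 1 N "refl_pair N"] by (simp add: cubic_form_iff n2 mult_2)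
      show "9 * a / 2 / c \<noteq> 0" using c by (simp add: a_def)
    qed
    moreover have "symmetric_clifford_system N 1 (refl_pair N)" by (rule refl_pair_clifford) (simp add: NM)
    moreover have "n = 1 + 1 + 2 * N" using n2 by simp
    ultimately have False using exc unfolding exceptional_def congruence_def by blast
    then show ?thesis ..
  qed
qed

section \<open>The eiconal equation for the Cartan polynomials\<close>

lemma cd_mult_step:
  fixes x y :: "nat \<Rightarrow> 'a::comm_ring_1"
  assumes "1 \<le> h"
  shows "i < h \<Longrightarrow> cd_mult (2 * h) x y i = cd_mult h x y i - cd_mult h (cd_conj (\<lambda>j. y (h + j))) (\<lambda>j. x (h + j)) i"
    and "\<not> i < h \<Longrightarrow> cd_mult (2 * h) x y i = cd_mult h (\<lambda>j. y (h + j)) x (i - h) + cd_mult h (\<lambda>j. x (h + j)) (cd_conj y) (i - h)"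
  using assms by (subst cd_mult.simps; simp add: Let_def)+

lemma cd_mult_1: "cd_mult (Suc 0) x y i = x 0 * y 0"
  by (simp add: cd_mult.simps)

lemma cd_mult_2: "cd_mult 2 x y 0 = x 0 * y 0 - x 1 * y 1" "cd_mult 2 x y (Suc 0) = x 0 * y 1 + x 1 * y 0"
  by (subst cd_mult.simps, simp add: Let_def cd_mult_1 cd_conj_def algebra_simps)+

lemma cd_mult_4:
  "cd_mult 4 x y 0 = x 0 * y 0 - x 1 * y 1 - x 2 * y 2 - x 3 * y 3"
  "cd_mult 4 x y (Suc 0) = x 0 * y 1 + x 1 * y 0 + x 2 * y 3 - x 3 * y 2"
  "cd_mult 4 x y 2 = x 0 * y 2 - x 1 * y 3 + x 2 * y 0 + x 3 * y 1"
  "cd_mult 4 x y 3 = x 0 * y 3 + x 1 * y 2 - x 2 * y 1 + x 3 * y 0"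
  using cd_mult_step(1)[of 2 0 x y] cd_mult_step(1)[of 2 1 x y] cd_mult_step(2)[of 2 2 x y] cd_mult_step(2)[of 2 3 x y]
  by (simp_all add: cd_mult_2 cd_conj_def algebra_simps del: add_2_eq_Suc add_2_eq_Suc')

lemma cd_mult_8:
  "cd_mult 8 x y 0 = x 0 * y 0 - x 1 * y 1 - x 2 * y 2 - x 3 * y 3 - x 4 * y 4 - x 5 * y 5 - x 6 * y 6 - x 7 * y 7"
  "cd_mult 8 x y (Suc 0) = x 0 * y 1 + x 1 * y 0 + x 2 * y 3 - x 3 * y 2 + x 4 * y 5 - x 5 * y 4 - x 6 * y 7 + x 7 * y 6"
  "cd_mult 8 x y 2 = x 0 * y 2 - x 1 * y 3 + x 2 * y 0 + x 3 * y 1 + x 4 * y 6 + x 5 * y 7 - x 6 * y 4 - x 7 * y 5"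
  "cd_mult 8 x y 3 = x 0 * y 3 + x 1 * y 2 - x 2 * y 1 + x 3 * y 0 + x 4 * y 7 - x 5 * y 6 + x 6 * y 5 - x 7 * y 4"
  "cd_mult 8 x y 4 = x 0 * y 4 - x 1 * y 5 - x 2 * y 6 - x 3 * y 7 + x 4 * y 0 + x 5 * y 1 + x 6 * y 2 + x 7 * y 3"
  "cd_mult 8 x y 5 = x 0 * y 5 + x 1 * y 4 - x 2 * y 7 + x 3 * y 6 - x 4 * y 1 + x 5 * y 0 - x 6 * y 3 + x 7 * y 2"
  "cd_mult 8 x y 6 = x 0 * y 6 + x 1 * y 7 + x 2 * y 4 - x 3 * y 5 - x 4 * y 2 + x 5 * y 3 + x 6 * y 0 - x 7 * y 1"
  "cd_mult 8 x y 7 = x 0 * y 7 - x 1 * y 6 + x 2 * y 5 + x 3 * y 4 - x 4 * y 3 - x 5 * y 2 + x 6 * y 1 + x 7 * y 0"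
  using cd_mult_step(1)[of 4 0 x y] cd_mult_step(1)[of 4 1 x y] cd_mult_step(1)[of 4 2 x y] cd_mult_step(1)[of 4 3 x y]
    cd_mult_step(2)[of 4 4 x y] cd_mult_step(2)[of 4 5 x y] cd_mult_step(2)[of 4 6 x y] cd_mult_step(2)[of 4 7 x y]
  by (simp_all add: cd_mult_4 cd_conj_def algebra_simps)

lemma sums_lessThan:
  fixes g :: "nat \<Rightarrow> 'a::comm_monoid_add"
  shows "sum g {..<2} = g 0 + g (Suc 0)" "sum g {..<4} = g 0 + g (Suc 0) + g 2 + g 3"
    "sum g {..<8} = g 0 + g (Suc 0) + g 2 + g 3 + g 4 + g 5 + g 6 + g 7"
  by (simp_all add: eval_nat_numeral)

text \<open>Expansion of the multiplication tables: the identities of two, four and eight squares.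
  This composition law is where the values 1, 2, 4, 8 are essential to the converse.\<close>

lemma cd_mult_norm:
  fixes x y :: "nat \<Rightarrow> real"
  assumes "l \<in> {1, 2, 4, 8}"
  shows "(\<Sum>i<l. (cd_mult l x y i)^2) = (\<Sum>i<l. (x i)^2) * (\<Sum>i<l. (y i)^2)"
proof -
  consider "l = 1" | "l = 2" | "l = 4" | "l = 8" using assms by auto
  then show ?thesis
  proof cases
    case 1
    then show ?thesis by (simp add: cd_mult_1 power_mult_distrib)
  next
    case 2
    show ?thesis
      unfolding 2 sums_lessThan(1) cd_mult_2 One_nat_def by (simp add: power2_eq_square algebra_simps)
  next
    case 3
    show ?thesis
      unfolding 3 sums_lessThan(2) cd_mult_4 One_nat_def by (simp add: power2_eq_square algebra_simps)
  next
    case 4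
    show ?thesis
      unfolding 4 sums_lessThan(3) cd_mult_8 One_nat_def by (simp add: power2_eq_square algebra_simps)
  qed
qed

text \<open>Lets any of the three arguments be brought to the last place, so that the derivatives of
  \<open>Re (z1 z2 z3)\<close> in all three follow from \<open>tau_sum\<close>.\<close>

lemma cd_mult_cyclic:
  fixes x y z :: "nat \<Rightarrow> real"
  assumes "l \<in> {1, 2, 4, 8}"
  shows "cd_mult l (cd_mult l x y) z 0 = cd_mult l (cd_mult l y z) x 0"
proof -
  consider "l = 1" | "l = 2" | "l = 4" | "l = 8" using assms by auto
  then show ?thesis
  proof cases
    case 1
    then show ?thesis by (simp add: cd_mult_1)
  next
    case 2
    show ?thesis
      unfolding 2 cd_mult_2 One_nat_def by (simp add: power2_eq_square algebra_simps)
  next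
    case 3
    show ?thesis
      unfolding 3 cd_mult_4 One_nat_def by (simp add: power2_eq_square algebra_simps)
  next
    case 4
    show ?thesis
      unfolding 4 cd_mult_8 One_nat_def by (simp add: power2_eq_square algebra_simps)
  qed
qed

lemma cd_conj_linear: "cd_conj (\<lambda>i. x i + c * x' i) i = cd_conj x i + c * cd_conj x' (i :: nat)"
  by (simp add: cd_conj_def)

lemma cd_mult_linear:
  fixes x y :: "nat \<Rightarrow> real"
  shows cd_mult_linear_left: "cd_mult (2 ^ k) (\<lambda>i. x i + c * x' i) y i = cd_mult (2 ^ k) x y i + c * cd_mult (2 ^ k) x' y i"
    and cd_mult_linear_right: "cd_mult (2 ^ k) x (\<lambda>i. y i + c * y' i) i = cd_mult (2 ^ k) x y i + c * cd_mult (2 ^ k) x y' i"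
proof (induction k arbitrary: x x' y y' i)
  case 0
  show "cd_mult (2 ^ 0) (\<lambda>i. x i + c * x' i) y i = cd_mult (2 ^ 0) x y i + c * cd_mult (2 ^ 0) x' y i"
    "cd_mult (2 ^ 0) x (\<lambda>i. y i + c * y' i) i = cd_mult (2 ^ 0) x y i + c * cd_mult (2 ^ 0) x y' i" for x x' y y' i
    by (simp_all add: cd_mult_1 algebra_simps)
next
  case (Suc k)
  have h: "1 \<le> (2 ^ k :: nat)" by simp
  have conj: "cd_conj (\<lambda>j. f j + c * g j) = (\<lambda>j. cd_conj f j + c * cd_conj g j)" for f g :: "nat \<Rightarrow> real"
    by (rule ext) (rule cd_conj_linear)
  show "cd_mult (2 ^ Suc k) (\<lambda>i. x i + c * x' i) y i = cd_mult (2 ^ Suc k) x y i + c * cd_mult (2 ^ Suc k) x' y i"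
    "cd_mult (2 ^ Suc k) x (\<lambda>i. y i + c * y' i) i = cd_mult (2 ^ Suc k) x y i + c * cd_mult (2 ^ Suc k) x y' i" for x x' y y' i
    by (cases "i < 2 ^ k"; simp add: cd_mult_step[OF h] Suc.IH conj algebra_simps)+
qed

lemma sum_split: "(\<Sum>i<m + n. g i) = (\<Sum>i<m. g i) + (\<Sum>i<n. g (m + i :: nat) :: real)"
  using sum_append_frame[of "\<lambda>i _. g i" m "\<lambda>_. ()" "\<lambda>_. ()" n] by simp

lemma sum_lincomb_sq:
  "(\<Sum>i<(n::nat). (c * f i + s * g i)^2) = c^2 * (\<Sum>i<n. (f i)^2) + 2 * c * s * (\<Sum>i<n. f i * g i) + s^2 * (\<Sum>i<n. (g i :: real)^2)"
  by (induction n) (simp_all add: power2_eq_square algebra_simps)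

lemma sum_lincomb_mult:
  "(\<Sum>i<(n::nat). (c * f i + s * g i) * h i) = c * (\<Sum>i<n. f i * h i) + s * (\<Sum>i<n. g i * h i :: real)"
  by (simp add: distrib_right sum.distrib sum_distrib_left mult.assoc)

definition tau :: "nat \<Rightarrow> (nat \<Rightarrow> real) \<Rightarrow> (nat \<Rightarrow> real) \<Rightarrow> (nat \<Rightarrow> real) \<Rightarrow> real" where
  "tau l a b c = cd_mult l (cd_mult l a b) c 0"

context
  fixes l k :: nat
  assumes l: "l \<in> {1, 2, 4, 8}" and k: "l = 2 ^ k"
begin

lemma tau_cyclic: "tau l a b c = tau l b c a"
  unfolding tau_def by (rule cd_mult_cyclic[OF l])

lemma tau_sum: "tau l a b c = (\<Sum>i<l. cd_conj (cd_mult l a b) i * c i)"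
  unfolding tau_def k cd_mult_0 by (rule sum.cong) (auto simp: cd_conj_def)

lemma tau_linear:
  "tau l (\<lambda>i. a i + r * a' i) b c = tau l a b c + r * tau l a' b c"
  "tau l a (\<lambda>i. b i + r * b' i) c = tau l a b c + r * tau l a b' c"
  "tau l a b (\<lambda>i. c i + r * c' i) = tau l a b c + r * tau l a b c'"
proof -
  show 1: "tau l (\<lambda>i. a i + r * a' i) b c = tau l a b c + r * tau l a' b c" for a a' b c
    unfolding tau_def k
    unfolding cd_mult_linear_left[of k a r a' b, THEN ext] by (rule cd_mult_linear_left)
  show "tau l a (\<lambda>i. b i + r * b' i) c = tau l a b c + r * tau l a b' c"
    using 1[of b b' c a] by (simp add: tau_cyclic[of a])
  show "tau l a b (\<lambda>i. c i + r * c' i) = tau l a b c + r * tau l a b c'"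
    using 1[of c c' a b] by (simp add: tau_cyclic[of c] tau_cyclic[of c'] tau_cyclic[of "\<lambda>i. c i + r * c' i"])
qed

lemma tau_add:
  "tau l (\<lambda>i. a i + a' i) b c = tau l a b c + tau l a' b c"
  "tau l a (\<lambda>i. b i + b' i) c = tau l a b c + tau l a b' c"
  "tau l a b (\<lambda>i. c i + c' i) = tau l a b c + tau l a b c'"
  using tau_linear(1)[of a 1 a' b c] tau_linear(2)[of a b 1 b' c] tau_linear(3)[of a b c 1 c'] by simp_all

lemma tau_diff:
  "tau l (\<lambda>i. a i - a' i) b c = tau l a b c - tau l a' b c"
  "tau l a (\<lambda>i. b i - b' i) c = tau l a b c - tau l a b' c"
  "tau l a b (\<lambda>i. c i - c' i) = tau l a b c - tau l a b c'"
  using tau_linear(1)[of a "-1" a' b c] tau_linear(2)[of a b "-1" b' c] tau_linear(3)[of a b c "-1" c'] by simp_all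

lemma tau_odd_part:
  "tau l (\<lambda>i. a i + a' i) (\<lambda>i. b i + b' i) (\<lambda>i. c i + c' i) - tau l (\<lambda>i. a i - a' i) (\<lambda>i. b i - b' i) (\<lambda>i. c i - c' i)
    = 2 * (tau l a' b c + tau l a b' c + tau l a b c' + tau l a' b' c')"
  unfolding tau_add tau_diff by simp

lemma sum_blocks:
  "(\<Sum>i<3 * l + 2. g i :: real) = g 0 + g 1 + (\<Sum>i<l. g (2 + i)) + (\<Sum>i<l. g (2 + l + i)) + (\<Sum>i<l. g (2 + 2 * l + i))"
proof -
  have "3 * l + 2 = 2 + (l + (l + l))" by simp
  then show ?thesis unfolding \<open>3 * l + 2 = _\<close> sum_split by (simp add: eval_nat_numeral algebra_simps)
qed

definition blocks :: "real \<Rightarrow> real \<Rightarrow> (nat \<Rightarrow> real) \<Rightarrow> (nat \<Rightarrow> real) \<Rightarrow> (nat \<Rightarrow> real) \<Rightarrow> nat \<Rightarrow> real" where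
  "blocks a0 a1 A1 A2 A3 i = (if i = 0 then a0 else if i = 1 then a1 else if i < 2 + l then A1 (i - 2)
     else if i < 2 + 2 * l then A2 (i - 2 - l) else A3 (i - 2 - 2 * l))"

lemma theta_eiconal:
  obtains S where "trilinear_form S" "\<And>x. S x x x = theta_val l (crd x)" "eiconal S (euclid (3 * l + 2)) (3 * l + 2) unitv"
proof -
  let ?N = "3 * l + 2"
  have "homogeneous_poly 3 (theta l)" using form_theta[OF k] by (simp add: cubic_form_iff[symmetric] cubic_form_def)
  then obtain S where S: "trilinear_form S" and val: "\<And>x. S x x x = pval (crd x) (theta l)"
    by (rule cubic_trilinear) (rule that)
  note val = val[unfolded pval_theta]
  interpret cubic_space S "euclid ?N" ?N unitv
    using S by (simp add: cubic_space_def cubic_space_axioms_def onframe_euclid)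
  have "eiconal S (euclid ?N) ?N unitv"
  proof unfold_locales
    fix x assume x: "x \<in> euclid ?N"
    define x0 where "x0 = crd x 0"
    define x1 where "x1 = crd x 1"
    define a where "a = (\<lambda>i. crd x (2 + i))"
    define b where "b = (\<lambda>i. crd x (2 + l + i))"
    define c where "c = (\<lambda>i. crd x (2 + 2 * l + i))"
    define na where "na = (\<Sum>i<l. (a i)^2)"
    \<comment> \<open>The expected value of \<open>x \<star> x\<close> is one third of the gradient
      of the Cartan polynomial: \<open>y0\<close>, \<open>y1\<close> and, for the three algebra
      blocks, \<open>Y1\<close>, \<open>Y2\<close>, \<open>Y3\<close>. In each block the cubic term
      contributes the conjugate of the product of the other two, in cyclic order.\<close>
    define nb where "nb = (\<Sum>i<l. (b i)^2)"
    define nc where "nc = (\<Sum>i<l. (c i)^2)"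
    define y0 where "y0 = x0^2 + (na + nb - 2 * nc) / 2 - x1^2"
    define y1 where "y1 = - 2 * x0 * x1 + sqrt 3 / 2 * (na - nb)"
    define Y1 where "Y1 i = (x0 + sqrt 3 * x1) * a i + sqrt 3 * cd_conj (cd_mult l b c) i" for i
    define Y2 where "Y2 i = (x0 - sqrt 3 * x1) * b i + sqrt 3 * cd_conj (cd_mult l c a) i" for i
    define Y3 where "Y3 i = (- 2 * x0) * c i + sqrt 3 * cd_conj (cd_mult l a b) i" for i
    define y where "y = trunc ?N (blocks y0 y1 Y1 Y2 Y3)"
    have y: "y \<in> euclid ?N" by (simp add: y_def trunc_euclid)
    have crd_y: "crd y 0 = y0" "crd y 1 = y1" "\<And>i. i < l \<Longrightarrow> crd y (2 + i) = Y1 i"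
      "\<And>i. i < l \<Longrightarrow> crd y (2 + l + i) = Y2 i" "\<And>i. i < l \<Longrightarrow> crd y (2 + 2 * l + i) = Y3 i"
      unfolding y_def crd_trunc by (simp_all add: blocks_def)
    have "mul x x = y"
    proof (rule mul_eqI[OF y])
      fix z assume z: "z \<in> euclid ?N"
      define a' where "a' = (\<lambda>i. crd z (2 + i))"
      define b' where "b' = (\<lambda>i. crd z (2 + l + i))"
      define c' where "c' = (\<lambda>i. crd z (2 + 2 * l + i))"
      have tau1: "tau l a' b c = (\<Sum>i<l. cd_conj (cd_mult l b c) i * a' i)" by (subst tau_cyclic) (rule tau_sum)
      have tau2: "tau l a b' c = (\<Sum>i<l. cd_conj (cd_mult l c a) i * b' i)" by (subst tau_cyclic, subst tau_cyclic) (rule tau_sum)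
      have tau3: "tau l a b c' = (\<Sum>i<l. cd_conj (cd_mult l a b) i * c' i)" by (rule tau_sum)
      \<comment> \<open>The difference of the cubes at \<open>x + z\<close> and \<open>x - z\<close>
        is \<open>6 S x x z + 2 S z z z\<close>.\<close>
      have 6: "6 * S x x z = theta_val l (crd (x + z)) - theta_val l (crd (x + (- z))) - 2 * theta_val l (crd z)"
        unfolding val[symmetric] S_cube_add by simp
      have sq: "(\<Sum>i<l. (f i + g i)^2) = (\<Sum>i<l. (f i)^2) + 2 * (\<Sum>i<l. f i * g i) + (\<Sum>i<l. (g i)^2)"
        "(\<Sum>i<l. (f i - g i)^2) = (\<Sum>i<l. (f i)^2) - 2 * (\<Sum>i<l. f i * g i) + (\<Sum>i<l. (g i)^2)" for f g :: "nat \<Rightarrow> real"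
        unfolding sum_square_add sum_square_diff by (simp_all add: power2_eq_square)
      have th: "theta_val l (crd (x + z)) = (x0 + crd z 0)^3 + 3/2 * (x0 + crd z 0) * ((\<Sum>i<l. (a i + a' i)^2) + (\<Sum>i<l. (b i + b' i)^2) - 2 * (\<Sum>i<l. (c i + c' i)^2) - 2 * (x1 + crd z 1)^2)
          + 3 * sqrt 3 / 2 * (x1 + crd z 1) * ((\<Sum>i<l. (a i + a' i)^2) - (\<Sum>i<l. (b i + b' i)^2)) + 3 * sqrt 3 * tau l (\<lambda>i. a i + a' i) (\<lambda>i. b i + b' i) (\<lambda>i. c i + c' i)"
        "theta_val l (crd (x + (- z))) = (x0 - crd z 0)^3 + 3/2 * (x0 - crd z 0) * ((\<Sum>i<l. (a i - a' i)^2) + (\<Sum>i<l. (b i - b' i)^2) - 2 * (\<Sum>i<l. (c i - c' i)^2) - 2 * (x1 - crd z 1)^2)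
          + 3 * sqrt 3 / 2 * (x1 - crd z 1) * ((\<Sum>i<l. (a i - a' i)^2) - (\<Sum>i<l. (b i - b' i)^2)) + 3 * sqrt 3 * tau l (\<lambda>i. a i - a' i) (\<lambda>i. b i - b' i) (\<lambda>i. c i - c' i)"
        "theta_val l (crd z) = (crd z 0)^3 + 3/2 * crd z 0 * ((\<Sum>i<l. (a' i)^2) + (\<Sum>i<l. (b' i)^2) - 2 * (\<Sum>i<l. (c' i)^2) - 2 * (crd z 1)^2)
          + 3 * sqrt 3 / 2 * crd z 1 * ((\<Sum>i<l. (a' i)^2) - (\<Sum>i<l. (b' i)^2)) + 3 * sqrt 3 * tau l a' b' c'"
        by (simp_all add: theta_val_def Let_def tau_def a_def b_def c_def a'_def b'_def c'_def x0_def x1_def)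
      define pa where "pa = (\<Sum>i<l. a i * a' i)"
      define pb where "pb = (\<Sum>i<l. b i * b' i)"
      define pc where "pc = (\<Sum>i<l. c i * c' i)"
      define na' where "na' = (\<Sum>i<l. (a' i)^2)"
      define nb' where "nb' = (\<Sum>i<l. (b' i)^2)"
      define nc' where "nc' = (\<Sum>i<l. (c' i)^2)"
      define T where "T = tau l a' b c + tau l a b' c + tau l a b c'"
      define Tp where "Tp = tau l (\<lambda>i. a i + a' i) (\<lambda>i. b i + b' i) (\<lambda>i. c i + c' i)"
      define Tm where "Tm = tau l (\<lambda>i. a i - a' i) (\<lambda>i. b i - b' i) (\<lambda>i. c i - c' i)"
      have TT: "Tp = Tm + 2 * (T + tau l a' b' c')"
        using tau_odd_part[of a a' b b' c c'] by (simp add: Tp_def Tm_def T_def)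
      have "6 * S x x z = 6 * (y0 * crd z 0 + y1 * crd z 1 + (x0 + sqrt 3 * x1) * pa + (x0 - sqrt 3 * x1) * pb - 2 * x0 * pc + sqrt 3 * T)"
        unfolding 6 th sq pa_def[symmetric] pb_def[symmetric] pc_def[symmetric] na_def[symmetric] nb_def[symmetric] nc_def[symmetric]
          na'_def[symmetric] nb'_def[symmetric] nc'_def[symmetric] Tp_def[symmetric] Tm_def[symmetric] TT y0_def y1_def
        by (simp add: power2_eq_square power3_eq_cube field_simps)
      also have "y0 * crd z 0 + y1 * crd z 1 + (x0 + sqrt 3 * x1) * pa + (x0 - sqrt 3 * x1) * pb - 2 * x0 * pc + sqrt 3 * T
          = y0 * crd z 0 + y1 * crd z 1 + (\<Sum>i<l. Y1 i * a' i) + (\<Sum>i<l. Y2 i * b' i) + (\<Sum>i<l. Y3 i * c' i)"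
        unfolding Y1_def Y2_def Y3_def T_def tau1 tau2 tau3 pa_def pb_def pc_def sum_lincomb_mult by (simp add: distrib_left)
      also have "\<dots> = (\<Sum>i<?N. crd y i * crd z i)"
        unfolding sum_blocks by (simp add: crd_y crd_y(2)[unfolded One_nat_def] a'_def b'_def c'_def del: add_2_eq_Suc add_2_eq_Suc')
      also have "\<dots> = inner y z" by (rule inner_euclid[OF y, symmetric])
      finally show "S x x z = inner y z" by simp
    qed
    have conj_sq: "(\<Sum>i<l. (cd_conj f i)^2) = (\<Sum>i<l. (f i)^2)" for f :: "nat \<Rightarrow> real"
      by (intro sum.cong) (auto simp: cd_conj_def)
    define t0 where "t0 = tau l a b c"
    have t: "(\<Sum>i<l. a i * cd_conj (cd_mult l b c) i) = t0" "(\<Sum>i<l. b i * cd_conj (cd_mult l c a) i) = t0"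
      "(\<Sum>i<l. c i * cd_conj (cd_mult l a b) i) = t0"
      unfolding t0_def using tau_sum[of b c a] tau_sum[of c a b] tau_sum[of a b c] tau_cyclic[of a b c] tau_cyclic[of b c a]
      by (simp_all add: mult.commute)
    have s3: "sqrt 3 * sqrt 3 = 3" "\<And>z. sqrt 3 * (sqrt 3 * z) = 3 * z" by (simp_all flip: mult.assoc)
    have "inner y y = (\<Sum>i<?N. (crd y i)^2)" unfolding inner_euclid[OF y] by (simp add: power2_eq_square)
    also have "\<dots> = y0^2 + y1^2 + (\<Sum>i<l. (Y1 i)^2) + (\<Sum>i<l. (Y2 i)^2) + (\<Sum>i<l. (Y3 i)^2)"
      unfolding sum_blocks by (simp add: crd_y crd_y(2)[unfolded One_nat_def] del: add_2_eq_Suc add_2_eq_Suc')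
    \<comment> \<open>The cross terms in \<open>t0\<close> have coefficients proportional to
      \<open>x0 + sqrt 3 x1\<close>, \<open>x0 - sqrt 3 x1\<close> and \<open>- 2 x0\<close>, whose
      sum is 0. The composition law turns the squares of the products into \<open>nb * nc\<close>,
      \<open>nc * na\<close> and \<open>na * nb\<close>.\<close>
    also have "\<dots> = (x0^2 + x1^2 + na + nb + nc)^2"
      unfolding Y1_def Y2_def Y3_def sum_lincomb_sq t conj_sq cd_mult_norm[OF l] na_def[symmetric] nb_def[symmetric] nc_def[symmetric]
        y0_def y1_def
      by (simp add: power2_eq_square s3 field_simps)
    also have "x0^2 + x1^2 + na + nb + nc = (\<Sum>i<?N. (crd x i)^2)"
      unfolding sum_blocks by (simp add: x0_def x1_def na_def nb_def nc_def a_def b_def c_def)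
    also have "\<dots> = inner x x" unfolding inner_euclid[OF x] by (simp add: power2_eq_square)
    finally show "inner (mul x x) (mul x x) = (inner x x)^2" unfolding \<open>mul x x = y\<close> .
  qed
  with S val that show ?thesis by blast
qed

end

section \<open>Coordinate blocks\<close>

definition part :: "nat \<Rightarrow> nat \<Rightarrow> fsvec \<Rightarrow> fsvec" where
  "part a b x = trunc b (\<lambda>i. crd x (a + i))"

definition shift :: "nat \<Rightarrow> nat \<Rightarrow> fsvec \<Rightarrow> fsvec" where
  "shift a b x = trunc (a + b) (\<lambda>i. if i < a then 0 else crd x (i - a))"

lemma crd_part: "crd (part a b x) i = (if i < b then crd x (a + i) else 0)"
  by (simp add: part_def crd_trunc)

lemma crd_shift: "crd (shift a b x) i = (if i < a + b \<and> a \<le> i then crd x (i - a) else 0)"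
  by (simp add: shift_def crd_trunc)

lemma part_euclid [simp, intro]: "part a b x \<in> euclid b"
  by (simp add: part_def trunc_euclid)

lemma shift_euclid [simp, intro]: "shift a b x \<in> euclid (a + b)"
  by (simp add: shift_def trunc_euclid)

lemma euclid_mono: "x \<in> euclid a \<Longrightarrow> a \<le> b \<Longrightarrow> x \<in> euclid b"
  by (simp add: euclid_def)

lemma part_linear [simp]:
  "part a b (x + y) = part a b x + part a b y" "part a b (x - y) = part a b x - part a b y"
  "part a b (c *\<^sub>R x) = c *\<^sub>R part a b x" "part a b 0 = 0"
  by (simp_all add: fsvec_eqI crd_part)

lemma part_shift: "part 0 a (shift a b x) = 0" "x \<in> euclid b \<Longrightarrow> part a b (shift a b x) = x"
  by (auto intro!: fsvec_eqI simp: crd_part crd_shift euclid_def)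

lemma part_id: "x \<in> euclid b \<Longrightarrow> part 0 b x = x"
  and part_zero: "x \<in> euclid a \<Longrightarrow> part a b x = 0"
  by (auto intro!: fsvec_eqI simp: crd_part euclid_def)

lemma part_unitv:
  "part 0 b (unitv i) = (if i < b then unitv i else 0)" "i < b \<Longrightarrow> part a b (unitv (a + i)) = unitv i"
  by (auto intro!: fsvec_eqI simp: crd_part crd_unitv)

lemma part_part: "b' \<le> b \<Longrightarrow> part 0 b' (part a b x) = part a b' x"
  by (auto intro!: fsvec_eqI simp: crd_part)

lemma inner_part: "x \<in> euclid a \<Longrightarrow> x \<bullet> y = x \<bullet> part 0 a y"
  by (simp add: inner_euclid crd_part)

lemma inner_shift: "x \<in> euclid b \<Longrightarrow> shift a b x \<bullet> y = x \<bullet> part a b y"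
  by (simp add: inner_euclid[OF shift_euclid] inner_euclid sum_split crd_shift crd_part)

lemma inner_parts: "x \<in> euclid (a + b) \<Longrightarrow> x \<bullet> y = part 0 a x \<bullet> part 0 a y + part a b x \<bullet> part a b y"
  by (simp add: inner_euclid[OF part_euclid] inner_euclid sum_split crd_part)

section \<open>Complex doubling\<close>

text \<open>The identity says that \<open>z \<mapsto> z \<star> z\<close> is an involution up to scalars; it extends to complex
  vectors, where it expresses the radial eigencubic equation of the doubled form.\<close>

locale square_square = cubic_space S "euclid d" d unitv
  for S :: "fsvec \<Rightarrow> fsvec \<Rightarrow> fsvec \<Rightarrow> real" and d :: nat +
  assumes square_square: "x \<in> euclid d \<Longrightarrow> mul (mul x x) (mul x x) = S x x x *\<^sub>R x"
begin

abbreviation lo where "lo \<equiv> part 0 d"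
abbreviation hi where "hi \<equiv> part d d"

text \<open>The real part of the complex trilinear extension of \<open>S\<close>, with
  \<open>lo\<close> as real and \<open>hi\<close> as imaginary part.\<close>

definition dbl :: "fsvec \<Rightarrow> fsvec \<Rightarrow> fsvec \<Rightarrow> real" where
  "dbl x y z = S (lo x) (lo y) (lo z) - S (lo x) (hi y) (hi z) - S (hi x) (lo y) (hi z) - S (hi x) (hi y) (lo z)"

lemma trilinear_dbl: "trilinear_form dbl"
proof
  show "dbl (x + y) z w = dbl x z w + dbl y z w" for x y z w by (simp add: dbl_def)
  show "dbl (c *\<^sub>R x) z w = c * dbl x z w" for c x z w by (simp add: dbl_def right_diff_distrib)
  show "dbl x y z = dbl y x z" for x y z
    unfolding dbl_def using S_swap12[of "lo x" "lo y" "lo z"] S_swap12[of "lo x" "hi y" "hi z"]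
      S_swap12[of "hi x" "lo y" "hi z"] S_swap12[of "hi x" "hi y" "lo z"] by linarith
  show "dbl x y z = dbl x z y" for x y z
    unfolding dbl_def using S_swap23[of "lo x" "lo y" "lo z"] S_swap23[of "lo x" "hi y" "hi z"]
      S_swap23[of "hi x" "lo y" "hi z"] S_swap23[of "hi x" "hi y" "lo z"] by linarith
qed

text \<open>Coefficients in \<open>s\<close> of the identity at \<open>x + s y\<close>. They are
  what is needed to use it with the imaginary unit in place of \<open>s\<close>.\<close>

lemma square_square_polar:
  assumes [simp]: "x \<in> euclid d" "y \<in> euclid d" "z \<in> euclid d"
  defines "P \<equiv> mul x x" and "B \<equiv> mul x y" and "R \<equiv> mul y y"
  shows "S P P z = S x x x * (x \<bullet> z)"
    "4 * S P B z = S x x x * (y \<bullet> z) + 3 * S x x y * (x \<bullet> z)"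
    "4 * S B B z + 2 * S P R z = 3 * S x x y * (y \<bullet> z) + 3 * S x y y * (x \<bullet> z)"
    "4 * S B R z = 3 * S x y y * (y \<bullet> z) + S y y y * (x \<bullet> z)"
    "S R R z = S y y y * (y \<bullet> z)"
proof -
  have "S P P z + (4 * S P B z) * s + (4 * S B B z + 2 * S P R z) * s^2 + (4 * S B R z) * s^3 + S R R z * s^4
    = S x x x * (x \<bullet> z) + (S x x x * (y \<bullet> z) + 3 * S x x y * (x \<bullet> z)) * s
      + (3 * S x x y * (y \<bullet> z) + 3 * S x y y * (x \<bullet> z)) * s^2 + (3 * S x y y * (y \<bullet> z) + S y y y * (x \<bullet> z)) * s^3
      + (S y y y * (y \<bullet> z)) * s^4" for s
  proof -
    let ?v = "x + s *\<^sub>R y"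
    have sq: "mul ?v ?v = P + (2 * s) *\<^sub>R B + s^2 *\<^sub>R R"
      unfolding P_def B_def R_def
      by (rule inner_eqI) (simp add: mul_commute[of y x] inner_add_left power2_eq_square algebra_simps)
    have "S (mul ?v ?v) (mul ?v ?v) z = S ?v ?v ?v * (?v \<bullet> z)"
      using arg_cong[OF square_square[of ?v], of "\<lambda>w. w \<bullet> z"] by (simp add: inner_mul del: mul_linear S_add S_add2 S_add3)
    then show ?thesis
      unfolding sq S_cube_add
      by (simp add: S_swap12[of B P] S_swap12[of R P] S_swap12[of R B] inner_add_left power2_eq_square
          power3_eq_cube power4_eq_xxxx algebra_simps)
  qed
  from quartic_coeffs[OF this]
  show "S P P z = S x x x * (x \<bullet> z)"
    "4 * S P B z = S x x x * (y \<bullet> z) + 3 * S x x y * (x \<bullet> z)"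
    "4 * S B B z + 2 * S P R z = 3 * S x x y * (y \<bullet> z) + 3 * S x y y * (x \<bullet> z)"
    "4 * S B R z = 3 * S x y y * (y \<bullet> z) + S y y y * (x \<bullet> z)"
    "S R R z = S y y y * (y \<bullet> z)" by simp_all
qed

interpretation D: cubic_space dbl "euclid (d + d)" "d + d" unitv
  using trilinear_dbl by (simp add: cubic_space_def cubic_space_axioms_def onframe_euclid)

text \<open>The real gradient of the real part of a holomorphic cubic is the conjugate of the
  complex gradient. Here the latter is \<open>(P - R) + 2 i B\<close>, which explains the sign of
  \<open>- 2\<close>.\<close>

lemma dbl_square: "D.mul X X = (mul (lo X) (lo X) - mul (hi X) (hi X)) + shift d d ((- 2) *\<^sub>R mul (lo X) (hi X))"
proof (rule D.mul_eqI)
  let ?P = "mul (lo X) (lo X)" and ?R = "mul (hi X) (hi X)" and ?B = "mul (lo X) (hi X)"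
  show "?P - ?R + shift d d ((- 2) *\<^sub>R ?B) \<in> euclid (d + d)"
    by (intro D.V_closed(2) shift_euclid) (rule euclid_mono[of _ d], auto)
  fix Z
  have 1: "(?P - ?R) \<bullet> Z = (?P - ?R) \<bullet> lo Z" by (rule inner_part) auto
  have 2: "shift d d ((- 2) *\<^sub>R ?B) \<bullet> Z = ((- 2) *\<^sub>R ?B) \<bullet> hi Z" by (rule inner_shift) auto
  show "dbl X X Z = (?P - ?R + shift d d ((- 2) *\<^sub>R ?B)) \<bullet> Z"
    unfolding inner_add_left 1 2 using S_swap12[of "hi X" "lo X" "hi Z"]
    by (simp add: dbl_def inner_diff_left inner_mul)
qed

text \<open>In complex terms, with \<open>q = z \<star> z\<close>, the left side is the real part of
  \<open>S (z, conj q, conj q)\<close>. Conjugating \<open>q \<star> q = S(z,z,z) z\<close> and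
  pairing with \<open>z\<close> gives \<open>|z|^2 Re S(z,z,z)\<close>. The proof carries this out
  on real and imaginary parts.\<close>

lemma dbl_eigen: "dbl X (D.mul X X) (D.mul X X) = (lo X \<bullet> lo X + hi X \<bullet> hi X) * dbl X X X"
proof -
  define x where "x = lo X"
  define y where "y = hi X"
  define P where "P = mul x x"
  define B where "B = mul x y"
  define R where "R = mul y y"
  have [simp]: "x \<in> euclid d" "y \<in> euclid d" "P \<in> euclid d" "B \<in> euclid d" "R \<in> euclid d"
    by (auto simp: x_def y_def P_def B_def R_def)
  have Q: "D.mul X X = (P - R) + shift d d ((- 2) *\<^sub>R B)"
    unfolding dbl_square by (simp add: x_def y_def P_def B_def R_def)
  have "(- 2) *\<^sub>R B \<in> euclid d" "P - R \<in> euclid d" by auto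
  then have loQ: "lo (D.mul X X) = P - R" and hiQ: "hi (D.mul X X) = (- 2) *\<^sub>R B"
    unfolding Q part_linear(1) by (simp_all only: part_shift part_id part_zero add_0 add_0_right)
  note px = square_square_polar[of x y x, folded P_def B_def R_def, simplified]
    and py = square_square_polar[of x y y, folded P_def B_def R_def, simplified]
  have "dbl X (D.mul X X) (D.mul X X) = S P P x - 2 * S P R x + S R R x - 4 * S B B x + 4 * S P B y - 4 * S B R y"
    unfolding dbl_def loQ hiQ x_def[symmetric] y_def[symmetric]
    using S_swap13[of x P P] S_swap13[of x P R] S_swap13[of x R P] S_swap12[of R P x] S_swap13[of x R R] S_swap13[of x B B]
      S_swap13[of y P B] S_swap13[of y B P] S_swap12[of B P y] S_swap13[of y R B] S_swap13[of y B R] S_swap12[of R B y]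
    by simp
  also have "\<dots> = (x \<bullet> x + y \<bullet> y) * (S x x x - 3 * S x y y)"
    using px(1,3,5) py(2,4) inner_commute[of x y] by (simp add: algebra_simps)
  also have "S x x x - 3 * S x y y = dbl X X X"
    unfolding dbl_def x_def[symmetric] y_def[symmetric] using S_swap12[of x y y] S_swap13[of x y y] by simp
  finally show ?thesis by (simp add: x_def y_def)
qed

text \<open>The real part of a holomorphic polynomial is harmonic: the second derivatives in the
  real and the imaginary direction of each coordinate cancel.\<close>

lemma dbl_trace: "D.tr X = 0"
proof -
  have lo: "dbl X (unitv i) (unitv i) = S (lo X) (unitv i) (unitv i)" if "i < d" for i
    using that by (simp add: dbl_def part_unitv part_zero unitv_euclid)
  have hi: "dbl X (unitv (d + i)) (unitv (d + i)) = - S (lo X) (unitv i) (unitv i)" if "i < d" for i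
    using that by (simp add: dbl_def part_unitv)
  show ?thesis unfolding D.tr_def sum_split by (simp add: lo hi sum_negf)
qed

context
  fixes g :: "real mpoly"
  assumes g: "form d 3 g" and val: "\<And>x. x \<in> euclid d \<Longrightarrow> S x x x = pval (crd x) g"
begin

lemma dbl_val: "dbl X X X = pval (crd X) (complex_doubling d g)"
proof -
  note cong = real_id.subst_in_vars_cong[OF form_in_vars[OF g]]
  have [simp]: "lo X + hi X \<in> euclid d" "lo X - hi X \<in> euclid d" by auto
  have "pval (crd X) g = S (lo X) (lo X) (lo X)"
    unfolding val[OF part_euclid] by (rule cong) (simp add: crd_part)
  moreover have "pval (\<lambda>i. crd X i + crd X (d + i)) g = S (lo X + hi X) (lo X + hi X) (lo X + hi X)"
    by (subst val) (auto intro!: cong simp: crd_part)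
  moreover have "pval (\<lambda>i. crd X i - crd X (d + i)) g = S (lo X + - hi X) (lo X + - hi X) (lo X + - hi X)"
    unfolding add_uminus_conv_diff by (subst val) (auto intro!: cong simp: crd_part)
  ultimately show ?thesis
    unfolding pval_complex_doubling[OF g] S_cube_add dbl_def
    using S_swap12[of "hi X" "lo X" "hi X"] S_swap13[of "hi X" "hi X" "lo X"] by (simp add: field_simps)
qed

text \<open>With vanishing trace only the second term of \<open>L_op_trilinear\<close> remains, so
  the eigenvalue is -54. The point \<open>x\<close> witnesses that the doubled polynomial is
  nonzero.\<close>

theorem radial_eigencubic_doubling:
  assumes "x \<in> euclid d" "S x x x \<noteq> 0"
  shows "radial_eigencubic (2 * d) (complex_doubling d g)"
proof -
  let ?f = "complex_doubling d g"
  have "dbl x x x = S x x x" using assms(1) by (simp add: dbl_def part_id part_zero)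
  then have "?f \<noteq> 0" using dbl_val[of x] assms(2) by auto
  moreover have "L_op (d + d) ?f - Cst (- 54) * (\<Sum>i<d + d. (Var i)^2) * ?f = 0"
  proof (rule pval_zero_imp_zero)
    fix X
    have "pval (crd X) (L_op (d + d) ?f) = 54 * ((D.mul X X \<bullet> D.mul X X) * D.tr X - D.mul X X \<bullet> D.mul X (D.mul X X))"
      by (rule L_op_trilinear[OF trilinear_dbl dbl_val])
    also have "\<dots> = - 54 * dbl X (D.mul X X) (D.mul X X)" by (simp add: dbl_trace D.inner_mul')
    also have "\<dots> = - 54 * (\<Sum>i<d + d. (crd X i)^2) * pval (crd X) ?f"
      unfolding dbl_eigen dbl_val
      by (simp add: inner_euclid[OF part_euclid] crd_part sum_split power2_eq_square algebra_simps)
    finally show "pval (crd X) (L_op (d + d) ?f - Cst (- 54) * (\<Sum>i<d + d. (Var i)^2) * ?f) = 0" by simp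
  qed
  ultimately show ?thesis
    unfolding radial_eigencubic_def cubic_form_iff mult_2 using form_complex_doubling[OF g]
    by (auto simp: mult_2 intro!: exI[of _ "- 54"])
qed

end

end

section \<open>The cubic built over an eiconal form and its adjoint identity\<close>

locale euclid_eiconal = eiconal S "euclid N" N unitv
  for S :: "fsvec \<Rightarrow> fsvec \<Rightarrow> fsvec \<Rightarrow> real" and N :: nat
begin

abbreviation pr where "pr \<equiv> part 0 N"

text \<open>Polarization of \<open>t^3 - 3/2 t |y|^2 + h(y) / sqrt 2\<close>, where \<open>t\<close>
  is coordinate \<open>N\<close> and \<open>h\<close> is the eiconal cubic; for a Cartan polynomial
  \<open>h\<close> this is \<open>g_cubic\<close>.\<close>

definition cone :: "fsvec \<Rightarrow> fsvec \<Rightarrow> fsvec \<Rightarrow> real" where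
  "cone x y z = crd x N * crd y N * crd z N
    - (crd x N * (pr y \<bullet> pr z) + crd y N * (pr x \<bullet> pr z) + crd z N * (pr x \<bullet> pr y)) / 2
    + S (pr x) (pr y) (pr z) / sqrt 2"

lemma trilinear_cone: "trilinear_form cone"
proof
  show "cone (x + y) z w = cone x z w + cone y z w" for x y z w
    by (simp add: cone_def inner_add_left inner_add_right add_divide_distrib algebra_simps)
  show "cone (c *\<^sub>R x) z w = c * cone x z w" for c x z w
    by (simp add: cone_def algebra_simps add_divide_distrib)
  show "cone x y z = cone y x z" for x y z
    using S_swap12[of "pr x" "pr y" "pr z"] inner_commute[of "pr x" "pr y"] by (simp add: cone_def)
  show "cone x y z = cone x z y" for x y z
    using S_swap23[of "pr x" "pr y" "pr z"] inner_commute[of "pr y" "pr z"] by (simp add: cone_def)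
qed

interpretation C: cubic_space cone "euclid (Suc N)" "Suc N" unitv
  using trilinear_cone by (simp add: cubic_space_def cubic_space_axioms_def onframe_euclid)

lemma cone_parts:
  assumes "w \<in> euclid N"
  shows "crd (a *\<^sub>R unitv N + w) N = a" "pr (a *\<^sub>R unitv N + w) = w" "a *\<^sub>R unitv N + w \<in> euclid (Suc N)"
  using assms by (auto simp: crd_unitv part_unitv part_id euclid_def)

lemma cone_expand: "x \<in> euclid (Suc N) \<Longrightarrow> x = crd x N *\<^sub>R unitv N + pr x"
  by (rule fsvec_eqI) (auto simp: crd_part crd_unitv euclid_def)

lemma cone_square:
  "C.mul x x = ((crd x N)^2 - (pr x \<bullet> pr x) / 2) *\<^sub>R unitv N + ((- crd x N) *\<^sub>R pr x + (1 / sqrt 2) *\<^sub>R mul (pr x) (pr x))"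
proof (rule C.mul_eqI)
  have w: "(- crd x N) *\<^sub>R pr x + (1 / sqrt 2) *\<^sub>R mul (pr x) (pr x) \<in> euclid N" by (intro V_closed mul_in part_euclid)
  show "((crd x N)^2 - (pr x \<bullet> pr x) / 2) *\<^sub>R unitv N + ((- crd x N) *\<^sub>R pr x + (1 / sqrt 2) *\<^sub>R mul (pr x) (pr x)) \<in> euclid (Suc N)"
    by (rule cone_parts[OF w])
  fix z
  show "cone x x z = (((crd x N)^2 - (pr x \<bullet> pr x) / 2) *\<^sub>R unitv N + ((- crd x N) *\<^sub>R pr x + (1 / sqrt 2) *\<^sub>R mul (pr x) (pr x))) \<bullet> z"
    unfolding inner_add_left[of "_ *\<^sub>R unitv N"] inner_part[OF w, of z]
    by (simp add: cone_def inner_add_left inner_diff_left inner_mul power2_eq_square field_simps)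
qed

text \<open>With \<open>p = y \<star> y\<close> it reduces to three facts:
  \<open>p \<bullet> p = |y|^4\<close>, \<open>y \<star> p = |y|^2 y\<close>, and the formula
  \<open>jordan_square\<close> for \<open>p \<star> p\<close>. The factor \<open>1 / sqrt 2\<close>
  is the one for which the terms in \<open>|y|^4\<close> of the last coordinate cancel.\<close>

lemma cone_square_square: "x \<in> euclid (Suc N) \<Longrightarrow> C.mul (C.mul x x) (C.mul x x) = cone x x x *\<^sub>R x"
proof -
  assume x: "x \<in> euclid (Suc N)"
  define t where "t = crd x N"
  define y where "y = pr x"
  define q where "q = y \<bullet> y"
  define p where "p = mul y y"
  define h where "h = y \<bullet> p"
  define k where "k = 1 / sqrt 2"
  define a where "a = t^2 - q / 2"
  define w where "w = (- t) *\<^sub>R y + k *\<^sub>R p"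
  have [simp]: "y \<in> euclid N" "p \<in> euclid N" "w \<in> euclid N" by (auto simp: y_def p_def w_def)
  have k2: "k * k = 1 / 2" "\<And>z. k * (k * z) = z / 2" by (simp_all add: k_def)
  have pp: "p \<bullet> p = q * q" unfolding p_def q_def using norm_sq[of y] by (simp add: power2_eq_square)
  have yp: "mul y p = q *\<^sub>R y" unfolding p_def q_def by (rule jordan_cube) simp
  have psq: "mul p p = (2 * h) *\<^sub>R y - q *\<^sub>R p" unfolding p_def q_def h_def by (rule jordan_square) simp
  have 1: "C.mul x x = a *\<^sub>R unitv N + w"
    unfolding cone_square a_def w_def p_def q_def y_def t_def k_def ..
  have 2: "C.mul (C.mul x x) (C.mul x x) = (a^2 - (w \<bullet> w) / 2) *\<^sub>R unitv N + ((- a) *\<^sub>R w + k *\<^sub>R mul w w)"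
    unfolding cone_square[of "C.mul x x"] unfolding 1 cone_parts[OF \<open>w \<in> euclid N\<close>] k_def ..
  have c: "cone x x x = t^3 - 3/2 * t * q + k * h"
    unfolding cone_def h_def p_def t_def q_def y_def k_def by (simp add: inner_mul' power3_eq_cube)
  have "w \<bullet> w = t^2 * q - 2 * t * k * h + q * q / 2"
    unfolding w_def h_def
    by (simp add: inner_add_left inner_add_right q_def[symmetric] pp inner_commute[of p y] h_def[symmetric] k2 power2_eq_square algebra_simps)
  then have A: "a^2 - (w \<bullet> w) / 2 = cone x x x * t"
    unfolding c a_def by (simp add: power2_eq_square power3_eq_cube field_simps)
  have B: "(- a) *\<^sub>R w + k *\<^sub>R mul w w = cone x x x *\<^sub>R y"
  proof (rule inner_eqI)
    fix z
    have ww: "mul w w = t^2 *\<^sub>R p - (2 * t * k * q) *\<^sub>R y + (k * k) *\<^sub>R mul p p"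
      unfolding w_def
      by (rule inner_eqI) (simp add: mul_commute[of p y] yp inner_add_left inner_diff_left power2_eq_square p_def[symmetric] algebra_simps)
    show "((- a) *\<^sub>R w + k *\<^sub>R mul w w) \<bullet> z = (cone x x x *\<^sub>R y) \<bullet> z"
      unfolding ww psq c k2(1) unfolding w_def a_def
      by (simp add: inner_add_left inner_diff_left k2 power2_eq_square power3_eq_cube field_simps)
  qed
  have "C.mul (C.mul x x) (C.mul x x) = cone x x x *\<^sub>R (t *\<^sub>R unitv N + y)"
    unfolding 2 A B by (simp add: scaleR_add_right)
  then show ?thesis unfolding t_def y_def cone_expand[OF x, symmetric] .
qed

lemma square_square_cone: "square_square cone (Suc N)"
  by unfold_locales (rule cone_square_square)

end

section \<open>Type of the doubled cubics\<close>

lemma to_vec_linear: "to_vec n (x + y) = to_vec n x + to_vec n y" "to_vec n (c *\<^sub>R x) = c \<cdot>\<^sub>v to_vec n x"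
  by (auto simp: to_vec_def)

lemma poly_val_to_vec: "in_vars n p \<Longrightarrow> poly_val p (to_vec n x) = pval (crd x) p"
  unfolding poly_val_def by (intro real_id.subst_in_vars_cong) (auto simp: to_vec_def)

lemma scalar_prod_to_vec: "x \<in> euclid n \<Longrightarrow> scalar_prod (to_vec n x) (to_vec n y) = x \<bullet> y"
  by (simp add: inner_euclid scalar_prod_def to_vec_def lessThan_atLeast0)

lemma trihomogeneousI:
  assumes p: "in_vars n p"
    and hom: "\<And>x y z a b c. x \<in> W1 \<Longrightarrow> y \<in> W2 \<Longrightarrow> z \<in> W3 \<Longrightarrow>
      pval (crd (a *\<^sub>R x + b *\<^sub>R y + c *\<^sub>R z)) p = a^i * b^j * c^k * pval (crd (x + y + z)) p"
  shows "trihomogeneous n (to_vec n ` W1) (to_vec n ` W2) (to_vec n ` W3) i j k p"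
  unfolding trihomogeneous_def using p
  by (auto simp: to_vec_linear[symmetric] poly_val_to_vec hom)

lemma vdim_to_vec:
  assumes "onframe W d u" "W \<subseteq> euclid n" shows "vdim n (to_vec n ` W) = d"
proof (rule vdim_eq)
  show "VectorSpace.subspace class_ring (to_vec n ` W) (module_vec TYPE(real) n)"
    by (rule jnf_subspaceI[OF onframe_subspace[OF assms(1)] assms(2)])
  have "of_vec ` to_vec n ` W = W" unfolding image_image using assms(2) by force
  then show "onframe (of_vec ` to_vec n ` W) d u" using assms(1) by simp
qed

text \<open>Specialized to normal forms with \<psi>102 equal to 0 and scaling constant 1, which is
  the shape of the doubled cubic.\<close>

lemma has_typeI:
  assumes e: "e \<in> euclid n" "e \<bullet> e = 1"
    and W: "W1 \<subseteq> euclid n" "W2 \<subseteq> euclid n" "W3 \<subseteq> euclid n" "onframe W1 n1 u1" "onframe W2 n2 u2" "subspace W3"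
    and orth: "\<And>x y z. x \<in> W1 \<Longrightarrow> y \<in> W2 \<Longrightarrow> z \<in> W3 \<Longrightarrow>
      e \<bullet> x = 0 \<and> e \<bullet> y = 0 \<and> e \<bullet> z = 0 \<and> x \<bullet> y = 0 \<and> x \<bullet> z = 0 \<and> y \<bullet> z = 0"
    and dec: "\<And>x. x \<in> euclid n \<Longrightarrow> \<exists>t. \<exists>\<xi>\<in>W1. \<exists>\<eta>\<in>W2. \<exists>\<zeta>\<in>W3. x = t *\<^sub>R e + \<xi> + \<eta> + \<zeta>"
    and f: "in_vars n f" and p: "in_vars n p111" "in_vars n p012" "in_vars n p030"
    and hom: "\<And>x y z a b c. x \<in> W1 \<Longrightarrow> y \<in> W2 \<Longrightarrow> z \<in> W3 \<Longrightarrow>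
        pval (crd (a *\<^sub>R x + b *\<^sub>R y + c *\<^sub>R z)) p111 = a * b * c * pval (crd (x + y + z)) p111
      \<and> pval (crd (a *\<^sub>R x + b *\<^sub>R y + c *\<^sub>R z)) p012 = b * c^2 * pval (crd (x + y + z)) p012
      \<and> pval (crd (a *\<^sub>R x + b *\<^sub>R y + c *\<^sub>R z)) p030 = b^3 * pval (crd (x + y + z)) p030"
    and val: "\<And>t x y z. x \<in> W1 \<Longrightarrow> y \<in> W2 \<Longrightarrow> z \<in> W3 \<Longrightarrow> pval (crd (t *\<^sub>R e + x + y + z)) f
      = t^3 - 3/2 * t * (2 * (x \<bullet> x) + y \<bullet> y - z \<bullet> z)
        + pval (crd (x + y + z)) p111 + pval (crd (x + y + z)) p012 + pval (crd (x + y + z)) p030"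
  shows "has_type n f n1 n2"
proof -
  note sub = onframe_subspace[OF W(4)] onframe_subspace[OF W(5)] W(6)
  have zero: "0 \<in> W1" "0 \<in> W2" "0 \<in> W3" using sub subspace_0 by auto
  have in_e: "x \<in> W1 \<Longrightarrow> x \<in> euclid n" "x \<in> W2 \<Longrightarrow> x \<in> euclid n" "x \<in> W3 \<Longrightarrow> x \<in> euclid n" for x using W by auto
  have "orthogonal_decomposition n (to_vec n e) (to_vec n ` W1) (to_vec n ` W2) (to_vec n ` W3)"
    unfolding orthogonal_decomposition_def
  proof (intro conjI ballI)
    show "scalar_prod (to_vec n e) (to_vec n e) = 1" using e by (simp add: scalar_prod_to_vec)
    show "VectorSpace.subspace class_ring V (module_vec TYPE(real) n)" if "V \<in> {to_vec n ` W1, to_vec n ` W2, to_vec n ` W3}" for V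
      using that jnf_subspaceI sub W by auto
    show "scalar_prod (to_vec n e) v = 0" if "v \<in> to_vec n ` W1 \<union> to_vec n ` W2 \<union> to_vec n ` W3" for v
      using that orth zero e by (auto simp: scalar_prod_to_vec)
    fix v w
    show "scalar_prod v w = 0" if "v \<in> to_vec n ` W1" "w \<in> to_vec n ` W2"
      using that orth zero in_e by (auto simp: scalar_prod_to_vec)
    show "scalar_prod v w = 0" if "v \<in> to_vec n ` W1" "w \<in> to_vec n ` W3"
      using that orth zero in_e by (auto simp: scalar_prod_to_vec)
    show "scalar_prod v w = 0" if "v \<in> to_vec n ` W2" "w \<in> to_vec n ` W3"
      using that orth zero in_e by (auto simp: scalar_prod_to_vec)
  next
    fix x :: "real vec" assume x: "x \<in> carrier_vec n"
    obtain t y1 y2 y3 where y: "y1 \<in> W1" "y2 \<in> W2" "y3 \<in> W3" "of_vec x = t *\<^sub>R e + y1 + y2 + y3"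
      using dec[OF of_vec_euclid[OF x]] by blast
    have "x = to_vec n (of_vec x)" using x by simp
    also have "\<dots> = t \<cdot>\<^sub>v to_vec n e + to_vec n y1 + to_vec n y2 + to_vec n y3"
      unfolding y(4) to_vec_linear ..
    finally show "\<exists>t. \<exists>\<xi>\<in>to_vec n ` W1. \<exists>\<eta>\<in>to_vec n ` W2. \<exists>\<zeta>\<in>to_vec n ` W3. x = t \<cdot>\<^sub>v to_vec n e + \<xi> + \<eta> + \<zeta>"
      using y(1-3) by blast
  qed simp
  moreover have "trihomogeneous n (to_vec n ` W1) (to_vec n ` W2) (to_vec n ` W3) 1 1 1 p111"
    "trihomogeneous n (to_vec n ` W1) (to_vec n ` W2) (to_vec n ` W3) 1 0 2 0"
    "trihomogeneous n (to_vec n ` W1) (to_vec n ` W2) (to_vec n ` W3) 0 1 2 p012"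
    "trihomogeneous n (to_vec n ` W1) (to_vec n ` W2) (to_vec n ` W3) 0 3 0 p030"
    using p hom by (auto intro!: trihomogeneousI simp: in_vars_def)
  moreover have "\<forall>t. \<forall>\<xi>\<in>to_vec n ` W1. \<forall>\<eta>\<in>to_vec n ` W2. \<forall>\<zeta>\<in>to_vec n ` W3.
      1 * poly_val f (t \<cdot>\<^sub>v to_vec n e + \<xi> + \<eta> + \<zeta>) =
        t^3 - 3/2 * t * (2 * (scalar_prod \<xi> \<xi>) + scalar_prod \<eta> \<eta> - scalar_prod \<zeta> \<zeta>)
        + poly_val p111 (\<xi> + \<eta> + \<zeta>) + poly_val 0 (\<xi> + \<eta> + \<zeta>) + poly_val p012 (\<xi> + \<eta> + \<zeta>) + poly_val p030 (\<xi> + \<eta> + \<zeta>)"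
    using in_e by (auto simp: to_vec_linear[symmetric] poly_val_to_vec[OF f] poly_val_to_vec[OF p(1)]
      poly_val_to_vec[OF p(2)] poly_val_to_vec[OF p(3)] scalar_prod_to_vec val poly_val_def[of 0])
  ultimately show ?thesis
    unfolding has_type_def using vdim_to_vec[OF W(4,1)] vdim_to_vec[OF W(5,2)] by (metis zero_neq_one)
qed

locale doubled_cartan = euclid_eiconal S N for S N +
  fixes l k :: nat
  assumes l: "l \<in> {1, 2, 4, 8}" and k: "l = 2 ^ k" and N: "N = 3 * l + 2"
    and S_val: "S x x x = theta_val l (crd x)"
begin

sublocale CC: square_square cone "Suc N" by (rule square_square_cone)

abbreviation "f \<equiv> complex_doubling (Suc N) (g_cubic l)"

lemma form_g: "form (Suc N) 3 (g_cubic l)"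
proof -
  have "Suc N = 3 * l + 3" by (simp add: N)
  then show ?thesis using form_g_cubic[OF k] by (simp only:)
qed

lemma theta_val_part: "theta_val l (crd (part 0 N x)) = theta_val l (crd x)"
proof -
  have "in_vars N (theta l)" using form_in_vars[OF form_theta[OF k]] by (simp add: N)
  then show ?thesis unfolding pval_theta[symmetric] by (rule real_id.subst_in_vars_cong) (simp add: crd_part)
qed

lemma cone_val: "cone x x x = pval (crd x) (g_cubic l)"
  unfolding pval_g_cubic cone_def S_val theta_val_part N[symmetric]
  by (simp add: inner_euclid[OF part_euclid] crd_part power2_eq_square power3_eq_cube)

lemmas f_val = CC.dbl_val[OF form_g cone_val]

lemma cone_unit: "cone (unitv N) x y = crd x N * crd y N - (pr x \<bullet> pr y) / 2"
  by (simp add: cone_def crd_unitv part_unitv)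

lemma f_radial: "radial_eigencubic (2 * Suc N) f"
  by (rule CC.radial_eigencubic_doubling[OF form_g cone_val unitv_euclid[of N]]) (simp_all add: cone_unit crd_unitv part_unitv)

lemma f_expand:
  assumes X: "crd X N = t" "crd X (Suc N + N) = r" "pr X = y" "part (Suc N) N X = z"
  shows "CC.dbl X X X = t^3 - 3/2 * t * (2 * r^2 + y \<bullet> y - z \<bullet> z) + 3 * r * (y \<bullet> z) + S y y y / sqrt 2 - 3 * S y z z / sqrt 2"
proof -
  have crd: "crd (CC.lo X) N = t" "crd (CC.hi X) N = r" using X by (auto simp: crd_part)
  have pr: "pr (CC.lo X) = y" "pr (CC.hi X) = z" using X by (simp_all add: part_part)
  define a where "a = S y y y / sqrt 2"
  define b where "b = S y z z / sqrt 2"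
  have b3: "3 * S y z z / sqrt 2 = 3 * b" by (simp add: b_def)
  show ?thesis
    unfolding CC.dbl_def cone_def crd pr S_swap12[of z y z] S_swap13[of z z y] inner_commute[of z y] b3
      a_def[symmetric] b_def[symmetric]
    by (simp add: power2_eq_square power3_eq_cube field_simps)
qed

lemma f_type: "has_type (2 * Suc N) f 1 N"
proof -
  let ?n = "2 * Suc N"
  define xi where "xi = unitv (Suc N + N)"
  define W1 where "W1 = range (\<lambda>r. r *\<^sub>R xi)"
  define W2 where "W2 = euclid N"
  define W3 where "W3 = {x \<in> euclid ?n. crd x N = 0 \<and> pr x = 0 \<and> crd x (Suc N + N) = 0}"
  define p111 :: "real mpoly" where "p111 = Cst 3 * Var (Suc N + N) * (\<Sum>i<N. Var i * Var (Suc N + i))"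
  define p030 where "p030 = Cst (1 / sqrt 2) * theta l"
  \<comment> \<open>Taken as what the other terms leave of \<open>f\<close>, so that it is a
    polynomial by construction; \<open>v012\<close> then finds its values to be
    \<open>- 3 S y z z / sqrt 2\<close>, from which the homogeneity is read off.\<close>
  define p012 where "p012 = f - (Var N)^3 + Cst (3/2) * Var N * (Cst 2 * (Var (Suc N + N))^2 + (\<Sum>i<N. (Var i)^2) - (\<Sum>i<N. (Var (Suc N + i))^2)) - p111 - p030"
  let ?w = "part (Suc N) N"
  have f_form: "form ?n 3 f" by (rule form_complex_doubling[OF form_g])
  have V: "form ?n 1 (Var i :: real mpoly)" if "i < ?n" for i using that by (rule form_Var)
  have V2: "form ?n 2 (Var i * Var j :: real mpoly)" if "i < ?n" "j < ?n" for i j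
    by (rule form_mult_eq[OF V V]) (use that in auto)
  have sq: "form ?n 2 ((Var i)^2 :: real mpoly)" if "i < ?n" for i
    unfolding power2_eq_square using that by (intro V2)
  have cube: "form ?n 3 ((Var N)^3 :: real mpoly)" by (rule form_power_eq[OF V]) auto
  have th: "form ?n 3 (theta l)" using form_theta[OF k] N by (force simp: form_def)
  have p111: "form ?n 3 p111"
    unfolding p111_def by (rule form_mult_eq[OF form_Cst_mult[OF V] form_sum[OF V2]]) auto
  have p030: "form ?n 3 p030" unfolding p030_def by (rule form_Cst_mult[OF th])
  have q: "form ?n 3 (Cst (3/2) * Var N * (Cst 2 * (Var (Suc N + N))^2 + (\<Sum>i<N. (Var i)^2) - (\<Sum>i<N. (Var (Suc N + i))^2)) :: real mpoly)"
    by (rule form_mult_eq[OF form_Cst_mult[OF V] form_diff[OF form_add[OF form_Cst_mult[OF sq] form_sum[OF sq]] form_sum[OF sq]]]) auto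
  have p012: "form ?n 3 p012" unfolding p012_def by (intro form_diff form_add f_form cube q p111 p030)
  have v111: "pval (crd X) p111 = 3 * crd X (Suc N + N) * (pr X \<bullet> ?w X)" for X
    by (simp add: p111_def inner_euclid[OF part_euclid] crd_part)
  have v030: "pval (crd X) p030 = S (pr X) (pr X) (pr X) / sqrt 2" for X
    by (simp add: p030_def pval_theta S_val theta_val_part)
  have sums: "(\<Sum>i<N. (crd X i)^2) = pr X \<bullet> pr X" "(\<Sum>i<N. (crd X (Suc N + i))^2) = ?w X \<bullet> ?w X" for X
    by (simp_all add: inner_euclid[OF part_euclid] crd_part power2_eq_square)
  have v012: "pval (crd X) p012 = - 3 * S (pr X) (?w X) (?w X) / sqrt 2" for X
  proof -
    have "pval (crd X) p012 = CC.dbl X X X - (crd X N)^3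
        + 3/2 * crd X N * (2 * (crd X (Suc N + N))^2 + (\<Sum>i<N. (crd X i)^2) - (\<Sum>i<N. (crd X (Suc N + i))^2))
        - pval (crd X) p111 - pval (crd X) p030"
      unfolding p012_def f_val by simp
    then show ?thesis unfolding f_expand[OF refl refl refl refl] sums v111 v030 by (simp add: algebra_simps)
  qed
  have prxi: "pr xi = 0" "?w xi = 0" "crd xi N = 0" "crd xi (Suc N + N) = 1"
    by (auto simp: xi_def part_unitv crd_unitv crd_part intro!: fsvec_eqI)
  have W1D: "pr x = 0" "?w x = 0" "crd x N = 0" "x \<bullet> x = (crd x (Suc N + N))^2" "x \<in> euclid ?n" "x \<bullet> y = crd x (Suc N + N) * crd y (Suc N + N)"
    if x: "x \<in> W1" for x y
  proof -
    from x obtain r where r: "x = r *\<^sub>R xi" by (auto simp: W1_def)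
    show "pr x = 0" "?w x = 0" "crd x N = 0" "x \<bullet> x = (crd x (Suc N + N))^2" "x \<bullet> y = crd x (Suc N + N) * crd y (Suc N + N)"
      using prxi by (simp_all add: r xi_def power2_eq_square)
    show "x \<in> euclid ?n" unfolding r by (intro subspace_scale[OF subspace_euclid]) (simp add: xi_def unitv_euclid)
  qed
  have W2D: "pr x = x" "?w x = 0" "crd x N = 0" "crd x (Suc N + N) = 0" "x \<in> euclid ?n" if "x \<in> W2" for x
    using that part_id[of x N] part_zero[of x "Suc N" N] euclid_mono[of x N] by (auto simp: W2_def euclid_def)
  have W3D: "pr x = 0" "crd x N = 0" "crd x (Suc N + N) = 0" "x \<in> euclid ?n" if "x \<in> W3" for x
    using that by (auto simp: W3_def)
  have W3sq: "x \<bullet> x = ?w x \<bullet> ?w x" if x: "x \<in> W3" for x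
  proof -
    have "crd x i = 0" if "i < Suc N" for i
      using arg_cong[OF W3D(1)[OF x], of "\<lambda>v. crd v i"] W3D(2)[OF x] that by (auto simp: crd_part less_Suc_eq)
    moreover have "x \<in> euclid (Suc N + Suc N)" using W3D(4)[OF x] by (simp add: mult_2)
    ultimately have "x \<bullet> x = (\<Sum>i<Suc N. crd x (Suc N + i) * crd x (Suc N + i))"
      by (simp only: inner_euclid sum_split) simp
    then show ?thesis using W3D(3)[OF x] by (simp add: inner_euclid[OF part_euclid] crd_part)
  qed
  show ?thesis
  proof (rule has_typeI)
    show "unitv N \<in> euclid ?n" by (simp add: unitv_euclid)
    show "unitv N \<bullet> unitv N = 1" by (simp add: crd_unitv)
    show "W1 \<subseteq> euclid ?n" "W2 \<subseteq> euclid ?n" "W3 \<subseteq> euclid ?n" using W1D(5) W2D(5) W3D(4) by blast+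
    have "subspace W1" unfolding W1_def span_singleton[symmetric] by (rule subspace_span)
    moreover have "xi \<in> W1" unfolding W1_def by (rule range_eqI[of _ _ 1]) simp
    ultimately show "onframe W1 1 (\<lambda>_. xi)"
      by (auto simp: onframe_def orthonormal_def W1_def xi_def crd_unitv)
    show "onframe W2 N unitv" unfolding W2_def by (rule onframe_euclid)
    show "subspace W3" by (auto simp: subspace_def W3_def euclid_def)
    show "in_vars ?n f" "in_vars ?n p111" "in_vars ?n p012" "in_vars ?n p030"
      using f_form p111 p012 p030 by (blast intro: form_in_vars)+
  next
    fix x assume x: "x \<in> euclid ?n"
    let ?z = "x - crd x N *\<^sub>R unitv N - crd x (Suc N + N) *\<^sub>R xi - pr x"
    have "?z \<in> W3"
      using x by (auto simp: W3_def xi_def part_unitv part_part crd_unitv crd_part euclid_def)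
    moreover have "x = crd x N *\<^sub>R unitv N + crd x (Suc N + N) *\<^sub>R xi + pr x + ?z" by simp
    ultimately show "\<exists>t. \<exists>\<xi>\<in>W1. \<exists>\<eta>\<in>W2. \<exists>\<zeta>\<in>W3. x = t *\<^sub>R unitv N + \<xi> + \<eta> + \<zeta>"
      unfolding W1_def W2_def by blast
  next
    fix x y z assume W: "x \<in> W1" "y \<in> W2" "z \<in> W3"
    have "y \<bullet> z = 0" using inner_part[of y N z] W W3D(1)[OF W(3)] by (simp add: W2_def)
    then show "unitv N \<bullet> x = 0 \<and> unitv N \<bullet> y = 0 \<and> unitv N \<bullet> z = 0 \<and> x \<bullet> y = 0 \<and> x \<bullet> z = 0 \<and> y \<bullet> z = 0"
      unfolding W1D(6)[OF W(1)] inner_unitv_left W1D(3)[OF W(1)] W2D(3,4)[OF W(2)] W3D(2,3)[OF W(3)] by simp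
    have lin: "pr (a *\<^sub>R x + b *\<^sub>R y + c *\<^sub>R z) = b *\<^sub>R y" "?w (a *\<^sub>R x + b *\<^sub>R y + c *\<^sub>R z) = c *\<^sub>R ?w z"
      "crd (a *\<^sub>R x + b *\<^sub>R y + c *\<^sub>R z) (Suc N + N) = a * crd x (Suc N + N)" for a b c
      unfolding part_linear crd_simps W1D(1,2)[OF W(1)] W2D(1,2,4)[OF W(2)] W3D(1,3)[OF W(3)] by simp_all
    note lin1 = lin[of 1 1 1, unfolded scaleR_one mult_1]
    show "pval (crd (a *\<^sub>R x + b *\<^sub>R y + c *\<^sub>R z)) p111 = a * b * c * pval (crd (x + y + z)) p111
      \<and> pval (crd (a *\<^sub>R x + b *\<^sub>R y + c *\<^sub>R z)) p012 = b * c^2 * pval (crd (x + y + z)) p012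
      \<and> pval (crd (a *\<^sub>R x + b *\<^sub>R y + c *\<^sub>R z)) p030 = b^3 * pval (crd (x + y + z)) p030" for a b c
      unfolding v111 v012 v030 lin lin1 by (simp add: power2_eq_square power3_eq_cube)
    fix t
    have "CC.dbl (t *\<^sub>R unitv N + x + y + z) (t *\<^sub>R unitv N + x + y + z) (t *\<^sub>R unitv N + x + y + z)
      = t^3 - 3/2 * t * (2 * (crd x (Suc N + N))^2 + y \<bullet> y - ?w z \<bullet> ?w z) + 3 * crd x (Suc N + N) * (y \<bullet> ?w z) + S y y y / sqrt 2 - 3 * S y (?w z) (?w z) / sqrt 2"
    proof (rule f_expand)
      have u: "pr (unitv N) = 0" "?w (unitv N) = 0" "crd (unitv N) (Suc N + N) = 0" "crd (unitv N) N = 1"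
        by (auto simp: part_unitv crd_unitv crd_part intro!: fsvec_eqI)
      show "crd (t *\<^sub>R unitv N + x + y + z) N = t" "crd (t *\<^sub>R unitv N + x + y + z) (Suc N + N) = crd x (Suc N + N)"
        "pr (t *\<^sub>R unitv N + x + y + z) = y" "?w (t *\<^sub>R unitv N + x + y + z) = ?w z"
        unfolding part_linear crd_simps u W1D(1-3)[OF W(1)] W2D(1-4)[OF W(2)] W3D(1-3)[OF W(3)] by simp_all
    qed
    then show "pval (crd (t *\<^sub>R unitv N + x + y + z)) f
      = t^3 - 3/2 * t * (2 * (x \<bullet> x) + y \<bullet> y - z \<bullet> z)
        + pval (crd (x + y + z)) p111 + pval (crd (x + y + z)) p012 + pval (crd (x + y + z)) p030"
      unfolding f_val v111 v012 v030 lin1 W1D(4)[OF W(1)] W3sq[OF W(3)] by simp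
  qed
qed

end

section \<open>Clifford systems\<close>

definition mat_op :: "nat \<Rightarrow> real mat \<Rightarrow> fsvec \<Rightarrow> fsvec" where
  "mat_op n W x = of_vec (W *\<^sub>v to_vec n x)"

context
  fixes n :: nat and W :: "real mat"
  assumes W: "W \<in> carrier_mat n n"
begin

lemma crd_mat_op: "crd (mat_op n W x) i = (if i < n then (\<Sum>j<n. W $$ (i, j) * crd x j) else 0)"
  using W by (auto simp: mat_op_def crd_of_vec[of _ n] scalar_prod_def lessThan_atLeast0 to_vec_def intro!: sum.cong)

lemma mat_op_euclid: "mat_op n W x \<in> euclid n"
  by (simp add: euclid_def crd_mat_op)

lemma mat_op_linear: "mat_op n W (x + y) = mat_op n W x + mat_op n W y" "mat_op n W (c *\<^sub>R x) = c *\<^sub>R mat_op n W x"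
  by (rule fsvec_eqI; simp add: crd_mat_op distrib_left sum.distrib sum_distrib_left mult_ac)+

lemma mat_op_sum: "mat_op n W (sum g I) = (\<Sum>i\<in>I. mat_op n W (g i))"
proof (induction I rule: infinite_finite_induct)
qed (auto simp: mat_op_linear intro!: fsvec_eqI simp: crd_mat_op)

lemma to_vec_mat_op: "to_vec n (mat_op n W x) = W *\<^sub>v to_vec n x"
  using W by (simp add: mat_op_def)

end

lemma mat_op_transpose:
  assumes W: "W \<in> carrier_mat n n" and x: "x \<in> euclid n"
  shows "mat_op n W x \<bullet> y = x \<bullet> mat_op n (transpose_mat W) y"
proof -
  have WT: "transpose_mat W \<in> carrier_mat n n" using W by simp
  have "mat_op n W x \<bullet> y = (\<Sum>i<n. \<Sum>j<n. W $$ (i, j) * crd x j * crd y i)"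
    unfolding inner_euclid[OF mat_op_euclid[OF W]] by (simp add: crd_mat_op[OF W] sum_distrib_right)
  also have "\<dots> = (\<Sum>j<n. \<Sum>i<n. W $$ (i, j) * crd x j * crd y i)" by (rule sum.swap)
  also have "\<dots> = x \<bullet> mat_op n (transpose_mat W) y"
    unfolding inner_euclid[OF x] using W by (simp add: crd_mat_op[OF WT] sum_distrib_left mult_ac)
  finally show ?thesis .
qed

lemma mat_op_smult_one: "x \<in> euclid n \<Longrightarrow> mat_op n (c \<cdot>\<^sub>m 1\<^sub>m n) x = c *\<^sub>R x"
  by (rule fsvec_eqI) (auto simp: crd_mat_op euclid_def if_distrib if_distribR cong: if_cong)

lemma mat_op_one: "x \<in> euclid n \<Longrightarrow> mat_op n (1\<^sub>m n) x = x"
  by (simp add: mat_op_def)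

lemma mat_op_mult:
  "W \<in> carrier_mat n n \<Longrightarrow> W' \<in> carrier_mat n n \<Longrightarrow> mat_op n (W * W') x = mat_op n W (mat_op n W' x)"
  by (simp add: mat_op_def)

lemma mat_op_plus:
  "W \<in> carrier_mat n n \<Longrightarrow> W' \<in> carrier_mat n n \<Longrightarrow> mat_op n (W + W') x = mat_op n W x + mat_op n W' x"
  by (rule fsvec_eqI) (simp add: crd_mat_op distrib_right sum.distrib)

locale clifford =
  fixes m q :: nat and A :: "nat \<Rightarrow> real mat"
  assumes sys: "symmetric_clifford_system m q A"
begin

definition act :: "fsvec \<Rightarrow> fsvec \<Rightarrow> fsvec" where
  "act z v = (\<Sum>i\<le>q. crd z i *\<^sub>R mat_op (2 * m) (A i) v)"

lemma A: "i \<le> q \<Longrightarrow> A i \<in> carrier_mat (2 * m) (2 * m)" "i \<le> q \<Longrightarrow> transpose_mat (A i) = A i"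
  "i \<le> q \<Longrightarrow> j \<le> q \<Longrightarrow> A i * A j + A j * A i = (if i = j then 2 else 0) \<cdot>\<^sub>m 1\<^sub>m (2 * m)"
  using sys by (auto simp: symmetric_clifford_system_def)

lemma act_euclid [simp, intro]: "act z v \<in> euclid (2 * m)"
  unfolding act_def by (intro subspace_sum subspace_scale subspace_euclid mat_op_euclid A) simp

lemma act_linear [simp]:
  "act (z + z') v = act z v + act z' v" "act (c *\<^sub>R z) v = c *\<^sub>R act z v"
  "act z (v + v') = act z v + act z v'" "act z (c *\<^sub>R v) = c *\<^sub>R act z v" "act 0 v = 0" "act z 0 = 0"
proof -
  show "act (z + z') v = act z v + act z' v" "act (c *\<^sub>R z) v = c *\<^sub>R act z v" "act 0 v = 0"
    by (simp_all add: act_def scaleR_left_distrib sum.distrib scaleR_sum_right)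
  show "act z (v + v') = act z v + act z v'"
    by (simp add: act_def mat_op_linear[OF A(1)] scaleR_right_distrib sum.distrib)
  show *: "act z (c *\<^sub>R v) = c *\<^sub>R act z v" for c v
    by (simp add: act_def mat_op_linear[OF A(1)] scaleR_sum_right scaleR_left_commute[of _ c] del: scaleR_scaleR)
  show "act z 0 = 0" using *[of 0 0] by simp
qed

lemma act_sym: "v \<in> euclid (2 * m) \<Longrightarrow> act z v \<bullet> w = v \<bullet> act z w"
  unfolding act_def inner_sum_left inner_sum_right
  by (intro sum.cong refl) (simp add: mat_op_transpose[OF A(1)] A(2))

lemma act_anticommute:
  assumes z: "z \<in> euclid (q + 1)" and v: "v \<in> euclid (2 * m)"
  shows "act z (act z' v) + act z' (act z v) = (2 * (z \<bullet> z')) *\<^sub>R v"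
proof -
  let ?B = "\<lambda>i. mat_op (2 * m) (A i)"
  have exp: "act a (act b v) = (\<Sum>i\<le>q. \<Sum>j\<le>q. (crd a i * crd b j) *\<^sub>R ?B i (?B j v))" for a b
    unfolding act_def by (intro sum.cong refl) (simp add: mat_op_sum[OF A(1)] mat_op_linear[OF A(1)] scaleR_sum_right)
  have BB: "?B i (?B j v) + ?B j (?B i v) = (if i = j then 2 else 0) *\<^sub>R v" if "i \<le> q" "j \<le> q" for i j
    unfolding mat_op_smult_one[OF v, symmetric] A(3)[OF that, symmetric]
    using mat_op_plus[OF mult_carrier_mat[OF A(1)[OF that(1)] A(1)[OF that(2)]] mult_carrier_mat[OF A(1)[OF that(2)] A(1)[OF that(1)]], of v]
      mat_op_mult[OF A(1)[OF that(1)] A(1)[OF that(2)], of v] mat_op_mult[OF A(1)[OF that(2)] A(1)[OF that(1)], of v] by simp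
  have "act z (act z' v) + act z' (act z v) = (\<Sum>i\<le>q. \<Sum>j\<le>q. (crd z i * crd z' j) *\<^sub>R (?B i (?B j v) + ?B j (?B i v)))"
    unfolding exp[of z z'] exp[of z' z] sum.swap[of "\<lambda>i j. (crd z' i * crd z j) *\<^sub>R ?B i (?B j v)"]
    by (simp add: sum.distrib[symmetric] scaleR_right_distrib mult.commute)
  also have "\<dots> = (\<Sum>i\<le>q. (2 * (crd z i * crd z' i)) *\<^sub>R v)"
  proof (intro sum.cong refl)
    fix i assume i: "i \<in> {..q}"
    have "(\<Sum>j\<le>q. (crd z i * crd z' j) *\<^sub>R (?B i (?B j v) + ?B j (?B i v)))
        = (\<Sum>j\<le>q. if j = i then (2 * (crd z i * crd z' j)) *\<^sub>R v else 0)"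
      by (intro sum.cong refl) (use i BB in auto)
    then show "(\<Sum>j\<le>q. (crd z i * crd z' j) *\<^sub>R (?B i (?B j v) + ?B j (?B i v))) = (2 * (crd z i * crd z' i)) *\<^sub>R v"
      using i by simp
  qed
  also have "\<dots> = (2 * (z \<bullet> z')) *\<^sub>R v"
    using inner_euclid[OF z, of z'] by (simp add: scaleR_sum_left[symmetric] sum_distrib_left lessThan_Suc_atMost)
  finally show ?thesis .
qed

abbreviation zc where "zc \<equiv> part 0 (q + 1)"
abbreviation yc where "yc \<equiv> part (q + 1) (2 * m)"

definition ct :: "fsvec \<Rightarrow> fsvec \<Rightarrow> fsvec \<Rightarrow> real" where
  "ct x y w = (act (zc x) (yc y) \<bullet> yc w + act (zc y) (yc x) \<bullet> yc w + act (zc w) (yc x) \<bullet> yc y) / 3"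

lemma trilinear_ct: "trilinear_form ct"
proof
  have sym: "act (zc a) (yc b) \<bullet> yc c = act (zc a) (yc c) \<bullet> yc b" for a b c
    using act_sym[of "yc b" "zc a" "yc c"] by (simp add: inner_commute)
  show "ct (x + y) z w = ct x z w + ct y z w" for x y z w
    by (simp add: ct_def inner_add_left inner_add_right add_divide_distrib)
  show "ct (c *\<^sub>R x) z w = c * ct x z w" for c x z w
    by (simp add: ct_def inner_add_left inner_add_right add_divide_distrib distrib_left)
  show "ct x y z = ct y x z" for x y z
    using sym[of z x y] by (simp add: ct_def)
  show "ct x y z = ct x z y" for x y z
    using sym[of x y z] by (simp add: ct_def)
qed

lemma ct_val: "ct x x x = pval (crd x) (clifford_cubic m q A)"
proof -
  have op: "mat_op (2 * m) (A i) (yc x) \<bullet> yc x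
      = (\<Sum>j<2*m. \<Sum>k<2*m. A i $$ (j, k) * crd x (q + 1 + j) * crd x (q + 1 + k))" if "i \<le> q" for i
    unfolding inner_euclid[OF mat_op_euclid[OF A(1)[OF that]]]
    by (simp add: crd_mat_op[OF A(1)[OF that]] crd_part sum_distrib_left sum_distrib_right
        mult.assoc[where 'a=real] mult.commute[where 'a=real] mult.left_commute[where 'a=real])
  have "ct x x x = act (zc x) (yc x) \<bullet> yc x" by (simp add: ct_def)
  also have "\<dots> = (\<Sum>i\<le>q. crd x i * (mat_op (2 * m) (A i) (yc x) \<bullet> yc x))"
    unfolding act_def inner_sum_left inner_scaleR_left by (intro sum.cong refl) (simp add: crd_part)
  also have "\<dots> = pval (crd x) (clifford_cubic m q A)"
    unfolding pval_clifford_cubic by (intro sum.cong refl) (simp add: op mult.commute[where 'a=real] del: One_nat_def add_Suc_right add_Suc)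
  finally show ?thesis .
qed

text \<open>Write \<open>A_z\<close> for \<open>act z\<close>; its square is \<open>|z|^2\<close>.
  By \<open>h1\<close>, \<open>y\<close> is an eigenvector for \<open>mu / 2\<close>, so
  \<open>|z|^2 = mu^2 / 4\<close>. As \<open>s\<close> is orthogonal to \<open>z\<close>, the
  operators anticommute and \<open>u = A_s y\<close> has eigenvalue \<open>- mu / 2\<close>. By
  \<open>h3\<close>, \<open>A_z v = - (mu / 2) v - u\<close>, so \<open>v\<close> and a nonzero
  \<open>u\<close> would form a Jordan block of a symmetric operator: applying \<open>A_z\<close>
  twice gives \<open>mu u = 0\<close>. Then \<open>|s|^2 y = A_s u = 0\<close>, so
  \<open>s = 0\<close>.\<close>

lemma clifford_vanishing:
  assumes E: "z \<in> euclid (q + 1)" "s \<in> euclid (q + 1)" "y \<in> euclid (2 * m)" "v \<in> euclid (2 * m)"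
    and mu: "mu \<noteq> 0" and norm: "z \<bullet> z + y \<bullet> y = 1"
    and h1: "\<And>r. r \<in> euclid (2 * m) \<Longrightarrow> 2 * (act z y \<bullet> r) = mu * (y \<bullet> r)"
    and h2: "\<And>p. p \<in> euclid (q + 1) \<Longrightarrow> act p y \<bullet> y = mu * (z \<bullet> p)"
    and h3: "\<And>r. r \<in> euclid (2 * m) \<Longrightarrow> act z v \<bullet> r + act s y \<bullet> r = - (mu / 2) * (v \<bullet> r)"
    and sz: "s \<bullet> z = 0"
  shows "act s v \<bullet> v = 0"
proof -
  note eqI = onframe_eqI[OF onframe_euclid]
  let ?u = "act s y"
  have scal: "c *\<^sub>R w \<in> euclid (2 * m)" if "w \<in> euclid (2 * m)" for c w
    using that by (rule subspace_scale[OF subspace_euclid])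
  have e1: "act z y = (mu / 2) *\<^sub>R y"
  proof (rule eqI[of _ "2 * m"])
    fix r assume "r \<in> euclid (2 * m)"
    then show "act z y \<bullet> r = ((mu / 2) *\<^sub>R y) \<bullet> r" using h1[of r] by simp
  qed (auto intro: scal E)
  have e3: "act z v = (- (mu / 2)) *\<^sub>R v + (- 1) *\<^sub>R ?u"
  proof (rule eqI[of _ "2 * m"])
    show "(- (mu / 2)) *\<^sub>R v + (- 1) *\<^sub>R ?u \<in> euclid (2 * m)"
      by (intro subspace_add[OF subspace_euclid] scal E act_euclid)
    fix r assume "r \<in> euclid (2 * m)"
    then show "act z v \<bullet> r = ((- (mu / 2)) *\<^sub>R v + (- 1) *\<^sub>R ?u) \<bullet> r"
      using h3[of r] unfolding inner_add_left inner_scaleR_left by linarith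
  qed auto
  \<comment> \<open>Were \<open>y\<close> zero, \<open>h2\<close> at \<open>p = z\<close> would give
    \<open>mu (z \<bullet> z) = 0\<close>, while \<open>z\<close> would be a unit vector.\<close>
  have y: "y \<bullet> y \<noteq> 0"
  proof
    assume "y \<bullet> y = 0"
    then have "y = 0" by simp
    then show False using h2[OF E(1)] mu norm by simp
  qed
  have zz: "act z (act z w) = (z \<bullet> z) *\<^sub>R w" if "w \<in> euclid (2 * m)" for w
  proof (rule inner_eqI)
    fix r show "act z (act z w) \<bullet> r = ((z \<bullet> z) *\<^sub>R w) \<bullet> r"
      using arg_cong[OF act_anticommute[OF E(1) that, of z], of "\<lambda>a. a \<bullet> r"] by (simp add: inner_add_left)
  qed
  have "(mu^2 / 4) * (y \<bullet> y) = (z \<bullet> z) * (y \<bullet> y)"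
    using arg_cong[OF zz[OF E(3)], of "\<lambda>a. a \<bullet> y"] by (simp add: e1 power2_eq_square)
  then have z2: "z \<bullet> z = mu^2 / 4" using y by simp
  have zu: "act z ?u = (- (mu / 2)) *\<^sub>R ?u"
    using act_anticommute[OF E(2) E(3), of z] by (simp add: sz e1 eq_neg_iff_add_eq_0 add.commute)
  have "(z \<bullet> z) * (v \<bullet> ?u) = act z (act z v) \<bullet> ?u" by (simp add: zz[OF E(4)])
  also have "\<dots> = (mu^2 / 4) * (v \<bullet> ?u) + mu * (?u \<bullet> ?u)"
    unfolding e3 act_linear zu unfolding e3
    by (simp add: inner_add_left inner_diff_left power2_eq_square field_simps)
  finally have "?u = 0" using mu z2 by simp
  then have "(s \<bullet> s) *\<^sub>R y = 0" using act_anticommute[OF E(2) E(3), of s] by simp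
  then have "s = 0" using y by auto
  then show ?thesis by simp
qed

end

text \<open>On \<open>p = 0\<close> the cubic is \<open>x0 (x0^2 - 3 (x1^2 + r^2))\<close>. It
  cannot vanish at two points of the hyperplane with the same nonzero \<open>x0\<close> and
  different \<open>x1^2 + r^2\<close>; this rules out \<open>a0 = 0\<close> and otherwise forces
  \<open>a1 = a3 = 0\<close>. Then \<open>x1\<close> is free, and the term linear in
  \<open>x1\<close> remains. All four coefficients may be zero, so the whole space is
  included.\<close>

lemma no_linear_zero_set:
  fixes a0 a1 a2 a3 :: real
  assumes H: "\<And>x0 x1 p r. a0 * x0 + a1 * x1 + a2 * p + a3 * r = 0 \<Longrightarrow>
    x0^3 + 3/2 * x0 * (p^2 - 2 * r^2 - 2 * x1^2) + 3 * sqrt 3 / 2 * x1 * p^2 = 0"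
  shows False
proof (cases "a0 = 0")
  case True
  have "k^3 - 3 * k * (a1^2 + a3^2) = 0" for k
    using H[of k "- a3" 0 a1] True by (simp add: algebra_simps)
  from this[of 1] this[of 2] show False by simp
next
  case False
  define R where "R = a1^2 + a3^2"
  have K: "x * (x^2 - 3 * a0^2 * (s^2 + u^2)) = 0" if "x = - (a1 * s + a3 * u)" for x s u
  proof -
    have "a0 * x + a1 * (a0 * s) + a2 * 0 + a3 * (a0 * u) = 0" unfolding that by (simp add: algebra_simps)
    from H[OF this] show ?thesis by (simp add: power2_eq_square power3_eq_cube algebra_simps)
  qed
  have R1: "(- R) * (R^2 - 3 * a0^2 * R) = 0"
  proof -
    have "- R = - (a1 * a1 + a3 * a3)" by (simp add: R_def power2_eq_square)
    from K[OF this] show ?thesis by (simp add: R_def[symmetric])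
  qed
  \<comment> \<open>The direction \<open>(a1, a3)\<close> is replaced by its sum with its quarter
    turn: the same \<open>x0 = - R\<close>, but twice the squared length.\<close>
  have R2: "(- R) * (R^2 - 3 * a0^2 * (2 * R)) = 0"
  proof -
    have 1: "- R = - (a1 * (a1 - a3) + a3 * (a3 + a1))" by (simp add: R_def power2_eq_square algebra_simps)
    have 2: "(a1 - a3)^2 + (a3 + a1)^2 = 2 * R" by (simp add: R_def power2_eq_square algebra_simps)
    show ?thesis using K[OF 1] unfolding 2 by simp
  qed
  have "R = 0"
  proof (rule ccontr)
    assume "R \<noteq> 0"
    then have "R^2 = 3 * a0^2 * R" "R^2 = 3 * a0^2 * (2 * R)" using R1 R2 by auto
    then show False using \<open>R \<noteq> 0\<close> False by simp
  qed
  then have a: "a1 = 0" "a3 = 0" by (auto simp: R_def sum_power2_eq_zero_iff)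
  \<comment> \<open>With \<open>a1 = a3 = 0\<close> the points \<open>(- a2, x1, a0, 0)\<close> lie
    on the hyperplane for both signs of \<open>x1\<close>; subtracting the two values leaves the
    term in \<open>sqrt 3\<close>.\<close>
  have E: "(- a2)^3 + 3/2 * (- a2) * (a0^2 - 2) + 3 * sqrt 3 / 2 * x1 * a0^2 = 0" if "x1^2 = 1" for x1
    using H[of "- a2" x1 a0 0] unfolding a that by simp
  have "sqrt 3 * a0^2 = 0" using E[of 1] E[of "-1"] unfolding power2_minus power_one by linarith
  then show False using False by simp
qed

context doubled_cartan
begin

text \<open>Only the real parts of \<open>z1\<close> and \<open>z3\<close> are kept and
  \<open>z2 = 0\<close> removes the triple product, so the same four-variable cubic serves for every
  \<open>l\<close>.\<close>

lemma theta_slice: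
  defines "w \<equiv> \<lambda>x0 x1 p r. x0 *\<^sub>R unitv 0 + x1 *\<^sub>R unitv 1 + p *\<^sub>R unitv 2 + r *\<^sub>R unitv (2 + 2 * l)"
  shows "theta_val l (crd (w x0 x1 p r)) = x0^3 + 3/2 * x0 * (p^2 - 2 * r^2 - 2 * x1^2) + 3 * sqrt 3 / 2 * x1 * p^2"
proof -
  have l0: "0 < l" using l by auto
  let ?c = "crd (w x0 x1 p r)"
  have c: "?c 0 = x0" "?c 1 = x1" "\<And>i. i < l \<Longrightarrow> ?c (2 + i) = (if i = 0 then p else 0)" "\<And>i. i < l \<Longrightarrow> ?c (2 + l + i) = 0"
    "\<And>i. i < l \<Longrightarrow> ?c (2 + 2 * l + i) = (if i = 0 then r else 0)"
    using l0 by (auto simp: w_def crd_unitv)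
  have n: "(\<Sum>i<l. (?c (2 + i))^2) = p^2" "(\<Sum>i<l. (?c (2 + l + i))^2) = 0" "(\<Sum>i<l. (?c (2 + 2 * l + i))^2) = r^2"
  proof -
    have "(\<Sum>i<l. (?c (2 + i))^2) = (\<Sum>i<l. if i = 0 then p^2 else 0)" by (intro sum.cong refl) (simp only: c lessThan_iff, simp)
    then show "(\<Sum>i<l. (?c (2 + i))^2) = p^2" using l0 by simp
    show "(\<Sum>i<l. (?c (2 + l + i))^2) = 0" by (intro sum.neutral ballI) (simp only: c lessThan_iff, simp)
    have "(\<Sum>i<l. (?c (2 + 2 * l + i))^2) = (\<Sum>i<l. if i = 0 then r^2 else 0)" by (intro sum.cong refl) (simp only: c lessThan_iff, simp)
    then show "(\<Sum>i<l. (?c (2 + 2 * l + i))^2) = r^2" using l0 by simp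
  qed
  have t: "tau l (\<lambda>i. ?c (2 + i)) (\<lambda>i. ?c (2 + l + i)) (\<lambda>i. ?c (2 + 2 * l + i)) = 0"
    unfolding tau_cyclic[OF l k, of "\<lambda>i. ?c (2 + i)"] tau_cyclic[OF l k, of "\<lambda>i. ?c (2 + l + i)"]
    unfolding tau_sum[OF l k] by (intro sum.neutral ballI) (simp only: c lessThan_iff mult_zero_right)
  show ?thesis
    unfolding theta_val_def Let_def n t[unfolded tau_def] c by simp
qed

text \<open>The congruence carries the idempotent \<open>e\<close> and its eigenvalue
  \<open>- 1/2\<close> on \<open>V2\<close> over to the Clifford cubic. There
  \<open>clifford_vanishing\<close> applies to every \<open>w\<close> of \<open>V2\<close>
  satisfying the single linear condition that the \<open>z\<close>-parts of the images of
  \<open>w\<close> and \<open>e\<close> be orthogonal. So the Cartan polynomial would vanish on the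
  kernel of a linear functional.\<close>

lemma f_not_clifford:
  assumes sys: "symmetric_clifford_system m q A" and n: "2 * Suc N = q + 1 + 2 * m"
    and cong: "congruent_cubics (2 * Suc N) f (clifford_cubic m q A)"
  shows False
proof -
  interpret K: clifford m q A by (unfold_locales) (rule sys)
  let ?n = "q + 1 + 2 * m"
  from cong obtain U c where U: "U \<in> carrier_mat ?n ?n" "transpose_mat U * U = 1\<^sub>m ?n" and c: "c \<noteq> 0"
    and eq: "\<And>x. x \<in> carrier_vec ?n \<Longrightarrow> poly_val f x = c * poly_val (clifford_cubic m q A) (U *\<^sub>v x)"
    unfolding congruent_cubics_def n by blast
  have UT: "transpose_mat U \<in> carrier_mat ?n ?n" using U by simp
  have inv: "U * transpose_mat U = 1\<^sub>m ?n" by (rule mat_mult_left_right_inverse[OF UT U(1) U(2)])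
  define T where "T = mat_op ?n (transpose_mat U)"
  define T' where "T' = mat_op ?n U"
  have TE: "T x \<in> euclid ?n" "T' x \<in> euclid ?n" for x
    unfolding T_def T'_def using mat_op_euclid[OF UT] mat_op_euclid[OF U(1)] by auto
  have T_lin: "T (x + y) = T x + T y" "T (r *\<^sub>R x) = r *\<^sub>R T x"
    "T' (x + y) = T' x + T' y" "T' (r *\<^sub>R x) = r *\<^sub>R T' x" for x y r
    unfolding T_def T'_def using mat_op_linear[OF UT] mat_op_linear[OF U(1)] by auto
  have TT': "T (T' x) = x" "T' (T x) = x" if "x \<in> euclid ?n" for x
    unfolding T_def T'_def using that
    by (simp_all only: mat_op_mult[OF UT U(1), symmetric] mat_op_mult[OF U(1) UT, symmetric] U(2) inv mat_op_one)
  have adj: "T' x \<bullet> y = x \<bullet> T y" if "x \<in> euclid ?n" for x y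
    unfolding T_def T'_def by (rule mat_op_transpose[OF U(1) that])
  have f_vars: "in_vars ?n f" using form_in_vars[OF form_complex_doubling[OF form_g]] unfolding n .
  have C_vars: "in_vars ?n (clifford_cubic m q A)" by (rule form_in_vars[OF form_clifford_cubic])
  have cube: "CC.dbl (T x) (T x) (T x) = c * K.ct x x x" if x: "x \<in> euclid ?n" for x
  proof -
    have "U *\<^sub>v to_vec ?n (T x) = to_vec ?n (T' (T x))" unfolding T'_def by (rule to_vec_mat_op[OF U(1), symmetric])
    then have "poly_val f (to_vec ?n (T x)) = c * poly_val (clifford_cubic m q A) (to_vec ?n x)"
      using eq[of "to_vec ?n (T x)"] TT'(2)[OF x] by simp
    then show ?thesis unfolding poly_val_to_vec[OF f_vars] poly_val_to_vec[OF C_vars] f_val K.ct_val .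
  qed
  have tri: "trilinear_form (\<lambda>x y z. CC.dbl (T x) (T y) (T z))"
  proof -
    interpret D: trilinear_form CC.dbl by (rule CC.trilinear_dbl)
    show ?thesis by unfold_locales (simp_all add: T_lin, rule D.S_swap12, rule D.S_swap23)
  qed
  have key: "CC.dbl (T x) (T y) (T z) = c * K.ct x y z" if "x \<in> euclid ?n" "y \<in> euclid ?n" "z \<in> euclid ?n" for x y z
    by (rule trilinear_form_eqI[OF tri trilinear_form_scale[OF K.trilinear_ct] subspace_euclid cube that])
  define e where "e = unitv N"
  have Nn: "N < ?n" unfolding n[symmetric] by simp
  have eE: "e \<in> euclid ?n" unfolding e_def by (rule unitv_euclid[OF Nn])
  have lo_e: "CC.lo e = e" "CC.hi e = 0" by (simp_all add: e_def part_unitv part_zero unitv_euclid)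
  \<comment> \<open>This says that \<open>e\<close> is idempotent for the doubled form;
    \<open>Dw\<close> below says that its multiplication is \<open>- 1/2\<close> on the first
    \<open>N\<close> coordinates.\<close>
  have De: "CC.dbl e e X = e \<bullet> X" for X
    unfolding CC.dbl_def lo_e by (simp add: e_def cone_unit crd_unitv part_unitv crd_part cone_def)
  have lo_w: "CC.lo w = w" "CC.hi w = 0" "crd w N = 0" "pr w = w" if "w \<in> euclid N" for w
    using euclid_mono[OF that, of "Suc N"] that by (simp_all add: part_id part_zero) (simp add: euclid_def)
  interpret cone: trilinear_form cone by (rule trilinear_cone)
  have Dw: "CC.dbl e w X = - (w \<bullet> X) / 2" if "w \<in> euclid N" for w X
    unfolding CC.dbl_def lo_e lo_w(1,2)[OF that] using inner_part[OF that, of X]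
    by (simp add: e_def cone_unit lo_w[OF that] part_part)
  define e' where "e' = T' e"
  define z where "z = K.zc e'"
  define y where "y = K.yc e'"
  \<comment> \<open>The 3 comes from the division by 3 in \<open>ct\<close>, the \<open>c\<close>
    from the scaling in the congruence.\<close>
  define mu where "mu = 3 / c"
  have e'E: "e' \<in> euclid ?n" unfolding e'_def by (rule TE)
  have Te': "T e' = e" unfolding e'_def by (rule TT'(1)[OF eE])
  have inner_e': "e' \<bullet> x = z \<bullet> K.zc x + y \<bullet> K.yc x" for x
    unfolding z_def y_def by (rule inner_parts[OF e'E])
  have "e' \<bullet> e' = e \<bullet> T e'" using adj[OF eE, of e'] by (simp only: e'_def)
  then have norm: "z \<bullet> z + y \<bullet> y = 1"
    using inner_e'[of e', folded z_def y_def] unfolding Te' by (simp add: e_def crd_unitv)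
  have ct_e: "c * K.ct e' e' x = z \<bullet> K.zc x + y \<bullet> K.yc x" if "x \<in> euclid ?n" for x
  proof -
    have "c * K.ct e' e' x = e \<bullet> T x" using key[OF e'E e'E that] unfolding Te' De by (rule HOL.sym)
    also have "\<dots> = e' \<bullet> x" unfolding e'_def by (rule adj[OF eE, symmetric])
    also have "\<dots> = z \<bullet> K.zc x + y \<bullet> K.yc x" by (rule inner_e')
    finally show ?thesis .
  qed
  have shift: "shift (q + 1) (2 * m) r \<in> euclid ?n" "K.zc (shift (q + 1) (2 * m) r) = 0"
    "r \<in> euclid (2 * m) \<Longrightarrow> K.yc (shift (q + 1) (2 * m) r) = r" for r
    using part_shift(1)[of "q + 1" "2 * m" r] shift_euclid[of "q + 1" "2 * m" r] part_shift(2)[of r "2 * m" "q + 1"] by simp_all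
  have zcE: "p \<in> euclid ?n" "K.zc p = p" "K.yc p = 0" if "p \<in> euclid (q + 1)" for p
    using that euclid_mono[OF that, of ?n] part_id[OF that] part_zero[OF that] by simp_all
  have h1: "2 * (K.act z y \<bullet> r) = mu * (y \<bullet> r)" if r: "r \<in> euclid (2 * m)" for r
    using ct_e[OF shift(1), of r] c unfolding K.ct_def shift(2) shift(3)[OF r] z_def[symmetric] y_def[symmetric]
    by (simp add: mu_def field_simps)
  have h2: "K.act p y \<bullet> y = mu * (z \<bullet> p)" if p: "p \<in> euclid (q + 1)" for p
    using ct_e[OF zcE(1)[OF p]] c unfolding K.ct_def zcE(2,3)[OF p] z_def[symmetric] y_def[symmetric]
    by (simp add: mu_def field_simps)
  have main: "S w w w = 0" if w: "w \<in> euclid N" and wz: "K.zc (T' w) \<bullet> z = 0" for w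
  proof -
    have wE: "w \<in> euclid ?n" by (rule euclid_mono[OF w]) (use Nn in simp)
    define w' where "w' = T' w"
    define s where "s = K.zc w'"
    define v where "v = K.yc w'"
    have w'E: "w' \<in> euclid ?n" and Tw': "T w' = w" unfolding w'_def using TE TT'(1)[OF wE] by auto
    have ct_w: "c * K.ct e' w' x = - (s \<bullet> K.zc x + v \<bullet> K.yc x) / 2" if "x \<in> euclid ?n" for x
      using key[OF e'E w'E that] adj[OF wE, of x] inner_parts[OF w'E, of x]
      by (simp add: Te' Tw' Dw[OF w] w'_def[symmetric] s_def v_def)
    have h3: "K.act z v \<bullet> r + K.act s y \<bullet> r = - (mu / 2) * (v \<bullet> r)" if r: "r \<in> euclid (2 * m)" for r
      using ct_w[OF shift(1), of r] c unfolding K.ct_def shift(2) shift(3)[OF r] z_def[symmetric] y_def[symmetric] s_def[symmetric] v_def[symmetric]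
      by (simp add: mu_def field_simps)
    have "K.act s v \<bullet> v = 0"
      by (rule K.clifford_vanishing[of z s y v mu]) (use c norm h1 h2 h3 wz in \<open>auto simp: z_def y_def s_def v_def mu_def w'_def\<close>)
    then have "K.ct w' w' w' = 0" by (simp add: K.ct_def s_def v_def)
    then have "CC.dbl w w w = 0" using key[OF w'E w'E w'E] by (simp add: Tw')
    then show ?thesis unfolding CC.dbl_def lo_w(1,2)[OF w] by (simp add: cone_def lo_w[OF w])
  qed
  \<comment> \<open>The functional whose kernel is the hyperplane for
    \<open>no_linear_zero_set\<close>.\<close>
  define \<phi> where "\<phi> x = K.zc (T' x) \<bullet> z" for x
  have \<phi>: "\<phi> (x + y) = \<phi> x + \<phi> y" "\<phi> (r *\<^sub>R x) = r * \<phi> x" for x y r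
    by (simp_all add: \<phi>_def T_lin inner_add_left)
  show False
  proof (rule no_linear_zero_set)
    fix x0 x1 p r
    let ?w = "x0 *\<^sub>R unitv 0 + x1 *\<^sub>R unitv 1 + p *\<^sub>R unitv 2 + r *\<^sub>R unitv (2 + 2 * l)"
    assume "\<phi> (unitv 0) * x0 + \<phi> (unitv 1) * x1 + \<phi> (unitv 2) * p + \<phi> (unitv (2 + 2 * l)) * r = 0"
    then have "\<phi> ?w = 0" unfolding \<phi> by (simp add: mult.commute)
    moreover have "?w \<in> euclid N" using l by (auto simp: euclid_def crd_unitv N)
    ultimately have "S ?w ?w ?w = 0" using main[of ?w] by (simp add: \<phi>_def)
    then show "x0^3 + 3/2 * x0 * (p^2 - 2 * r^2 - 2 * x1^2) + 3 * sqrt 3 / 2 * x1 * p^2 = 0"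
      unfolding S_val theta_slice .
  qed
qed

lemma f_exceptional: "(2 * Suc N, f) \<in> exceptional_of_type 1 N"
proof -
  have "exceptional (2 * Suc N) f"
    unfolding exceptional_def using f_radial f_not_clifford by (auto simp: congruence_def)
  then show ?thesis using f_type by (simp add: exceptional_of_type_def)
qed

end

section \<open>The four congruence classes\<close>

lemma doubled_exceptional:
  assumes l: "l \<in> {1, 2, 4, 8}"
  shows "(6 * l + 6, complex_doubling (3 * l + 3) (g_cubic l)) \<in> exceptional_of_type 1 (3 * l + 2)"
proof -
  have "l = 2 ^ 0 \<or> l = 2 ^ 1 \<or> l = 2 ^ 2 \<or> l = 2 ^ 3" using l by auto
  then obtain k where k: "l = 2 ^ k" by blast
  obtain S where S: "\<And>x. S x x x = theta_val l (crd x)" "eiconal S (euclid (3 * l + 2)) (3 * l + 2) unitv"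
    by (rule theta_eiconal[OF l k]) (rule that)
  interpret doubled_cartan S "3 * l + 2" l k
    unfolding doubled_cartan_def doubled_cartan_axioms_def euclid_eiconal_def using S l k by simp
  have "2 * Suc (3 * l + 2) = 6 * l + 6" "Suc (3 * l + 2) = 3 * l + 3" by simp_all
  with f_exceptional show ?thesis by metis
qed

lemma congruence_sym: "(x, y) \<in> congruence \<Longrightarrow> (y, x) \<in> congruence"
  and congruence_trans: "(x, y) \<in> congruence \<Longrightarrow> (y, z) \<in> congruence \<Longrightarrow> (x, z) \<in> congruence"
  by (auto simp: congruence_def intro: congruent_cubics_sym congruent_cubics_trans)

theorem proposition6p2:
  shows "card ((\<Union>l\<in>{1, 2, 4, 8}. exceptional_of_type 1 (3*l + 2)) // congruence) = 4 \<and>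
    (\<forall>l\<in>{1, 2, 4, 8}.
       card (exceptional_of_type 1 (3*l + 2) // congruence) = 1 \<and>
       (\<forall>n f. (n, f) \<in> exceptional_of_type 1 (3*l + 2) \<longrightarrow>
          ((n, f), (6*l + 6, complex_doubling (3*l + 3) (g_cubic l))) \<in> congruence))"
proof -
  let ?L = "{1, 2, 4, 8} :: nat set"
  define E where "E l = exceptional_of_type 1 (3*l + 2)" for l :: nat
  define g where "g l = (6*l + 6, complex_doubling (3*l + 3) (g_cubic l))" for l :: nat
  have g: "g l \<in> E l" if "l \<in> ?L" for l
    unfolding g_def E_def by (rule doubled_exceptional[OF that])
  have congr: "(x, g l) \<in> congruence" if "l \<in> ?L" "x \<in> E l" for l x
  proof -
    obtain n f where x: "x = (n, f)" by (cases x)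
    have "l = 2 ^ 0 \<or> l = 2 ^ 1 \<or> l = 2 ^ 2 \<or> l = 2 ^ 3" using that(1) by auto
    then obtain k where k: "l = 2 ^ k" by blast
    have "exceptional n f" "has_type n f 1 (3 * l + 2)" using that(2) by (simp_all add: x E_def exceptional_of_type_def)
    from exceptional_congruent[OF this k] show ?thesis by (simp add: x g_def congruence_def)
  qed
  have g_refl: "(g l, g l) \<in> congruence" if "l \<in> ?L" for l using congr[OF that g[OF that]] .
  have cls: "congruence `` {x} = congruence `` {g l}" if "l \<in> ?L" "x \<in> E l" for l x
    using congr[OF that] congruence_sym congruence_trans by blast
  \<comment> \<open>\<open>congruence\<close> is reflexive only on cubic forms, so the classes are
    computed directly as relational images: each element of \<open>E l\<close> has the same image as
    \<open>g l\<close>. It is stated for a set \<open>L\<close> so as to give both the total and the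
    individual counts.\<close>
  have quot: "(\<Union>l\<in>L. E l) // congruence = (\<lambda>l. congruence `` {g l}) ` L" if "L \<subseteq> ?L" for L
  proof -
    have "(\<Union>l\<in>L. E l) // congruence = (\<Union>l\<in>L. (\<lambda>x. congruence `` {x}) ` E l)" by (auto simp: quotient_def)
    also have "\<dots> = (\<Union>l\<in>L. {congruence `` {g l}})"
    proof (intro SUP_cong refl)
      fix l assume "l \<in> L"
      then have l: "l \<in> ?L" using that by blast
      have "(\<lambda>x. congruence `` {x}) ` E l = (\<lambda>x. congruence `` {g l}) ` E l" by (rule image_cong[OF refl cls[OF l]])
      also have "\<dots> = {congruence `` {g l}}" by (rule image_constant[OF g[OF l]])
      finally show "(\<lambda>x. congruence `` {x}) ` E l = {congruence `` {g l}}" .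
    qed
    finally show ?thesis by auto
  qed
  \<comment> \<open>Congruent forms live in the same dimension, and \<open>6 l + 6\<close>
    determines \<open>l\<close>.\<close>
  have inj: "inj_on (\<lambda>l. congruence `` {g l}) ?L"
  proof (rule inj_onI)
    fix l l' assume l: "l \<in> ?L" "l' \<in> ?L" "congruence `` {g l} = congruence `` {g l'}"
    then have "(g l, g l') \<in> congruence" using g_refl[OF l(2)] by blast
    then show "l = l'" by (simp add: g_def congruence_def)
  qed
  have "card ((\<Union>l\<in>?L. E l) // congruence) = 4"
    unfolding quot[OF subset_refl] card_image[OF inj] by simp
  moreover have "card (E l // congruence) = 1" if "l \<in> ?L" for l
    using quot[of "{l}"] that by simp
  ultimately show ?thesis using congr unfolding E_def g_def by blast
qed

end
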